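(* Let $B$ be a pointed topological space, let $A$ be a $CW(B)$-complex of finite dimension and let $X$ be a generalized $CW(A)$-complex. Then $X$ is a generalized $CW(B)$-complex. In particular, if $A$ is a standard finite dimensional CW-complex, then $X$ is a generalized CW-complex and therefore it has the homotopy type of a CW-complex.
   Context: All spaces are pointed, all maps are pointed, and homotopies preserve base points. $\mathrm{C}X$ is the reduced cone of $X$, $\Sigma X$ the reduced suspension, $\Sigma^0A=A$, and $\bigvee$ is the wedge. Let $A$ be a pointed space (the core). For $n\ge 1$, $X$ is obtained from a pointed space $Z$ by attaching $n$-cells of type $A$ if $X$ is a pushout of $Z\xleftarrow{\,g\,}\bigvee_{\alpha\in J}\Sigma^{n-1}A\xrightarrow{\,i\,}\bigvee_{\alpha\in J}\mathrm{C}\Sigma^{n-1}A$ for some index set $J$ and some map $g$ (the sum of the attaching maps $g_\alpha$), where $i$ is the wedge of the inclusions as bases of the cones. $X$ is obtained from $Z$ by attaching $0$-cells of type $A$ if $X=Z\vee\bigvee_{\alpha\in J}A$. A $CW(A)$-structure on $X$ is a sequence $*=X^{-1}\to X^0\to X^1\to\cdots$ with colimit $X$ such that, for all $n\ge 0$, $X^n$ is obtained from $X^{n-1}$ by attaching $n$-cells of type $A$. A space admitting such a structure is a $CW(A)$-complex. The structure is finite dimensional, of dimension $n$, if $X^n=X$ and $X^{n-1}\ne X$; $X$ is of finite dimension if it admits a finite dimensional structure. $X$ is obtained from $Z$ by attaching cells (of different dimensions) of type $A$ if $X$ is a pushout of $Z\leftarrow\bigvee_{\alpha\in J}\Sigma^{n_\alpha-1}A\to(\bigvee_{\alpha\in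 J_0}A)\vee(\bigvee_{\alpha\in J}\mathrm{C}\Sigma^{n_\alpha-1}A)$, with $n_\alpha\ge 1$ for all $\alpha\in J$, where the second map is given by the inclusions of the bases of the cones. $X$ is a generalized $CW(A)$-complex if it is the colimit of a sequence $*=X^0\to X^1\to X^2\to\cdots$ where each $X^n$ is obtained from $X^{n-1}$ by attaching cells (of different dimensions) of type $A$. A generalized CW-complex is a generalized complex with ordinary cells, i.e. cells of any dimension may be attached at any of countably many steps (the case of core $S^0$; CW-complexes are regarded as $CW(S^0)$-complexes, attaching an $S^0$-$n$-cell being attaching an $n$-cell in the usual sense). *)

theory Defs
  imports "HOL-Analysis.Analysis"
begin

section \<open>Quotients, disjoint unions, pushouts and sequential colimits\<close>

text \<open>The topology coinduced on the image of the point map \<open>q\<close>.\<close>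

definition quotient_topology :: "'a topology \<Rightarrow> ('a \<Rightarrow> 'b) \<Rightarrow> 'b topology" where
  "quotient_topology X q =
     topology (\<lambda>U. U \<subseteq> q ` topspace X \<and> openin X {x \<in> topspace X. q x \<in> U})"

lemma openin_quotient_topology:
  "openin (quotient_topology X q) U \<longleftrightarrow>
     U \<subseteq> q ` topspace X \<and> openin X {x \<in> topspace X. q x \<in> U}"
proof -
  have "istopology (\<lambda>U. U \<subseteq> q ` topspace X \<and> openin X {x \<in> topspace X. q x \<in> U})"
    unfolding istopology_def
  proof (intro conjI allI impI)
    fix S T
    assume S: "S \<subseteq> q ` topspace X \<and> openin X {x \<in> topspace X. q x \<in> S}"
      and T: "T \<subseteq> q ` topspace X \<and> openin X {x \<in> topspace X. q x \<in> T}"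
    have "{x \<in> topspace X. q x \<in> S \<inter> T} =
        {x \<in> topspace X. q x \<in> S} \<inter> {x \<in> topspace X. q x \<in> T}"
      by auto
    then show "openin X {x \<in> topspace X. q x \<in> S \<inter> T}"
      using S T by auto
    show "S \<inter> T \<subseteq> q ` topspace X"
      using S by auto
  next
    fix \<K>
    assume K: "\<forall>K\<in>\<K>. K \<subseteq> q ` topspace X \<and> openin X {x \<in> topspace X. q x \<in> K}"
    have "{x \<in> topspace X. q x \<in> \<Union>\<K>} = (\<Union>K\<in>\<K>. {x \<in> topspace X. q x \<in> K})"
      by auto
    then show "openin X {x \<in> topspace X. q x \<in> \<Union>\<K>}"
      using K by auto
    show "\<Union>\<K> \<subseteq> q ` topspace X"
      using K by auto
  qed
  then show ?thesis
    by (simp add: quotient_topology_def)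
qed

lemma topspace_quotient_topology [simp]:
  "topspace (quotient_topology X q) = q ` topspace X"
proof
  have "{x \<in> topspace X. q x \<in> q ` topspace X} = topspace X"
    by auto
  then have "openin (quotient_topology X q) (q ` topspace X)"
    by (simp add: openin_quotient_topology)
  then show "q ` topspace X \<subseteq> topspace (quotient_topology X q)"
    by (rule openin_subset)
  show "topspace (quotient_topology X q) \<subseteq> q ` topspace X"
    using openin_topspace [of "quotient_topology X q"] unfolding openin_quotient_topology
    by (rule conjunct1)
qed

lemma quotient_map_quotient_topology: "quotient_map X (quotient_topology X q) q"
  by (simp add: quotient_map_def openin_quotient_topology)

lemma homeomorphic_map_quotient_topology:
  "inj_on q (topspace X) \<Longrightarrow> homeomorphic_map X (quotient_topology X q) q"
  by (simp add: homeomorphic_map_def quotient_map_quotient_topology)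

definition disjoint_sum :: "'a topology \<Rightarrow> 'b topology \<Rightarrow> ('a + 'b) topology" where
  "disjoint_sum X Y = topology (\<lambda>U. openin X (Inl -` U) \<and> openin Y (Inr -` U))"

lemma openin_disjoint_sum:
  "openin (disjoint_sum X Y) U \<longleftrightarrow> openin X (Inl -` U) \<and> openin Y (Inr -` U)"
proof -
  have "istopology (\<lambda>U. openin X (Inl -` U) \<and> openin Y (Inr -` U))"
    unfolding istopology_def
  proof (intro conjI allI impI)
    fix \<K> :: "('a + 'b) set set"
    assume K: "\<forall>K\<in>\<K>. openin X (Inl -` K) \<and> openin Y (Inr -` K)"
    then show "openin X (Inl -` \<Union>\<K>)"
      unfolding vimage_Union by (intro openin_Union) auto
    show "openin Y (Inr -` \<Union>\<K>)"
      using K unfolding vimage_Union by (intro openin_Union) auto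
  qed (simp_all add: openin_Int)
  then show ?thesis
    by (simp add: disjoint_sum_def)
qed

lemma topspace_disjoint_sum [simp]:
  "topspace (disjoint_sum X Y) = topspace X <+> topspace Y"
proof
  have "Inl -` (topspace X <+> topspace Y) = topspace X"
    and "Inr -` (topspace X <+> topspace Y) = topspace Y"
    by auto
  then have "openin (disjoint_sum X Y) (topspace X <+> topspace Y)"
    by (simp add: openin_disjoint_sum)
  then show "topspace X <+> topspace Y \<subseteq> topspace (disjoint_sum X Y)"
    by (rule openin_subset)
  show "topspace (disjoint_sum X Y) \<subseteq> topspace X <+> topspace Y"
  proof
    fix u
    assume u: "u \<in> topspace (disjoint_sum X Y)"
    have "openin (disjoint_sum X Y) (topspace (disjoint_sum X Y))"
      by (rule openin_topspace)
    then have l: "Inl -` topspace (disjoint_sum X Y) \<subseteq> topspace X"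
      and r: "Inr -` topspace (disjoint_sum X Y) \<subseteq> topspace Y"
      unfolding openin_disjoint_sum by (blast dest: openin_subset)+
    show "u \<in> topspace X <+> topspace Y"
    proof (cases u)
      case (Inl a)
      then have "a \<in> topspace X"
        using u l by blast
      then show ?thesis
        using Inl by blast
    next
      case (Inr b)
      then have "b \<in> topspace Y"
        using u r by blast
      then show ?thesis
        using Inr by blast
    qed
  qed
qed

text \<open>\<open>Y\<close> is, through \<open>q\<close>, the quotient of \<open>X\<close> by the equivalence relation generated
  by \<open>r\<close>. Pushouts and colimits are expressed through this, since a universal property
  cannot quantify over spaces of all types; the lemma below recovers it.\<close>

definition is_quotient_by ::
    "'a topology \<Rightarrow> ('a \<Rightarrow> 'a \<Rightarrow> bool) \<Rightarrow> 'b topology \<Rightarrow> ('a \<Rightarrow> 'b) \<Rightarrow> bool" where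
  "is_quotient_by X r Y q \<longleftrightarrow>
     quotient_map X Y q \<and>
     (\<forall>x\<in>topspace X. \<forall>y\<in>topspace X. q x = q y \<longleftrightarrow> equivclp r x y)"

lemma is_quotient_by_universal:
  assumes q: "is_quotient_by X r Y q" and h: "continuous_map X Z h"
    and r: "\<And>x y. r x y \<Longrightarrow> h x = h y"
  shows "\<exists>g. continuous_map Y Z g \<and> (\<forall>x\<in>topspace X. g (q x) = h x)"
    and "\<lbrakk>\<And>x. x \<in> topspace X \<Longrightarrow> g (q x) = h x; \<And>x. x \<in> topspace X \<Longrightarrow> g' (q x) = h x;
          y \<in> topspace Y\<rbrakk> \<Longrightarrow> g y = g' y"
proof -
  have qm: "quotient_map X Y q"
    using q by (simp add: is_quotient_by_def)
  have "h x = h y" if "equivclp r x y" for x y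
    using that by (induction rule: equivclp_induct) (use r in auto)
  then have eq: "h x = h y" if "x \<in> topspace X" "y \<in> topspace X" "q x = q y" for x y
    using q that by (auto simp: is_quotient_by_def)
  obtain k where "continuous_map Y Z k" "\<And>x. x \<in> topspace X \<Longrightarrow> k (q x) = h x"
    by (rule quotient_map_lift_exists[OF qm h]) (use eq in blast)+
  then show "\<exists>g. continuous_map Y Z g \<and> (\<forall>x\<in>topspace X. g (q x) = h x)"
    by blast
  show "g y = g' y" if "\<And>x. x \<in> topspace X \<Longrightarrow> g (q x) = h x"
    "\<And>x. x \<in> topspace X \<Longrightarrow> g' (q x) = h x" "y \<in> topspace Y"
  proof -
    obtain x where "x \<in> topspace X" "y = q x"
      using \<open>y \<in> topspace Y\<close> quotient_imp_surjective_map[OF qm] by blast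
    then show ?thesis
      using that(1,2) by simp
  qed
qed

text \<open>The square with sides \<open>g : W \<rightarrow> Z\<close>, \<open>i : W \<rightarrow> C\<close>, \<open>f : Z \<rightarrow> X\<close>, \<open>h : C \<rightarrow> X\<close>
  is a pushout. For a span of pointed spaces and pointed maps the pushout of pointed spaces
  has this underlying space.\<close>

definition is_pushout ::
    "'z topology \<Rightarrow> 'w topology \<Rightarrow> 'c topology \<Rightarrow> 'x topology \<Rightarrow>
     ('w \<Rightarrow> 'z) \<Rightarrow> ('w \<Rightarrow> 'c) \<Rightarrow> ('z \<Rightarrow> 'x) \<Rightarrow> ('c \<Rightarrow> 'x) \<Rightarrow> bool" where
  "is_pushout Z W C X g i f h \<longleftrightarrow>
     continuous_map W Z g \<and> continuous_map W C i \<and>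
     is_quotient_by (disjoint_sum Z C)
       (\<lambda>u v. \<exists>w\<in>topspace W. u = Inl (g w) \<and> v = Inr (i w))
       X (case_sum f h)"

definition is_seq_colimit ::
    "(nat \<Rightarrow> 's topology) \<Rightarrow> (nat \<Rightarrow> 's \<Rightarrow> 's) \<Rightarrow> 'x topology \<Rightarrow> (nat \<Rightarrow> 's \<Rightarrow> 'x) \<Rightarrow> bool" where
  "is_seq_colimit S j X c \<longleftrightarrow>
     (\<forall>n. continuous_map (S n) (S (Suc n)) (j n)) \<and>
     is_quotient_by (sum_topology S UNIV)
       (\<lambda>u v. \<exists>n. \<exists>s\<in>topspace (S n). u = (n, s) \<and> v = (Suc n, j n s))
       X (\<lambda>(n, s). c n s)"


section \<open>Pointed spaces\<close>

type_synonym 'a pointed = "'a topology \<times> 'a"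

abbreviation underlying :: "'a pointed \<Rightarrow> 'a topology" where
  "underlying \<equiv> fst"

abbreviation basept :: "'a pointed \<Rightarrow> 'a" where
  "basept \<equiv> snd"

definition pointed_space :: "'a pointed \<Rightarrow> bool" where
  "pointed_space X \<longleftrightarrow> basept X \<in> topspace (underlying X)"

definition pointed_map :: "'a pointed \<Rightarrow> 'b pointed \<Rightarrow> ('a \<Rightarrow> 'b) \<Rightarrow> bool" where
  "pointed_map X Y f \<longleftrightarrow> continuous_map (underlying X) (underlying Y) f \<and> f (basept X) = basept Y"

definition pointed_homotopic ::
    "'a pointed \<Rightarrow> 'b pointed \<Rightarrow> ('a \<Rightarrow> 'b) \<Rightarrow> ('a \<Rightarrow> 'b) \<Rightarrow> bool" where
  "pointed_homotopic X Y f g \<longleftrightarrow>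
     homotopic_with (\<lambda>h. h (basept X) = basept Y) (underlying X) (underlying Y) f g"

definition pointed_homotopy_equivalent :: "'a pointed \<Rightarrow> 'b pointed \<Rightarrow> bool" where
  "pointed_homotopy_equivalent X Y \<longleftrightarrow>
     (\<exists>f g. pointed_map X Y f \<and> pointed_map Y X g \<and>
            pointed_homotopic X X (g \<circ> f) id \<and> pointed_homotopic Y Y (f \<circ> g) id)"

definition is_point :: "'a pointed \<Rightarrow> bool" where
  "is_point X \<longleftrightarrow> topspace (underlying X) = {basept X}"

text \<open>The image of a pointed space under a point map \<open>e\<close>, meant for injective \<open>e\<close>:
  a homeomorphic copy on another type.\<close>

definition pointed_copy :: "('a \<Rightarrow> 'b) \<Rightarrow> 'a pointed \<Rightarrow> 'b pointed" where
  "pointed_copy e X = (quotient_topology (underlying X) e, e (basept X))"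

text \<open>Quotients are realised on normal forms: each collapsing map below is constant on the part
  that becomes the base point and is the identity elsewhere. The vertex of the cone is at
  height 1, its base at height 0.\<close>

definition reduced_cone :: "'a pointed \<Rightarrow> ('a \<times> real) pointed" where
  "reduced_cone X =
     (quotient_topology (prod_topology (underlying X) (top_of_set {0..1}))
        (\<lambda>(x, t). if x = basept X \<or> t = 1 then (basept X, 0) else (x, t)),
      (basept X, 0))"

definition cone_base :: "'a \<Rightarrow> 'a \<times> real" where
  "cone_base x = (x, 0)"

definition reduced_suspension :: "'a pointed \<Rightarrow> ('a \<times> real) pointed" where
  "reduced_suspension X =
     (quotient_topology (prod_topology (underlying X) (top_of_set {0..1}))
        (\<lambda>(x, t). if x = basept X \<or> t = 0 \<or> t = 1 then (basept X, 0) else (x, t)),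
      (basept X, 0))"

text \<open>The iterated suspensions \<open>\<Sigma>\<^sup>n A\<close>, all on one type, with the suspension coordinates
  collected in a list.\<close>

primrec iterated_suspension :: "nat \<Rightarrow> 'a pointed \<Rightarrow> ('a \<times> real list) pointed" where
  "iterated_suspension 0 A = pointed_copy (\<lambda>a. (a, [])) A"
| "iterated_suspension (Suc n) A =
     pointed_copy (\<lambda>((a, ts), t). (a, t # ts)) (reduced_suspension (iterated_suspension n A))"

text \<open>In a wedge, \<open>None\<close> is the common base point; the summand \<open>unit\<close> makes the empty
  wedge a point.\<close>

definition wedge_incl :: "('j \<Rightarrow> 'a pointed) \<Rightarrow> 'j \<Rightarrow> 'a \<Rightarrow> ('j \<times> 'a) option" where
  "wedge_incl X \<alpha> x = (if x = basept (X \<alpha>) then None else Some (\<alpha>, x))"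

definition wedge :: "('j \<Rightarrow> 'a pointed) \<Rightarrow> 'j set \<Rightarrow> ('j \<times> 'a) option pointed" where
  "wedge X J =
     (quotient_topology
        (disjoint_sum (discrete_topology {()}) (sum_topology (\<lambda>\<alpha>. underlying (X \<alpha>)) J))
        (case_sum (\<lambda>_. None) (\<lambda>(\<alpha>, x). wedge_incl X \<alpha> x)),
      None)"

definition wedge_map ::
    "('j \<Rightarrow> 'b pointed) \<Rightarrow> ('j \<Rightarrow> 'a \<Rightarrow> 'b) \<Rightarrow> ('j \<times> 'a) option \<Rightarrow> ('j \<times> 'b) option" where
  "wedge_map Y f w = (case w of None \<Rightarrow> None | Some (\<alpha>, x) \<Rightarrow> wedge_incl Y \<alpha> (f \<alpha> x))"

definition wedge2_inr :: "'a pointed \<Rightarrow> 'b pointed \<Rightarrow> 'b \<Rightarrow> 'a + 'b" where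
  "wedge2_inr X Y y = (if y = basept Y then Inl (basept X) else Inr y)"

definition wedge2 :: "'a pointed \<Rightarrow> 'b pointed \<Rightarrow> ('a + 'b) pointed" where
  "wedge2 X Y =
     (quotient_topology (disjoint_sum (underlying X) (underlying Y)) (case_sum Inl (wedge2_inr X Y)),
      Inl (basept X))"


section \<open>CW-complexes with a core\<close>

text \<open>
  In the definitions of this and the next section all stages of a filtration of \<open>X\<close>, and all
  index sets of cells, live on the type of the points of \<open>X\<close>. This is no restriction: attaching
  maps are glued along injective maps, so the stages inject into \<open>X\<close>; and every cell contributes
  a point of its own to \<open>X\<close>, unless the core is a point, when cells do not matter.

  \<open>f\<close> is the structure map from \<open>Z\<close> to \<open>X\<close>.
\<close>

definition attach_cells ::
    "'a pointed \<Rightarrow> nat \<Rightarrow> 'x pointed \<Rightarrow> 'x pointed \<Rightarrow> ('x \<Rightarrow> 'x) \<Rightarrow> bool" where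
  "attach_cells A n Z X f \<longleftrightarrow>
     pointed_map Z X f \<and>
     (case n of
        0 \<Rightarrow> \<exists>(J :: 'x set) \<phi>.
               homeomorphic_map (underlying (wedge2 Z (wedge (\<lambda>_. A) J))) (underlying X) \<phi> \<and>
               (\<forall>z\<in>topspace (underlying Z). f z = \<phi> (Inl z))
      | Suc m \<Rightarrow> \<exists>(J :: 'x set) g h.
               (let S = (\<lambda>_. iterated_suspension m A);
                    D = (\<lambda>_. reduced_cone (iterated_suspension m A))
                in pointed_map (wedge S J) Z g \<and>
                   is_pushout (underlying Z) (underlying (wedge S J)) (underlying (wedge D J)) (underlying X)
                     g (wedge_map D (\<lambda>_. cone_base)) f h))"

text \<open>\<open>J0\<close> indexes the 0-cells, \<open>J\<close> the cells of positive dimension \<open>d \<alpha>\<close>.\<close>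

definition attach_mixed_cells ::
    "'a pointed \<Rightarrow> 'x pointed \<Rightarrow> 'x pointed \<Rightarrow> ('x \<Rightarrow> 'x) \<Rightarrow> bool" where
  "attach_mixed_cells A Z X f \<longleftrightarrow>
     pointed_map Z X f \<and>
     (\<exists>(J0 :: 'x set) (J :: 'x set) d g h.
        (\<forall>\<alpha>\<in>J. 1 \<le> d \<alpha>) \<and>
        (let S = (\<lambda>\<alpha>. iterated_suspension (d \<alpha> - 1) A);
             D = (\<lambda>\<alpha>. reduced_cone (iterated_suspension (d \<alpha> - 1) A));
             V = wedge (\<lambda>_. A) J0
         in pointed_map (wedge S J) Z g \<and>
            is_pushout (underlying Z) (underlying (wedge S J)) (underlying (wedge2 V (wedge D J))) (underlying X)
              g (wedge2_inr V (wedge D J) \<circ> wedge_map D (\<lambda>_. cone_base)) f h))"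

text \<open>Filtrations are numbered from 0: \<open>F n\<close> is the stage \<open>X\<^sup>n\<^sup>-\<^sup>1\<close>. The maps \<open>j n\<close> go
  from one stage to the next, the maps \<open>c n\<close> from the stages to \<open>X\<close>.\<close>

definition CW_structure ::
    "'a pointed \<Rightarrow> 'x pointed \<Rightarrow> (nat \<Rightarrow> 'x pointed) \<Rightarrow> (nat \<Rightarrow> 'x \<Rightarrow> 'x) \<Rightarrow> (nat \<Rightarrow> 'x \<Rightarrow> 'x) \<Rightarrow> bool"
    where
  "CW_structure A X F j c \<longleftrightarrow>
     is_point (F 0) \<and>
     (\<forall>n. attach_cells A n (F n) (F (Suc n)) (j n)) \<and>
     (\<forall>n. pointed_map (F n) X (c n)) \<and>
     is_seq_colimit (\<lambda>n. underlying (F n)) j (underlying X) c"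

definition CW_complex :: "'a pointed \<Rightarrow> 'x pointed \<Rightarrow> bool" where
  "CW_complex A X \<longleftrightarrow> (\<exists>F j c. CW_structure A X F j c)"

text \<open>\<open>F n\<close> is all of \<open>X\<close> and \<open>F (n - 1)\<close> is not, that is, the dimension is \<open>n - 1\<close>. For
  \<open>n = 0\<close> the second condition is void: a point without cells has dimension \<open>-1\<close>.\<close>

definition finite_dim_filtration ::
    "'x topology \<Rightarrow> (nat \<Rightarrow> 's topology) \<Rightarrow> (nat \<Rightarrow> 's \<Rightarrow> 'x) \<Rightarrow> bool" where
  "finite_dim_filtration X F c \<longleftrightarrow>
     (\<exists>n. homeomorphic_map (F n) X (c n) \<and>
          (0 < n \<longrightarrow> \<not> homeomorphic_map (F (n - 1)) X (c (n - 1))))"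

definition finite_dim_CW_complex :: "'a pointed \<Rightarrow> 'x pointed \<Rightarrow> bool" where
  "finite_dim_CW_complex A X \<longleftrightarrow>
     (\<exists>F j c. CW_structure A X F j c \<and>
        finite_dim_filtration (underlying X) (\<lambda>n. underlying (F n)) c)"

definition generalized_CW_complex :: "'a pointed \<Rightarrow> 'x pointed \<Rightarrow> bool" where
  "generalized_CW_complex A X \<longleftrightarrow>
     (\<exists>(F :: nat \<Rightarrow> 'x pointed) j c. is_point (F 0) \<and>
        (\<forall>n. attach_mixed_cells A (F n) (F (Suc n)) (j n)) \<and>
        (\<forall>n. pointed_map (F n) X (c n)) \<and>
        is_seq_colimit (\<lambda>n. underlying (F n)) j (underlying X) c)"

definition S0 :: "bool pointed" where
  "S0 = (discrete_topology UNIV, False)"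


section \<open>Ordinary CW-complexes\<close>

text \<open>Complexes with core \<open>S0\<close> have base point preserving attaching maps, so that for instance
  every 1-cell attached to the 0-skeleton has an end at the base point. Here the attaching maps
  \<open>S\<^sup>d\<^sup>-\<^sup>1 \<rightarrow> Z\<close> are arbitrary, as usual for CW-complexes. For \<open>d = 0\<close> the sphere is empty and
  the disk is a point.\<close>

definition disk :: "nat \<Rightarrow> (nat \<Rightarrow> real) topology" where
  "disk d = subtopology (Euclidean_space d) {x. (\<Sum>i<d. x i ^ 2) \<le> 1}"

definition disk_boundary :: "nat \<Rightarrow> (nat \<Rightarrow> real) topology" where
  "disk_boundary d = subtopology (Euclidean_space d) {x. (\<Sum>i<d. x i ^ 2) = 1}"

lemma disk_boundary_Suc: "disk_boundary (Suc n) = nsphere n"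
  by (simp add: disk_boundary_def nsphere_def lessThan_Suc_atMost)

lemma topspace_disk_boundary_0: "topspace (disk_boundary 0) = {}"
  by (simp add: disk_boundary_def)

lemma topspace_disk_0: "topspace (disk 0) = {\<lambda>_. 0}"
  by (auto simp: disk_def topspace_Euclidean_space)

definition attach_ordinary_cells ::
    "(nat \<Rightarrow> bool) \<Rightarrow> 'x topology \<Rightarrow> 'x topology \<Rightarrow> ('x \<Rightarrow> 'x) \<Rightarrow> bool" where
  "attach_ordinary_cells P Z X f \<longleftrightarrow>
     (\<exists>(J :: 'x set) d g h.
        (\<forall>\<alpha>\<in>J. P (d \<alpha>)) \<and>
        is_pushout Z (sum_topology (\<lambda>\<alpha>. disk_boundary (d \<alpha>)) J)
          (sum_topology (\<lambda>\<alpha>. disk (d \<alpha>)) J) X g id f h)"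

text \<open>The base point of an ordinary CW-complex is required to be a 0-cell. As above, \<open>F n\<close> is
  the skeleton \<open>X\<^sup>n\<^sup>-\<^sup>1\<close>; here \<open>F 0\<close> is empty.\<close>

definition ordinary_CW_structure ::
    "'x pointed \<Rightarrow> (nat \<Rightarrow> 'x topology) \<Rightarrow> (nat \<Rightarrow> 'x \<Rightarrow> 'x) \<Rightarrow> (nat \<Rightarrow> 'x \<Rightarrow> 'x) \<Rightarrow> bool" where
  "ordinary_CW_structure X F j c \<longleftrightarrow>
     topspace (F 0) = {} \<and>
     (\<forall>n. attach_ordinary_cells (\<lambda>d. d = n) (F n) (F (Suc n)) (j n)) \<and>
     is_seq_colimit F j (underlying X) c \<and>
     basept X \<in> c 1 ` topspace (F 1)"

definition ordinary_CW_complex :: "'x pointed \<Rightarrow> bool" where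
  "ordinary_CW_complex X \<longleftrightarrow> (\<exists>F j c. ordinary_CW_structure X F j c)"

definition finite_dim_ordinary_CW_complex :: "'x pointed \<Rightarrow> bool" where
  "finite_dim_ordinary_CW_complex X \<longleftrightarrow>
     (\<exists>F j c. ordinary_CW_structure X F j c \<and> finite_dim_filtration (underlying X) F c)"

definition generalized_ordinary_CW_complex :: "'x pointed \<Rightarrow> bool" where
  "generalized_ordinary_CW_complex X \<longleftrightarrow>
     (\<exists>F j c. topspace (F 0) = {basept X} \<and> c 0 (basept X) = basept X \<and>
        (\<forall>n. attach_ordinary_cells (\<lambda>_. True) (F n) (F (Suc n)) (j n)) \<and>
        is_seq_colimit F j (underlying X) c)"

end

theory Submission
  imports Defs
begin

text \<open>
  Complexes of all kinds are presented by characteristic maps: \<open>X\<close> has the final topology for maps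
  \<open>\<Phi> e\<close> from \<open>B \<times> cube (d e)\<close>, injective and with disjoint images on the open cells, and the boundary of each
  cell lies in cells of smaller rank; any rank function is allowed for generalized complexes, and rank = dimension + 1
  for CW-complexes. If \<open>A\<close> is a finite dimensional complex over \<open>B\<close>, a cell \<open>A \<times> cube n\<close> of \<open>X\<close>
  decomposes into the cells \<open>B \<times> cube m \<times> cube n\<close>, one for each \<open>m\<close>-cell of \<open>A\<close>, and finite dimensionality makes
  the lexicographic rank (cell of \<open>X\<close>, cell of \<open>A\<close>) a natural number.

  For the homotopy type, a cylinder on \<open>X\<close> is built cell by cell, its cells being \<open>{0..1} \<times> cube (d e)\<close>. Each new
  attaching map is deformed within the cylinder to the opposite end and made cellular there, so that this
  end is a CW-complex. Pushing the prisms to one end deforms the cylinder onto either of its ends.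
\<close>

section \<open>Final topologies\<close>

text \<open>Cubes are used because they are compact Hausdorff: the product of a final topology, or
  of a quotient map, with a cube or an interval is again one, whatever the core is. Hence
  suspensions, cones, wedges and cells over cells can all be tested on products of the core with
  cubes. The obstacle is the base point. The model of a \<open>d\<close>-cell is a cone over a
  suspension, so all faces of the cube but one are collapsed. A product of two such cubes has two
  free faces, and a folding of the unit square joins them into a single one; otherwise the composed
  cell would not be a cell of the required type.

  The order of attachment in a generalized complex ignores dimension, so an attaching map may meet
  cells of higher dimension and has to be moved off them. This happens to every cell in turn, so the
  old and the new space must be compared while both are under construction. Moving a map off a cell
  rests on the fact that a Lipschitz map from the boundary of an \<open>n\<close>-cube misses a
  point of every box of dimension at least \<open>n\<close>; Lipschitz approximations come from
  Stone-Weierstrass, the missed point from counting.\<close>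

abbreviation "pts X \<equiv> topspace (underlying X)"

abbreviation preim :: "'a topology \<Rightarrow> ('a \<Rightarrow> 'b) \<Rightarrow> 'b set \<Rightarrow> 'a set" where
  "preim X f U \<equiv> {x \<in> topspace X. f x \<in> U}"

text \<open>The set \<open>Q\<close> supplies points that need not be hit by any \<open>q i\<close>.
  In the applications it has at most one element, the base point, which must be present even when
  there are no cells.\<close>

definition final_top ::
    "'x set \<Rightarrow> 'i set \<Rightarrow> ('i \<Rightarrow> 'p topology) \<Rightarrow> ('i \<Rightarrow> 'p \<Rightarrow> 'x) \<Rightarrow> 'x topology" where
  "final_top Q I P q = topology (\<lambda>U. U \<subseteq> Q \<union> (\<Union>i\<in>I. q i ` topspace (P i)) \<and>
     (\<forall>i\<in>I. openin (P i) (preim (P i) (q i) U)))"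

lemma openin_final_top:
  "openin (final_top Q I P q) U \<longleftrightarrow> U \<subseteq> Q \<union> (\<Union>i\<in>I. q i ` topspace (P i)) \<and>
     (\<forall>i\<in>I. openin (P i) (preim (P i) (q i) U))"
proof -
  have 1: "{p \<in> topspace (P i). q i p \<in> S \<inter> T} = preim (P i) (q i) S \<inter> preim (P i) (q i) T" for i S T by auto
  have 2: "{p \<in> topspace (P i). q i p \<in> \<Union>\<K>} = (\<Union>K\<in>\<K>. preim (P i) (q i) K)" for i \<K> by auto
  have "istopology (\<lambda>U. U \<subseteq> Q \<union> (\<Union>i\<in>I. q i ` topspace (P i)) \<and>
     (\<forall>i\<in>I. openin (P i) (preim (P i) (q i) U)))"
    unfolding istopology_def 1 2 by (intro conjI allI impI ballI openin_Int openin_Union) auto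
  then show ?thesis by (simp add: final_top_def)
qed

lemma topspace_final_top [simp]:
  "topspace (final_top Q I P q) = Q \<union> (\<Union>i\<in>I. q i ` topspace (P i))"
proof
  have "{p \<in> topspace (P i). q i p \<in> Q \<union> (\<Union>i\<in>I. q i ` topspace (P i))} = topspace (P i)" if "i \<in> I" for i
    using that by auto
  then have "openin (final_top Q I P q) (Q \<union> (\<Union>i\<in>I. q i ` topspace (P i)))" by (simp add: openin_final_top)
  then show "Q \<union> (\<Union>i\<in>I. q i ` topspace (P i)) \<subseteq> topspace (final_top Q I P q)" by (rule openin_subset)
  show "topspace (final_top Q I P q) \<subseteq> Q \<union> (\<Union>i\<in>I. q i ` topspace (P i))"
    using openin_topspace [of "final_top Q I P q"] unfolding openin_final_top by blast
qed

lemma closedin_final_top: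
  "closedin (final_top Q I P q) C \<longleftrightarrow> C \<subseteq> Q \<union> (\<Union>i\<in>I. q i ` topspace (P i)) \<and>
     (\<forall>i\<in>I. closedin (P i) (preim (P i) (q i) C))"
proof -
  have "topspace (P i) - preim (P i) (q i) C =
      {p \<in> topspace (P i). q i p \<in> topspace (final_top Q I P q) - C}" if "i \<in> I" for i using that by auto
  then show ?thesis unfolding closedin_def openin_final_top by auto
qed

lemma continuous_map_into_final_top:
  "i \<in> I \<Longrightarrow> continuous_map (P i) (final_top Q I P q) (q i)" by (auto simp: continuous_map_def openin_final_top)

lemma continuous_map_from_final_top:
  assumes "\<And>x. x \<in> Q \<Longrightarrow> f x \<in> topspace Y" and "\<And>i. i \<in> I \<Longrightarrow> continuous_map (P i) Y (f \<circ> q i)"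
  shows "continuous_map (final_top Q I P q) Y f" unfolding continuous_map_def
proof (intro conjI allI impI)
  have "f (q i p) \<in> topspace Y" if "i \<in> I" "p \<in> topspace (P i)" for i p
    using continuous_map_image_subset_topspace [OF assms(2) [OF that(1)]] that by auto
  then show "f \<in> topspace (final_top Q I P q) \<rightarrow> topspace Y" using assms(1) by auto
  fix U
  assume U: "openin Y U"
  have "{p \<in> topspace (P i). q i p \<in> preim (final_top Q I P q) f U} =
      {p \<in> topspace (P i). (f \<circ> q i) p \<in> U}" if "i \<in> I" for i using that by auto
  then show "openin (final_top Q I P q) (preim (final_top Q I P q) f U)"
    unfolding openin_final_top using openin_continuous_map_preimage [OF assms(2) U] by auto
qed

lemma quotient_map_openin:
  "quotient_map X Y f \<Longrightarrow> U \<subseteq> topspace Y \<Longrightarrow> openin X (preim X f U) \<longleftrightarrow> openin Y U"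
  by (simp add: quotient_map_def)

text \<open>Openness can be tested upstairs along a quotient map. In this way spheres and cones are
  exchanged for products of the core with cubes.\<close>

lemma final_top_quotient:
  assumes "\<And>i. i \<in> I \<Longrightarrow> quotient_map (P' i) (P i) (\<delta> i)"
  shows "final_top Q I P q = final_top Q I P' (\<lambda>i. q i \<circ> \<delta> i)"
proof -
  have s: "\<delta> i ` topspace (P' i) = topspace (P i)" if "i \<in> I" for i using assms that by (simp add: quotient_map_def)
  have o: "openin (P i) (preim (P i) (q i) U) \<longleftrightarrow>
      openin (P' i) {p \<in> topspace (P' i). (q i \<circ> \<delta> i) p \<in> U}" if "i \<in> I" for i U
  proof -
    have "{x \<in> topspace (P' i). \<delta> i x \<in> preim (P i) (q i) U} =
        {p \<in> topspace (P' i). (q i \<circ> \<delta> i) p \<in> U}" using s that by auto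
    moreover have "preim (P i) (q i) U \<subseteq> topspace (P i)" by auto
    ultimately show ?thesis using quotient_map_openin [OF assms [OF that], of "preim (P i) (q i) U"] by simp
  qed
  have i: "(\<Union>i\<in>I. q i ` topspace (P i)) = (\<Union>i\<in>I. (q i \<circ> \<delta> i) ` topspace (P' i))"
    using s by (intro SUP_cong refl) (metis image_comp)
  show ?thesis unfolding topology_eq openin_final_top i using o by blast
qed

lemma final_top_cong:
  assumes "\<And>i p. i \<in> I \<Longrightarrow> p \<in> topspace (P i) \<Longrightarrow> q i p = q' i p"
  shows "final_top Q I P q = final_top Q I P q'"
proof -
  have "(\<Union>i\<in>I. q i ` topspace (P i)) = (\<Union>i\<in>I. q' i ` topspace (P i))"
    using assms by (intro SUP_cong refl image_cong) auto
  moreover have "preim (P i) (q i) U = preim (P i) (q' i) U" if "i \<in> I" for i U using assms that by auto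
  ultimately show ?thesis unfolding topology_eq openin_final_top by simp
qed

section \<open>Products with a locally compact Hausdorff space\<close>

lemma openin_prod_disjoint_sum:
  assumes "V \<subseteq> topspace (disjoint_sum X Y) \<times> topspace L"
    and X: "openin (prod_topology X L) {(x, l). (Inl x, l) \<in> V}" and Y: "openin (prod_topology Y L) {(y, l). (Inr y, l) \<in> V}"
  shows "openin (prod_topology (disjoint_sum X Y) L) V" unfolding openin_prod_topology_alt
proof (intro allI impI)
  fix s l
  assume V: "(s, l) \<in> V"
  show "\<exists>U W. openin (disjoint_sum X Y) U \<and> openin L W \<and> s \<in> U \<and> l \<in> W \<and> U \<times> W \<subseteq> V"
  proof (cases s)
    case (Inl x)
    then have "(x, l) \<in> {(x, l). (Inl x, l) \<in> V}" using V by simp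
    then obtain U W where UW: "openin X U" "openin L W" "x \<in> U" "l \<in> W"
      "U \<times> W \<subseteq> {(x, l). (Inl x, l) \<in> V}" using openin_prod_topology_alt [THEN iffD1, rule_format, OF X] by meson
    have "Inl -` (Inl ` U :: ('a + 'b) set) = U" "Inr -` (Inl ` U :: ('a + 'b) set) = {}" by auto
    then have "openin (disjoint_sum X Y) (Inl ` U)" using UW by (simp add: openin_disjoint_sum)
    moreover have "Inl ` U \<times> W \<subseteq> V" using UW by auto
    ultimately show ?thesis using UW Inl by blast
  next
    case (Inr y)
    then have "(y, l) \<in> {(x, l). (Inr x, l) \<in> V}" using V by simp
    then obtain U W where UW: "openin Y U" "openin L W" "y \<in> U" "l \<in> W"
      "U \<times> W \<subseteq> {(x, l). (Inr x, l) \<in> V}" using openin_prod_topology_alt [THEN iffD1, rule_format, OF Y] by meson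
    have "Inr -` (Inr ` U :: ('a + 'b) set) = U" "Inl -` (Inr ` U :: ('a + 'b) set) = {}" by auto
    then have "openin (disjoint_sum X Y) (Inr ` U)" using UW by (simp add: openin_disjoint_sum)
    moreover have "Inr ` U \<times> W \<subseteq> V" using UW by auto
    ultimately show ?thesis using UW Inr by blast
  qed
qed

lemma openin_prod_sum_topology:
  assumes "V \<subseteq> topspace (sum_topology X I) \<times> topspace L"
    and X: "\<And>i. i \<in> I \<Longrightarrow> openin (prod_topology (X i) L) {(x, l). ((i, x), l) \<in> V}"
  shows "openin (prod_topology (sum_topology X I) L) V" unfolding openin_prod_topology_alt
proof (intro allI impI)
  fix s l
  assume V: "(s, l) \<in> V"
  obtain i x where s: "s = (i, x)" by (cases s)
  have i: "i \<in> I" using V s assms(1) by auto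
  have "(x, l) \<in> {(x, l). ((i, x), l) \<in> V}" using V s by simp
  then obtain U W where UW: "openin (X i) U" "openin L W" "x \<in> U" "l \<in> W"
    "U \<times> W \<subseteq> {(x, l). ((i, x), l) \<in> V}"
    using openin_prod_topology_alt [THEN iffD1, rule_format, OF X [OF i]] by meson
  have "openin (sum_topology X I) (Pair i ` U)" using open_map_component_injection [OF i, of X] UW(1) by (auto simp: open_map_def)
  moreover have "Pair i ` U \<times> W \<subseteq> V" using UW by auto
  ultimately show "\<exists>U W. openin (sum_topology X I) U \<and> openin L W \<and> s \<in> U \<and> l \<in> W \<and> U \<times> W \<subseteq> V"
    using UW s by blast
qed

text \<open>A final topology is a quotient of a disjoint sum. The product with a locally compact
  Hausdorff space preserves quotient maps and distributes over sums, so openness in the product is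
  again tested map by map. Both homotopies and the cells \<open>A \<times> cube n\<close> of a
  complex over a complex rely on this.\<close>

lemma openin_prod_final_top:
  assumes L: "locally_compact_space L" "Hausdorff_space L" and V: "V \<subseteq> topspace (final_top Q I P q) \<times> topspace L"
    and o: "\<And>x. x \<in> Q \<Longrightarrow> openin L {l. (x, l) \<in> V}"
    and i: "\<And>i. i \<in> I \<Longrightarrow> openin (prod_topology (P i) L) {(p, l). p \<in> topspace (P i) \<and> (q i p, l) \<in> V}"
  shows "openin (prod_topology (final_top Q I P q) L) V"
proof -
  let ?S = "disjoint_sum (discrete_topology Q) (sum_topology P I)"
  let ?q = "case_sum id (\<lambda>(i, p). q i p)"
  have "quotient_map ?S (final_top Q I P q) ?q" unfolding quotient_map_def
  by (fastforce simp: Plus_def image_Un image_iff openin_disjoint_sum openin_sum_topology openin_final_top)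
  then have "quotient_map (prod_topology ?S L) (prod_topology (final_top Q I P q) L) (\<lambda>(x, y). (?q x, y))"
    using L by (intro quotient_map_prod_left) auto
  moreover have "openin (prod_topology ?S L)
      {z \<in> topspace (prod_topology ?S L). (case z of (x, y) \<Rightarrow> (?q x, y)) \<in> V}"
  proof (intro openin_prod_disjoint_sum openin_prod_sum_topology)
    have "{(x, l). (Inl x, l) \<in> {z \<in> topspace (prod_topology ?S L). (case z of (x, y) \<Rightarrow> (?q x, y)) \<in> V}}
        = (\<Union>x\<in>Q. {x} \<times> {l. (x, l) \<in> V})" using V by auto
    moreover have "openin (prod_topology (discrete_topology Q) L) (\<Union>x\<in>Q. {x} \<times> {l. (x, l) \<in> V})"
      using o by (intro openin_Union) (auto simp: openin_prod_Times_iff)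
    ultimately show "openin (prod_topology (discrete_topology Q) L) {(x, l). (Inl x, l) \<in>
        {z \<in> topspace (prod_topology ?S L). (case z of (x, y) \<Rightarrow> (?q x, y)) \<in> V}}" by simp
  next
    fix i
    assume "i \<in> I"
    then have "{(x, l). ((i, x), l) \<in> {(y, l). (Inr y, l) \<in>
        {z \<in> topspace (prod_topology ?S L). (case z of (x, y) \<Rightarrow> (?q x, y)) \<in> V}}} =
        {(p, l). p \<in> topspace (P i) \<and> (q i p, l) \<in> V}" using V by auto
    then show "openin (prod_topology (P i) L) {(x, l). ((i, x), l) \<in> {(y, l). (Inr y, l) \<in>
        {z \<in> topspace (prod_topology ?S L). (case z of (x, y) \<Rightarrow> (?q x, y)) \<in> V}}}"
      using i [OF \<open>i \<in> I\<close>] by simp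
  qed auto
  moreover have "V \<subseteq> topspace (prod_topology (final_top Q I P q) L)" using V by simp
  ultimately show ?thesis unfolding quotient_map_def by blast
qed

lemma continuous_map_from_prod_final_top:
  assumes L: "locally_compact_space L" "Hausdorff_space L"
    and o: "\<And>x. x \<in> Q \<Longrightarrow> continuous_map L Y (\<lambda>l. f (x, l))"
    and i: "\<And>i. i \<in> I \<Longrightarrow> continuous_map (prod_topology (P i) L) Y (\<lambda>(p, l). f (q i p, l))"
  shows "continuous_map (prod_topology (final_top Q I P q) L) Y f" unfolding continuous_map_def
proof (intro conjI allI impI)
  have 1: "f (x, l) \<in> topspace Y" if "x \<in> Q" "l \<in> topspace L" for x l
    using continuous_map_image_subset_topspace [OF o [OF that(1)]] that by auto
  have 2: "f (q i p, l) \<in> topspace Y" if "i \<in> I" "p \<in> topspace (P i)" "l \<in> topspace L" for i p l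
    using continuous_map_image_subset_topspace [OF i [OF that(1)]] that by fastforce
  show "f \<in> topspace (prod_topology (final_top Q I P q) L) \<rightarrow> topspace Y" using 1 2 by auto
  fix U
  assume U: "openin Y U"
  show "openin (prod_topology (final_top Q I P q) L) (preim (prod_topology (final_top Q I P q) L) f U)"
  proof (rule openin_prod_final_top [OF L])
    fix x
    assume "x \<in> Q"
    then have "{l. (x, l) \<in> preim (prod_topology (final_top Q I P q) L) f U} = {l \<in> topspace L. f (x, l) \<in> U}" by auto
    then show "openin L {l. (x, l) \<in> preim (prod_topology (final_top Q I P q) L) f U}"
      using openin_continuous_map_preimage [OF o [OF \<open>x \<in> Q\<close>] U] by simp
  next
    fix j
    assume j: "j \<in> I"
    then have "{(p, l). p \<in> topspace (P j) \<and> (q j p, l) \<in> preim (prod_topology (final_top Q I P q) L) f U}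
      = {z \<in> topspace (prod_topology (P j) L). (case z of (p, l) \<Rightarrow> f (q j p, l)) \<in> U}" by auto
    then show "openin (prod_topology (P j) L)
        {(p, l). p \<in> topspace (P j) \<and> (q j p, l) \<in> preim (prod_topology (final_top Q I P q) L) f U}"
      using openin_continuous_map_preimage [OF i [OF j] U] by simp
  qed auto
qed

lemma continuous_map_paste:
  assumes "closedin X S" "closedin X T" "topspace X \<subseteq> S \<union> T"
    and "continuous_map (subtopology X S) Y f" "continuous_map (subtopology X T) Y f"
  shows "continuous_map X Y f" unfolding continuous_map_closedin
proof (intro conjI allI impI)
  show "f \<in> topspace X \<rightarrow> topspace Y" using assms(3) continuous_map_image_subset_topspace [OF assms(4)]
      continuous_map_image_subset_topspace [OF assms(5)] by (auto simp: image_subset_iff)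
  fix C
  assume C: "closedin Y C"
  have "closedin X (preim (subtopology X S) f C)"
    using closedin_continuous_map_preimage [OF assms(4) C] assms(1) closedin_trans_full by blast
  moreover have "closedin X (preim (subtopology X T) f C)"
    using closedin_continuous_map_preimage [OF assms(5) C] assms(2) closedin_trans_full by blast
  moreover have "preim X f C = preim (subtopology X S) f C \<union> preim (subtopology X T) f C" using assms(3) by auto
  ultimately show "closedin X (preim X f C)" by (simp add: closedin_Un)
qed


section \<open>Pushouts and sequential colimits along injective maps\<close>

text \<open>A canonical representative of each gluing class: points in the image of \<open>i\<close>
  are moved to \<open>Z\<close>, all others stay. For injective \<open>i\<close> this turns the
  generated equivalence relation into equality of representatives.\<close>

definition glue_rep :: "'w set \<Rightarrow> ('w \<Rightarrow> 'z) \<Rightarrow> ('w \<Rightarrow> 'c) \<Rightarrow> 'z + 'c \<Rightarrow> 'z + 'c" where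
  "glue_rep W g i u = (case u of Inl z \<Rightarrow> Inl z
     | Inr c \<Rightarrow> if c \<in> i ` W then Inl (g (the_inv_into W i c)) else Inr c)"

lemma equivclp_glue_iff:
  assumes "inj_on i W"
  shows "equivclp (\<lambda>u v. \<exists>w\<in>W. u = Inl (g w) \<and> v = Inr (i w)) x y \<longleftrightarrow> glue_rep W g i x = glue_rep W g i y"
    (is "equivclp ?r x y \<longleftrightarrow> _")
proof
  assume "equivclp ?r x y"
  then show "glue_rep W g i x = glue_rep W g i y"
  proof (induction rule: equivclp_induct)
    case (step y z)
    then show ?case using assms by (auto simp: glue_rep_def the_inv_into_f_f)
  qed simp
next
  have *: "equivclp ?r u (glue_rep W g i u)" for u
  proof (cases "\<exists>w\<in>W. u = Inr (i w)")
    case True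
    then obtain w where "w \<in> W" "u = Inr (i w)" by blast
    then have "?r (glue_rep W g i u) u" using assms by (auto simp: glue_rep_def the_inv_into_f_f)
    then show ?thesis by (intro equivclp_sym [OF r_into_equivclp [where r = ?r]])
  next
    case False
    then have "glue_rep W g i u = u" by (auto simp: glue_rep_def split: sum.split)
    then show ?thesis by simp
  qed
  assume "glue_rep W g i x = glue_rep W g i y"
  then have "equivclp ?r (glue_rep W g i x) y" using equivclp_sym [OF * [of y]] by simp
  then show "equivclp ?r x y" by (rule equivclp_trans [OF * [of x]])
qed

text \<open>Along an injective \<open>i\<close> the pushout is, as a set, \<open>Z\<close> together
  with the part of \<open>C\<close> outside the image of \<open>i\<close>. The conditions on the
  right replace the generated equivalence both when pushouts are used and when they are
  built.\<close>

lemma is_pushout_iff: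
  assumes inj: "inj_on i (topspace W)" and g: "continuous_map W Z g" and i: "continuous_map W C i"
  shows "is_pushout Z W C X g i f h \<longleftrightarrow> inj_on f (topspace Z) \<and> inj_on h (topspace C - i ` topspace W) \<and>
    f ` topspace Z \<inter> h ` (topspace C - i ` topspace W) = {} \<and>
    (\<forall>w\<in>topspace W. f (g w) = h (i w)) \<and> topspace X = f ` topspace Z \<union> h ` topspace C \<and>
    (\<forall>U\<subseteq>topspace X. openin X U \<longleftrightarrow> openin Z (preim Z f U) \<and> openin C (preim C h U))"
    (is "_ \<longleftrightarrow> ?rhs")
proof -
  let ?q = "case_sum f h" and ?D = "disjoint_sum Z C" and ?rep = "glue_rep (topspace W) g i"
  have gW: "g w \<in> topspace Z" and iW: "i w \<in> topspace C" if "w \<in> topspace W" for w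
    using that g i by (auto simp: continuous_map_def)
  have pre: "openin ?D (preim ?D ?q U) \<longleftrightarrow> openin Z (preim Z f U) \<and> openin C (preim C h U)" for U
  proof -
    have "Inl -` preim ?D ?q U = preim Z f U"
      "Inr -` preim ?D ?q U = preim C h U" by auto
    then show ?thesis by (simp add: openin_disjoint_sum)
  qed
  have im: "?q ` topspace ?D = f ` topspace Z \<union> h ` topspace C" by (force simp: Plus_def image_Un)
  have q: "quotient_map ?D X ?q \<longleftrightarrow> topspace X = f ` topspace Z \<union> h ` topspace C \<and>
    (\<forall>U\<subseteq>topspace X. openin X U \<longleftrightarrow> openin Z (preim Z f U) \<and> openin C (preim C h U))"
    unfolding quotient_map_def im pre by blast
  have repW: "?rep (Inr (i w)) = Inl (g w)" if "w \<in> topspace W" for w using that inj by (auto simp: glue_rep_def the_inv_into_f_f)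
  have rep1: "?rep (Inl z) = Inl z" for z by (simp add: glue_rep_def)
  have rep2: "?rep (Inr c) = Inr c" if "c \<notin> i ` topspace W" for c using that by (simp add: glue_rep_def)
  have "(\<forall>x\<in>topspace ?D. \<forall>y\<in>topspace ?D. ?q x = ?q y \<longleftrightarrow> ?rep x = ?rep y) \<longleftrightarrow>
    inj_on f (topspace Z) \<and> inj_on h (topspace C - i ` topspace W) \<and>
    f ` topspace Z \<inter> h ` (topspace C - i ` topspace W) = {} \<and>
    (\<forall>w\<in>topspace W. f (g w) = h (i w))" (is "?L \<longleftrightarrow> ?R")
  proof
    assume ?L
    then have L: "?q x = ?q y \<longleftrightarrow> ?rep x = ?rep y" if "x \<in> topspace ?D" "y \<in> topspace ?D" for x y
      using that by blast
    show ?R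
    proof (intro conjI ballI)
      show "inj_on f (topspace Z)"
      proof (rule inj_onI)
        fix x y assume "x \<in> topspace Z" "y \<in> topspace Z" "f x = f y"
        then show "x = y" using L [of "Inl x" "Inl y"] by (simp add: rep1 InlI)
      qed
      show "inj_on h (topspace C - i ` topspace W)"
      proof (rule inj_onI)
        fix x y assume "x \<in> topspace C - i ` topspace W" "y \<in> topspace C - i ` topspace W" "h x = h y"
        then show "x = y" using L [of "Inr x" "Inr y"] by (simp add: rep2 InrI)
      qed
      have "f z \<noteq> h c" if "z \<in> topspace Z" "c \<in> topspace C - i ` topspace W" for z c
        using L [of "Inl z" "Inr c"] that by (auto simp: rep1 rep2)
      then show "f ` topspace Z \<inter> h ` (topspace C - i ` topspace W) = {}" by blast
      fix w assume w: "w \<in> topspace W"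
      show "f (g w) = h (i w)" using L [of "Inl (g w)" "Inr (i w)"] w by (simp add: rep1 repW gW iW InlI InrI)
    qed
  next
    assume R: ?R
    define q' where "q' = ?q"
    have *: "\<exists>v. ?rep u = v \<and> ?q u = ?q v \<and> v \<in> Inl ` topspace Z \<union> Inr ` (topspace C - i ` topspace W)"
      if "u \<in> topspace ?D" for u
    proof (cases u)
      case (Inl z)
      then show ?thesis using that by (auto simp: rep1)
    next
      case (Inr c)
      show ?thesis
      proof (cases "c \<in> i ` topspace W")
        case True
        then show ?thesis using Inr R by (auto simp: repW gW)
      next
        case False
        then show ?thesis using Inr that by (auto simp: rep2)
      qed
    qed
    have "inj_on ?q (Inl ` topspace Z \<union> Inr ` (topspace C - i ` topspace W))" unfolding inj_on_Un
    proof (intro conjI)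
      show "inj_on ?q (Inl ` topspace Z)" "inj_on ?q (Inr ` (topspace C - i ` topspace W))" using R by (simp_all add: inj_on_def)
      have "?q ` (Inl ` topspace Z - Inr ` (topspace C - i ` topspace W)) \<subseteq> f ` topspace Z"
        "?q ` (Inr ` (topspace C - i ` topspace W) - Inl ` topspace Z) \<subseteq> h ` (topspace C - i ` topspace W)" by auto
      moreover have "f ` topspace Z \<inter> h ` (topspace C - i ` topspace W) = {}" using R by simp
      ultimately show "?q ` (Inl ` topspace Z - Inr ` (topspace C - i ` topspace W)) \<inter>
          ?q ` (Inr ` (topspace C - i ` topspace W) - Inl ` topspace Z) = {}" by blast
    qed
    then show ?L using * unfolding inj_on_def by metis
  qed
  then show ?thesis unfolding is_pushout_def is_quotient_by_def q equivclp_glue_iff [OF inj] using g i by blast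
qed

primrec push_up :: "(nat \<Rightarrow> 's \<Rightarrow> 's) \<Rightarrow> nat \<Rightarrow> nat \<Rightarrow> 's \<Rightarrow> 's" where
  "push_up j n 0 s = s"
| "push_up j n (Suc k) s = j (n + k) (push_up j n k s)"

lemma push_up_add: "push_up j n (k + l) s = push_up j (n + k) l (push_up j n k s)" by (induction l) (simp_all add: add.assoc)

lemma is_seq_colimit_iff:
  assumes inj: "\<And>n. inj_on (j n) (topspace (S n))" and j: "\<And>n. continuous_map (S n) (S (Suc n)) (j n)"
  shows "is_seq_colimit S j X c \<longleftrightarrow>
    (\<forall>n. inj_on (c n) (topspace (S n))) \<and> (\<forall>n. \<forall>s\<in>topspace (S n). c (Suc n) (j n s) = c n s) \<and>
    topspace X = (\<Union>n. c n ` topspace (S n)) \<and>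
    (\<forall>U\<subseteq>topspace X. openin X U \<longleftrightarrow> (\<forall>n. openin (S n) (preim (S n) (c n) U)))"
    (is "_ \<longleftrightarrow> ?rhs")
proof -
  let ?r = "\<lambda>u v. \<exists>n. \<exists>s\<in>topspace (S n). u = (n, s) \<and> v = (Suc n, j n s)"
  let ?T = "sum_topology S UNIV" and ?q = "\<lambda>(n, s). c n s"
  have jS: "j n s \<in> topspace (S (Suc n))" if "s \<in> topspace (S n)" for n s using that j by (auto simp: continuous_map_def)
  have pS: "push_up j n k s \<in> topspace (S (n + k))" if "s \<in> topspace (S n)" for n k s by (induction k) (use that jS in auto)
  have pinj: "s = t" if "s \<in> topspace (S n)" "t \<in> topspace (S n)" "push_up j n k s = push_up j n k t" for n k s t
    using that(3)
  proof (induction k)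
    case (Suc k)
    then show ?case using inj [of "n + k"] pS that(1,2) by (auto simp: inj_on_def)
  qed simp
  have eqp: "equivclp ?r (n, s) (n + k, push_up j n k s)" if "s \<in> topspace (S n)" for n k s
  proof (induction k)
    case (Suc k)
    have "?r (n + k, push_up j n k s) (n + Suc k, push_up j n (Suc k) s)" using pS that by auto
    then have "equivclp ?r (n + k, push_up j n k s) (n + Suc k, push_up j n (Suc k) s)" by (rule r_into_equivclp [where r = ?r])
    with Suc show ?case by (rule equivclp_trans)
  qed simp
  \<comment> \<open>Two points are identified in the colimit exactly when their images agree at some
    common later stage \<open>N\<close>. Comparing at a still later stage gives transitivity, and
    injectivity of the maps brings equality back to the original stage.\<close>
  define R where "R = (\<lambda>u v. \<exists>N. fst u \<le> N \<and> fst v \<le> N \<and>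
    push_up j (fst u) (N - fst u) (snd u) = push_up j (fst v) (N - fst v) (snd v))"
  have push_more: "push_up j n (N' - n) s = push_up j N (N' - N) (push_up j n (N - n) s)" if "n \<le> N" "N \<le> N'" for n N N' s
    using push_up_add [of j n "N - n" "N' - N" s] that by simp
  have Rtrans: "R u w" if uv: "R u v" and vw: "R v w" for u v w
  proof -
    obtain N M where N: "fst u \<le> N" "fst v \<le> N" "push_up j (fst u) (N - fst u) (snd u) = push_up j (fst v) (N - fst v) (snd v)"
      and M: "fst v \<le> M" "fst w \<le> M" "push_up j (fst v) (M - fst v) (snd v) = push_up j (fst w) (M - fst w) (snd w)"
      using uv vw unfolding R_def by blast
    obtain K where K: "N \<le> K" "M \<le> K" by (meson max.cobounded1 max.cobounded2)
    have "push_up j (fst u) (K - fst u) (snd u) = push_up j (fst v) (K - fst v) (snd v)"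
      using push_more [OF N(1) K(1), of "snd u"] push_more [OF N(2) K(1), of "snd v"] N(3) by metis
    also have "\<dots> = push_up j (fst w) (K - fst w) (snd w)"
      using push_more [OF M(1) K(2), of "snd v"] push_more [OF M(2) K(2), of "snd w"] M(3) by metis
    finally show ?thesis using N M K unfolding R_def by (intro exI [of _ K]) auto
  qed
  have Rr: "R u v \<and> R v u" if uv: "?r u v" for u v
  proof -
    obtain n s where "u = (n, s)" "v = (Suc n, j n s)" using uv by blast
    then have "push_up j (fst u) (Suc n - fst u) (snd u) = push_up j (fst v) (Suc n - fst v) (snd v)" by (simp add: Suc_diff_le)
    then show ?thesis using \<open>u = (n, s)\<close> \<open>v = (Suc n, j n s)\<close>
      unfolding R_def by (intro conjI exI [of _ "Suc n"]) auto
  qed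
  have eqR: "R u v" if "equivclp ?r u v" for u v using that
  proof (induction rule: equivclp_induct)
    case base
    show ?case by (auto simp: R_def)
  next
    case (step y z)
    then show ?case using Rr Rtrans by blast
  qed
  have q: "quotient_map ?T X ?q \<longleftrightarrow> topspace X = (\<Union>n. c n ` topspace (S n)) \<and>
    (\<forall>U\<subseteq>topspace X. openin X U \<longleftrightarrow> (\<forall>n. openin (S n) (preim (S n) (c n) U)))"
  proof -
    have im: "?q ` topspace ?T = (\<Union>n. c n ` topspace (S n))" by force
    have op: "openin ?T (preim ?T ?q U) \<longleftrightarrow> (\<forall>n. openin (S n) (preim (S n) (c n) U))" for U
    by (auto simp: openin_sum_topology)
    show ?thesis unfolding quotient_map_def im op by blast
  qed
  have "(\<forall>x\<in>topspace ?T. \<forall>y\<in>topspace ?T. ?q x = ?q y \<longleftrightarrow> equivclp ?r x y) \<longleftrightarrow>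
     (\<forall>n. inj_on (c n) (topspace (S n))) \<and> (\<forall>n. \<forall>s\<in>topspace (S n). c (Suc n) (j n s) = c n s)" (is "?L \<longleftrightarrow> ?R")
  proof
    assume L: ?L
    show ?R
    proof (intro conjI allI ballI)
      fix n
      show "inj_on (c n) (topspace (S n))"
      proof (rule inj_onI)
        fix s t assume st: "s \<in> topspace (S n)" "t \<in> topspace (S n)" "c n s = c n t"
        then have "equivclp ?r (n, s) (n, t)" using L by auto
        then have "R (n, s) (n, t)" by (rule eqR)
        then show "s = t" using pinj st unfolding R_def by auto
      qed
      fix s assume s: "s \<in> topspace (S n)"
      then have "equivclp ?r (n, s) (Suc n, j n s)" by (intro r_into_equivclp [where r = ?r]) auto
      then show "c (Suc n) (j n s) = c n s" using L s jS by fastforce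
    qed
  next
    assume R: ?R
    have cp: "c (n + k) (push_up j n k s) = c n s" if "s \<in> topspace (S n)" for n k s by (induction k) (use R pS that in auto)
    show ?L
    proof (intro ballI iffI)
      fix x y assume "x \<in> topspace ?T" "y \<in> topspace ?T" and eq: "?q x = ?q y"
      then obtain n s m t where xy: "x = (n, s)" "y = (m, t)" "s \<in> topspace (S n)" "t \<in> topspace (S m)" by auto
      have *: "equivclp ?r (n, s) (m, t)" if "n \<le> m" "s \<in> topspace (S n)" "t \<in> topspace (S m)" "c n s = c m t" for n s m t
      proof -
        have "c m (push_up j n (m - n) s) = c m t" using cp [OF that(2), of "m - n"] that by simp
        then have "push_up j n (m - n) s = t" using R that pS [OF that(2), of "m - n"] by (auto simp: inj_on_def)
        then show ?thesis using eqp [OF that(2), of "m - n"] that(1) by simp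
      qed
      show "equivclp ?r x y" using * [of n m s t] * [of m n t s] xy eq equivclp_sym by (cases "n \<le> m") (auto simp: equivclp_sym)
    next
      fix x y assume "equivclp ?r x y"
      then show "?q x = ?q y" by (induction rule: equivclp_induct) (use R in auto)
    qed
  qed
  then show ?thesis unfolding is_seq_colimit_def is_quotient_by_def q using j by blast
qed

section \<open>Cells modelled on cubes\<close>

type_synonym coords = "nat \<Rightarrow> real"

abbreviation "I01 \<equiv> top_of_set {0..1::real}"

definition cube :: "nat \<Rightarrow> coords set" where
  "cube d = {u. (\<forall>i<d. 0 \<le> u i \<and> u i \<le> 1) \<and> (\<forall>i\<ge>d. u i = 0)}"

definition cube_int :: "nat \<Rightarrow> coords set" where
  "cube_int d = {u. (\<forall>i<d. 0 < u i \<and> u i < 1) \<and> (\<forall>i\<ge>d. u i = 0)}"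

definition cube_bd :: "nat \<Rightarrow> coords set" where
  "cube_bd d = {u \<in> cube d. \<exists>i<d. u i = 0 \<or> u i = 1}"

text \<open>All faces except the face \<open>u 0 = 0\<close>, which is the base of the cone in the model
  \<open>C\<Sigma>\<^sup>d\<^sup>-\<^sup>1B\<close> of a \<open>d\<close>-cell.\<close>

definition cube_J :: "nat \<Rightarrow> coords set" where
  "cube_J d = {u \<in> cube d. \<exists>i<d. u i = 1 \<or> 0 < i \<and> u i = 0}"

lemma cube_int_subset: "cube_int d \<subseteq> cube d" by (auto simp: cube_int_def cube_def)

lemma cube_bd_subset: "cube_bd d \<subseteq> cube d" by (auto simp: cube_bd_def)

lemma cube_J_subset: "cube_J d \<subseteq> cube_bd d" by (auto simp: cube_J_def cube_bd_def)

lemma cube_cases: "u \<in> cube d \<Longrightarrow> u \<in> cube_int d \<or> u \<in> cube_bd d"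
  by (force simp: cube_def cube_int_def cube_bd_def)

lemma cube_int_bd_disjoint: "u \<in> cube_int d \<Longrightarrow> u \<notin> cube_bd d" by (force simp: cube_int_def cube_bd_def)

lemma cube_0 [simp]: "cube 0 = {\<lambda>_. 0}" "cube_int 0 = {\<lambda>_. 0}" "cube_bd 0 = {}" "cube_J 0 = {}"
  by (auto simp: cube_def cube_int_def cube_bd_def cube_J_def)

lemma cube_int_nonempty: "(\<lambda>i. if i < d then 1/2 else 0) \<in> cube_int d" by (simp add: cube_int_def)

lemma compact_cube: "compact (cube d)"
proof -
  have "u \<in> cube d \<longleftrightarrow> (\<forall>i. u i \<in> (if i < d then {0..1} else {0}))" for u
  using spec by (auto simp: cube_def)
  then have "cube d = PiE UNIV (\<lambda>i. if i < d then {0..1} else {0})"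
    by (intro set_eqI) (simp only: PiE_UNIV_domain Pi_iff ball_UNIV)
  moreover have "compactin (product_topology (\<lambda>_::nat. euclidean) UNIV) (PiE UNIV (\<lambda>i. if i < d then {0..1::real} else {0}))"
    by (subst compactin_PiE) simp
  ultimately show ?thesis by (simp add: euclidean_product_topology)
qed

lemma compact_space_cube: "compact_space (top_of_set (cube d))" by (simp add: compact_cube compact_space_subtopology)

lemma Hausdorff_space_cube: "Hausdorff_space (top_of_set (cube d))" by (simp add: Hausdorff_space_subtopology)

lemma locally_compact_space_cube: "locally_compact_space (top_of_set (cube d))"
  by (simp add: compact_space_cube compact_imp_locally_compact_space)

lemma continuous_map_euclidean_fun:
  "continuous_map X (euclidean :: coords topology) f \<longleftrightarrow> (\<forall>i. continuous_map X euclideanreal (\<lambda>x. f x i))"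
  unfolding euclidean_product_topology [symmetric] by (rule continuous_map_componentwise_UNIV)

lemma continuous_map_into_cube:
  "continuous_map X (top_of_set (cube d)) f \<longleftrightarrow>
     (\<forall>x\<in>topspace X. f x \<in> cube d) \<and> (\<forall>i. continuous_map X euclideanreal (\<lambda>x. f x i))"
  by (auto simp: continuous_map_in_subtopology continuous_map_euclidean_fun)

lemma continuous_map_coordinate:
  "continuous_map (top_of_set S) euclideanreal (\<lambda>u::nat \<Rightarrow> real. u i)"
  using continuous_map_euclidean_fun [of "top_of_set S" "\<lambda>u. u"] by (simp add: continuous_map_from_subtopology)

lemma continuous_map_snd_coordinate:
  "continuous_map (prod_topology X (top_of_set S)) euclideanreal (\<lambda>p. (snd p :: nat \<Rightarrow> real) i)"
  using continuous_map_compose [OF continuous_map_snd continuous_map_coordinate] by (simp add: o_def)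

lemma closed_coordinate: "closed {u :: nat \<Rightarrow> real. u i = c}"
proof -
  have "continuous_on UNIV (\<lambda>u :: nat \<Rightarrow> real. u i)" by simp
  then show ?thesis using closed_Collect_eq [of "\<lambda>u :: nat \<Rightarrow> real. u i" "\<lambda>_. c"] by simp
qed

lemma closed_cube: "closed (cube d)" by (simp add: compact_cube compact_imp_closed)

lemma closed_cube_bd: "closed (cube_bd d)"
proof -
  have "cube_bd d = cube d \<inter> (\<Union>i<d. {u. u i = 0} \<union> {u. u i = 1})" by (auto simp: cube_bd_def)
  then show ?thesis by (auto intro!: closed_Int closed_UN closed_Un closed_coordinate closed_cube)
qed

lemma compact_cube_bd: "compact (cube_bd d)"
  using compact_cube closed_cube_bd cube_bd_subset by (metis compact_Int_closed inf.absorb_iff2)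

lemma closed_cube_J: "closed (cube_J d)"
proof -
  have "cube_J d = cube d \<inter> ((\<Union>i\<in>{0<..<d}. {u. u i = 0}) \<union> (\<Union>i<d. {u. u i = 1}))"
    by (auto simp: cube_J_def)
  then show ?thesis by (auto intro!: closed_Int closed_UN closed_Un closed_coordinate closed_cube)
qed

abbreviation cell_space :: "'b topology \<Rightarrow> nat \<Rightarrow> ('b \<times> coords) topology" where
  "cell_space B d \<equiv> prod_topology B (top_of_set (cube d))"

abbreviation cell_bd_space :: "'b topology \<Rightarrow> nat \<Rightarrow> ('b \<times> coords) topology" where
  "cell_bd_space B d \<equiv> prod_topology B (top_of_set (cube_bd d))"

abbreviation cell_set :: "'b topology \<Rightarrow> nat \<Rightarrow> ('b \<times> coords) set" where
  "cell_set B d \<equiv> topspace (cell_space B d)"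

abbreviation cell_bd_set :: "'b topology \<Rightarrow> nat \<Rightarrow> ('b \<times> coords) set" where
  "cell_bd_set B d \<equiv> topspace (cell_bd_space B d)"

abbreviation cell_preimage ::
    "'b topology \<Rightarrow> nat \<Rightarrow> ('b \<times> coords \<Rightarrow> 'x) \<Rightarrow> 'x set \<Rightarrow> ('b \<times> coords) set" where
  "cell_preimage B d f U \<equiv> {p \<in> cell_set B d. f p \<in> U}"

abbreviation cells_top ::
    "'b topology \<Rightarrow> 'x set \<Rightarrow> 'e set \<Rightarrow> ('e \<Rightarrow> nat) \<Rightarrow> ('e \<Rightarrow> 'b \<times> coords \<Rightarrow> 'x) \<Rightarrow> 'x topology" where
  "cells_top B Q E d \<equiv> final_top Q E (\<lambda>e. cell_space B (d e))"

definition cell_int :: "'b topology \<Rightarrow> 'b set \<Rightarrow> nat \<Rightarrow> ('b \<times> coords) set" where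
  "cell_int B B0 d = (topspace B - B0) \<times> cube_int d"

text \<open>\<open>X\<close> arises from \<open>Z\<close> by attaching the cells \<open>B \<times> cube (d e)\<close> along their boundaries. The
  part over \<open>B0\<close> of each cell goes to the base point, and so does \<open>cube_J\<close> if \<open>fl\<close> holds. A
  pointed core \<open>(B, b0)\<close> is the case \<open>B0 = {b0}\<close> with \<open>fl\<close>; ordinary cells are the case of a
  one-point \<open>B\<close> with \<open>B0 = {}\<close> without \<open>fl\<close>.\<close>

locale attaches =
  fixes B :: "'b topology" and B0 :: "'b set" and fl :: bool and Z :: "'z topology" and z0 :: 'z
    and X :: "'x topology" and f :: "'z \<Rightarrow> 'x" and E :: "'e set" and d :: "'e \<Rightarrow> nat"
    and \<Phi> :: "'e \<Rightarrow> 'b \<times> coords \<Rightarrow> 'x"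
  assumes inj_f: "inj_on f (topspace Z)" and base: "B0 \<noteq> {} \<or> fl \<Longrightarrow> z0 \<in> topspace Z"
    and points: "topspace X = f ` topspace Z \<union> (\<Union>e\<in>E. \<Phi> e ` cell_int B B0 (d e))"
    and inj_cell: "e \<in> E \<Longrightarrow> inj_on (\<Phi> e) (cell_int B B0 (d e))"
    and cell_new: "e \<in> E \<Longrightarrow> p \<in> cell_int B B0 (d e) \<Longrightarrow> z \<in> topspace Z \<Longrightarrow> \<Phi> e p \<noteq> f z"
    and cells_disjoint: "e \<in> E \<Longrightarrow> e' \<in> E \<Longrightarrow> p \<in> cell_int B B0 (d e) \<Longrightarrow> p' \<in> cell_int B B0 (d e') \<Longrightarrow>
        \<Phi> e p = \<Phi> e' p' \<Longrightarrow> e = e'"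
    and open_iff: "U \<subseteq> topspace X \<Longrightarrow> openin X U \<longleftrightarrow> openin Z (preim Z f U) \<and>
        (\<forall>e\<in>E. openin (cell_space B (d e)) (cell_preimage B (d e) (\<Phi> e) U))"
    and bd: "e \<in> E \<Longrightarrow> \<exists>g. continuous_map (cell_bd_space B (d e)) Z g \<and>
        (\<forall>p\<in>cell_bd_set B (d e). \<Phi> e p = f (g p))"
    and B0: "e \<in> E \<Longrightarrow> b \<in> B0 \<Longrightarrow> b \<in> topspace B \<Longrightarrow> u \<in> cube (d e) \<Longrightarrow> \<Phi> e (b, u) = f z0"
    and J: "fl \<Longrightarrow> e \<in> E \<Longrightarrow> b \<in> topspace B \<Longrightarrow> u \<in> cube_J (d e) \<Longrightarrow> \<Phi> e (b, u) = f z0"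

abbreviation "attaches_pointed A Z X \<equiv> attaches (underlying A) {basept A} True (underlying Z) (basept Z) (underlying X)"

lemma attaches_reindex:
  assumes a: "attaches B B0 fl Z z0 X f E d \<Phi>" and k: "bij_betw k E' E"
    and d': "\<And>e. e \<in> E' \<Longrightarrow> d' e = d (k e)"
  shows "attaches B B0 fl Z z0 X f E' d' (\<Phi> \<circ> k)"
proof -
  interpret attaches B B0 fl Z z0 X f E d \<Phi> by fact
  have E: "E = k ` E'" and kE: "\<And>e. e \<in> E' \<Longrightarrow> k e \<in> E" and inj: "inj_on k E'"
    using k by (auto simp: bij_betw_def)
  show ?thesis
  proof
    show "topspace X = f ` topspace Z \<union> (\<Union>e\<in>E'. (\<Phi> \<circ> k) e ` cell_int B B0 (d' e))"
      using points by (simp add: E d')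
    show "e = e'" if "e \<in> E'" "e' \<in> E'" "p \<in> cell_int B B0 (d' e)" "p' \<in> cell_int B B0 (d' e')"
       "(\<Phi> \<circ> k) e p = (\<Phi> \<circ> k) e' p'" for e e' p p'
      using cells_disjoint [OF kE kE, of e e' p p'] that inj by (auto simp: inj_on_def d')
    show "openin X U = (openin Z (preim Z f U) \<and>
        (\<forall>e\<in>E'. openin (cell_space B (d' e)) {p \<in> cell_set B (d' e). (\<Phi> \<circ> k) e p \<in> U}))"
      if "U \<subseteq> topspace X" for U using open_iff [OF that] by (simp add: E d')
    show "\<exists>g. continuous_map (cell_bd_space B (d' e)) Z g \<and>
        (\<forall>p\<in>cell_bd_set B (d' e). (\<Phi> \<circ> k) e p = f (g p))" if "e \<in> E'" for e
      using bd [OF kE [OF that]] by (simp add: d' [OF that])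
  qed (use inj_f base kE inj_cell cell_new B0 J d' in \<open>auto simp: o_def\<close>)
qed


section \<open>The model cells as quotients of products with cubes\<close>

text \<open>Coordinate 0 is split off because it is the outermost one:
  \<open>iterated_suspension\<close> puts each new coordinate in front of the list, and the cone
  coordinate is added outside the suspensions.\<close>

lemma homeomorphic_map_cube_Suc:
  "homeomorphic_map (cell_space A (Suc n)) (prod_topology (cell_space A n) I01)
     (\<lambda>(a, u). ((a, \<lambda>i. u (Suc i)), u 0))"
proof -
  have "homeomorphic_maps (cell_space A (Suc n)) (prod_topology (cell_space A n) I01)
     (\<lambda>(a, u). ((a, \<lambda>i. u (Suc i)), u 0)) (\<lambda>((a, v), t). (a, case_nat t v))" unfolding homeomorphic_maps_def
  proof (intro conjI)
    have 1: "continuous_map (cell_space A (Suc n)) (top_of_set (cube n)) (\<lambda>p. \<lambda>i. snd p (Suc i))"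
      unfolding continuous_map_into_cube by (auto simp: cube_def continuous_map_snd_coordinate)
    have 2: "continuous_map (cell_space A (Suc n)) I01 (\<lambda>p. snd p 0)"
      by (auto simp: continuous_map_in_subtopology continuous_map_snd_coordinate cube_def)
    show "continuous_map (cell_space A (Suc n)) (prod_topology (cell_space A n) I01)
        (\<lambda>(a, u). ((a, \<lambda>i. u (Suc i)), u 0))"
      using 1 2 continuous_map_fst by (simp add: case_prod_unfold continuous_map_pairwise o_def)
    have 3: "continuous_map (prod_topology (cell_space A n) I01) (top_of_set (cube (Suc n)))
        (\<lambda>p. case_nat (snd p) (snd (fst p)))" unfolding continuous_map_into_cube
    proof (intro conjI ballI allI)
      show "case_nat (snd p) (snd (fst p)) \<in> cube (Suc n)"
        if "p \<in> topspace (prod_topology (cell_space A n) I01)" for p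
        using that by (auto simp: cube_def split: nat.split)
      fix i
      show "continuous_map (prod_topology (cell_space A n) I01) euclideanreal
          (\<lambda>p. case_nat (snd p) (snd (fst p)) i)"
      proof (cases i)
        case 0
        then show ?thesis using continuous_map_into_fulltopology [OF continuous_map_snd] by simp
      next
        case (Suc j)
        then show ?thesis using continuous_map_compose [OF continuous_map_fst continuous_map_snd_coordinate] by (simp add: o_def)
      qed
    qed
    have 4: "continuous_map (prod_topology (cell_space A n) I01) A (\<lambda>p. fst (fst p))"
      using continuous_map_compose [OF continuous_map_fst continuous_map_fst] by (simp add: o_def)
    show "continuous_map (prod_topology (cell_space A n) I01) (cell_space A (Suc n))
        (\<lambda>((a, v), t). (a, case_nat t v))" using 3 4 by (simp add: case_prod_unfold continuous_map_pairwise o_def)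
  qed (auto simp: fun_eq_iff split: nat.split)
  then show ?thesis by (rule homeomorphic_maps_map [THEN iffD1, THEN conjunct1])
qed

definition susp_triv :: "'a \<Rightarrow> nat \<Rightarrow> 'a \<times> coords \<Rightarrow> bool" where
  "susp_triv a0 n p \<longleftrightarrow> fst p = a0 \<or> (\<exists>i<n. snd p i = 0 \<or> snd p i = 1)"

text \<open>The collapse of \<open>A \<times> cube n\<close> onto the iterated suspension. The value
  \<open>(a0, replicate n 0)\<close> is the base point in the chosen normal forms, and the list
  holds the most recent coordinate first.\<close>

definition susp_map :: "'a \<Rightarrow> nat \<Rightarrow> 'a \<times> coords \<Rightarrow> 'a \<times> real list" where
  "susp_map a0 n p = (if susp_triv a0 n p then (a0, replicate n 0) else (fst p, map (snd p) [0..<n]))"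

lemma basept_iterated_suspension [simp]:
  "basept (iterated_suspension n A) = (basept A, replicate n 0)" by (induction n) (auto simp: pointed_copy_def reduced_suspension_def)

lemma locally_compact_Icc: "locally_compact_space I01"
  by (simp add: compact_space_subtopology compact_imp_locally_compact_space)

lemma Hausdorff_Icc: "Hausdorff_space I01" by (simp add: Hausdorff_space_subtopology)

lemma ex_less_Suc: "(\<exists>i<Suc n. P i) \<longleftrightarrow> P 0 \<or> (\<exists>i<n. P (Suc i))" by (metis less_Suc_eq_0_disj)

lemma map_upt_Suc0: "map u [0..<Suc n] = u 0 # map (\<lambda>i. u (Suc i)) [0..<n]" by (metis map_upt_Suc)

lemma quotient_map_cong:
  assumes "quotient_map X Y f" "\<And>x. x \<in> topspace X \<Longrightarrow> f x = g x"
  shows "quotient_map X Y g"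
proof -
  have "f ` topspace X = g ` topspace X" "\<And>U. preim X f U = preim X g U" using assms(2) by (auto simp: image_iff)
  then show ?thesis using assms(1) by (simp add: quotient_map_def)
qed

text \<open>The interval is compact Hausdorff, so the product of a quotient map with it is a
  quotient map; this carries the presentation by cubes through each suspension.\<close>

lemma quotient_map_susp_step:
  assumes "quotient_map (cell_space A n) Y \<sigma>"
  shows "quotient_map (cell_space A (Suc n)) (prod_topology Y I01)
           (\<lambda>(a, u). (\<sigma> (a, \<lambda>i. u (Suc i)), u 0))"
proof -
  have "quotient_map (prod_topology (cell_space A n) I01) (prod_topology Y I01)
      (\<lambda>(x, y). (\<sigma> x, y))" using assms by (intro quotient_map_prod_left locally_compact_Icc disjI1 Hausdorff_Icc)
  then have "quotient_map (cell_space A (Suc n)) (prod_topology Y I01)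
      ((\<lambda>(x, y). (\<sigma> x, y)) \<circ> (\<lambda>(a, u). ((a, \<lambda>i. u (Suc i)), u 0)))"
    using homeomorphic_map_cube_Suc [of A n] by (intro quotient_map_compose) (auto simp: homeomorphic_map_def)
  then show ?thesis by (rule quotient_map_cong) auto
qed

lemma quotient_map_susp_map:
  "quotient_map (cell_space (underlying A) n) (underlying (iterated_suspension n A)) (susp_map (basept A) n)"
proof (induction n)
  case 0
  have "quotient_map (cell_space (underlying A) 0) (underlying A) fst"
    by (rule quotient_map_fst [THEN iffD2]) (auto simp flip: null_topspace_iff_trivial)
  then have "quotient_map (cell_space (underlying A) 0) (underlying (iterated_suspension 0 A)) ((\<lambda>a. (a, [])) \<circ> fst)"
    by (rule quotient_map_compose) (simp add: pointed_copy_def quotient_map_quotient_topology)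
  then show ?case by (rule quotient_map_cong) (auto simp: susp_map_def susp_triv_def)
next
  case (Suc n)
  let ?b = "(basept A, replicate n 0)"
  let ?c = "\<lambda>(x, t). if x = ?b \<or> t = 0 \<or> t = 1 then (?b, 0::real) else (x, t)"
  let ?e = "\<lambda>((a, ts), t). (a, t # ts)"
  have "quotient_map (cell_space (underlying A) (Suc n)) (underlying (iterated_suspension (Suc n) A))
      (?e \<circ> (?c \<circ> (\<lambda>(a, u). (susp_map (basept A) n (a, \<lambda>i. u (Suc i)), u 0))))"
  proof (intro quotient_map_compose)
    show "quotient_map (cell_space (underlying A) (Suc n)) (prod_topology (underlying (iterated_suspension n A)) I01)
        (\<lambda>(a, u). (susp_map (basept A) n (a, \<lambda>i. u (Suc i)), u 0))" by (rule quotient_map_susp_step [OF Suc])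
    show "quotient_map (prod_topology (underlying (iterated_suspension n A)) I01)
        (underlying (reduced_suspension (iterated_suspension n A))) ?c"
      by (simp only: reduced_suspension_def basept_iterated_suspension fst_conv quotient_map_quotient_topology)
    show "quotient_map (underlying (reduced_suspension (iterated_suspension n A))) (underlying (iterated_suspension (Suc n) A)) ?e"
      by (simp only: iterated_suspension.simps pointed_copy_def fst_conv quotient_map_quotient_topology)
  qed
  then show ?case by (rule quotient_map_cong) (auto simp: susp_map_def susp_triv_def ex_less_Suc map_upt_Suc0 simp del: upt_Suc)
qed

lemma susp_map_eq_base_iff: "susp_map a0 n p = (a0, replicate n 0) \<longleftrightarrow> susp_triv a0 n p"
  by (auto simp: susp_map_def susp_triv_def)

lemma susp_map_inj:
  assumes "susp_map a0 n p = susp_map a0 n p'" "\<not> susp_triv a0 n p" "snd p \<in> cube n" "snd p' \<in> cube n"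
  shows "p = p'"
proof -
  have "\<not> susp_triv a0 n p'" using assms(1,2) susp_map_eq_base_iff by metis
  then have "fst p = fst p'" "\<forall>i<n. snd p i = snd p' i" using assms(1,2) by (auto simp: susp_map_def)
  moreover have "snd p i = snd p' i" for i
    using assms(3,4) \<open>\<forall>i<n. snd p i = snd p' i\<close> by (cases "i < n") (auto simp: cube_def)
  ultimately show ?thesis by (simp add: prod_eq_iff fun_eq_iff)
qed

definition cell_triv :: "'a \<Rightarrow> nat \<Rightarrow> 'a \<times> coords \<Rightarrow> bool" where
  "cell_triv a0 d p \<longleftrightarrow> fst p = a0 \<or> snd p \<in> cube_J d"

definition cone_map :: "'a \<Rightarrow> nat \<Rightarrow> 'a \<times> coords \<Rightarrow> ('a \<times> real list) \<times> real" where
  "cone_map a0 n p = (let b = (a0, replicate n 0); s = susp_map a0 n (fst p, \<lambda>i. snd p (Suc i))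
     in if s = b \<or> snd p 0 = 1 then (b, 0) else (s, snd p 0))"

lemma quotient_map_cone_map:
  "quotient_map (cell_space (underlying A) (Suc n)) (underlying (reduced_cone (iterated_suspension n A))) (cone_map (basept A) n)"
proof -
  let ?b = "(basept A, replicate n 0)"
  let ?c = "\<lambda>(x, t). if x = ?b \<or> t = 1 then (?b, 0::real) else (x, t)"
  have "quotient_map (cell_space (underlying A) (Suc n)) (underlying (reduced_cone (iterated_suspension n A)))
      (?c \<circ> (\<lambda>(a, u). (susp_map (basept A) n (a, \<lambda>i. u (Suc i)), u 0)))"
    by (rule quotient_map_compose [OF quotient_map_susp_step [OF quotient_map_susp_map]])
       (simp only: reduced_cone_def basept_iterated_suspension fst_conv quotient_map_quotient_topology)
  then show ?thesis by (rule quotient_map_cong) (auto simp: cone_map_def)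
qed

text \<open>In the cone over a suspension the face \<open>u 0 = 1\<close> is the vertex, and the
  faces of the remaining coordinates were collapsed by the suspensions. Together they are
  \<open>cube_J\<close>; only \<open>u 0 = 0\<close>, the base, survives.\<close>

lemma susp_triv_face:
  assumes "snd p \<in> cube (Suc n)"
  shows "susp_triv a0 n (fst p, \<lambda>i. snd p (Suc i)) \<or> snd p 0 = 1 \<longleftrightarrow> cell_triv a0 (Suc n) p"
  using assms by (auto simp: susp_triv_def cell_triv_def cube_J_def ex_less_Suc)

lemma cone_map_eq_base_iff:
  assumes "snd p \<in> cube (Suc n)"
  shows "cone_map a0 n p = ((a0, replicate n 0), 0) \<longleftrightarrow> cell_triv a0 (Suc n) p"
  unfolding susp_triv_face [OF assms, of a0, symmetric] cone_map_def Let_def susp_map_eq_base_iff by (auto simp: susp_map_eq_base_iff)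

lemma cone_map_inj:
  assumes eq: "cone_map a0 n p = cone_map a0 n p'" and nt: "\<not> cell_triv a0 (Suc n) p"
    and c: "snd p \<in> cube (Suc n)" "snd p' \<in> cube (Suc n)"
  shows "p = p'"
proof -
  have "\<not> cell_triv a0 (Suc n) p'" using eq nt cone_map_eq_base_iff c by metis
  then have "susp_map a0 n (fst p, \<lambda>i. snd p (Suc i)) = susp_map a0 n (fst p', \<lambda>i. snd p' (Suc i))"
    "snd p 0 = snd p' 0" "\<not> susp_triv a0 n (fst p, \<lambda>i. snd p (Suc i))"
    using eq nt c by (auto simp: cone_map_def Let_def susp_map_eq_base_iff susp_triv_face [symmetric] split: if_splits)
  moreover have "(\<lambda>i. snd p (Suc i)) \<in> cube n" "(\<lambda>i. snd p' (Suc i)) \<in> cube n"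
    using c by (auto simp: cube_def)
  ultimately have "(fst p, \<lambda>i. snd p (Suc i)) = (fst p', \<lambda>i. snd p' (Suc i))" and 0: "snd p 0 = snd p' 0"
    using susp_map_inj [of a0 n "(fst p, \<lambda>i. snd p (Suc i))" "(fst p', \<lambda>i. snd p' (Suc i))"] by auto
  then have "snd p i = snd p' i" for i by (cases i) (auto simp: fun_eq_iff)
  then show ?thesis using \<open>(fst p, _) = _\<close> by (simp add: prod_eq_iff fun_eq_iff)
qed

text \<open>The map from the boundary of the model cell to its base; it collapses the faces other
  than \<open>u 0 = 0\<close>.\<close>

definition cone_bd_map :: "'a \<Rightarrow> nat \<Rightarrow> 'a \<times> coords \<Rightarrow> 'a \<times> real list" where
  "cone_bd_map a0 n p =
     (if snd p \<in> cube_J (Suc n) then (a0, replicate n 0) else susp_map a0 n (fst p, \<lambda>i. snd p (Suc i)))"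

lemma cone_base_cone_bd_map:
  assumes "snd p \<in> cube_bd (Suc n)"
  shows "cone_base (cone_bd_map a0 n p) = cone_map a0 n p"
proof -
  have c: "snd p \<in> cube (Suc n)" using assms cube_bd_subset by blast
  show ?thesis
proof (cases "cell_triv a0 (Suc n) p")
  case True
  then have "cone_bd_map a0 n p = (a0, replicate n 0)" by (auto simp: cone_bd_map_def cell_triv_def susp_map_def susp_triv_def)
  then show ?thesis using True cone_map_eq_base_iff [OF c, of a0] by (auto simp: cone_base_def)
next
  case False
  moreover have "snd p 0 = 0" using False assms by (auto simp: cell_triv_def cube_J_def cube_bd_def)
  ultimately show ?thesis using c susp_triv_face [OF c, of a0]
    by (auto simp: cone_bd_map_def cone_base_def cone_map_def Let_def susp_map_eq_base_iff cell_triv_def)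
qed
qed

text \<open>The boundary of the cube is the union of two closed sets, the base face and
  \<open>cube_J\<close>. On the first the map is the suspension collapse, on the second it is
  constant, and on the overlap the collapse is already constant.\<close>

lemma continuous_map_cone_bd_map:
  assumes A: "pointed_space A"
  shows "continuous_map (cell_bd_space (underlying A) (Suc n)) (underlying (iterated_suspension n A)) (cone_bd_map (basept A) n)"
proof (rule continuous_map_paste)
  let ?A = "underlying A" and ?a = "basept A"
  let ?X = "cell_bd_space ?A (Suc n)" and ?Y = "underlying (iterated_suspension n A)"
  let ?S = "topspace ?A \<times> (cube_bd (Suc n) \<inter> {u. u 0 = 0})" and ?T = "topspace ?A \<times> cube_J (Suc n)"
  show "closedin ?X ?S" by (simp add: closedin_prod_Times_iff closedin_closed_Int closed_coordinate)
  show "closedin ?X ?T" using closed_subset [OF cube_J_subset closed_cube_J] by (simp add: closedin_prod_Times_iff)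
  show "topspace ?X \<subseteq> ?S \<union> ?T" by (auto simp: cube_J_def cube_bd_def ex_less_Suc)
  have base: "(?a, replicate n 0) \<in> topspace ?Y"
    using quotient_imp_surjective_map [OF quotient_map_susp_map [of A n]] A cube_int_nonempty [of n] cube_int_subset
    by (force simp: pointed_space_def susp_map_def susp_triv_def)
  show "continuous_map (subtopology ?X ?T) ?Y (cone_bd_map ?a n)"
    by (rule continuous_map_eq [where f = "\<lambda>_. (?a, replicate n 0)"]) (auto simp: base cone_bd_map_def)
  have 1: "continuous_map (subtopology ?X ?S) (top_of_set (cube n)) (\<lambda>p. \<lambda>i. snd p (Suc i))"
    unfolding continuous_map_into_cube
    by (auto simp: cube_bd_def cube_def continuous_map_from_subtopology continuous_map_snd_coordinate)
  have "continuous_map (subtopology ?X ?S) (cell_space ?A n) (\<lambda>p. (fst p, \<lambda>i. snd p (Suc i)))"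
    using 1 by (simp add: continuous_map_pairwise o_def continuous_map_from_subtopology continuous_map_fst)
  then have "continuous_map (subtopology ?X ?S) ?Y (susp_map ?a n \<circ> (\<lambda>p. (fst p, \<lambda>i. snd p (Suc i))))"
    by (rule continuous_map_compose) (rule quotient_imp_continuous_map [OF quotient_map_susp_map])
  then show "continuous_map (subtopology ?X ?S) ?Y (cone_bd_map ?a n)"
  proof (rule continuous_map_eq)
    fix p assume p: "p \<in> topspace (subtopology ?X ?S)"
    then have "susp_triv ?a n (fst p, \<lambda>i. snd p (Suc i))" if "snd p \<in> cube_J (Suc n)"
      using that by (auto simp: susp_triv_def cube_J_def ex_less_Suc)
    then show "(susp_map ?a n \<circ> (\<lambda>p. (fst p, \<lambda>i. snd p (Suc i)))) p = cone_bd_map ?a n p"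
      by (auto simp: cone_bd_map_def susp_map_def)
  qed
qed


text \<open>Restricted to the face \<open>u 0 = 0\<close> the map is \<open>susp_map\<close>, which
  is a quotient map; a continuous map that becomes a quotient map after precomposition with a
  continuous map is one itself.\<close>

lemma quotient_map_cone_bd_map:
  assumes A: "pointed_space A"
  shows "quotient_map (cell_bd_space (underlying A) (Suc n)) (underlying (iterated_suspension n A)) (cone_bd_map (basept A) n)"
proof (rule quotient_map_from_composition [OF _ continuous_map_cone_bd_map [OF A]])
  let ?k = "\<lambda>p. (fst p, case_nat 0 (snd p))"
  have "continuous_map (cell_space (underlying A) n) (top_of_set (cube (Suc n))) (\<lambda>p. case_nat 0 (snd p))"
    unfolding continuous_map_into_cube
  proof (intro conjI ballI allI)
    show "continuous_map (cell_space (underlying A) n) euclideanreal (\<lambda>p. case_nat 0 (snd p) i)" for i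
      by (cases i) (auto simp: continuous_map_snd_coordinate)
  qed (auto simp: cube_def split: nat.split)
  moreover have "case_nat 0 u \<in> cube_bd (Suc n)" if "u \<in> cube n" for u
    using that by (auto simp: cube_bd_def cube_def split: nat.split)
  ultimately have "continuous_map (cell_space (underlying A) n) (top_of_set (cube_bd (Suc n))) (\<lambda>p. case_nat 0 (snd p))"
    by (auto simp: continuous_map_in_subtopology)
  then show "continuous_map (cell_space (underlying A) n) (cell_bd_space (underlying A) (Suc n)) ?k"
    by (simp add: continuous_map_pairwise o_def continuous_map_fst)
  show "quotient_map (cell_space (underlying A) n) (underlying (iterated_suspension n A)) (cone_bd_map (basept A) n \<circ> ?k)"
  proof (rule quotient_map_cong [OF quotient_map_susp_map])
    fix p :: "'a \<times> coords"
    assume "p \<in> cell_set (underlying A) n"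
    show "susp_map (basept A) n p = (cone_bd_map (basept A) n \<circ> ?k) p"
      by (auto simp: cone_bd_map_def cube_J_def ex_less_Suc susp_map_def susp_triv_def)
  qed
qed

text \<open>A map out of the union of the images is defined by choosing preimages; the two
  hypotheses make the result independent of the choice. Continuity is a separate matter.\<close>

lemma final_top_lift:
  assumes 0: "\<And>e p. e \<in> E \<Longrightarrow> p \<in> topspace (P e) \<Longrightarrow> q e p = c0 \<Longrightarrow> \<Phi> e p = x0"
    and 1: "\<And>e e' p p'. e \<in> E \<Longrightarrow> e' \<in> E \<Longrightarrow> p \<in> topspace (P e) \<Longrightarrow> p' \<in> topspace (P e') \<Longrightarrow>
      q e p = q e' p' \<Longrightarrow> \<Phi> e p = \<Phi> e' p'"
  obtains h where "h c0 = x0" "\<And>e p. e \<in> E \<Longrightarrow> p \<in> topspace (P e) \<Longrightarrow> h (q e p) = \<Phi> e p"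
proof -
  define h where "h = (\<lambda>c. if c = c0 then x0 else
    (let z = SOME z. fst z \<in> E \<and> snd z \<in> topspace (P (fst z)) \<and> q (fst z) (snd z) = c in \<Phi> (fst z) (snd z)))"
  have "h (q e p) = \<Phi> e p" if ep: "e \<in> E" "p \<in> topspace (P e)" for e p
  proof -
  let ?Q = "\<lambda>z. fst z \<in> E \<and> snd z \<in> topspace (P (fst z)) \<and> q (fst z) (snd z) = q e p"
  have "?Q (e, p)" using ep by simp
  then have Q: "?Q (SOME z. ?Q z)" by (rule someI)
  then show ?thesis using 0 [OF ep] 1 [of "fst (SOME z. ?Q z)" e "snd (SOME z. ?Q z)" p] ep by (auto simp: h_def)
  qed
  moreover have "h c0 = x0" by (simp add: h_def)
  ultimately show thesis by (rule that [rotated])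
qed

text \<open>Wedges of cones over their bases, with the cells presented by maps from \<open>A \<times> cube (d e)\<close>:
  these are injective apart from collapsing the trivial points to the base point.\<close>

locale cone_model =
  fixes A :: "'a topology" and a0 :: 'a and E :: "'e set" and d :: "'e \<Rightarrow> nat"
    and W :: "'w topology" and w0 :: 'w and \<gamma> :: "'e \<Rightarrow> 'a \<times> coords \<Rightarrow> 'w"
    and C :: "'c topology" and c0 :: 'c and q :: "'e \<Rightarrow> 'a \<times> coords \<Rightarrow> 'c" and i :: "'w \<Rightarrow> 'c"
  assumes W: "W = final_top {w0} E (\<lambda>e. cell_bd_space A (d e)) \<gamma>" and C: "C = cells_top A {c0} E d q"
    and i_\<gamma>: "e \<in> E \<Longrightarrow> p \<in> topspace A \<times> cube_bd (d e) \<Longrightarrow> i (\<gamma> e p) = q e p"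
    and i_w0: "i w0 = c0" and inj_i: "inj_on i (topspace W)"
    and q_triv: "e \<in> E \<Longrightarrow> p \<in> topspace A \<times> cube (d e) \<Longrightarrow> q e p = c0 \<longleftrightarrow> cell_triv a0 (d e) p"
    and q_inj: "e \<in> E \<Longrightarrow> e' \<in> E \<Longrightarrow> p \<in> topspace A \<times> cube (d e) \<Longrightarrow> p' \<in> topspace A \<times> cube (d e') \<Longrightarrow>
      q e p = q e' p' \<Longrightarrow> \<not> cell_triv a0 (d e) p \<Longrightarrow> e = e' \<and> p = p'"
begin

lemma topspace_W: "topspace W = {w0} \<union> (\<Union>e\<in>E. \<gamma> e ` (topspace A \<times> cube_bd (d e)))" by (simp add: W)

lemma topspace_C: "topspace C = {c0} \<union> (\<Union>e\<in>E. q e ` (topspace A \<times> cube (d e)))" by (simp add: C)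

lemma cell_int_not_triv: "p \<in> cell_int A {a0} n \<Longrightarrow> \<not> cell_triv a0 n p \<and> p \<in> topspace A \<times> cube n \<and> snd p \<notin> cube_bd n"
  using cube_int_subset cube_int_bd_disjoint cube_J_subset by (fastforce simp: cell_int_def cell_triv_def)

lemma q_cell_int:
  assumes e: "e \<in> E" and p: "p \<in> cell_int A {a0} (d e)"
  shows "q e p \<in> topspace C - i ` topspace W"
proof -
  have nt: "\<not> cell_triv a0 (d e) p" "p \<in> topspace A \<times> cube (d e)" "snd p \<notin> cube_bd (d e)"
    using cell_int_not_triv [OF p] by auto
  have "q e p \<noteq> i w" if "w \<in> topspace W" for w
  proof
    assume eq: "q e p = i w"
    have "w \<noteq> w0" using eq nt e q_triv i_w0 by auto
    then obtain e' p' where e': "e' \<in> E" "p' \<in> topspace A \<times> cube_bd (d e')" "w = \<gamma> e' p'"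
      using \<open>w \<in> topspace W\<close> by (auto simp: topspace_W)
    moreover have "p' \<in> topspace A \<times> cube (d e')" using e'(2) cube_bd_subset by blast
    ultimately have "e = e' \<and> p = p'" using q_inj [OF e e'(1) nt(2), of p'] eq nt(1) by (simp add: i_\<gamma>)
    then show False using e'(2) nt(3) by auto
  qed
  then show ?thesis using e nt by (auto simp: topspace_C)
qed

lemma C_minus_W:
  assumes "c \<in> topspace C - i ` topspace W"
  obtains e p where "e \<in> E" "p \<in> cell_int A {a0} (d e)" "c = q e p"
proof -
  have "c \<noteq> c0" using assms i_w0 by (auto simp: topspace_W)
  then obtain e p where e: "e \<in> E" "p \<in> topspace A \<times> cube (d e)" "c = q e p" using assms by (auto simp: topspace_C)
  have "snd p \<notin> cube_bd (d e)"
  proof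
    assume "snd p \<in> cube_bd (d e)"
    then have "p \<in> topspace A \<times> cube_bd (d e)" using e(2) by (auto simp: mem_Times_iff)
    then have "c = i (\<gamma> e p)" "\<gamma> e p \<in> topspace W" using e i_\<gamma> by (auto simp: topspace_W)
    then show False using assms by blast
  qed
  then have "p \<in> cell_int A {a0} (d e)" using e \<open>c \<noteq> c0\<close> q_triv [OF e(1,2)] cube_cases [of "snd p" "d e"]
    by (auto simp: cell_int_def cell_triv_def)
  then show thesis using e that by blast
qed

lemma continuous_map_q: "e \<in> E \<Longrightarrow> continuous_map (cell_space A (d e)) C (q e)"
  unfolding C by (rule continuous_map_into_final_top [where P = "\<lambda>e. cell_space A (d e)" and q = q])

lemma continuous_map_\<gamma>: "e \<in> E \<Longrightarrow> continuous_map (cell_bd_space A (d e)) W (\<gamma> e)"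
  unfolding W by (rule continuous_map_into_final_top [where P = "\<lambda>e. cell_bd_space A (d e)" and q = \<gamma>])

lemma continuous_map_i: "continuous_map W C i" unfolding W
proof (rule continuous_map_from_final_top)
  fix e assume e: "e \<in> E"
  have "continuous_map (cell_bd_space A (d e)) (cell_space A (d e)) id" unfolding id_def using cube_bd_subset [of "d e"]
    by (auto simp: continuous_map_pairwise o_def continuous_map_fst continuous_map_in_subtopology
          intro: continuous_map_into_fulltopology [OF continuous_map_snd])
  then have "continuous_map (cell_bd_space A (d e)) C (q e \<circ> id)"
    by (rule continuous_map_compose) (rule continuous_map_q [OF e])
  then show "continuous_map (cell_bd_space A (d e)) C (i \<circ> \<gamma> e)" by (rule continuous_map_eq) (auto simp: i_\<gamma> e)
qed (simp add: C i_w0)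

text \<open>Outside the bases of the cones, \<open>C\<close> is the disjoint union of the open
  cells, by \<open>q_cell_int\<close> and \<open>C_minus_W\<close>, so the pushout conditions can be
  read cell by cell. The attaching map of the cell \<open>e\<close> is
  \<open>g \<circ> \<gamma> e\<close>.\<close>

lemma attaches_if_pushout:
  assumes po: "is_pushout Z W C X g i f h" and z0: "g w0 = z0"
  shows "attaches A {a0} True Z z0 X f E d (\<lambda>e. h \<circ> q e)"
proof -
  have g: "continuous_map W Z g" using po by (simp add: is_pushout_def)
  have P: "inj_on f (topspace Z)" "inj_on h (topspace C - i ` topspace W)"
    "f ` topspace Z \<inter> h ` (topspace C - i ` topspace W) = {}"
    "\<And>w. w \<in> topspace W \<Longrightarrow> f (g w) = h (i w)"
    "topspace X = f ` topspace Z \<union> h ` topspace C"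
    "\<And>U. U \<subseteq> topspace X \<Longrightarrow> openin X U \<longleftrightarrow>
        openin Z (preim Z f U) \<and> openin C (preim C h U)" using po unfolding is_pushout_iff [OF inj_i g continuous_map_i] by auto
  have gZ: "g w \<in> topspace Z" if "w \<in> topspace W" for w using that g by (auto simp: continuous_map_def)
  have w0: "w0 \<in> topspace W" by (simp add: topspace_W)
  have hc0: "h c0 = f z0" using P(4) [OF w0] z0 i_w0 by simp
  have triv: "h (q e p) = f z0" if "e \<in> E" "p \<in> topspace A \<times> cube (d e)" "cell_triv a0 (d e) p" for e p
    using q_triv [OF that(1,2)] that(3) hc0 by simp
  show ?thesis
  proof
    show "inj_on f (topspace Z)" by fact
    show "z0 \<in> topspace Z" using gZ w0 z0 by blast
    have "h ` topspace C \<subseteq> f ` topspace Z \<union> (\<Union>e\<in>E. (h \<circ> q e) ` cell_int A {a0} (d e))"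
    proof (rule image_subsetI)
      fix c assume c: "c \<in> topspace C"
      show "h c \<in> f ` topspace Z \<union> (\<Union>e\<in>E. (h \<circ> q e) ` cell_int A {a0} (d e))"
      proof (cases "c \<in> i ` topspace W")
        case True
        then show ?thesis using P(4) gZ by force
      next
        case False
        then have "c \<in> topspace C - i ` topspace W" using c by simp
        then obtain e p where "e \<in> E" "p \<in> cell_int A {a0} (d e)" "c = q e p" by (rule C_minus_W)
        then show ?thesis by auto
      qed
    qed
    then show "topspace X = f ` topspace Z \<union> (\<Union>e\<in>E. (h \<circ> q e) ` cell_int A {a0} (d e))"
      using P(5) q_cell_int by auto
    fix e assume e: "e \<in> E"
    show "inj_on (h \<circ> q e) (cell_int A {a0} (d e))"
    proof (rule inj_onI)
      fix p p' assume p: "p \<in> cell_int A {a0} (d e)" "p' \<in> cell_int A {a0} (d e)" "(h \<circ> q e) p = (h \<circ> q e) p'"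
      then have "q e p = q e p'" using P(2) q_cell_int [OF e] by (auto simp: inj_on_def)
      then show "p = p'" using q_inj [OF e e, of p p'] p cell_int_not_triv by blast
    qed
    show "(h \<circ> q e) p \<noteq> f z" if "p \<in> cell_int A {a0} (d e)" "z \<in> topspace Z" for p z
      using P(3) q_cell_int [OF e that(1)] that(2) by (metis IntI comp_apply emptyE image_eqI)
    show "e = e'" if "e' \<in> E" "p \<in> cell_int A {a0} (d e)" "p' \<in> cell_int A {a0} (d e')"
      "(h \<circ> q e) p = (h \<circ> q e') p'" for e' p p'
    proof -
      have "q e p = q e' p'" using P(2) q_cell_int [OF e that(2)] q_cell_int [OF that(1,3)] that(4) by (auto simp: inj_on_def)
      then show ?thesis using q_inj [OF e that(1)] that cell_int_not_triv by blast
    qed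
    show "\<exists>g. continuous_map (cell_bd_space A (d e)) Z g \<and>
            (\<forall>p\<in>cell_bd_set A (d e). (h \<circ> q e) p = f (g p))"
    proof (intro exI conjI ballI)
      show "continuous_map (cell_bd_space A (d e)) Z (g \<circ> \<gamma> e)"
        by (rule continuous_map_compose [OF continuous_map_\<gamma> [OF e] g])
      fix p assume "p \<in> cell_bd_set A (d e)"
      then have p: "p \<in> topspace A \<times> cube_bd (d e)" by simp
      then have "\<gamma> e p \<in> topspace W" using e by (auto simp: topspace_W)
      then show "(h \<circ> q e) p = f ((g \<circ> \<gamma> e) p)" using P(4) [of "\<gamma> e p"] i_\<gamma> [OF e p] by simp
    qed
    show "(h \<circ> q e) (b, u) = f z0" if "b \<in> {a0}" "b \<in> topspace A" "u \<in> cube (d e)" for b u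
      using triv [OF e, of "(b, u)"] that by (simp add: cell_triv_def)
    show "(h \<circ> q e) (b, u) = f z0" if "b \<in> topspace A" "u \<in> cube_J (d e)" for b u
      using triv [OF e, of "(b, u)"] that cube_J_subset cube_bd_subset by (auto simp: cell_triv_def)
  next
    fix U assume U: "U \<subseteq> topspace X"
    have "{p \<in> cell_set A (d e). q e p \<in> preim C h U} =
        {p \<in> cell_set A (d e). (h \<circ> q e) p \<in> U}" if "e \<in> E" for e using that by (auto simp: topspace_C)
    moreover have "preim C h U \<subseteq> topspace C" by auto
    ultimately have "openin C (preim C h U) \<longleftrightarrow>
        (\<forall>e\<in>E. openin (cell_space A (d e)) {p \<in> cell_set A (d e). (h \<circ> q e) p \<in> U})"
      unfolding C openin_final_top by simp
    then show "openin X U = (openin Z (preim Z f U) \<and>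
        (\<forall>e\<in>E. openin (cell_space A (d e)) {p \<in> cell_set A (d e). (h \<circ> q e) p \<in> U}))"
      using P(6) [OF U] by simp
  qed
qed

lemma pushout_if_attaches:
  assumes "attaches A {a0} True Z z0 X f E d \<Phi>"
  obtains g h where "continuous_map W Z g" "g w0 = z0" "is_pushout Z W C X g i f h"
proof -
  interpret attaches A "{a0}" True Z z0 X f E d \<Phi> by fact
  have z0: "z0 \<in> topspace Z" using base by simp
  obtain g' where g': "\<And>e. e \<in> E \<Longrightarrow> continuous_map (cell_bd_space A (d e)) Z (g' e)"
    "\<And>e p. e \<in> E \<Longrightarrow> p \<in> cell_bd_set A (d e) \<Longrightarrow> \<Phi> e p = f (g' e p)" using bd by metis
  have g'Z: "g' e p \<in> topspace Z" if "e \<in> E" "p \<in> cell_bd_set A (d e)" for e p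
    using g'(1) [OF that(1)] that(2) by (auto simp: continuous_map_def)
  have triv: "\<Phi> e p = f z0" if "e \<in> E" "p \<in> topspace A \<times> cube (d e)" "cell_triv a0 (d e) p" for e p
    using that B0 [of e "fst p" "snd p"] J [of e "fst p" "snd p"] by (auto simp: cell_triv_def)
  have \<Phi>q: "\<Phi> e p = \<Phi> e' p'" if "e \<in> E" "e' \<in> E" "p \<in> topspace A \<times> cube (d e)" "p' \<in> topspace A \<times> cube (d e')"
    "q e p = q e' p'" for e e' p p'
  proof (cases "cell_triv a0 (d e) p")
    case True
    then have "cell_triv a0 (d e') p'" using q_triv that by metis
    then show ?thesis using True triv that by metis
  next
    case False
    then show ?thesis using q_inj that by blast
  qed
  have bd_cell: "p \<in> topspace A \<times> cube n" if "p \<in> topspace A \<times> cube_bd n" for p n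
    using that cube_bd_subset by blast
  obtain h where h: "h c0 = f z0" "\<And>e p. e \<in> E \<Longrightarrow> p \<in> cell_set A (d e) \<Longrightarrow> h (q e p) = \<Phi> e p"
  proof (rule final_top_lift [of E "\<lambda>e. cell_space A (d e)" q c0 \<Phi> "f z0"])
    fix e p assume ep: "e \<in> E" "p \<in> cell_set A (d e)" and eq: "q e p = c0"
    then show "\<Phi> e p = f z0" using triv [OF ep(1)] q_triv [OF ep(1)] by simp
  next
    fix e e' p p' assume ep: "e \<in> E" "e' \<in> E" "p \<in> cell_set A (d e)"
      "p' \<in> cell_set A (d e')" and eq: "q e p = q e' p'"
    then show "\<Phi> e p = \<Phi> e' p'" using \<Phi>q [OF ep(1,2) _ _ eq] by simp
  qed blast
  \<comment> \<open>The boundary maps \<open>g' e\<close> were chosen independently for each cell.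
    They fit together on the wedge of the bases because \<open>f\<close> is injective and
    \<open>f \<circ> g' e\<close> is the restriction of \<open>\<Phi> e\<close>.\<close>
  obtain g where g: "g w0 = z0" "\<And>e p. e \<in> E \<Longrightarrow> p \<in> cell_bd_set A (d e) \<Longrightarrow> g (\<gamma> e p) = g' e p"
  proof (rule final_top_lift [of E "\<lambda>e. cell_bd_space A (d e)" \<gamma> w0 g' z0])
    fix e p assume ep: "e \<in> E" "p \<in> cell_bd_set A (d e)" and eq: "\<gamma> e p = w0"
    then have "q e p = c0" using i_\<gamma> i_w0 by (metis topspace_prod_topology topspace_euclidean_subtopology)
    then have "\<Phi> e p = f z0" using triv q_triv ep bd_cell by (metis topspace_prod_topology topspace_euclidean_subtopology)
    then show "g' e p = z0" using g'(2) [OF ep] g'Z [OF ep] z0 inj_f by (auto simp: inj_on_def)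
  next
    fix e e' p p' assume ep: "e \<in> E" "e' \<in> E" "p \<in> cell_bd_set A (d e)"
      "p' \<in> cell_bd_set A (d e')" and eq: "\<gamma> e p = \<gamma> e' p'"
    then have "q e p = q e' p'" using i_\<gamma> by (metis topspace_prod_topology topspace_euclidean_subtopology)
    then have "\<Phi> e p = \<Phi> e' p'" using \<Phi>q ep bd_cell by (metis topspace_prod_topology topspace_euclidean_subtopology)
    then show "g' e p = g' e' p'" using g'(2) ep g'Z inj_f by (metis inj_onD)
  qed blast
  have cg: "continuous_map W Z g" unfolding W
  proof (rule continuous_map_from_final_top)
    fix e assume e: "e \<in> E"
    show "continuous_map (cell_bd_space A (d e)) Z (g \<circ> \<gamma> e)"
      by (rule continuous_map_eq [OF g'(1) [OF e]]) (use g(2) e in auto)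
  qed (use g z0 in auto)
  have "is_pushout Z W C X g i f h" unfolding is_pushout_iff [OF inj_i cg continuous_map_i]
  proof (intro conjI ballI allI impI)
    show "inj_on f (topspace Z)" by (rule inj_f)
    have h_int: "h (q e p) = \<Phi> e p" if "e \<in> E" "p \<in> cell_int A {a0} (d e)" for e p
      using h(2) [OF that(1)] cell_int_not_triv [OF that(2)] by simp
    show "inj_on h (topspace C - i ` topspace W)"
    proof (rule inj_onI)
      fix c c' assume c: "c \<in> topspace C - i ` topspace W" and c': "c' \<in> topspace C - i ` topspace W" and eq: "h c = h c'"
      obtain e p where e: "e \<in> E" "p \<in> cell_int A {a0} (d e)" "c = q e p" using c by (rule C_minus_W)
      obtain e' p' where e': "e' \<in> E" "p' \<in> cell_int A {a0} (d e')" "c' = q e' p'" using c' by (rule C_minus_W)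
      have "\<Phi> e p = \<Phi> e' p'" using eq h_int e e' by simp
      then have "e = e'" using cells_disjoint e e' by blast
      then have "p = p'" using inj_cell [OF e(1)] e e' \<open>\<Phi> e p = \<Phi> e' p'\<close> by (auto simp: inj_on_def)
      then show "c = c'" using e e' \<open>e = e'\<close> by simp
    qed
    show "f ` topspace Z \<inter> h ` (topspace C - i ` topspace W) = {}"
    proof -
      have "h c \<noteq> f z" if c: "c \<in> topspace C - i ` topspace W" and z: "z \<in> topspace Z" for c z
      proof -
        obtain e p where "e \<in> E" "p \<in> cell_int A {a0} (d e)" "c = q e p" using c by (rule C_minus_W)
        then show ?thesis using h_int cell_new z by simp
      qed
      then show ?thesis by (intro equals0I) (elim IntE imageE, simp)
    qed
    show "f (g w) = h (i w)" if w: "w \<in> topspace W" for w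
    proof (cases "w = w0")
      case True
      then show ?thesis using g h i_w0 by simp
    next
      case False
      then obtain e p where e: "e \<in> E" "p \<in> topspace A \<times> cube_bd (d e)" "w = \<gamma> e p"
        using w by (auto simp: topspace_W)
      then have "f (g w) = \<Phi> e p" using g(2) g'(2) by simp
      also have "\<dots> = h (i w)" using h(2) [OF e(1)] bd_cell [OF e(2)] e i_\<gamma> by simp
      finally show ?thesis .
    qed
    have hC: "h ` topspace C = {f z0} \<union> (\<Union>e\<in>E. \<Phi> e ` (topspace A \<times> cube (d e)))"
      using h by (force simp: topspace_C)
    have cov: "\<Phi> e p \<in> f ` topspace Z \<union> \<Phi> e ` cell_int A {a0} (d e)" if "e \<in> E" "p \<in> topspace A \<times> cube (d e)" for e p
    proof (cases "snd p \<in> cube_bd (d e)")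
      case True
      then have "p \<in> cell_bd_set A (d e)" using that(2) by (auto simp: mem_Times_iff)
      then show ?thesis using g'(2) [OF that(1)] g'Z [OF that(1)] by blast
    next
      case False
      then have i: "snd p \<in> cube_int (d e)" using that(2) cube_cases by (auto simp: mem_Times_iff)
      show ?thesis
      proof (cases "fst p = a0")
        case True
        then show ?thesis using triv [OF that] z0 by (simp add: cell_triv_def)
      next
        case False
        then show ?thesis using that i by (auto simp: cell_int_def)
      qed
    qed
    have "\<Phi> e ` (topspace A \<times> cube (d e)) \<subseteq> f ` topspace Z \<union> (\<Union>e\<in>E. \<Phi> e ` cell_int A {a0} (d e))" if e: "e \<in> E" for e
    using image_subsetI cov e by fastforce
    then have 1: "(\<Union>e\<in>E. \<Phi> e ` (topspace A \<times> cube (d e))) \<subseteq> f ` topspace Z \<union> (\<Union>e\<in>E. \<Phi> e ` cell_int A {a0} (d e))"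
      by (rule UN_least)
    have 2: "(\<Union>e\<in>E. \<Phi> e ` cell_int A {a0} (d e)) \<subseteq> (\<Union>e\<in>E. \<Phi> e ` (topspace A \<times> cube (d e)))"
      using cell_int_not_triv by (intro UN_mono image_mono) auto
    have 3: "{f z0} \<subseteq> f ` topspace Z" using z0 by simp
    show eqX: "topspace X = f ` topspace Z \<union> h ` topspace C"
      unfolding hC points using 1 2 3 by (meson Un_least Un_upper1 Un_upper2 order_trans subset_antisym)
    fix U assume U: "U \<subseteq> topspace X"
    have "{p \<in> cell_set A (d e). q e p \<in> preim C h U} = cell_preimage A (d e) (\<Phi> e) U" if "e \<in> E" for e
      using h(2) [OF that] continuous_map_image_subset_topspace [OF continuous_map_q [OF that]] by auto
    moreover have "preim C h U \<subseteq> topspace C" by auto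
    ultimately have "openin C (preim C h U) \<longleftrightarrow>
        (\<forall>e\<in>E. openin (cell_space A (d e)) (cell_preimage A (d e) (\<Phi> e) U))" unfolding C openin_final_top by simp
    then show "openin X U = (openin Z (preim Z f U) \<and> openin C (preim C h U))" using open_iff [OF U] by simp
  qed
  then show thesis using that cg g by blast
qed

end

section \<open>Wedges of model cells\<close>

lemma underlying_wedge:
  "underlying (wedge X J) = final_top {None} J (\<lambda>k. underlying (X k)) (wedge_incl X)"
proof -
  let ?q = "case_sum (\<lambda>_. None) (\<lambda>(k, x). wedge_incl X k x)"
  let ?S = "disjoint_sum (discrete_topology {()}) (sum_topology (\<lambda>k. underlying (X k)) J)"
  have "?q ` topspace ?S = {None} \<union> (\<Union>k\<in>J. wedge_incl X k ` pts (X k))" by (force simp: Plus_def image_Un)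
  moreover have "openin ?S (preim ?S ?q U) \<longleftrightarrow>
      (\<forall>k\<in>J. openin (underlying (X k)) {p \<in> pts (X k). wedge_incl X k p \<in> U})" for U
  proof -
    have "{x. (k, x) \<in> Inr -` preim ?S ?q U} =
        {p \<in> pts (X k). wedge_incl X k p \<in> U}" if "k \<in> J" for k using that by auto
    moreover have "Inr -` preim ?S ?q U \<subseteq> Sigma J (topspace \<circ> (\<lambda>k. underlying (X k)))" by auto
    moreover have "Inl -` preim ?S ?q U \<subseteq> {()}" by auto
    ultimately show ?thesis by (simp add: openin_disjoint_sum openin_sum_topology)
  qed
  ultimately show ?thesis unfolding wedge_def topology_eq fst_conv openin_quotient_topology openin_final_top by simp
qed

lemma basept_wedge [simp]: "basept (wedge X J) = None" by (simp add: wedge_def)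

lemma wedge_incl_eq_None_iff: "wedge_incl X k x = None \<longleftrightarrow> x = basept (X k)" by (simp add: wedge_incl_def)

lemma wedge_incl_inj: "wedge_incl X k x = wedge_incl X \<beta> y \<Longrightarrow> x \<noteq> basept (X k) \<Longrightarrow> k = \<beta> \<and> x = y"
  by (auto simp: wedge_incl_def split: if_splits)

lemma openin_wedge2:
  "openin (underlying (wedge2 X Y)) U \<longleftrightarrow> U \<subseteq> Inl ` pts X \<union> wedge2_inr X Y ` pts Y \<and>
     openin (underlying X) (preim (underlying X) Inl U) \<and> openin (underlying Y) (preim (underlying Y) (wedge2_inr X Y) U)"
proof -
  let ?S = "disjoint_sum (underlying X) (underlying Y)" and ?q = "case_sum Inl (wedge2_inr X Y)"
  have "Inl -` preim ?S ?q U = preim (underlying X) Inl U"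
    "Inr -` preim ?S ?q U = preim (underlying Y) (wedge2_inr X Y) U" by auto
  moreover have "?q ` topspace ?S = Inl ` pts X \<union> wedge2_inr X Y ` pts Y" by (force simp: Plus_def image_Un)
  ultimately show ?thesis unfolding wedge2_def fst_conv openin_quotient_topology by (simp add: openin_disjoint_sum)
qed

lemma topspace_wedge2:
  "pts (wedge2 X Y) = Inl ` pts X \<union> wedge2_inr X Y ` pts Y" by (force simp: wedge2_def Plus_def image_Un)

abbreviation cell_spheres :: "'a pointed \<Rightarrow> ('j \<Rightarrow> nat) \<Rightarrow> 'j \<Rightarrow> ('a \<times> real list) pointed" where
  "cell_spheres A d \<equiv> \<lambda>k. iterated_suspension (d k - 1) A"

abbreviation cell_cones :: "'a pointed \<Rightarrow> ('j \<Rightarrow> nat) \<Rightarrow> 'j \<Rightarrow> (('a \<times> real list) \<times> real) pointed" where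
  "cell_cones A d \<equiv> \<lambda>k. reduced_cone (iterated_suspension (d k - 1) A)"

definition cone_cell :: "'a pointed \<Rightarrow> ('j \<Rightarrow> nat) \<Rightarrow> 'j \<Rightarrow> 'a \<times> coords \<Rightarrow> ('j \<times> ('a \<times> real list) \<times> real) option" where
  "cone_cell A d k p = wedge_incl (cell_cones A d) k (cone_map (basept A) (d k - 1) p)"

definition sphere_cell :: "'a pointed \<Rightarrow> ('j \<Rightarrow> nat) \<Rightarrow> 'j \<Rightarrow> 'a \<times> coords \<Rightarrow> ('j \<times> 'a \<times> real list) option" where
  "sphere_cell A d k p = wedge_incl (cell_spheres A d) k (cone_bd_map (basept A) (d k - 1) p)"

lemma basept_reduced_cone: "basept (reduced_cone X) = cone_base (basept X)" by (simp add: reduced_cone_def cone_base_def)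

lemma cone_model_wedge:
  assumes A: "pointed_space A" and d: "\<And>k. k \<in> J \<Longrightarrow> 1 \<le> d k"
  shows "cone_model (underlying A) (basept A) J d (underlying (wedge (cell_spheres A d) J)) None (sphere_cell A d)
    (underlying (wedge (cell_cones A d) J)) None (cone_cell A d) (wedge_map (cell_cones A d) (\<lambda>_. cone_base))"
proof
  let ?S = "cell_spheres A d" and ?D = "cell_cones A d"
  have s: "Suc (d k - 1) = d k" if "k \<in> J" for k using d [OF that] by simp
  have "quotient_map (cell_bd_space (underlying A) (d k)) (underlying (?S k)) (cone_bd_map (basept A) (d k - 1))"
    if "k \<in> J" for k using quotient_map_cone_bd_map [OF A, of "d k - 1"] unfolding s [OF that] .
  then have "underlying (wedge ?S J) = final_top {None} J (\<lambda>k. cell_bd_space (underlying A) (d k))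
      (\<lambda>k. wedge_incl ?S k \<circ> cone_bd_map (basept A) (d k - 1))" unfolding underlying_wedge by (rule final_top_quotient)
  then show "underlying (wedge ?S J) = final_top {None} J (\<lambda>k. cell_bd_space (underlying A) (d k)) (sphere_cell A d)"
    by (simp add: sphere_cell_def [abs_def] o_def)
  have "quotient_map (cell_space (underlying A) (d k)) (underlying (?D k)) (cone_map (basept A) (d k - 1))"
    if "k \<in> J" for k using quotient_map_cone_map [of A "d k - 1"] unfolding s [OF that] .
  then have "underlying (wedge ?D J) = final_top {None} J (\<lambda>k. cell_space (underlying A) (d k))
      (\<lambda>k. wedge_incl ?D k \<circ> cone_map (basept A) (d k - 1))" unfolding underlying_wedge by (rule final_top_quotient)
  then show "underlying (wedge ?D J) = final_top {None} J (\<lambda>k. cell_space (underlying A) (d k)) (cone_cell A d)"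
    by (simp add: cone_cell_def [abs_def] o_def)
  have wm: "wedge_map ?D (\<lambda>_. cone_base) (wedge_incl ?S k x) = wedge_incl ?D k (cone_base x)" for k :: 'b and x
    by (auto simp: wedge_map_def wedge_incl_def basept_reduced_cone)
  show "wedge_map ?D (\<lambda>_. cone_base) (sphere_cell A d k p) = cone_cell A d k p"
    if "k \<in> J" "p \<in> pts A \<times> cube_bd (d k)" for k p using cone_base_cone_bd_map [of p "d k - 1" "basept A"] that(2)
    by (auto simp: sphere_cell_def cone_cell_def wm s [OF that(1)] simp del: One_nat_def)
  show "wedge_map ?D (\<lambda>_. cone_base) None = None" by (simp add: wedge_map_def)
  show "inj_on (wedge_map ?D (\<lambda>_. cone_base)) (pts (wedge ?S J))" unfolding underlying_wedge by (rule inj_onI)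
       (auto simp: wedge_map_def wedge_incl_def basept_reduced_cone cone_base_def split: if_splits)
  have b: "basept (?D k) = ((basept A, replicate (d k - 1) 0), 0)" for k by (simp add: basept_reduced_cone cone_base_def)
  show triv: "cone_cell A d k p = None \<longleftrightarrow> cell_triv (basept A) (d k) p"
    if "k \<in> J" "p \<in> pts A \<times> cube (d k)" for k p using cone_map_eq_base_iff [of p "d k - 1" "basept A"] that(2)
    by (auto simp: cone_cell_def wedge_incl_eq_None_iff b s [OF that(1)] simp del: One_nat_def)
  show "k = \<beta> \<and> p = p'" if "k \<in> J" "\<beta> \<in> J" "p \<in> pts A \<times> cube (d k)"
    "p' \<in> pts A \<times> cube (d \<beta>)" "cone_cell A d k p = cone_cell A d \<beta> p'"
    "\<not> cell_triv (basept A) (d k) p" for k \<beta> p p'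
  proof -
    have "cone_map (basept A) (d k - 1) p \<noteq> basept (?D k)"
      using triv [OF that(1,3)] that(6) by (auto simp: cone_cell_def wedge_incl_eq_None_iff)
    with that(5) have "k = \<beta> \<and> cone_map (basept A) (d k - 1) p = cone_map (basept A) (d \<beta> - 1) p'"
      unfolding cone_cell_def by (rule wedge_incl_inj)
    then show ?thesis using cone_map_inj [of "basept A" "d k - 1" p p'] that s [OF that(1)] by (auto simp: mem_Times_iff)
  qed
qed

text \<open>\<open>cube 0\<close> is a single point, so a 0-cell of type \<open>A\<close> is a copy
  of \<open>A\<close>.\<close>

lemma openin_cell_space_0:
  "openin A {a \<in> topspace A. Q a} \<longleftrightarrow> openin (cell_space A 0) {p \<in> cell_set A 0. Q (fst p)}"
proof -
  have "quotient_map (cell_space A 0) A fst" by (rule quotient_map_fst [THEN iffD2]) (auto simp flip: null_topspace_iff_trivial)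
  moreover have "{p \<in> cell_set A 0. fst p \<in> {a \<in> topspace A. Q a}} = {p \<in> cell_set A 0. Q (fst p)}" by auto
  ultimately show ?thesis
    using quotient_map_openin [of "cell_space A 0" A fst "{a \<in> topspace A. Q a}"] by (simp only: Collect_subset)
qed

text \<open>The index sets of the 0-cells and of the cells of positive dimension may overlap, so
  indices carry a tag: \<open>False\<close> for the former, \<open>True\<close> for the
  latter.\<close>

definition mixed_dim :: "('j \<Rightarrow> nat) \<Rightarrow> bool \<times> 'j \<Rightarrow> nat" where
  "mixed_dim d e = (if fst e then d (snd e) else 0)"

definition mixed_cell :: "'a pointed \<Rightarrow> 'j set \<Rightarrow> 'j set \<Rightarrow> ('j \<Rightarrow> nat) \<Rightarrow> bool \<times> 'j \<Rightarrow> 'a \<times> coords \<Rightarrow>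
    ('j \<times> 'a) option + ('j \<times> ('a \<times> real list) \<times> real) option" where
  "mixed_cell A J0 J d e p = (if fst e then wedge2_inr (wedge (\<lambda>_. A) J0) (wedge (cell_cones A d) J) (cone_cell A d (snd e) p)
     else Inl (wedge_incl (\<lambda>_. A) (snd e) (fst p)))"

lemma cone_model_mixed:
  fixes A :: "'a pointed" and J0 J :: "'j set"
  assumes A: "pointed_space A" and d: "\<And>k. k \<in> J \<Longrightarrow> 1 \<le> d k"
  defines "V \<equiv> wedge (\<lambda>_. A) J0" and "D \<equiv> wedge (cell_cones A d) J"
  shows "cone_model (underlying A) (basept A) (Pair False ` J0 \<union> Pair True ` J) (mixed_dim d)
    (underlying (wedge (cell_spheres A d) J)) None (\<lambda>e. sphere_cell A d (snd e))
    (underlying (wedge2 V D)) (Inl None) (mixed_cell A J0 J d)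
    (wedge2_inr V D \<circ> wedge_map (cell_cones A d) (\<lambda>_. cone_base))"
proof -
  interpret cone_model "underlying A" "basept A" J d "underlying (wedge (cell_spheres A d) J)" None "sphere_cell A d"
    "underlying D" None "cone_cell A d" "wedge_map (cell_cones A d) (\<lambda>_. cone_base)"
    unfolding D_def by (rule cone_model_wedge) fact+
  have inr: "wedge2_inr V D y = (if y = None then Inl None else Inr y)" for y by (simp add: wedge2_inr_def V_def D_def)
  have A0: "underlying A \<noteq> trivial_topology" using A by (auto simp: pointed_space_def)
  let ?E = "Pair False ` J0 \<union> Pair True ` J"
  have mT: "mixed_cell A J0 J d (True, k) = wedge2_inr V D \<circ> cone_cell A d k"
    and mF: "mixed_cell A J0 J d (False, k) = Inl \<circ> wedge_incl (\<lambda>_. A) k \<circ> fst" for k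
    by (auto simp: mixed_cell_def V_def D_def)
  have dT: "mixed_dim d (True, k) = d k" and dF: "mixed_dim d (False, k) = 0" for k by (auto simp: mixed_dim_def)
  have ball: "(\<forall>e\<in>?E. P e) \<longleftrightarrow> (\<forall>k\<in>J0. P (False, k)) \<and> (\<forall>k\<in>J. P (True, k))" for P
    by auto
  have UN: "(\<Union>e\<in>?E. P e) = (\<Union>k\<in>J0. P (False, k)) \<union> (\<Union>k\<in>J. P (True, k))" for P :: "bool \<times> 'j \<Rightarrow> 'z set"
    by auto
  show ?thesis
  proof
    \<comment> \<open>The boundary of a 0-cell is empty, so the cells tagged \<open>False\<close>
      add nothing to the wedge of the bases.\<close>
    show "underlying (wedge (cell_spheres A d) J) =
        final_top {None} ?E (\<lambda>e. cell_bd_space (underlying A) (mixed_dim d e)) (\<lambda>e. sphere_cell A d (snd e))"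
      unfolding W topology_eq openin_final_top ball dT dF by (simp add: UN dT dF)
    show "underlying (wedge2 V D) = cells_top (underlying A) {Inl None} ?E (mixed_dim d) (mixed_cell A J0 J d)" unfolding topology_eq
    proof
      fix U
      have V: "openin (underlying V) (preim (underlying V) Inl U) \<longleftrightarrow>
          (\<forall>k\<in>J0. openin (cell_space (underlying A) 0)
            {p \<in> cell_set (underlying A) 0. mixed_cell A J0 J d (False, k) p \<in> U})"
      proof -
        have "{p \<in> pts A. wedge_incl (\<lambda>_. A) k p \<in> preim (underlying V) Inl U} =
            {p \<in> pts A. Inl (wedge_incl (\<lambda>_. A) k p) \<in> U}" if "k \<in> J0" for k
          using that by (auto simp: V_def underlying_wedge)
        moreover have "preim (underlying V) Inl U \<subseteq> pts V" by auto
        ultimately have "openin (underlying V) (preim (underlying V) Inl U) \<longleftrightarrow>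
          (\<forall>k\<in>J0. openin (underlying A) {p \<in> pts A. Inl (wedge_incl (\<lambda>_. A) k p) \<in> U})"
          unfolding V_def underlying_wedge openin_final_top by simp
        then show ?thesis
          using openin_cell_space_0 [of "underlying A" "\<lambda>a. Inl (wedge_incl (\<lambda>_. A) k a) \<in> U" for k]
          by (simp only: mF o_apply)
      qed
      have D: "openin (underlying D) (preim (underlying D) (wedge2_inr V D) U) \<longleftrightarrow>
          (\<forall>k\<in>J. openin (cell_space (underlying A) (d k))
            {p \<in> cell_set (underlying A) (d k). mixed_cell A J0 J d (True, k) p \<in> U})"
      proof -
        have "{p \<in> cell_set (underlying A) (d k). cone_cell A d k p \<in> preim (underlying D) (wedge2_inr V D) U} =
            {p \<in> cell_set (underlying A) (d k). mixed_cell A J0 J d (True, k) p \<in> U}" if "k \<in> J" for k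
          using that by (auto simp: topspace_C mT)
        moreover have "preim (underlying D) (wedge2_inr V D) U \<subseteq> pts D" by auto
        ultimately show ?thesis unfolding C openin_final_top by simp
      qed
      have "Inl ` pts V \<union> wedge2_inr V D ` pts D =
          {Inl None} \<union> (\<Union>e\<in>?E. mixed_cell A J0 J d e ` cell_set (underlying A) (mixed_dim d e))"
      proof -
        have "Inl ` pts V = {Inl None} \<union> (\<Union>k\<in>J0. mixed_cell A J0 J d (False, k) ` cell_set (underlying A) 0)"
        proof -
          have "fst ` cell_set (underlying A) 0 = pts A" by force
          then show ?thesis unfolding V_def underlying_wedge topspace_final_top image_Un image_UN mF image_comp [symmetric] by simp
        qed
        moreover have "wedge2_inr V D ` pts D = {Inl None} \<union>
            (\<Union>k\<in>J. mixed_cell A J0 J d (True, k) ` cell_set (underlying A) (d k))"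
        proof -
          have n: "wedge2_inr V D None = Inl None" by (simp add: inr)
          show ?thesis unfolding topspace_C image_Un image_UN mT image_comp [symmetric] by (simp add: n)
        qed
        ultimately show ?thesis unfolding UN dT dF by auto
      qed
      then show "openin (underlying (wedge2 V D)) U = openin (cells_top (underlying A) {Inl None} ?E
          (mixed_dim d) (mixed_cell A J0 J d)) U" unfolding openin_wedge2 openin_final_top ball dT dF V D by simp
    qed
    show "(wedge2_inr V D \<circ> wedge_map (cell_cones A d) (\<lambda>_. cone_base)) (sphere_cell A d (snd e) p) = mixed_cell A J0 J d e p"
      if "e \<in> ?E" "p \<in> pts A \<times> cube_bd (mixed_dim d e)" for e p
      using that i_\<gamma> [of "snd e" p] by (auto simp: mT dT dF)
    show "(wedge2_inr V D \<circ> wedge_map (cell_cones A d) (\<lambda>_. cone_base)) None = Inl None" using i_w0 by (simp add: inr)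
    have "inj (wedge2_inr V D)" by (auto simp: inj_on_def inr split: if_splits)
    then show "inj_on (wedge2_inr V D \<circ> wedge_map (cell_cones A d) (\<lambda>_. cone_base)) (pts (wedge (cell_spheres A d) J))"
      by (intro comp_inj_on inj_i) (auto intro: inj_on_subset)
    show triv: "mixed_cell A J0 J d e p = Inl None \<longleftrightarrow> cell_triv (basept A) (mixed_dim d e) p"
      if "e \<in> ?E" "p \<in> pts A \<times> cube (mixed_dim d e)" for e p using that
    proof (elim UnE imageE)
      fix k assume "e = (False, k)"
      then show ?thesis by (simp add: mF dF wedge_incl_eq_None_iff cell_triv_def)
    next
      fix k assume "e = (True, k)" "k \<in> J"
      then show ?thesis using that(2) q_triv [of k p] by (simp add: mT dT inr)
    qed
    show "e = e' \<and> p = p'" if "e \<in> ?E" "e' \<in> ?E" "p \<in> pts A \<times> cube (mixed_dim d e)"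
      "p' \<in> pts A \<times> cube (mixed_dim d e')" "mixed_cell A J0 J d e p = mixed_cell A J0 J d e' p'"
      "\<not> cell_triv (basept A) (mixed_dim d e) p" for e e' p p'
    proof -
      have nt: "mixed_cell A J0 J d e p \<noteq> Inl None" using triv that by blast
      obtain b k b' \<beta> where e: "e = (b, k)" "e' = (b', \<beta>)" by (cases e, cases e')
      have "b = b'" using that(5) nt unfolding e by (cases b; cases b') (auto simp: mT mF inr split: if_splits)
      show ?thesis
      proof (cases b)
        case True
        then have "cone_cell A d k p = cone_cell A d \<beta> p'"
          using that(5) nt \<open>b = b'\<close> unfolding e by (auto simp: mT inr split: if_splits)
        then show ?thesis using q_inj [of k \<beta> p p'] that(1-4,6) True \<open>b = b'\<close> unfolding e by (auto simp: dT)
      next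
        case False
        then have "wedge_incl (\<lambda>_. A) k (fst p) = wedge_incl (\<lambda>_. A) \<beta> (fst p')" "fst p \<noteq> basept A"
          using that(5,6) \<open>b = b'\<close> unfolding e by (auto simp: mF cell_triv_def)
        then have "k = \<beta>" "fst p = fst p'" using wedge_incl_inj [of "\<lambda>_. A" k "fst p" \<beta> "fst p'"] by auto
        then show ?thesis using that(3,4) False \<open>b = b'\<close> unfolding e by (auto simp: dF)
      qed
    qed
  qed
qed

section \<open>Attached cells in terms of characteristic maps\<close>

lemma attaches_if_attach_mixed_cells:
  fixes A :: "'a pointed" and Z X :: "'x pointed"
  assumes A: "pointed_space A" and at: "attach_mixed_cells A Z X f"
  obtains E :: "(bool \<times> 'x) set" and d \<Phi> where
    "attaches_pointed A Z X f E d \<Phi>"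
proof -
  obtain J0 J :: "'x set" and d g h where d: "\<And>k. k \<in> J \<Longrightarrow> 1 \<le> d k"
    and g: "pointed_map (wedge (cell_spheres A d) J) Z g" and po: "is_pushout (underlying Z) (underlying (wedge (cell_spheres A d) J))
       (underlying (wedge2 (wedge (\<lambda>_. A) J0) (wedge (cell_cones A d) J))) (underlying X) g
       (wedge2_inr (wedge (\<lambda>_. A) J0) (wedge (cell_cones A d) J) \<circ> wedge_map (cell_cones A d) (\<lambda>_. cone_base)) f h"
    using at unfolding attach_mixed_cells_def Let_def by blast
  have "g None = basept Z" using g by (simp add: pointed_map_def)
  then show thesis using cone_model.attaches_if_pushout [OF cone_model_mixed [OF A d] po] that by blast
qed

lemma attach_mixed_cells_if_attaches:
  fixes A :: "'a pointed" and Z X :: "'x pointed" and E :: "'x set"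
  assumes A: "pointed_space A" and f: "pointed_map Z X f" and at: "attaches_pointed A Z X f E d \<Phi>"
  shows "attach_mixed_cells A Z X f"
proof -
  let ?K = "{e \<in> E. d e = 0}" and ?J = "{e \<in> E. 1 \<le> d e}"
  let ?E = "Pair False ` ?K \<union> Pair True ` ?J"
  have "bij_betw snd ?E E" unfolding bij_betw_def
  proof
    have "fst e = (1 \<le> d (snd e))" if "e \<in> ?E" for e using that by (elim UnE imageE) simp_all
    then show "inj_on snd ?E" by (intro inj_onI prod_eqI) simp_all
    have "x \<in> snd ` ?E" if "x \<in> E" for x
    proof (rule image_eqI)
      show "(1 \<le> d x, x) \<in> ?E" using that by (cases "d x") auto
    qed simp
    then show "snd ` ?E = E" by auto
  qed
  then have *: "attaches_pointed A Z X f ?E (mixed_dim d) (\<Phi> \<circ> snd)"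
    by (rule attaches_reindex [OF at]) (auto simp: mixed_dim_def)
  interpret m: cone_model "underlying A" "basept A" ?E "mixed_dim d" "underlying (wedge (cell_spheres A d) ?J)" None
    "\<lambda>e. sphere_cell A d (snd e)" "underlying (wedge2 (wedge (\<lambda>_. A) ?K) (wedge (cell_cones A d) ?J))" "Inl None"
    "mixed_cell A ?K ?J d"
    "wedge2_inr (wedge (\<lambda>_. A) ?K) (wedge (cell_cones A d) ?J) \<circ> wedge_map (cell_cones A d) (\<lambda>_. cone_base)"
    by (rule cone_model_mixed [OF A]) auto
  obtain g h where "continuous_map (underlying (wedge (cell_spheres A d) ?J)) (underlying Z) g" "g None = basept Z"
    "is_pushout (underlying Z) (underlying (wedge (cell_spheres A d) ?J))
       (underlying (wedge2 (wedge (\<lambda>_. A) ?K) (wedge (cell_cones A d) ?J))) (underlying X) g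
       (wedge2_inr (wedge (\<lambda>_. A) ?K) (wedge (cell_cones A d) ?J) \<circ> wedge_map (cell_cones A d) (\<lambda>_. cone_base)) f h"
    by (rule m.pushout_if_attaches [OF *])
  then show ?thesis unfolding attach_mixed_cells_def Let_def using f
    by (intro conjI exI [of _ ?K] exI [of _ ?J] exI [of _ d] exI [of _ g] exI [of _ h]) (auto simp: pointed_map_def)
qed

lemma topspace_wedge_copies:
  assumes "basept Z \<in> pts Z"
  shows "topspace (underlying (wedge2 Z (wedge (\<lambda>_. A) J))) =
    Inl ` pts Z \<union> (\<Union>k\<in>J. (\<lambda>a. wedge2_inr Z (wedge (\<lambda>_. A) J) (wedge_incl (\<lambda>_. A) k a)) ` pts A)"
proof -
  have "wedge2_inr Z (wedge (\<lambda>_. A) J) None = Inl (basept Z)" by (simp add: wedge2_inr_def)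
  then show ?thesis unfolding topspace_wedge2 underlying_wedge topspace_final_top image_Un image_UN
    using assms by (auto simp: image_image)
qed

text \<open>Dimension 0 is treated separately, since it is defined by a wedge and not by a pushout
  of cones. There \<open>q k\<close> is the inclusion of the copy of \<open>A\<close> with index
  \<open>k\<close>, and the boundary condition is void because \<open>cube_bd 0\<close> is
  empty.\<close>

lemma attaches_if_attach_cells:
  fixes A :: "'a pointed" and Z X :: "'x pointed"
  assumes A: "pointed_space A" and Z: "pointed_space Z" and at: "attach_cells A n Z X f"
  obtains J :: "'x set" and \<Phi> where
    "attaches_pointed A Z X f J (\<lambda>_. n) \<Phi>"
proof (cases n)
  case (Suc m)
  obtain J :: "'x set" and g h where
    g: "pointed_map (wedge (cell_spheres A (\<lambda>_. n)) J) Z g"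
    and po: "is_pushout (underlying Z) (underlying (wedge (cell_spheres A (\<lambda>_. n)) J))
       (underlying (wedge (cell_cones A (\<lambda>_. n)) J)) (underlying X) g (wedge_map (cell_cones A (\<lambda>_. n)) (\<lambda>_. cone_base)) f h"
    using at unfolding attach_cells_def Let_def Suc by auto
  have g0: "g None = basept Z" using g by (simp add: pointed_map_def)
  have cm: "cone_model (underlying A) (basept A) J (\<lambda>_. n) (underlying (wedge (cell_spheres A (\<lambda>_. n)) J)) None
      (sphere_cell A (\<lambda>_. n)) (underlying (wedge (cell_cones A (\<lambda>_. n)) J)) None (cone_cell A (\<lambda>_. n))
      (wedge_map (cell_cones A (\<lambda>_. n)) (\<lambda>_. cone_base))" by (rule cone_model_wedge [OF A]) (simp add: Suc)
  show thesis by (rule that [OF cone_model.attaches_if_pushout [OF cm po g0]])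
next
  case 0
  obtain J :: "'x set" and \<phi> where \<phi>: "homeomorphic_map (underlying (wedge2 Z (wedge (\<lambda>_. A) J))) (underlying X) \<phi>"
    and f: "\<And>z. z \<in> pts Z \<Longrightarrow> f z = \<phi> (Inl z)" using at unfolding attach_cells_def 0 by auto
  let ?V = "wedge (\<lambda>_. A) J"
  let ?W = "underlying (wedge2 Z ?V)"
  have inj: "inj_on \<phi> (topspace ?W)" and surj: "\<phi> ` topspace ?W = pts X"
    and quo: "\<And>U. U \<subseteq> pts X \<Longrightarrow> openin (underlying X) U \<longleftrightarrow> openin ?W {w \<in> topspace ?W. \<phi> w \<in> U}"
    using \<phi> by (auto simp: homeomorphic_map_def quotient_map_def)
  define q where "q = (\<lambda>k a. wedge2_inr Z ?V (wedge_incl (\<lambda>_. A) k a))"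
  have z0: "basept Z \<in> pts Z" using Z by (simp add: pointed_space_def)
  have q: "q k a = (if a = basept A then Inl (basept Z) else Inr (Some (k, a)))" for k a
    by (auto simp: q_def wedge2_inr_def wedge_incl_def)
  have W: "topspace ?W = Inl ` pts Z \<union> (\<Union>k\<in>J. q k ` pts A)" unfolding q_def by (rule topspace_wedge_copies [OF z0])
  have W': "topspace ?W = Inl ` pts Z \<union> (\<Union>k\<in>J. q k ` (pts A - {basept A}))" unfolding W using z0 by (auto simp: q)
  have A0: "underlying A \<noteq> trivial_topology" using A by (auto simp: pointed_space_def)
  show thesis
  proof (rule that [of J "\<lambda>k p. \<phi> (q k (fst p))"], unfold_locales)
    show "inj_on f (pts Z)" using inj f by (auto simp: inj_on_def W)
    have ci: "cell_int (underlying A) {basept A} n = (pts A - {basept A}) \<times> {\<lambda>_. 0}" by (simp add: cell_int_def 0)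
    show "pts X = f ` pts Z \<union> (\<Union>k\<in>J. (\<lambda>p. \<phi> (q k (fst p))) ` cell_int (underlying A) {basept A} n)"
    proof -
      have "(\<lambda>p. \<phi> (q k (fst p))) ` cell_int (underlying A) {basept A} n = \<phi> ` q k ` (pts A - {basept A})" for k
        by (force simp: ci)
      then show ?thesis unfolding surj [symmetric] W' using f by (auto simp: image_Un image_UN)
    qed
    fix k assume k: "k \<in> J"
    have qW: "q k a \<in> topspace ?W" if "a \<in> pts A" "k \<in> J" for a k using that by (auto simp: W)
    show "inj_on (\<lambda>p. \<phi> (q k (fst p))) (cell_int (underlying A) {basept A} n)"
      using inj_onD [OF inj] qW k by (intro inj_onI) (fastforce simp: ci q)
    show "\<phi> (q k (fst p)) \<noteq> f z" if "p \<in> cell_int (underlying A) {basept A} n" "z \<in> pts Z" for p z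
      using inj_onD [OF inj, of "q k (fst p)" "Inl z"] qW [of "fst p" k] k that f by (auto simp: ci q W)
    show "k = \<beta>" if "\<beta> \<in> J" "p \<in> cell_int (underlying A) {basept A} n" "p' \<in> cell_int (underlying A) {basept A} n"
      "\<phi> (q k (fst p)) = \<phi> (q \<beta> (fst p'))" for \<beta> p p'
      using inj_onD [OF inj that(4)] qW [of "fst p" k] qW [of "fst p'" \<beta>] k that(1-3) by (auto simp: ci q split: if_splits)
    show "\<exists>g. continuous_map (cell_bd_space (underlying A) n) (underlying Z) g \<and>
         (\<forall>p\<in>cell_bd_set (underlying A) n. \<phi> (q k (fst p)) = f (g p))" by (simp add: 0)
    show "\<phi> (q k (fst (b, u))) = f (basept Z)" if "b \<in> {basept A}" for b and u :: "nat \<Rightarrow> real"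
      using that f z0 by (simp add: q)
  next
    fix U assume U: "U \<subseteq> pts X"
    let ?U = "{w \<in> topspace ?W. \<phi> w \<in> U}"
    have 1: "preim (underlying Z) Inl ?U = preim (underlying Z) f U" using f by (auto simp: W)
    have 2: "openin (underlying ?V) (preim (underlying ?V) (wedge2_inr Z ?V) ?U) \<longleftrightarrow>
        (\<forall>k\<in>J. openin (underlying A) {a \<in> pts A. \<phi> (q k a) \<in> U})"
    proof -
      have "{a \<in> pts A. wedge_incl (\<lambda>_. A) k a \<in> preim (underlying ?V) (wedge2_inr Z ?V) ?U} =
          {a \<in> pts A. \<phi> (q k a) \<in> U}" if "k \<in> J" for k using that by (auto simp: underlying_wedge W q_def)
      moreover have "preim (underlying ?V) (wedge2_inr Z ?V) ?U \<subseteq> pts ?V" by auto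
      ultimately show ?thesis unfolding underlying_wedge openin_final_top by simp
    qed
    have 3: "openin (underlying A) {a \<in> pts A. \<phi> (q k a) \<in> U} \<longleftrightarrow>
        openin (cell_space (underlying A) 0) {p \<in> cell_set (underlying A) 0. \<phi> (q k (fst p)) \<in> U}" for k
      by (rule openin_cell_space_0)
    show "openin (underlying X) U = (openin (underlying Z) (preim (underlying Z) f U) \<and>
        (\<forall>k\<in>J. openin (cell_space (underlying A) n) {p \<in> cell_set (underlying A) n. \<phi> (q k (fst p)) \<in> U}))"
      unfolding quo [OF U] openin_wedge2 1 2 3 0 using topspace_wedge2 [of Z ?V] by auto
  qed (use z0 0 in auto)
qed

lemma attach_cells_if_attaches:
  fixes A :: "'a pointed" and Z X :: "'x pointed" and E :: "'x set"
  assumes A: "pointed_space A" and f: "pointed_map Z X f" and at: "attaches_pointed A Z X f E (\<lambda>_. n) \<Phi>"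
  shows "attach_cells A n Z X f"
proof (cases n)
  case (Suc m)
  interpret m: cone_model "underlying A" "basept A" E "\<lambda>_. n" "underlying (wedge (cell_spheres A (\<lambda>_. n)) E)" None
    "sphere_cell A (\<lambda>_. n)" "underlying (wedge (cell_cones A (\<lambda>_. n)) E)" None "cone_cell A (\<lambda>_. n)"
    "wedge_map (cell_cones A (\<lambda>_. n)) (\<lambda>_. cone_base)" by (rule cone_model_wedge [OF A]) (simp add: Suc)
  obtain g h where "continuous_map (underlying (wedge (cell_spheres A (\<lambda>_. n)) E)) (underlying Z) g" "g None = basept Z"
    "is_pushout (underlying Z) (underlying (wedge (cell_spheres A (\<lambda>_. n)) E))
       (underlying (wedge (cell_cones A (\<lambda>_. n)) E)) (underlying X) g (wedge_map (cell_cones A (\<lambda>_. n)) (\<lambda>_. cone_base)) f h"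
    by (rule m.pushout_if_attaches [OF at])
  then show ?thesis unfolding attach_cells_def Let_def using f by (auto simp: Suc pointed_map_def intro!: exI [of _ E] exI [of _ g])
next
  case 0
  interpret attaches "underlying A" "{basept A}" True "underlying Z" "basept Z" "underlying X" f E "\<lambda>_. n" \<Phi> by (rule at)
  let ?V = "wedge (\<lambda>_. A) E"
  let ?W = "underlying (wedge2 Z ?V)"
  have z0: "basept Z \<in> pts Z" using base by simp
  define q where "q = (\<lambda>k a. wedge2_inr Z ?V (wedge_incl (\<lambda>_. A) k a))"
  have q: "q k a = (if a = basept A then Inl (basept Z) else Inr (Some (k, a)))" for k a
    by (auto simp: q_def wedge2_inr_def wedge_incl_def)
  have W: "topspace ?W = Inl ` pts Z \<union> (\<Union>k\<in>E. q k ` pts A)" unfolding q_def by (rule topspace_wedge_copies [OF z0])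
  have W': "topspace ?W = Inl ` pts Z \<union> (\<Union>k\<in>E. q k ` (pts A - {basept A}))" unfolding W using z0 by (auto simp: q)
  have ci: "cell_int (underlying A) {basept A} n = (pts A - {basept A}) \<times> {\<lambda>_. 0}" by (simp add: cell_int_def 0)
  \<comment> \<open>The converse for 0-cells: the structure map and the characteristic maps are
    combined into one map on the wedge. The point \<open>\<lambda>_. 0\<close> is the only point of
    \<open>cube 0\<close>.\<close>
  define \<phi> where "\<phi> = case_sum f (\<lambda>y. case y of None \<Rightarrow> f (basept Z) | Some (k, a) \<Rightarrow> \<Phi> k (a, \<lambda>_. 0))"
  have \<phi>Z: "\<phi> (Inl z) = f z" for z by (simp add: \<phi>_def)
  have \<phi>q: "\<phi> (q k a) = \<Phi> k (a, \<lambda>_. 0)" if "k \<in> E" "a \<in> pts A" for k a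
    using B0 [of k a "\<lambda>_. 0"] that by (auto simp: q \<phi>_def 0)
  have surj: "\<phi> ` topspace ?W = pts X" using \<phi>q points W' by (auto simp: ci image_iff image_Un image_UN \<phi>Z image_image)
  have inj: "inj_on \<phi> (topspace ?W)" unfolding W' inj_on_Un
  proof (intro conjI)
    show "inj_on \<phi> (Inl ` pts Z)" using inj_f by (auto simp: inj_on_def \<phi>Z)
    show "inj_on \<phi> (\<Union>k\<in>E. q k ` (pts A - {basept A}))"
    proof (rule inj_onI)
      fix x y assume "x \<in> (\<Union>k\<in>E. q k ` (pts A - {basept A}))"
        "y \<in> (\<Union>k\<in>E. q k ` (pts A - {basept A}))" and eq: "\<phi> x = \<phi> y"
      then obtain k a \<beta> b where *: "k \<in> E" "a \<in> pts A - {basept A}" "x = q k a"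
        "\<beta> \<in> E" "b \<in> pts A - {basept A}" "y = q \<beta> b" by auto
      then have "\<Phi> k (a, \<lambda>_. 0) = \<Phi> \<beta> (b, \<lambda>_. 0)" using eq \<phi>q by auto
      moreover from this have "k = \<beta>"
        using cells_disjoint [of k \<beta> "(a, \<lambda>_. 0)" "(b, \<lambda>_. 0)"] * by (simp add: ci)
      ultimately show "x = y" using inj_onD [OF inj_cell [OF *(1)], of "(a, \<lambda>_. 0)" "(b, \<lambda>_. 0)"] * by (simp add: ci)
    qed
    have "\<phi> (q k a) \<noteq> f z" if "k \<in> E" "a \<in> pts A - {basept A}" "z \<in> pts Z" for k a z
      using cell_new [OF that(1), of "(a, \<lambda>_. 0)" z] \<phi>q [of k a] that by (simp add: ci)
    then show "\<phi> ` (Inl ` pts Z - (\<Union>k\<in>E. q k ` (pts A - {basept A}))) \<inter>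
       \<phi> ` ((\<Union>k\<in>E. q k ` (pts A - {basept A})) - Inl ` pts Z) = {}" by (fastforce simp: \<phi>Z)
  qed
  have A0: "underlying A \<noteq> trivial_topology" using A by (auto simp: pointed_space_def)
  have "quotient_map ?W (underlying X) \<phi>" unfolding quotient_map_def
  proof (intro conjI surj allI impI)
    fix U assume U: "U \<subseteq> pts X"
    let ?U = "{w \<in> topspace ?W. \<phi> w \<in> U}"
    have 1: "preim (underlying Z) Inl ?U = preim (underlying Z) f U" by (auto simp: W \<phi>Z)
    have 2: "openin (underlying ?V) (preim (underlying ?V) (wedge2_inr Z ?V) ?U) \<longleftrightarrow>
        (\<forall>k\<in>E. openin (underlying A) {a \<in> pts A. \<Phi> k (a, \<lambda>_. 0) \<in> U})"
    proof -
      have "{a \<in> pts A. wedge_incl (\<lambda>_. A) k a \<in> preim (underlying ?V) (wedge2_inr Z ?V) ?U} =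
          {a \<in> pts A. \<Phi> k (a, \<lambda>_. 0) \<in> U}" if "k \<in> E" for k
      proof -
        have qd: "wedge2_inr Z ?V (wedge_incl (\<lambda>_. A) k a) = q k a" for a by (simp add: q_def)
        have "wedge_incl (\<lambda>_. A) k a \<in> pts ?V" "q k a \<in> topspace ?W"
          if "a \<in> pts A" for a using that \<open>k \<in> E\<close> by (auto simp: underlying_wedge W)
        then show ?thesis using \<phi>q [OF that] by (auto simp: qd)
      qed
      moreover have "preim (underlying ?V) (wedge2_inr Z ?V) ?U \<subseteq> pts ?V" by auto
      ultimately show ?thesis unfolding underlying_wedge openin_final_top by simp
    qed
    have 3: "openin (underlying A) {a \<in> pts A. \<Phi> k (a, \<lambda>_. 0) \<in> U} \<longleftrightarrow>
        openin (cell_space (underlying A) 0) {p \<in> cell_set (underlying A) 0. \<Phi> k p \<in> U}" for k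
    proof -
      have "{p \<in> cell_set (underlying A) 0. \<Phi> k (fst p, \<lambda>_. 0) \<in> U} =
          {p \<in> cell_set (underlying A) 0. \<Phi> k p \<in> U}" by auto
      then show ?thesis
        using openin_cell_space_0 [of "underlying A" "\<lambda>a. \<Phi> k (a, \<lambda>_. 0) \<in> U"] by (simp only:)
    qed
    show "openin ?W ?U = openin (underlying X) U"
      unfolding open_iff [OF U] openin_wedge2 1 2 3 0 using topspace_wedge2 [of Z ?V] by auto
  qed
  then have "homeomorphic_map ?W (underlying X) \<phi>" using inj by (simp add: homeomorphic_map_def)
  then show ?thesis unfolding attach_cells_def using f by (auto simp: 0 \<phi>Z intro!: exI [of _ E])
qed

section \<open>Spaces presented by cells\<close>

lemma (in attaches) cell_image: "e \<in> E \<Longrightarrow> p \<in> cell_set B (d e) \<Longrightarrow> \<Phi> e p \<in> topspace X"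
proof -
  assume e: "e \<in> E" and p: "p \<in> cell_set B (d e)"
  obtain g where g: "continuous_map (cell_bd_space B (d e)) Z g"
    "\<And>p. p \<in> cell_bd_set B (d e) \<Longrightarrow> \<Phi> e p = f (g p)" using bd [OF e] by blast
  obtain b u where bu: "p = (b, u)" "b \<in> topspace B" "u \<in> cube (d e)" using p by auto
  consider "u \<in> cube_bd (d e)" | "b \<in> B0" | "(b, u) \<in> cell_int B B0 (d e)"
    using bu cube_cases by (auto simp: cell_int_def)
  then show ?thesis
  proof cases
    case 1
    then have "p \<in> cell_bd_set B (d e)" using bu by simp
    then show ?thesis using g by (auto simp: points continuous_map_def)
  next
    case 2
    then show ?thesis using B0 [OF e 2 bu(2,3)] base bu by (auto simp: points)
  next
    case 3
    then show ?thesis using e bu by (auto simp: points)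
  qed
qed

lemma (in attaches) continuous_map_f: "continuous_map Z X f" unfolding continuous_map_def
proof (intro conjI allI impI)
  show "f \<in> topspace Z \<rightarrow> topspace X" by (auto simp: points)
  show "openin Z (preim Z f U)" if "openin X U" for U using open_iff [of U] that openin_subset by blast
qed

text \<open>Attaching maps appear only through their images: on the boundary,
  \<open>\<Phi> e\<close> must be continuous into the final topology of the cells of smaller rank.
  \<open>Q\<close> is empty for ordinary complexes whose base point is still a cell, and otherwise
  holds the base point. Ranks are positive so that the stage with index 1 is \<open>Q\<close> alone
  and can begin a filtration.\<close>

locale cell_complex =
  fixes B :: "'b topology" and B0 :: "'b set" and fl :: bool and Q :: "'x set" and x0 :: 'x
    and E :: "'e set" and d :: "'e \<Rightarrow> nat" and \<Phi> :: "'e \<Rightarrow> 'b \<times> coords \<Rightarrow> 'x" and rk :: "'e \<Rightarrow> nat"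
  assumes Q: "Q \<subseteq> {x0}" and base: "B0 \<noteq> {} \<or> fl \<Longrightarrow> x0 \<in> Q"
    and rk_pos: "e \<in> E \<Longrightarrow> 0 < rk e"
    and inj_cell: "e \<in> E \<Longrightarrow> inj_on (\<Phi> e) (cell_int B B0 (d e))"
    and cell_new: "e \<in> E \<Longrightarrow> p \<in> cell_int B B0 (d e) \<Longrightarrow> \<Phi> e p \<notin> Q"
    and cells_disjoint: "e \<in> E \<Longrightarrow> e' \<in> E \<Longrightarrow> p \<in> cell_int B B0 (d e) \<Longrightarrow> p' \<in> cell_int B B0 (d e') \<Longrightarrow>
        \<Phi> e p = \<Phi> e' p' \<Longrightarrow> e = e'"
    and bd: "e \<in> E \<Longrightarrow> continuous_map (cell_bd_space B (d e))
        (cells_top B Q {e' \<in> E. rk e' < rk e} d \<Phi>) (\<Phi> e)"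
    and B0: "e \<in> E \<Longrightarrow> b \<in> B0 \<Longrightarrow> b \<in> topspace B \<Longrightarrow> u \<in> cube (d e) \<Longrightarrow> \<Phi> e (b, u) = x0"
    and J: "fl \<Longrightarrow> e \<in> E \<Longrightarrow> b \<in> topspace B \<Longrightarrow> u \<in> cube_J (d e) \<Longrightarrow> \<Phi> e (b, u) = x0"
begin

definition stage :: "nat \<Rightarrow> 'x topology" where
  "stage r = cells_top B Q {e \<in> E. rk e < r} d \<Phi>"

definition total :: "'x topology" where
  "total = cells_top B Q E d \<Phi>"

lemma bd_stage: "e \<in> E \<Longrightarrow> continuous_map (cell_bd_space B (d e)) (stage (rk e)) (\<Phi> e)"
  using bd by (simp add: stage_def)

lemma continuous_map_cell_stage: "e \<in> E \<Longrightarrow> rk e < r \<Longrightarrow> continuous_map (cell_space B (d e)) (stage r) (\<Phi> e)"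
  unfolding stage_def by (rule continuous_map_into_final_top [where P = "\<lambda>e. cell_space B (d e)" and q = \<Phi>]) simp

lemma continuous_map_cell_total: "e \<in> E \<Longrightarrow> continuous_map (cell_space B (d e)) total (\<Phi> e)"
  unfolding total_def by (rule continuous_map_into_final_top [where P = "\<lambda>e. cell_space B (d e)" and q = \<Phi>])

lemma topspace_stage: "topspace (stage r) = Q \<union> (\<Union>e\<in>{e \<in> E. rk e < r}. \<Phi> e ` (topspace B \<times> cube (d e)))"
  by (simp add: stage_def)

lemma topspace_total: "topspace total = Q \<union> (\<Union>e\<in>E. \<Phi> e ` (topspace B \<times> cube (d e)))"
  by (simp add: total_def)

lemma openin_stage: "openin (stage r) U \<longleftrightarrow> U \<subseteq> topspace (stage r) \<and>
    (\<forall>e\<in>E. rk e < r \<longrightarrow> openin (cell_space B (d e)) (cell_preimage B (d e) (\<Phi> e) U))"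
  unfolding stage_def openin_final_top by auto

lemma openin_total: "openin total U \<longleftrightarrow> U \<subseteq> topspace total \<and>
    (\<forall>e\<in>E. openin (cell_space B (d e)) (cell_preimage B (d e) (\<Phi> e) U))" unfolding total_def openin_final_top by auto

lemma cell_space_cases:
  assumes "e \<in> E" "p \<in> cell_set B (d e)"
  obtains (boundary) "p \<in> cell_bd_set B (d e)" "\<Phi> e p \<in> topspace (stage (rk e))"
    | (basepoint) "fst p \<in> B0" "\<Phi> e p = x0" "x0 \<in> Q"
    | (interior) "p \<in> cell_int B B0 (d e)"
proof -
  obtain b u where bu: "p = (b, u)" "b \<in> topspace B" "u \<in> cube (d e)" using assms(2) by auto
  consider "u \<in> cube_bd (d e)" | "b \<in> B0" | "(b, u) \<in> cell_int B B0 (d e)"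
    using bu cube_cases by (auto simp: cell_int_def)
  then show thesis
  proof cases
    case 1
    then have "p \<in> cell_bd_set B (d e)" using bu by simp
    moreover from this have "\<Phi> e p \<in> topspace (stage (rk e))" using bd_stage [OF assms(1)] by (auto simp: continuous_map_def)
    ultimately show thesis by (rule that(1))
  next
    case 2
    then show thesis using B0 [OF assms(1) 2 bu(2,3)] base bu that(2) by auto
  next
    case 3
    then show thesis using bu that(3) by simp
  qed
qed

text \<open>Strong induction on the rank: a boundary point lies in a lower stage and a point over
  \<open>B0\<close> is the base point, so what remains is covered by open cells.\<close>

lemma stage_points: "topspace (stage r) = Q \<union> (\<Union>e\<in>{e \<in> E. rk e < r}. \<Phi> e ` cell_int B B0 (d e))"
proof (induction r rule: less_induct)
  case (less r)
  have "\<Phi> e p \<in> Q \<union> (\<Union>e\<in>{e \<in> E. rk e < r}. \<Phi> e ` cell_int B B0 (d e))"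
    if e: "e \<in> E" "rk e < r" and p: "p \<in> cell_set B (d e)" for e p using e(1) p
  proof (cases rule: cell_space_cases)
    case boundary
    then have "\<Phi> e p \<in> Q \<union> (\<Union>e'\<in>{e' \<in> E. rk e' < rk e}. \<Phi> e' ` cell_int B B0 (d e'))"
      using less [OF e(2)] by simp
    then show ?thesis using e(2) by auto
  next
    case basepoint
    then show ?thesis by simp
  next
    case interior
    then show ?thesis using e by auto
  qed
  moreover have "cell_int B B0 n \<subseteq> topspace B \<times> cube n" for n using cube_int_subset by (auto simp: cell_int_def)
  ultimately show ?case unfolding topspace_stage by (fastforce simp: image_subset_iff)
qed

lemma total_stage: "x \<in> topspace total \<Longrightarrow> \<exists>r. x \<in> topspace (stage r)"
  unfolding topspace_total topspace_stage by blast

lemma stage_subset_total: "topspace (stage r) \<subseteq> topspace total" unfolding topspace_total topspace_stage by blast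

lemma stage_mono: "r \<le> s \<Longrightarrow> topspace (stage r) \<subseteq> topspace (stage s)"
  unfolding topspace_stage by (fastforce intro: order_less_le_trans)

lemma total_points: "topspace total = Q \<union> (\<Union>e\<in>E. \<Phi> e ` cell_int B B0 (d e))"
proof
  show "topspace total \<subseteq> Q \<union> (\<Union>e\<in>E. \<Phi> e ` cell_int B B0 (d e))"
    using total_stage stage_points by blast
  have "cell_int B B0 n \<subseteq> topspace B \<times> cube n" for n using cube_int_subset by (auto simp: cell_int_def)
  then show "Q \<union> (\<Union>e\<in>E. \<Phi> e ` cell_int B B0 (d e)) \<subseteq> topspace total"
    unfolding topspace_total by blast
qed

text \<open>Open cells are disjoint from each other and from \<open>Q\<close>, so a stage contains
  all or nothing of an open cell. Later arguments read off ranks and dimensions of cells from points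
  in this way.\<close>

lemma cell_int_rank:
  assumes "e \<in> E" "p \<in> cell_int B B0 (d e)"
  shows "\<Phi> e p \<in> topspace (stage r) \<longleftrightarrow> rk e < r"
proof
  assume "\<Phi> e p \<in> topspace (stage r)"
  then obtain e' p' where "e' \<in> E" "rk e' < r" "p' \<in> cell_int B B0 (d e')" "\<Phi> e p = \<Phi> e' p'"
    using cell_new [OF assms] unfolding stage_points by blast
  then show "rk e < r" using cells_disjoint assms by blast
next
  assume "rk e < r"
  then show "\<Phi> e p \<in> topspace (stage r)" using assms unfolding stage_points by blast
qed

lemma openin_stage_mono:
  assumes "openin (stage s) U" "r \<le> s"
  shows "openin (stage r) (U \<inter> topspace (stage r))" unfolding openin_stage
proof (intro conjI ballI impI)
  fix e assume e: "e \<in> E" "rk e < r"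
  have "cell_preimage B (d e) (\<Phi> e) (U \<inter> topspace (stage r)) =
      cell_preimage B (d e) (\<Phi> e) U" using e by (auto simp: topspace_stage)
  then show "openin (cell_space B (d e)) (cell_preimage B (d e) (\<Phi> e) (U \<inter> topspace (stage r)))"
    using assms e by (simp add: openin_stage)
qed simp

lemma openin_total_stage:
  assumes "openin total U"
  shows "openin (stage r) (U \<inter> topspace (stage r))" unfolding openin_stage
proof (intro conjI ballI impI)
  fix e assume e: "e \<in> E" "rk e < r"
  have "cell_preimage B (d e) (\<Phi> e) (U \<inter> topspace (stage r)) =
      cell_preimage B (d e) (\<Phi> e) U" using e by (auto simp: topspace_stage)
  then show "openin (cell_space B (d e)) (cell_preimage B (d e) (\<Phi> e) (U \<inter> topspace (stage r)))"
    using assms e by (simp add: openin_total)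
qed simp

lemma continuous_map_stage_mono: "r \<le> s \<Longrightarrow> continuous_map (stage r) (stage s) id"
  unfolding continuous_map_def using stage_mono openin_stage_mono by (fastforce simp: Int_def conj_commute)

lemma continuous_map_stage_total: "continuous_map (stage r) total id" unfolding continuous_map_def
using stage_subset_total openin_total_stage by (fastforce simp: Int_def conj_commute)

lemma topspace_stage_1: "topspace (stage (Suc 0)) = Q" using rk_pos by (fastforce simp: topspace_stage)

lemma attaches_stage:
  "attaches B B0 fl (stage (Suc n)) x0 (stage (Suc (Suc n))) id {e \<in> E. rk e = Suc n} d \<Phi>"
proof
  show "x0 \<in> topspace (stage (Suc n))" if "B0 \<noteq> {} \<or> fl" using base [OF that] by (simp add: topspace_stage)
  show "topspace (stage (Suc (Suc n))) = id ` topspace (stage (Suc n)) \<union>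
      (\<Union>e\<in>{e \<in> E. rk e = Suc n}. \<Phi> e ` cell_int B B0 (d e))" unfolding stage_points by (auto simp: less_Suc_eq)
  fix U assume U: "U \<subseteq> topspace (stage (Suc (Suc n)))"
  have eq: "{p \<in> cell_set B (d e). \<Phi> e p \<in> preim (stage (Suc n)) id U} =
      cell_preimage B (d e) (\<Phi> e) U" if "e \<in> E" "rk e < Suc n" for e using that by (auto simp: topspace_stage)
  show "openin (stage (Suc (Suc n))) U = (openin (stage (Suc n)) (preim (stage (Suc n)) id U) \<and>
      (\<forall>e\<in>{e \<in> E. rk e = Suc n}. openin (cell_space B (d e)) (cell_preimage B (d e) (\<Phi> e) U)))"
    unfolding openin_stage [of "Suc n"] openin_stage [of "Suc (Suc n)"] using U eq by (auto simp: less_Suc_eq)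
next
  fix e assume "e \<in> {e \<in> E. rk e = Suc n}"
  then show "\<exists>g. continuous_map (cell_bd_space B (d e)) (stage (Suc n)) g \<and>
         (\<forall>p\<in>cell_bd_set B (d e). \<Phi> e p = id (g p))" using bd_stage [of e] by (intro exI [of _ "\<Phi> e"]) auto
next
  fix e p z assume "e \<in> {e \<in> E. rk e = Suc n}" "p \<in> cell_int B B0 (d e)" "z \<in> topspace (stage (Suc n))"
  then show "\<Phi> e p \<noteq> id z" using cell_int_rank [of e p "Suc n"] by auto
qed (use inj_cell cells_disjoint B0 J in auto)

lemma is_seq_colimit_stage: "is_seq_colimit (\<lambda>n. stage (Suc n)) (\<lambda>_. id) total (\<lambda>_. id)"
proof (subst is_seq_colimit_iff)
  show "continuous_map (stage (Suc n)) (stage (Suc (Suc n))) id" for n by (rule continuous_map_stage_mono) simp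
  have "openin total U \<longleftrightarrow> (\<forall>n. openin (stage (Suc n)) (preim (stage (Suc n)) id U))"
    if U: "U \<subseteq> topspace total" for U
  proof
    assume "openin total U"
    then show "\<forall>n. openin (stage (Suc n)) (preim (stage (Suc n)) id U)"
      using openin_total_stage [of U] by (simp add: Int_def conj_commute)
  next
    assume R: "\<forall>n. openin (stage (Suc n)) (preim (stage (Suc n)) id U)"
    show "openin total U" unfolding openin_total
    proof (intro conjI ballI U)
      fix e assume e: "e \<in> E"
      have "openin (cell_space B (d e)) {p \<in> cell_set B (d e). \<Phi> e p \<in> preim (stage (Suc (rk e))) id U}"
        using spec [OF R, of "rk e"] e by (simp add: openin_stage)
      moreover have "{p \<in> cell_set B (d e). \<Phi> e p \<in> preim (stage (Suc (rk e))) id U} =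
          cell_preimage B (d e) (\<Phi> e) U" using e by (auto simp: topspace_stage)
      ultimately show "openin (cell_space B (d e)) (cell_preimage B (d e) (\<Phi> e) U)" by simp
    qed
  qed
  moreover have "topspace total = (\<Union>n. id ` topspace (stage (Suc n)))"
  proof
    show "topspace total \<subseteq> (\<Union>n. id ` topspace (stage (Suc n)))"
    proof
      fix x assume "x \<in> topspace total"
      then obtain r where "x \<in> topspace (stage r)" using total_stage by blast
      then have "x \<in> topspace (stage (Suc r))" using stage_mono [of r "Suc r"] by auto
      then show "x \<in> (\<Union>n. id ` topspace (stage (Suc n)))" by auto
    qed
  qed (use stage_subset_total in auto)
  ultimately show "(\<forall>n. inj_on id (topspace (stage (Suc n)))) \<and>
    (\<forall>n. \<forall>s\<in>topspace (stage (Suc n)). id (id s) = id s) \<and>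
    topspace total = (\<Union>n. id ` topspace (stage (Suc n))) \<and>
    (\<forall>U\<subseteq>topspace total. openin total U = (\<forall>n. openin (stage (Suc n)) (preim (stage (Suc n)) id U)))" by auto
qed auto

end

abbreviation "pointed_cells A x0 \<equiv> cell_complex (underlying A) {basept A} True {x0} x0"

lemma final_top_reindex:
  assumes k: "k ` E' = E" and eq: "\<And>e. e \<in> E' \<Longrightarrow> P' e = P (k e)" "\<And>e. e \<in> E' \<Longrightarrow> q' e = q (k e)"
  shows "final_top Q E P q = final_top Q E' P' q'" unfolding topology_eq openin_final_top k [symmetric] using eq by simp

lemma cell_complex_reindex:
  assumes "cell_complex B B0 fl Q x0 E d \<Phi> rk" and k: "bij_betw k E' E"
  shows "cell_complex B B0 fl Q x0 E' (d \<circ> k) (\<Phi> \<circ> k) (rk \<circ> k)"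
proof -
  interpret cell_complex B B0 fl Q x0 E d \<Phi> rk by fact
  have kE: "\<And>e. e \<in> E' \<Longrightarrow> k e \<in> E" and inj: "inj_on k E'" and im: "k ` E' = E"
    using k by (auto simp: bij_betw_def)
  show ?thesis
  proof
    fix e assume e: "e \<in> E'"
    have "k ` {e' \<in> E'. rk (k e') < rk (k e)} = {e' \<in> E. rk e' < rk (k e)}" using im by auto
    then have "cells_top B Q {e' \<in> E. rk e' < rk (k e)} d \<Phi> =
        cells_top B Q {e' \<in> E'. (rk \<circ> k) e' < (rk \<circ> k) e} (d \<circ> k) (\<Phi> \<circ> k)"
      by (intro final_top_reindex) auto
    then show "continuous_map (cell_bd_space B ((d \<circ> k) e))
        (cells_top B Q {e' \<in> E'. (rk \<circ> k) e' < (rk \<circ> k) e} (d \<circ> k) (\<Phi> \<circ> k)) ((\<Phi> \<circ> k) e)"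
      using bd [OF kE [OF e]] by simp
    show "e = e'" if "e' \<in> E'" "p \<in> cell_int B B0 ((d \<circ> k) e)" "p' \<in> cell_int B B0 ((d \<circ> k) e')"
       "(\<Phi> \<circ> k) e p = (\<Phi> \<circ> k) e' p'" for e' p p'
      using cells_disjoint [OF kE kE, of e e' p p'] that e inj by (auto simp: inj_on_def)
  qed (use Q base kE rk_pos inj_cell cell_new B0 J in auto)
qed

text \<open>The definitions ask for indices of the type of the points of the space. Over a fixed
  \<open>b\<close> outside \<open>B0\<close> the centre of each cell is a point of its own, which
  gives an injection of the cells into the points.\<close>

lemma cell_complex_index_by_points:
  fixes \<Phi> :: "'e \<Rightarrow> 'b \<times> coords \<Rightarrow> 'x"
  assumes cc: "cell_complex B B0 fl Q x0 E d \<Phi> rk" and b: "b \<in> topspace B - B0"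
  obtains E' :: "'x set" and k where "bij_betw k E' E"
    "cell_complex B B0 fl Q x0 E' (d \<circ> k) (\<Phi> \<circ> k) (rk \<circ> k)"
    "cells_top B Q E d \<Phi> = cells_top B Q E' (d \<circ> k) (\<Phi> \<circ> k)"
proof -
  interpret cell_complex B B0 fl Q x0 E d \<Phi> rk by fact
  define m where "m = (\<lambda>e. \<Phi> e (b, \<lambda>i. if i < d e then 1/2 else 0))"
  have c: "(b, \<lambda>i. if i < n then 1/2 else 0) \<in> cell_int B B0 n" for n
    using b cube_int_nonempty [of n] by (simp add: cell_int_def)
  have "inj_on m E" using cells_disjoint c unfolding m_def by (intro inj_onI) blast
  then have "bij_betw m E (m ` E)" by (rule inj_on_imp_bij_betw)
  then have k: "bij_betw (inv_into E m) (m ` E) E" by (rule bij_betw_inv_into)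
  show thesis by (rule that [OF k cell_complex_reindex [OF cc k]])
       (rule final_top_reindex, use k in \<open>auto simp: bij_betw_def\<close>)
qed

text \<open>If the whole core lies in \<open>B0\<close>, every cell is mapped to the base point and
  imposes no condition on open sets, so all cells can be discarded. This is the case in which cells
  cannot be indexed by points.\<close>

lemma cell_complex_trivial:
  assumes cc: "cell_complex B B0 fl Q x0 E d \<Phi> rk" and B: "topspace B \<subseteq> B0" "topspace B \<noteq> {}"
  shows "cell_complex B B0 fl Q x0 {} d' \<Phi>' rk'" and "cells_top B Q E d \<Phi> = cells_top B Q {} d' \<Phi>'"
proof -
  interpret cell_complex B B0 fl Q x0 E d \<Phi> rk by fact
  show "cell_complex B B0 fl Q x0 {} d' \<Phi>' rk'" by standard (use Q base in auto)
  have "B0 \<noteq> {}" using B by (metis subset_empty)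
  then have x0: "x0 \<in> Q" using base by simp
  have c: "\<Phi> e p = x0" if "e \<in> E" "p \<in> cell_set B (d e)" for e p using B0 [OF that(1), of "fst p" "snd p"] B that by auto
  have "openin (cell_space B (d e)) (cell_preimage B (d e) (\<Phi> e) U)" if e: "e \<in> E" for e U
  proof (cases "x0 \<in> U")
    case True
    then have "cell_preimage B (d e) (\<Phi> e) U = cell_set B (d e)" using c [OF e] by auto
    then show ?thesis by (simp only: openin_topspace)
  next
    case False
    then have "cell_preimage B (d e) (\<Phi> e) U = {}" using c [OF e] by auto
    then show ?thesis by (simp only: openin_empty)
  qed
  moreover have "Q \<union> (\<Union>e\<in>E. \<Phi> e ` cell_set B (d e)) = Q" using c x0 by auto
  ultimately show "cells_top B Q E d \<Phi> = cells_top B Q {} d' \<Phi>'" unfolding topology_eq openin_final_top by simp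
qed

section \<open>From filtrations to cells of the colimit\<close>

locale attaching_sequence =
  fixes B :: "'b topology" and B0 :: "'b set" and fl :: bool
    and F :: "nat \<Rightarrow> 's topology" and z :: "nat \<Rightarrow> 's" and j c and X :: "'x topology" and x0 :: 'x
    and J :: "nat \<Rightarrow> 'e set" and d \<Phi>
  assumes at: "attaches B B0 fl (F n) (z n) (F (Suc n)) (j n) (J n) (d n) (\<Phi> n)" and F0: "topspace (F 0) \<subseteq> {z 0}"
    and jz: "B0 \<noteq> {} \<or> fl \<Longrightarrow> j n (z n) = z (Suc n)"
    and c0: "z 0 \<in> topspace (F 0) \<Longrightarrow> c 0 (z 0) = x0" and colim: "is_seq_colimit F j X c"
begin

definition "cells = Sigma UNIV J"
definition "cell_dim e = d (fst e) (snd e)"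
definition "cell_char e = c (Suc (fst e)) \<circ> \<Phi> (fst e) (snd e)"
definition "cell_rank e = Suc (fst e)"

lemma colimit_facts:
  shows inj_c: "inj_on (c n) (topspace (F n))" and compat: "s \<in> topspace (F n) \<Longrightarrow> c (Suc n) (j n s) = c n s"
    and top_X: "topspace X = (\<Union>n. c n ` topspace (F n))"
    and open_X: "U \<subseteq> topspace X \<Longrightarrow> openin X U \<longleftrightarrow> (\<forall>n. openin (F n) (preim (F n) (c n) U))"
proof -
  have "inj_on (j n) (topspace (F n))" for n by (rule attaches.inj_f [OF at])
  moreover have "continuous_map (F n) (F (Suc n)) (j n)" for n by (rule attaches.continuous_map_f [OF at])
  ultimately have *: "(\<forall>n. inj_on (c n) (topspace (F n))) \<and> (\<forall>n. \<forall>s\<in>topspace (F n). c (Suc n) (j n s) = c n s) \<and>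
    topspace X = (\<Union>n. c n ` topspace (F n)) \<and>
    (\<forall>U\<subseteq>topspace X. openin X U \<longleftrightarrow> (\<forall>n. openin (F n) (preim (F n) (c n) U)))"
    by (rule is_seq_colimit_iff [THEN iffD1, OF _ _ colim])
  show "inj_on (c n) (topspace (F n))" using * [THEN conjunct1] by (rule spec)
  show "s \<in> topspace (F n) \<Longrightarrow> c (Suc n) (j n s) = c n s" using * [THEN conjunct2, THEN conjunct1] by blast
  show "topspace X = (\<Union>n. c n ` topspace (F n))" by (rule * [THEN conjunct2, THEN conjunct2, THEN conjunct1])
  show "U \<subseteq> topspace X \<Longrightarrow> openin X U \<longleftrightarrow> (\<forall>n. openin (F n) (preim (F n) (c n) U))"
    by (rule * [THEN conjunct2, THEN conjunct2, THEN conjunct2, rule_format])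
qed

lemma jF: "s \<in> topspace (F n) \<Longrightarrow> j n s \<in> topspace (F (Suc n))" using attaches.points [OF at] by blast

lemma cF_mono: "n \<le> m \<Longrightarrow> c n ` topspace (F n) \<subseteq> c m ` topspace (F m)"
proof (induction m rule: dec_induct)
  case (step m)
  have "c m ` topspace (F m) \<subseteq> c (Suc m) ` topspace (F (Suc m))" using compat jF by (metis image_eqI image_subsetI)
  then show ?case using step by blast
qed simp

text \<open>The open cells of \<open>F (Suc n)\<close> are disjoint from the image of
  \<open>F n\<close>, and \<open>c (Suc n)\<close> is injective, so their points are new in the
  colimit as well.\<close>

lemma cell_not_in_stage:
  assumes "e \<in> J n" "p \<in> cell_int B B0 (d n e)" "m \<le> n" "s \<in> topspace (F m)"
  shows "c (Suc n) (\<Phi> n e p) \<noteq> c m s"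
proof
  assume eq: "c (Suc n) (\<Phi> n e p) = c m s"
  have "c m s \<in> c n ` topspace (F n)" using cF_mono [OF assms(3)] assms(4) by blast
  then obtain t where t: "t \<in> topspace (F n)" "c (Suc n) (\<Phi> n e p) = c (Suc n) (j n t)" using eq compat by auto
  have "\<Phi> n e p \<in> topspace (F (Suc n))" using attaches.points [OF at, of n] assms(1,2) by blast
  then have "\<Phi> n e p = j n t" using inj_onD [OF inj_c t(2)] jF [OF t(1)] by blast
  then show False using attaches.cell_new [OF at assms(1,2) t(1)] by blast
qed

abbreviation "Stg n \<equiv> cells_top B (c 0 ` topspace (F 0)) {e \<in> cells. cell_rank e < Suc n}
  cell_dim cell_char"

text \<open>Induction on \<open>n\<close>: openness in \<open>F (Suc n)\<close> is openness in
  \<open>F n\<close> together with one condition for each new cell, and these conditions add up to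
  the final topology of all cells attached so far. The image of each stage in the colimit is thus
  itself presented by cells.\<close>

lemma stage_iff:
  shows "topspace (Stg n) = c n ` topspace (F n)"
    and "U \<subseteq> c n ` topspace (F n) \<Longrightarrow> openin (Stg n) U \<longleftrightarrow> openin (F n) (preim (F n) (c n) U)"
proof (induction n arbitrary: U)
  case 0
  have e: "{e \<in> cells. cell_rank e < Suc 0} = {}" by (auto simp: cell_rank_def)
  {
    case 1
    show ?case unfolding e by simp
  next
    case 2
    \<comment> \<open>\<open>F 0\<close> has at most one point, so a preimage is empty or
      everything.\<close>
    have "preim (F 0) (c 0) U = {} \<or> preim (F 0) (c 0) U = topspace (F 0)" using F0 by auto
    then have "openin (F 0) (preim (F 0) (c 0) U)" by (metis openin_empty openin_topspace)
    then show ?case using 2 unfolding e openin_final_top by simp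
  }
next
  case (Suc n)
  interpret a: attaches B B0 fl "F n" "z n" "F (Suc n)" "j n" "J n" "d n" "\<Phi> n" by (rule at)
  have cells_Suc: "{e \<in> cells. cell_rank e < Suc (Suc n)} = {e \<in> cells. cell_rank e < Suc n} \<union> Pair n ` J n"
    by (auto simp: cells_def cell_rank_def less_Suc_eq)
  have cc: "cell_char (n, e) = c (Suc n) \<circ> \<Phi> n e" "cell_dim (n, e) = d n e" for e
    by (auto simp: cell_char_def cell_dim_def)
  have top_Suc: "topspace (Stg (Suc n)) = c n ` topspace (F n) \<union> (\<Union>e\<in>J n. c (Suc n) ` \<Phi> n e ` (topspace B \<times> cube (d n e)))"
  proof -
    have "topspace (Stg (Suc n)) = topspace (Stg n) \<union> (\<Union>e\<in>Pair n ` J n. cell_char e ` cell_set B (cell_dim e))"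
      unfolding topspace_final_top cells_Suc by (simp only: UN_Un Un_assoc)
    then show ?thesis unfolding Suc(1) by (simp add: cc image_comp)
  qed
  have jn: "c n ` topspace (F n) = c (Suc n) ` j n ` topspace (F n)" using compat by (auto simp: image_image)
  have top: "topspace (Stg (Suc n)) = c (Suc n) ` topspace (F (Suc n))"
    proof
      show "topspace (Stg (Suc n)) \<subseteq> c (Suc n) ` topspace (F (Suc n))" unfolding top_Suc jn using a.cell_image jF by auto
      have "cell_int B B0 k \<subseteq> topspace B \<times> cube k" for k using cube_int_subset by (auto simp: cell_int_def)
      then show "c (Suc n) ` topspace (F (Suc n)) \<subseteq> topspace (Stg (Suc n))" unfolding top_Suc jn a.points by blast
    qed
  {
    case 1
    show ?case by (rule top)
  next
    case 2
    note UF = this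
    let ?U' = "preim (F (Suc n)) (c (Suc n)) U"
    have U': "?U' \<subseteq> topspace (F (Suc n))" by blast
    have 1: "preim (F n) (j n) ?U' = {s \<in> topspace (F n). c n s \<in> U \<inter> topspace (Stg n)}" using compat jF Suc(1) by auto
    have 2: "{p \<in> cell_set B (d n e). \<Phi> n e p \<in> ?U'} =
        {p \<in> topspace (cell_space B (cell_dim (n, e))). cell_char (n, e) p \<in> U}" if "e \<in> J n" for e
      using a.cell_image [OF that] by (auto simp: cc)
    have 3: "openin (F n) {s \<in> topspace (F n). c n s \<in> U \<inter> topspace (Stg n)} \<longleftrightarrow> openin (Stg n) (U \<inter> topspace (Stg n))"
      using Suc(2) [of "U \<inter> topspace (Stg n)"] Suc(1) by blast
    have 4: "cell_preimage B (cell_dim e) (cell_char e) (U \<inter> topspace (Stg n)) =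
        cell_preimage B (cell_dim e) (cell_char e) U" if "e \<in> cells" "cell_rank e < Suc n" for e
    proof -
      have "cell_char e ` cell_set B (cell_dim e) \<subseteq> topspace (Stg n)" unfolding topspace_final_top using that by blast
      then show ?thesis by blast
    qed
    have "openin (Stg n) (U \<inter> topspace (Stg n)) \<longleftrightarrow> (\<forall>e\<in>{e \<in> cells. cell_rank e < Suc n}.
        openin (cell_space B (cell_dim e)) (cell_preimage B (cell_dim e) (cell_char e) U))" unfolding openin_final_top using 4 by simp
    moreover have "openin (Stg (Suc n)) U \<longleftrightarrow> (\<forall>e\<in>{e \<in> cells. cell_rank e < Suc n} \<union> Pair n ` J n.
        openin (cell_space B (cell_dim e)) (cell_preimage B (cell_dim e) (cell_char e) U))"
      using UF top unfolding openin_final_top cells_Suc [symmetric] topspace_final_top by simp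
    ultimately show ?case unfolding a.open_iff [OF U'] 1 3 using 2 by (simp add: ball_Un cc)
  }
qed

lemma continuous_map_c_stage:
  "continuous_map (F n) (Stg n) (c n)"
  unfolding continuous_map_def
proof (intro conjI allI impI)
  fix U assume U: "openin (Stg n) U"
  then have "U \<subseteq> c n ` topspace (F n)" using openin_subset stage_iff(1) [of n] by blast
  then show "openin (F n) (preim (F n) (c n) U)" using stage_iff(2) U by blast
qed (use stage_iff(1) [of n] in blast)

lemma cz: "B0 \<noteq> {} \<or> fl \<Longrightarrow> c n (z n) = x0"
proof (induction n)
  case 0
  then show ?case using c0 attaches.base [OF at 0] by simp
next
  case (Suc n)
  have "c (Suc n) (j n (z n)) = c n (z n)" using compat attaches.base [OF at Suc.prems] by blast
  then show ?case using Suc jz by simp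
qed

text \<open>A cell of rank above \<open>N\<close> would contribute its centre over \<open>b\<close>
  as a point of \<open>X\<close> outside the stage \<open>N\<close>. This is where finite dimension
  enters: it bounds the ranks.\<close>

lemma cell_rank_le:
  assumes b: "b \<in> topspace B - B0" and N: "topspace X = c N ` topspace (F N)" and e: "e \<in> cells"
  shows "cell_rank e \<le> N"
proof (rule ccontr)
  assume "\<not> cell_rank e \<le> N"
  then have n: "N \<le> fst e" by (simp add: cell_rank_def)
  have eJ: "snd e \<in> J (fst e)" using e by (auto simp: cells_def)
  let ?p = "(b, \<lambda>i. if i < d (fst e) (snd e) then 1/2 else 0)"
  have p: "?p \<in> cell_int B B0 (d (fst e) (snd e))" using b cube_int_nonempty by (simp add: cell_int_def)
  have "c (Suc (fst e)) (\<Phi> (fst e) (snd e) ?p) \<in> topspace X"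
    unfolding top_X using attaches.points [OF at, of "fst e"] eJ p by blast
  then show False using cell_not_in_stage [OF eJ p n] N by blast
qed

lemma cell_complex: "cell_complex B B0 fl (c 0 ` topspace (F 0)) x0 cells cell_dim cell_char cell_rank"
proof
  show "c 0 ` topspace (F 0) \<subseteq> {x0}" using F0 c0 by auto
  show "x0 \<in> c 0 ` topspace (F 0)" if "B0 \<noteq> {} \<or> fl" using attaches.base [OF at that] c0 by force
  have c: "cell_char (n, e) p = c (Suc n) (\<Phi> n e p)" "cell_dim (n, e) = d n e" "cell_rank (n, e) = Suc n" for n e p
    by (auto simp: cell_char_def cell_dim_def cell_rank_def)
  have \<Phi>F: "\<Phi> n e p \<in> topspace (F (Suc n))" if "e \<in> J n" "p \<in> cell_int B B0 (d n e)" for n e p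
    using attaches.points [OF at, of n] that by blast
  fix e assume "e \<in> cells"
  then obtain n a where e: "e = (n, a)" "a \<in> J n" by (auto simp: cells_def)
  interpret a: attaches B B0 fl "F n" "z n" "F (Suc n)" "j n" "J n" "d n" "\<Phi> n" by (rule at)
  show "0 < cell_rank e" by (simp add: cell_rank_def)
  show "inj_on (cell_char e) (cell_int B B0 (cell_dim e))"
    using a.inj_cell [OF e(2)] inj_onD [OF inj_c [of "Suc n"]] \<Phi>F [OF e(2)] unfolding e(1) inj_on_def c by blast
  show "cell_char e p \<notin> c 0 ` topspace (F 0)" if "p \<in> cell_int B B0 (cell_dim e)" for p
    using cell_not_in_stage [OF e(2) _ le0] that unfolding e(1) c by blast
  show "continuous_map (cell_bd_space B (cell_dim e)) (cells_top B (c 0 ` topspace (F 0)) {e' \<in> cells. cell_rank e' < cell_rank e}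
      cell_dim cell_char) (cell_char e)"
  proof -
    obtain g where g: "continuous_map (cell_bd_space B (d n a)) (F n) g"
      "\<And>p. p \<in> cell_bd_set B (d n a) \<Longrightarrow> \<Phi> n a p = j n (g p)" using a.bd [OF e(2)] by blast
    have "continuous_map (cell_bd_space B (cell_dim e)) (cells_top B (c 0 ` topspace (F 0)) {e' \<in> cells. cell_rank e' < cell_rank e}
      cell_dim cell_char) (c n \<circ> g)" unfolding e(1) c by (rule continuous_map_compose [OF g(1) continuous_map_c_stage])
    then show ?thesis
    proof (rule continuous_map_eq)
      fix p assume "p \<in> cell_bd_set B (cell_dim e)"
      then have p: "p \<in> cell_bd_set B (d n a)" by (simp add: e(1) c)
      then have "g p \<in> topspace (F n)" using g(1) by (auto simp: continuous_map_def)
      then show "(c n \<circ> g) p = cell_char e p" using compat g(2) [OF p] by (simp add: e(1) c)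
    qed
  qed
  show "cell_char e (b, u) = x0" if "b \<in> B0" "b \<in> topspace B" "u \<in> cube (cell_dim e)" for b u
    using a.B0 [OF e(2) that(1,2)] that compat cz a.base unfolding e(1) c by (metis emptyE)
  show "cell_char e (b, u) = x0" if "fl" "b \<in> topspace B" "u \<in> cube_J (cell_dim e)" for b u
    using a.J [OF that(1) e(2) that(2)] that compat cz a.base unfolding e(1) c by metis
  fix e' p p' assume "e' \<in> cells" and p: "p \<in> cell_int B B0 (cell_dim e)" "p' \<in> cell_int B B0 (cell_dim e')"
    and eq: "cell_char e p = cell_char e' p'"
  then obtain m a' where e': "e' = (m, a')" "a' \<in> J m" by (auto simp: cells_def)
  have p1: "p \<in> cell_int B B0 (d n a)" "p' \<in> cell_int B B0 (d m a')" and
    eq1: "c (Suc n) (\<Phi> n a p) = c (Suc m) (\<Phi> m a' p')" using p eq unfolding e(1) e'(1) c by auto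
  have "n = m"
  proof (rule linorder_cases [of n m])
    assume "n < m"
    then show ?thesis using cell_not_in_stage [OF e'(2) p1(2), of "Suc n"] \<Phi>F [OF e(2) p1(1)] eq1 by (metis Suc_leI)
  next
    assume "m < n"
    then show ?thesis using cell_not_in_stage [OF e(2) p1(1), of "Suc m"] \<Phi>F [OF e'(2) p1(2)] eq1 by (metis Suc_leI)
  qed
  then have "\<Phi> n a p = \<Phi> n a' p'"
    using inj_onD [OF inj_c eq1 [unfolded \<open>n = m\<close>]] \<Phi>F [OF e(2) p1(1)] \<Phi>F [OF e'(2) p1(2)] by simp
  then show "e = e'" using a.cells_disjoint [of a a' p p'] e e' p1 \<open>n = m\<close> by simp
qed

lemma total: "X = cells_top B (c 0 ` topspace (F 0)) cells cell_dim cell_char" (is "X = ?T")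
proof -
  have e: "e \<in> {e \<in> cells. cell_rank e < Suc (cell_rank e)}" if "e \<in> cells" for e using that by simp
  have top: "topspace ?T = topspace X"
  proof
    show "topspace ?T \<subseteq> topspace X"
    proof -
      have "cell_char e ` cell_set B (cell_dim e) \<subseteq> topspace X" if "e \<in> cells" for e
      proof -
        have "cell_char e ` cell_set B (cell_dim e) \<subseteq> c (cell_rank e) ` topspace (F (cell_rank e))"
          unfolding stage_iff(1) [of "cell_rank e", symmetric] topspace_final_top using e [OF that] by blast
        then show ?thesis unfolding top_X by blast
      qed
      then show ?thesis unfolding topspace_final_top using top_X by blast
    qed
    show "topspace X \<subseteq> topspace ?T"
    proof -
      have "topspace (Stg n) \<subseteq> topspace ?T" for n unfolding topspace_final_top by (intro Un_mono UN_mono) auto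
      then show ?thesis unfolding top_X stage_iff(1) by (rule UN_least)
    qed
  qed
  show ?thesis unfolding topology_eq
  proof
    fix U
    show "openin X U = openin ?T U"
    proof (cases "U \<subseteq> topspace X")
      case False
      then show ?thesis using openin_subset top by metis
    next
      case True
      have "openin (F n) (preim (F n) (c n) U) \<longleftrightarrow>
          (\<forall>e\<in>{e \<in> cells. cell_rank e < Suc n}. openin (cell_space B (cell_dim e)) (cell_preimage B (cell_dim e) (cell_char e) U))" for n
      proof -
        let ?S = "Stg n"
        have 1: "preim (F n) (c n) U = {s \<in> topspace (F n). c n s \<in> U \<inter> topspace ?S}"
          using stage_iff(1) [of n] by blast
        have 2: "openin (F n) {s \<in> topspace (F n). c n s \<in> U \<inter> topspace ?S} \<longleftrightarrow> openin ?S (U \<inter> topspace ?S)"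
          using stage_iff(2) [of "U \<inter> topspace ?S" n] stage_iff(1) [of n] by blast
        have "cell_preimage B (cell_dim e) (cell_char e) (U \<inter> topspace ?S) =
            cell_preimage B (cell_dim e) (cell_char e) U" if "e \<in> cells" "cell_rank e < Suc n" for e
        proof -
          have "cell_char e ` cell_set B (cell_dim e) \<subseteq> topspace ?S" unfolding topspace_final_top using that by blast
          then show ?thesis by blast
        qed
        then show ?thesis unfolding 1 2 openin_final_top by simp
      qed
      note open_F = this
      have "(\<forall>n. \<forall>e\<in>{e \<in> cells. cell_rank e < Suc n}. P e) \<longleftrightarrow> (\<forall>e\<in>cells. P e)" for P
        by blast
      then show ?thesis using True top unfolding open_X [OF True] open_F openin_final_top topspace_final_top by simp
    qed
  qed
qed

end

section \<open>Complexes with a pointed core as spaces presented by cells\<close>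

lemma generalized_CW_complex_cells:
  fixes A :: "'a pointed" and X :: "'x pointed"
  assumes A: "pointed_space A" and X: "generalized_CW_complex A X"
  obtains E :: "(nat \<times> bool \<times> 'x) set" and d \<Phi> rk
  where "pointed_cells A (basept X) E d \<Phi> rk"
    "underlying X = cells_top (underlying A) {basept X} E d \<Phi>"
proof -
  obtain F :: "nat \<Rightarrow> 'x pointed" and j c where F0: "is_point (F 0)"
    and F: "\<And>n. attach_mixed_cells A (F n) (F (Suc n)) (j n)" and c: "\<And>n. pointed_map (F n) X (c n)"
    and colim: "is_seq_colimit (\<lambda>n. underlying (F n)) j (underlying X) c"
    using X unfolding generalized_CW_complex_def by blast
  have "\<exists>(E :: (bool \<times> 'x) set) d \<Phi>. attaches_pointed A (F n) (F (Suc n)) (j n) E d \<Phi>" for n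
    using attaches_if_attach_mixed_cells [OF A F] by metis
  then obtain J :: "nat \<Rightarrow> (bool \<times> 'x) set" and d \<Phi> where at: "\<And>n. attaches_pointed A (F n) (F (Suc n)) (j n) (J n) (d n) (\<Phi> n)" by metis
  have top_F0: "pts (F 0) = {basept (F 0)}" using F0 by (simp add: is_point_def)
  interpret attaching_sequence "underlying A" "{basept A}" True "\<lambda>n. underlying (F n)" "\<lambda>n. basept (F n)" j c
    "underlying X" "basept X" J d \<Phi>
  proof (rule attaching_sequence.intro)
    show "pts (F 0) \<subseteq> {basept (F 0)}" using F0 by (simp add: is_point_def)
    show "j n (basept (F n)) = basept (F (Suc n))" for n using F [of n] by (simp add: attach_mixed_cells_def pointed_map_def)
    show "c 0 (basept (F 0)) = basept X" using c by (simp add: pointed_map_def)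
  qed (rule at, rule colim)
  have "c 0 ` pts (F 0) = {basept X}" using top_F0 c by (simp add: pointed_map_def)
  then show thesis using cell_complex total by (intro that [of cells cell_dim cell_char cell_rank]) auto
qed

lemma pointed_map_pointed_space: "pointed_map X Y f \<Longrightarrow> pointed_space X \<Longrightarrow> pointed_space Y"
  using continuous_map_image_subset_topspace unfolding pointed_map_def pointed_space_def by fastforce

lemma is_point_pointed_space: "is_point X \<Longrightarrow> pointed_space X" by (simp add: is_point_def pointed_space_def)

lemma finite_dim_CW_complex_cells:
  fixes B :: "'b pointed" and A :: "'a pointed"
  assumes B: "pointed_space B" and A: "finite_dim_CW_complex B A"
  obtains E :: "(nat \<times> 'a) set" and d \<Phi> rk N
  where "pointed_cells B (basept A) E d \<Phi> rk"
    "underlying A = cells_top (underlying B) {basept A} E d \<Phi>"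
    "\<And>e. e \<in> E \<Longrightarrow> rk e \<le> N"
proof -
  obtain F :: "nat \<Rightarrow> 'a pointed" and j c where S: "CW_structure B A F j c"
    and fd: "finite_dim_filtration (underlying A) (\<lambda>n. underlying (F n)) c"
    using A unfolding finite_dim_CW_complex_def by blast
  have F0: "is_point (F 0)" and F: "\<And>n. attach_cells B n (F n) (F (Suc n)) (j n)" and c: "\<And>n. pointed_map (F n) A (c n)"
    and colim: "is_seq_colimit (\<lambda>n. underlying (F n)) j (underlying A) c" using S unfolding CW_structure_def by auto
  have jp: "pointed_map (F n) (F (Suc n)) (j n)" for n using F [of n] by (simp add: attach_cells_def)
  have pF: "pointed_space (F n)" for n
  proof (induction n)
    case 0
    show ?case using F0 by (rule is_point_pointed_space)
  next
    case (Suc n)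
    then show ?case by (rule pointed_map_pointed_space [OF jp])
  qed
  have "\<exists>(E :: 'a set) \<Phi>. attaches_pointed B (F n) (F (Suc n)) (j n) E (\<lambda>_. n) \<Phi>" for n
    using attaches_if_attach_cells [OF B pF F] by metis
  then obtain J :: "nat \<Rightarrow> 'a set" and \<Phi> where at: "\<And>n. attaches_pointed B (F n) (F (Suc n)) (j n) (J n) (\<lambda>_. n) (\<Phi> n)" by metis
  have top_F0: "pts (F 0) = {basept (F 0)}" using F0 by (simp add: is_point_def)
  interpret attaching_sequence "underlying B" "{basept B}" True "\<lambda>n. underlying (F n)" "\<lambda>n. basept (F n)" j c
    "underlying A" "basept A" J "\<lambda>n _. n" \<Phi>
  proof (rule attaching_sequence.intro)
    show "pts (F 0) \<subseteq> {basept (F 0)}" using F0 by (simp add: is_point_def)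
    show "j n (basept (F n)) = basept (F (Suc n))" for n using jp [of n] by (simp add: pointed_map_def)
    show "c 0 (basept (F 0)) = basept A" using c by (simp add: pointed_map_def)
  qed (rule at, rule colim)
  have Q: "c 0 ` pts (F 0) = {basept A}" using top_F0 c by (simp add: pointed_map_def)
  obtain N where N: "homeomorphic_map (underlying (F N)) (underlying A) (c N)" using fd unfolding finite_dim_filtration_def by blast
  show thesis
  proof (cases "pts B \<subseteq> {basept B}")
    \<comment> \<open>Over a one-point core the cells leave no points in \<open>A\<close>, so the
      dimension says nothing about their ranks; they are discarded.\<close>
    case True
    have ne: "pts B \<noteq> {}" using B by (auto simp: pointed_space_def)
    show thesis by (rule that [OF cell_complex_trivial(1) [OF cell_complex [unfolded Q] True ne]
            trans [OF total [unfolded Q] cell_complex_trivial(2) [OF cell_complex [unfolded Q] True ne]]]) simp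
  next
    case False
    then obtain b where b: "b \<in> pts B - {basept B}" by blast
    have "cell_rank e \<le> N" if e: "e \<in> cells" for e
      using cell_rank_le [OF b _ e] N by (auto simp: homeomorphic_map_def quotient_map_def)
    then show thesis using cell_complex total unfolding Q by (intro that [of cells cell_dim cell_char cell_rank]) auto
  qed
qed

lemma generalized_CW_complex_if_cells:
  fixes B :: "'b pointed" and X :: "'x pointed" and E :: "'e set"
  assumes B: "pointed_space B" and cc: "pointed_cells B (basept X) E d \<Phi> rk"
    and X: "underlying X = cells_top (underlying B) {basept X} E d \<Phi>"
  shows "generalized_CW_complex B X"
proof -
  obtain E' :: "'x set" and d' \<Phi>' rk' where
    cc': "pointed_cells B (basept X) E' d' \<Phi>' rk'"
    and X': "underlying X = cells_top (underlying B) {basept X} E' d' \<Phi>'"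
  proof (cases "pts B \<subseteq> {basept B}")
    case True
    have ne: "pts B \<noteq> {}" using B by (auto simp: pointed_space_def)
    show thesis by (rule that [OF cell_complex_trivial(1) [OF cc True ne] trans [OF X cell_complex_trivial(2) [OF cc True ne]]])
  next
    case False
    then obtain b where b: "b \<in> pts B - {basept B}" by blast
    show thesis using cell_complex_index_by_points [OF cc b] that unfolding X by metis
  qed
  interpret cell_complex "underlying B" "{basept B}" True "{basept X}" "basept X" E' d' \<Phi>' rk' by (rule cc')
  have X: "underlying X = total" using X' by (simp add: total_def)
  define F where "F n = (stage (Suc n), basept X)" for n
  have "attach_mixed_cells B (F n) (F (Suc n)) id" for n
  proof (rule attach_mixed_cells_if_attaches [OF B])
    show "pointed_map (F n) (F (Suc n)) id"
      using continuous_map_stage_mono [of "Suc n" "Suc (Suc n)"] by (simp add: pointed_map_def F_def)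
    show "attaches_pointed B (F n) (F (Suc n)) id
        {e \<in> E'. rk' e = Suc n} d' \<Phi>'" using attaches_stage [of n] by (simp add: F_def)
  qed
  moreover have "is_point (F 0)" by (simp add: is_point_def F_def topspace_stage_1)
  moreover have "pointed_map (F n) X id" for n using continuous_map_stage_total X by (simp add: pointed_map_def F_def)
  moreover have "is_seq_colimit (\<lambda>n. underlying (F n)) (\<lambda>_. id) (underlying X) (\<lambda>_. id)"
    using is_seq_colimit_stage X by (simp add: F_def)
  ultimately show ?thesis unfolding generalized_CW_complex_def by (intro exI [of _ F] exI [of _ "\<lambda>_. id"] conjI allI) auto
qed

text \<open>When the rank is the dimension plus 1, each stage arises from the previous one by cells
  of a single dimension, which is what separates a complex from a generalized one.\<close>

lemma CW_complex_if_cells: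
  fixes B :: "'b pointed" and X :: "'x pointed" and E :: "'x set"
  assumes B: "pointed_space B" and cc: "pointed_cells B (basept X) E d \<Phi> (\<lambda>e. Suc (d e))"
    and X: "underlying X = cells_top (underlying B) {basept X} E d \<Phi>"
  shows "CW_complex B X"
proof -
  interpret cell_complex "underlying B" "{basept B}" True "{basept X}" "basept X" E d \<Phi> "\<lambda>e. Suc (d e)" by (rule cc)
  have X: "underlying X = total" using X by (simp add: total_def)
  define F where "F n = (stage (Suc n), basept X)" for n
  have "attach_cells B n (F n) (F (Suc n)) id" for n
  proof (rule attach_cells_if_attaches [OF B])
    show "pointed_map (F n) (F (Suc n)) id"
      using continuous_map_stage_mono [of "Suc n" "Suc (Suc n)"] by (simp add: pointed_map_def F_def)
    have "attaches_pointed B (F n) (F (Suc n)) id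
        {e \<in> E. Suc (d e) = Suc n} d \<Phi>" using attaches_stage [of n] by (simp add: F_def)
    then have "attaches_pointed B (F n) (F (Suc n)) id
        {e \<in> E. Suc (d e) = Suc n} (\<lambda>_. n) (\<Phi> \<circ> id)" by (rule attaches_reindex) auto
    then show "attaches_pointed B (F n) (F (Suc n)) id {e \<in> E. Suc (d e) = Suc n} (\<lambda>_. n) \<Phi>" by simp
  qed
  moreover have "is_point (F 0)" by (simp add: is_point_def F_def topspace_stage_1)
  moreover have "pointed_map (F n) X id" for n using continuous_map_stage_total X by (simp add: pointed_map_def F_def)
  moreover have "is_seq_colimit (\<lambda>n. underlying (F n)) (\<lambda>_. id) (underlying X) (\<lambda>_. id)"
    using is_seq_colimit_stage X by (simp add: F_def)
  ultimately show ?thesis unfolding CW_complex_def CW_structure_def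
    by (intro exI [of _ F] exI [of _ "\<lambda>_. id"] conjI allI) auto
qed

section \<open>Complexes over a complex\<close>

text \<open>\<open>(v, x) \<mapsto> (square_fst v x, square_snd v x)\<close> bends the edge \<open>v = 0\<close> of the unit square onto
  the two edges \<open>s = 0\<close> and \<open>t = 0\<close>, carries the other three edges into the edges \<open>s = 1\<close> and
  \<open>t = 1\<close>, and is bijective on the interior.\<close>

definition square_fst :: "real \<Rightarrow> real \<Rightarrow> real" where
  "square_fst v x = v + (1 - v) * max 0 (1 - 2 * x)"

definition square_snd :: "real \<Rightarrow> real \<Rightarrow> real" where
  "square_snd v x = v + (1 - v) * max 0 (2 * x - 1)"

lemma square_aux:
  fixes v m :: real
  assumes "0 \<le> v" "v \<le> 1" "0 \<le> m" "m \<le> 1"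
  shows "v \<le> v + (1 - v) * m" "v + (1 - v) * m \<le> 1"
    "v + (1 - v) * m = 1 \<longleftrightarrow> v = 1 \<or> m = 1" "v + (1 - v) * m = v \<longleftrightarrow> v = 1 \<or> m = 0"
proof -
  show "v \<le> v + (1 - v) * m" using assms by simp
  have e: "1 - (v + (1 - v) * m) = (1 - v) * (1 - m)" by (simp add: algebra_simps)
  have "0 \<le> 1 - (v + (1 - v) * m)" unfolding e using assms by simp
  then show "v + (1 - v) * m \<le> 1" by linarith
  show "v + (1 - v) * m = 1 \<longleftrightarrow> v = 1 \<or> m = 1"
    using e by (metis diff_add_cancel add_0 eq_iff_diff_eq_0 mult_eq_0_iff)
  show "v + (1 - v) * m = v \<longleftrightarrow> v = 1 \<or> m = 0" by simp
qed

lemma square_bounds: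
  assumes "0 \<le> v" "v \<le> 1" "0 \<le> x" "x \<le> 1"
  shows "0 \<le> square_fst v x" "square_fst v x \<le> 1" "0 \<le> square_snd v x" "square_snd v x \<le> 1"
  using square_aux [of v "max 0 (1 - 2 * x)"] square_aux [of v "max 0 (2 * x - 1)"] assms
  by (auto simp: square_fst_def square_snd_def)

lemma square_interior:
  assumes "0 \<le> v" "v \<le> 1" "0 \<le> x" "x \<le> 1"
  shows "0 < square_fst v x \<and> square_fst v x < 1 \<and> 0 < square_snd v x \<and> square_snd v x < 1 \<longleftrightarrow>
    0 < v \<and> v < 1 \<and> 0 < x \<and> x < 1"
proof -
  let ?p = "max 0 (1 - 2 * x)" and ?q = "max 0 (2 * x - 1)"
  have a: "square_fst v x = 1 \<longleftrightarrow> v = 1 \<or> x = 0"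
    using square_aux(3) [of v ?p] assms by (auto simp: square_fst_def)
  have b: "square_snd v x = 1 \<longleftrightarrow> v = 1 \<or> x = 1"
    using square_aux(3) [of v ?q] assms by (auto simp: square_snd_def)
  have c: "v \<le> square_fst v x" "v \<le> square_snd v x"
    using square_aux(1) [of v ?p] square_aux(1) [of v ?q] assms by (auto simp: square_fst_def square_snd_def)
  have d: "square_fst 0 x = 0 \<or> square_snd 0 x = 0" by (auto simp: square_fst_def square_snd_def)
  show ?thesis using d a b assms c square_bounds by (auto simp: order_less_le)
qed

text \<open>One of the two maxima is always 0, so \<open>v\<close> is the smaller of the two images;
  \<open>square_diff\<close> then determines \<open>x\<close> as long as
  \<open>v < 1\<close>.\<close>

lemma square_min:
  assumes "0 \<le> v" "v \<le> 1"
  shows "min (square_fst v x) (square_snd v x) = v"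
proof (cases "x \<le> 1 / 2")
  case True
  then have "square_snd v x = v" "v \<le> square_fst v x" using assms by (auto simp: square_fst_def square_snd_def)
  then show ?thesis by simp
next
  case False
  then have "square_fst v x = v" "v \<le> square_snd v x" using assms by (auto simp: square_fst_def square_snd_def)
  then show ?thesis by simp
qed

lemma square_diff: "square_fst v x - square_snd v x = (1 - v) * (1 - 2 * x)"
  by (simp add: square_fst_def square_snd_def max_def algebra_simps)

lemma square_inj:
  assumes "0 \<le> v" "v < 1" "0 \<le> v'" "v' < 1" and eq: "square_fst v x = square_fst v' x'" "square_snd v x = square_snd v' x'"
  shows "v = v'" "x = x'"
proof -
  show v: "v = v'" using square_min [of v x] square_min [of v' x'] assms by simp
  have "(1 - v) * (1 - 2 * x) = (1 - v) * (1 - 2 * x')" using square_diff [of v x] square_diff [of v' x'] eq v by metis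
  then have "1 - 2 * x = 1 - 2 * x'" using assms(2) by simp
  then show "x = x'" by simp
qed

lemma square_surj:
  assumes "0 \<le> s" "s \<le> 1" "0 \<le> t" "t \<le> 1"
  obtains v x where "0 \<le> v" "v \<le> 1" "0 \<le> x" "x \<le> 1" "square_fst v x = s" "square_snd v x = t"
proof (cases "s \<le> t")
  case True
  \<comment> \<open>The smaller coordinate must be \<open>v\<close>; \<open>r\<close> is the
    relative position of \<open>t\<close> between \<open>s\<close> and 1, and
    \<open>x = (1 + r) / 2\<close> solves \<open>2 * x - 1 = r\<close>. At the corner
    \<open>s = t = 1\<close> every \<open>x\<close> works.\<close>
  define r where "r = (if s = 1 then 1 else (t - s) / (1 - s))"
  have "0 \<le> r" "r \<le> 1" "(1 - s) * r = t - s" using True assms by (auto simp: r_def)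
  then show thesis using that [of s "(1 + r) / 2"] assms by (auto simp: square_fst_def square_snd_def field_simps)
next
  case False
  define r where "r = (s - t) / (1 - t)"
  have "0 \<le> r" "r \<le> 1" "(1 - t) * r = s - t" using False assms by (auto simp: r_def)
  then show thesis using that [of t "(1 - r) / 2"] assms by (auto simp: square_fst_def square_snd_def field_simps)
qed

text \<open>Both factors have one free face, at coordinate 0, and the product must again have only
  one. So the first two coordinates of \<open>u\<close> are folded by the square map into the
  coordinates 0 of the factors, which sends the face \<open>u 0 = 0\<close> onto the union of the
  two free faces; the other \<open>k - 1\<close> and \<open>d - 1\<close> coordinates are copied in
  order. If one factor is 0-dimensional there is nothing to fold.\<close>

definition cube_fst :: "nat \<Rightarrow> nat \<Rightarrow> coords \<Rightarrow> nat \<Rightarrow> real" where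
  "cube_fst k d u = (if k = 0 then (\<lambda>_. 0) else if d = 0 then u
     else (\<lambda>i. if i = 0 then square_fst (u 0) (u 1) else if i < k then u (Suc i) else 0))"

definition cube_snd :: "nat \<Rightarrow> nat \<Rightarrow> coords \<Rightarrow> nat \<Rightarrow> real" where
  "cube_snd k d u = (if d = 0 then (\<lambda>_. 0) else if k = 0 then u
     else (\<lambda>i. if i = 0 then square_snd (u 0) (u 1) else if i < d then u (k + i) else 0))"

lemma cube_fst_snd_in_cube:
  assumes "u \<in> cube (k + d)"
  shows "cube_fst k d u \<in> cube k" "cube_snd k d u \<in> cube d"
  using assms square_bounds [of "u 0" "u 1"] by (auto simp: cube_fst_def cube_snd_def cube_def)

lemma all_less_add:
  assumes "0 < k" "0 < d"
  shows "(\<forall>i<k + d. P i) \<longleftrightarrow> P 0 \<and> P (Suc 0) \<and> (\<forall>i. 0 < i \<and> i < k \<longrightarrow> P (Suc i)) \<and> (\<forall>i. 0 < i \<and> i < d \<longrightarrow> P (k + i))"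
    (is "?L \<longleftrightarrow> ?R")
proof
  assume R: ?R
  show ?L
  proof (intro allI impI)
    fix i assume i: "i < k + d"
    consider "i = 0" | "i = Suc 0" | m where "i = Suc m" "0 < m" "m < k" | m where "i = k + m" "0 < m" "m < d"
    proof (cases "i \<le> k")
      case True
      then show thesis using that by (cases i; cases "i - 1") auto
    next
      case False
      then show thesis using that(4) [of "i - k"] i by auto
    qed
    then show "P i" using R by cases auto
  qed
qed (use assms in auto)

lemma cube_int_fst_snd:
  assumes "u \<in> cube (k + d)"
  shows "u \<in> cube_int (k + d) \<longleftrightarrow> cube_fst k d u \<in> cube_int k \<and> cube_snd k d u \<in> cube_int d"
proof (cases "k = 0 \<or> d = 0")
  case True
  then show ?thesis using assms by (auto simp: cube_fst_def cube_snd_def)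
next
  case False
  then have kd: "0 < k" "0 < d" by auto
  have 01: "0 \<le> u 0" "u 0 \<le> 1" "0 \<le> u 1" "u 1 \<le> 1" using assms kd by (auto simp: cube_def)
  have "u \<in> cube_int (k + d) \<longleftrightarrow> (\<forall>i<k + d. 0 < u i \<and> u i < 1)"
    using assms by (auto simp: cube_int_def cube_def)
  also have "\<dots> \<longleftrightarrow> (0 < u 0 \<and> u 0 < 1 \<and> 0 < u 1 \<and> u 1 < 1) \<and> (\<forall>i. 0 < i \<and> i < k \<longrightarrow> 0 < u (Suc i) \<and> u (Suc i) < 1)
     \<and> (\<forall>i. 0 < i \<and> i < d \<longrightarrow> 0 < u (k + i) \<and> u (k + i) < 1)"
    unfolding all_less_add [OF kd] by auto
  also have "\<dots> \<longleftrightarrow> (\<forall>i<k. 0 < cube_fst k d u i \<and> cube_fst k d u i < 1) \<and> (\<forall>i<d. 0 < cube_snd k d u i \<and> cube_snd k d u i < 1)"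
    unfolding square_interior [OF 01, symmetric] using kd by (auto simp: cube_fst_def cube_snd_def)
  also have "\<dots> \<longleftrightarrow> cube_fst k d u \<in> cube_int k \<and> cube_snd k d u \<in> cube_int d"
    using cube_fst_snd_in_cube [OF assms] by (auto simp: cube_int_def cube_def)
  finally show ?thesis .
qed

lemma cube_bd_fst_snd:
  assumes "u \<in> cube_bd (k + d)"
  shows "cube_fst k d u \<in> cube_bd k \<or> cube_snd k d u \<in> cube_bd d"
  using assms cube_int_fst_snd [of u k d] cube_cases cube_fst_snd_in_cube cube_int_bd_disjoint cube_bd_subset by blast

text \<open>The edges \<open>u 0 = 1\<close>, \<open>u 1 = 0\<close> and \<open>u 1 = 1\<close> of
  the folded square go to points where coordinate 0 of one factor is 1, and the remaining faces are
  copied. Hence a composed cell sends all faces but its base to the base point.\<close>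

lemma cube_J_fst_snd:
  assumes "u \<in> cube_J (k + d)"
  shows "cube_fst k d u \<in> cube_J k \<or> cube_snd k d u \<in> cube_J d"
proof (cases "k = 0 \<or> d = 0")
  case True
  then show ?thesis using assms by (cases "d = 0"; cases "k = 0") (auto simp: cube_fst_def cube_snd_def)
next
  case False
  then have kd: "0 < k" "0 < d" by auto
  have u: "u \<in> cube (k + d)" using assms by (simp add: cube_J_def)
  obtain i where i: "i < k + d" "u i = 1 \<or> 0 < i \<and> u i = 0" using assms by (auto simp: cube_J_def)
  consider "i = 0" | "i = Suc 0" | m where "i = Suc m" "0 < m" "m < k" | m where "i = k + m" "0 < m" "m < d"
  proof (cases "i \<le> k")
    case True
    then show thesis using that by (cases i; cases "i - 1") auto
  next
    case False
    then show thesis using that(4) [of "i - k"] i by auto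
  qed
  then have "(\<exists>i<k. cube_fst k d u i = 1 \<or> 0 < i \<and> cube_fst k d u i = 0) \<or>
      (\<exists>i<d. cube_snd k d u i = 1 \<or> 0 < i \<and> cube_snd k d u i = 0)"
  proof cases
    case 1
    then have "cube_fst k d u 0 = 1" using i kd by (simp add: cube_fst_def square_fst_def)
    then show ?thesis using kd by auto
  next
    case 2
    then have "cube_fst k d u 0 = 1 \<or> cube_snd k d u 0 = 1"
      using i kd by (auto simp: cube_fst_def square_fst_def cube_snd_def square_snd_def)
    then show ?thesis using kd by auto
  next
    case (3 m)
    then have "cube_fst k d u m = u i" using kd by (simp add: cube_fst_def)
    then show ?thesis using 3 i by metis
  next
    case (4 m)
    then have "cube_snd k d u m = u i" by (simp add: cube_snd_def)
    then show ?thesis using 4 i by metis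
  qed
  then show ?thesis using cube_fst_snd_in_cube [OF u] by (simp add: cube_J_def)
qed

lemma cube_fst_snd_inj:
  assumes u: "u \<in> cube_int (k + d)" "u' \<in> cube_int (k + d)"
    and eq: "cube_fst k d u = cube_fst k d u'" "cube_snd k d u = cube_snd k d u'"
  shows "u = u'"
proof (cases "k = 0 \<or> d = 0")
  case True
  then show ?thesis using assms by (auto simp: cube_fst_def cube_snd_def split: if_splits)
next
  case False
  then have kd: "0 < k" "0 < d" by auto
  have r: "0 < u 0" "u 0 < 1" "0 < u' 0" "u' 0 < 1" using u kd by (auto simp: cube_int_def)
  have "square_fst (u 0) (u 1) = square_fst (u' 0) (u' 1)" "square_snd (u 0) (u 1) = square_snd (u' 0) (u' 1)"
    using fun_cong [OF eq(1), of 0] fun_cong [OF eq(2), of 0] kd by (auto simp: cube_fst_def cube_snd_def)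
  then have "u 0 = u' 0" "u 1 = u' 1" using square_inj [of "u 0" "u' 0" "u 1" "u' 1"] r by auto
  moreover have "u (Suc i) = u' (Suc i)" if "0 < i" "i < k" for i using fun_cong [OF eq(1), of i] that kd by (simp add: cube_fst_def)
  moreover have "u (k + i) = u' (k + i)" if "0 < i" "i < d" for i using fun_cong [OF eq(2), of i] that kd by (simp add: cube_snd_def)
  ultimately have "\<forall>i<k + d. u i = u' i" unfolding all_less_add [OF kd] by auto
  then have "u i = u' i" for i using u by (cases "i < k + d") (auto simp: cube_int_def)
  then show ?thesis by (simp add: fun_eq_iff)
qed

lemma cube_fst_snd_surj:
  assumes a: "a \<in> cube k" and b: "b \<in> cube d"
  obtains u where "u \<in> cube (k + d)" "cube_fst k d u = a" "cube_snd k d u = b"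
proof (cases "k = 0 \<or> d = 0")
  case True
  then show thesis
  proof
    assume k: "k = 0"
    have "a = (\<lambda>_. 0)" "d = 0 \<Longrightarrow> b = (\<lambda>_. 0)" using a b k by simp_all
    then show thesis by (intro that [of b]) (use k b in \<open>auto simp: cube_fst_def cube_snd_def\<close>)
  next
    assume d: "d = 0"
    have "b = (\<lambda>_. 0)" "k = 0 \<Longrightarrow> a = (\<lambda>_. 0)" using a b d by simp_all
    then show thesis by (intro that [of a]) (use d a in \<open>auto simp: cube_fst_def cube_snd_def\<close>)
  qed
next
  case False
  then have kd: "0 < k" "0 < d" by auto
  obtain v x where vx: "0 \<le> v" "v \<le> 1" "0 \<le> x" "x \<le> 1" "square_fst v x = a 0" "square_snd v x = b 0"
    using square_surj [of "a 0" "b 0"] a b kd by (auto simp: cube_def)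
  define u where "u = (\<lambda>i. if i = 0 then v else if i = 1 then x else if i \<le> k then a (i - 1) else b (i - k))"
  have u0: "u 0 = v" "u (Suc 0) = x" by (auto simp: u_def)
  have u1: "u (Suc i) = a i" if "0 < i" "i < k" for i using that by (simp add: u_def)
  have u2: "u (k + i) = b i" if "0 < i" for i using that kd by (auto simp: u_def)
  have "\<forall>i<k + d. 0 \<le> u i \<and> u i \<le> 1"
    unfolding all_less_add [OF kd] using vx a b by (auto simp: u0 u1 u2 cube_def)
  moreover have "u i = 0" if "i \<ge> k + d" for i using u2 [of "i - k"] that kd b by (auto simp: cube_def)
  ultimately have "u \<in> cube (k + d)" by (simp add: cube_def)
  moreover have "cube_fst k d u i = a i" for i using kd vx u0 u1 a by (auto simp: cube_fst_def cube_def)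
  moreover have "cube_snd k d u i = b i" for i using kd vx u0 u2 b by (auto simp: cube_snd_def cube_def)
  ultimately show thesis using that by (simp add: fun_eq_iff)
qed

lemma continuous_map_cube_fst_snd:
  shows "continuous_map (top_of_set (cube (k + d))) (top_of_set (cube k)) (cube_fst k d)"
    and "continuous_map (top_of_set (cube (k + d))) (top_of_set (cube d)) (cube_snd k d)"
proof -
  have c: "continuous_map (top_of_set (cube (k + d))) euclideanreal (\<lambda>u. square_fst (u 0) (u 1))"
    "continuous_map (top_of_set (cube (k + d))) euclideanreal (\<lambda>u. square_snd (u 0) (u 1))"
    unfolding square_fst_def square_snd_def continuous_map_iff_continuous
    by (intro continuous_intros continuous_on_subset [OF continuous_on_product_coordinates subset_UNIV])+
  have "continuous_map (top_of_set (cube (k + d))) euclideanreal (\<lambda>u. cube_fst k d u i)" for i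
    using c continuous_map_coordinate by (cases "k = 0"; cases "d = 0"; cases "i = 0"; cases "i < k") (simp_all add: cube_fst_def)
  then show "continuous_map (top_of_set (cube (k + d))) (top_of_set (cube k)) (cube_fst k d)"
    unfolding continuous_map_into_cube using cube_fst_snd_in_cube by auto
  have "continuous_map (top_of_set (cube (k + d))) euclideanreal (\<lambda>u. cube_snd k d u i)" for i
    using c continuous_map_coordinate by (cases "k = 0"; cases "d = 0"; cases "i = 0"; cases "i < d") (simp_all add: cube_snd_def)
  then show "continuous_map (top_of_set (cube (k + d))) (top_of_set (cube d)) (cube_snd k d)"
    unfolding continuous_map_into_cube using cube_fst_snd_in_cube by auto
qed

definition split_cell :: "nat \<Rightarrow> nat \<Rightarrow> 'b \<times> coords \<Rightarrow> ('b \<times> coords) \<times> coords" where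
  "split_cell k d p = ((fst p, cube_fst k d (snd p)), cube_snd k d (snd p))"

lemma continuous_map_split_cell:
  "continuous_map (cell_space B (k + d)) (prod_topology (cell_space B k) (top_of_set (cube d))) (split_cell k d)"
  unfolding split_cell_def continuous_map_pairwise o_def
  using continuous_map_compose [OF continuous_map_snd continuous_map_cube_fst_snd(1), of B k d]
    continuous_map_compose [OF continuous_map_snd continuous_map_cube_fst_snd(2), of B k d] by (simp add: continuous_map_fst o_def)

text \<open>The folding of cubes is a continuous surjection from a compact onto a Hausdorff space,
  hence proper. A proper map stays closed after taking the product with the identity of any space
  \<open>B\<close>, and a closed continuous surjection is a quotient map.\<close>

lemma quotient_map_split_cell:
  "quotient_map (cell_space B (k + d)) (prod_topology (cell_space B k) (top_of_set (cube d))) (split_cell k d)"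
proof -
  let ?C = "top_of_set (cube (k + d))" and ?D = "prod_topology (top_of_set (cube k)) (top_of_set (cube d))"
  let ?\<kappa> = "\<lambda>u. (cube_fst k d u, cube_snd k d u)"
  have \<kappa>: "continuous_map ?C ?D ?\<kappa>"
    by (simp only: continuous_map_pairwise o_def fst_conv snd_conv continuous_map_cube_fst_snd)
  have H: "Hausdorff_space ?D" by (intro Hausdorff_space_prod_topology [THEN iffD2] disjI2 conjI Hausdorff_space_cube)
  have "proper_map ?C ?D ?\<kappa>" by (rule continuous_imp_proper_map [OF compact_space_cube Hausdorff_imp_kc_space [OF H] \<kappa>])
  then have "proper_map (prod_topology B ?C) (prod_topology B ?D) (\<lambda>(x, y). (id x, ?\<kappa> y))"
    unfolding proper_map_prod using proper_map_id by blast
  then have cl: "closed_map (prod_topology B ?C) (prod_topology B ?D) (\<lambda>(x, y). (id x, ?\<kappa> y))"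
    by (rule proper_imp_closed_map)
  have "continuous_map (prod_topology B ?C) (prod_topology B ?D) (\<lambda>(x, y). (id x, ?\<kappa> y))"
    using continuous_map_compose [OF continuous_map_snd \<kappa>, of B]
    by (simp add: case_prod_unfold continuous_map_pairwise o_def continuous_map_fst)
  moreover have "(\<lambda>(x, y). (id x, ?\<kappa> y)) ` topspace (prod_topology B ?C) = topspace (prod_topology B ?D)"
  proof
    show "topspace (prod_topology B ?D) \<subseteq> (\<lambda>(x, y). (id x, ?\<kappa> y)) ` topspace (prod_topology B ?C)"
    proof
      fix z assume "z \<in> topspace (prod_topology B ?D)"
      then obtain b a a' where z: "z = (b, a, a')" "b \<in> topspace B" "a \<in> cube k" "a' \<in> cube d" by auto
      obtain u where "u \<in> cube (k + d)" "cube_fst k d u = a" "cube_snd k d u = a'" by (rule cube_fst_snd_surj [OF z(3,4)])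
      then show "z \<in> (\<lambda>(x, y). (id x, ?\<kappa> y)) ` topspace (prod_topology B ?C)"
        using z by (intro image_eqI [of _ _ "(b, u)"]) auto
    qed
  qed (use cube_fst_snd_in_cube in auto)
  ultimately have q: "quotient_map (prod_topology B ?C) (prod_topology B ?D) (\<lambda>(x, y). (id x, ?\<kappa> y))"
    using cl by (intro continuous_closed_imp_quotient_map)
  have "homeomorphic_maps (prod_topology B ?D) (prod_topology (cell_space B k) (top_of_set (cube d)))
      (\<lambda>(b, a, a'). ((b, a), a')) (\<lambda>((b, a), a'). (b, a, a'))" unfolding homeomorphic_maps_def
  proof (intro conjI)
    have "continuous_map (prod_topology B ?D) (top_of_set (cube k)) (fst \<circ> snd)"
      by (rule continuous_map_compose [OF continuous_map_snd continuous_map_fst])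
    moreover have "continuous_map (prod_topology B ?D) (top_of_set (cube d)) (snd \<circ> snd)"
      by (rule continuous_map_compose [OF continuous_map_snd continuous_map_snd])
    ultimately show "continuous_map (prod_topology B ?D) (prod_topology (cell_space B k) (top_of_set (cube d)))
        (\<lambda>(b, a, a'). ((b, a), a'))"
      by (simp only: case_prod_unfold continuous_map_pairwise o_def fst_conv snd_conv continuous_map_fst)
    have "continuous_map (prod_topology (cell_space B k) (top_of_set (cube d))) B (\<lambda>p. fst (fst p))"
      "continuous_map (prod_topology (cell_space B k) (top_of_set (cube d))) (top_of_set (cube k)) (\<lambda>p. snd (fst p))"
      using continuous_map_compose [OF continuous_map_fst continuous_map_fst]
        continuous_map_compose [OF continuous_map_fst continuous_map_snd] by (auto simp: o_def)
    then show "continuous_map (prod_topology (cell_space B k) (top_of_set (cube d))) (prod_topology B ?D)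
        (\<lambda>((b, a), a'). (b, a, a'))"
      by (simp only: case_prod_unfold continuous_map_pairwise o_def fst_conv snd_conv continuous_map_snd)
  qed auto
  then have "quotient_map (prod_topology B ?D) (prod_topology (cell_space B k) (top_of_set (cube d)))
      (\<lambda>(b, a, a'). ((b, a), a'))" by (meson homeomorphic_maps_map homeomorphic_map_def)
  from quotient_map_compose [OF q this] show ?thesis by (rule quotient_map_cong) (auto simp: split_cell_def)
qed

lemma continuous_map_final_top_mono:
  assumes "E1 \<subseteq> E2"
  shows "continuous_map (final_top Q E1 P q) (final_top Q E2 P q) id"
proof (rule continuous_map_from_final_top)
  show "continuous_map (P e) (final_top Q E2 P q) (id \<circ> q e)" if "e \<in> E1" for e
    using continuous_map_into_final_top [of e E2 P Q q] that assms by auto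
qed simp

section \<open>Cells of a complex over a complex\<close>

locale complex_over_complex =
  A: cell_complex B B0 fl "{a0}" a0 C k \<psi> rkC + X: cell_complex A "{a0}" True "{x0}" x0 E d \<Phi> rk
  for B :: "'b topology" and B0 fl and a0 :: 'a and C :: "'c set" and k \<psi> rkC and A :: "'a topology"
    and x0 :: 'x and E :: "'e set" and d \<Phi> rk +
  fixes N :: nat
  assumes A_total: "A = A.total" and N: "c \<in> C \<Longrightarrow> rkC c \<le> N"
begin

definition comp_dim where
  "comp_dim e = k (snd e) + d (fst e)"

definition comp_cell where
  "comp_cell e p = \<Phi> (fst e) (apfst (\<psi> (snd e)) (split_cell (k (snd e)) (d (fst e)) p))"

text \<open>\<open>rkC\<close> stays below \<open>Suc N\<close>, so this number orders the pairs
  lexicographically, with the cell of \<open>X\<close> first.\<close>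

definition comp_rank where
  "comp_rank e = rk (fst e) * Suc N + rkC (snd e)"

lemma comp_cell_eq: "comp_cell (e, c) = \<Phi> e \<circ> (\<lambda>z. (\<psi> c (fst z), snd z)) \<circ> split_cell (k c) (d e)"
  by (simp add: comp_cell_def fun_eq_iff apfst_def map_prod_def case_prod_unfold)

lemma a0: "a0 \<in> topspace A" by (simp add: A_total A.topspace_total)

lemma \<Phi>_a0: "e \<in> E \<Longrightarrow> l \<in> cube (d e) \<Longrightarrow> \<Phi> e (a0, l) = x0" using X.B0 a0 by blast

lemma split_cell_onto:
  assumes "p \<in> cell_set B n" "l \<in> cube m"
  obtains p' where "p' \<in> cell_set B (n + m)" "split_cell n m p' = (p, l)"
proof -
  have "(p, l) \<in> split_cell n m ` cell_set B (n + m)"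
    using assms quotient_imp_surjective_map [OF quotient_map_split_cell [of B n m]] by simp
  then show thesis using that by auto
qed

text \<open>The final topology on cells of \<open>A\<close> survives the product with a cube, and
  \<open>split_cell\<close> is a quotient map, so openness can be tested on composed cells. The
  subset \<open>C'\<close> is either all of \<open>C\<close>, for the topology of \<open>X\<close>,
  or the cells of \<open>A\<close> below a given one, for the attaching map of a composed
  cell.\<close>

lemma openin_\<Phi>_if_comp:
  assumes C': "C' \<subseteq> C" and e: "e \<in> E"
    and open_c: "\<And>c. c \<in> C' \<Longrightarrow> openin (cell_space B (k c + d e)) {p \<in> cell_set B (k c + d e). comp_cell (e, c) p \<in> U}"
  shows "openin (prod_topology (cells_top B {a0} C' k \<psi>) (top_of_set (cube (d e))))
    {z \<in> topspace (cells_top B {a0} C' k \<psi>) \<times> cube (d e). \<Phi> e z \<in> U}"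
    (is "openin (prod_topology ?A' ?L) ?V")
proof (rule openin_prod_final_top [OF locally_compact_space_cube Hausdorff_space_cube])
  fix x assume "x \<in> {a0}"
  then have "{l. (x, l) \<in> ?V} = (if x0 \<in> U then cube (d e) else {})" using \<Phi>_a0 [OF e] by auto
  then show "openin ?L {l. (x, l) \<in> ?V}" by simp
next
  fix c assume c: "c \<in> C'"
  let ?S = "{(p, l). p \<in> cell_set B (k c) \<and> (\<psi> c p, l) \<in> ?V}"
  have S: "?S = {z \<in> topspace (prod_topology (cell_space B (k c)) ?L). \<Phi> e (\<psi> c (fst z), snd z) \<in> U}"
    using c by auto
  have "{p \<in> cell_set B (k c + d e). split_cell (k c) (d e) p \<in> ?S} =
      {p \<in> cell_set B (k c + d e). comp_cell (e, c) p \<in> U}" unfolding S comp_cell_eq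
    using continuous_map_image_subset_topspace [OF continuous_map_split_cell [of B "k c" "d e"]] by auto
  then show "openin (prod_topology (cell_space B (k c)) ?L) ?S"
    using quotient_map_openin [OF quotient_map_split_cell [of B "k c" "d e"], of ?S] open_c [OF c] by auto
qed auto

lemma continuous_map_\<psi>_split:
  assumes c: "c \<in> C"
  shows "continuous_map (cell_space B (k c + n)) (cell_space A n) (\<lambda>p. (\<psi> c (fst (split_cell (k c) n p)), snd (split_cell (k c) n p)))"
proof -
  have s: "continuous_map (cell_space B (k c + n)) (cell_space B (k c)) (\<lambda>p. fst (split_cell (k c) n p))"
    "continuous_map (cell_space B (k c + n)) (top_of_set (cube n)) (\<lambda>p. snd (split_cell (k c) n p))"
    using continuous_map_split_cell [of B "k c" n] by (auto simp: continuous_map_componentwise o_def continuous_map_pairwise)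
  show ?thesis using continuous_map_compose [OF s(1) A.continuous_map_cell_total [OF c]] s(2)
    by (simp add: continuous_map_pairwise o_def A_total)
qed

lemma final_top_comp:
  assumes E': "E' \<subseteq> E"
  shows "cells_top A {x0} E' d \<Phi> = cells_top B {x0} (E' \<times> C) comp_dim comp_cell" unfolding topology_eq
proof
  fix U
  have o: "openin (cell_space A (d e)) {z \<in> cell_set A (d e). \<Phi> e z \<in> U} \<longleftrightarrow>
      (\<forall>c\<in>C. openin (cell_space B (comp_dim (e, c))) {p \<in> topspace (cell_space B (comp_dim (e, c))). comp_cell (e, c) p \<in> U})"
    if e: "e \<in> E'" for e
  proof
    assume L: "openin (cell_space A (d e)) {z \<in> cell_set A (d e). \<Phi> e z \<in> U}"
    show "\<forall>c\<in>C. openin (cell_space B (comp_dim (e, c))) {p \<in> topspace (cell_space B (comp_dim (e, c))). comp_cell (e, c) p \<in> U}"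
    proof
      fix c assume c: "c \<in> C"
      have "{p \<in> cell_set B (k c + d e). (\<psi> c (fst (split_cell (k c) (d e) p)), snd (split_cell (k c) (d e) p))
          \<in> {z \<in> cell_set A (d e). \<Phi> e z \<in> U}} = {p \<in> cell_set B (k c + d e). comp_cell (e, c) p \<in> U}"
        using continuous_map_image_subset_topspace [OF continuous_map_\<psi>_split [OF c, of "d e"]] by (auto simp: comp_cell_eq)
      then show "openin (cell_space B (comp_dim (e, c))) {p \<in> topspace (cell_space B (comp_dim (e, c))). comp_cell (e, c) p \<in> U}"
        using openin_continuous_map_preimage [OF continuous_map_\<psi>_split [OF c, of "d e"] L] by (simp add: comp_dim_def)
    qed
  next
    assume "\<forall>c\<in>C. openin (cell_space B (comp_dim (e, c))) {p \<in> topspace (cell_space B (comp_dim (e, c))). comp_cell (e, c) p \<in> U}"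
    then show "openin (cell_space A (d e)) {z \<in> cell_set A (d e). \<Phi> e z \<in> U}"
      using openin_\<Phi>_if_comp [OF subset_refl, of e U] e E' by (auto simp: comp_dim_def A_total A.total_def)
  qed
  have "{x0} \<union> (\<Union>e\<in>E'. \<Phi> e ` cell_set A (d e)) =
      {x0} \<union> (\<Union>e\<in>E' \<times> C. comp_cell e ` cell_set B (comp_dim e))"
  proof (intro equalityI subsetI)
    fix x assume "x \<in> {x0} \<union> (\<Union>e\<in>E'. \<Phi> e ` cell_set A (d e))"
    then consider "x = x0" | e a l where "e \<in> E'" "a \<in> topspace A" "l \<in> cube (d e)" "x = \<Phi> e (a, l)" by auto
    then show "x \<in> {x0} \<union> (\<Union>e\<in>E' \<times> C. comp_cell e ` cell_set B (comp_dim e))"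
    proof cases
      case (2 e a l)
      show ?thesis
      proof (cases "a = a0")
        case True
        then show ?thesis using 2 \<Phi>_a0 E' by auto
      next
        case False
        then obtain c p where cp: "c \<in> C" "p \<in> cell_set B (k c)" "a = \<psi> c p"
          using 2(2) by (auto simp: A_total A.topspace_total)
        obtain p' where "p' \<in> cell_set B (k c + d e)" "split_cell (k c) (d e) p' = (p, l)"
          by (rule split_cell_onto [OF cp(2) 2(3)])
        then have "x = comp_cell (e, c) p'" "p' \<in> topspace (cell_space B (comp_dim (e, c)))"
          using 2(4) cp(3) by (auto simp: comp_cell_eq comp_dim_def)
        then show ?thesis using 2(1) cp(1) by blast
      qed
    qed simp
  next
    fix x assume "x \<in> {x0} \<union> (\<Union>e\<in>E' \<times> C. comp_cell e ` cell_set B (comp_dim e))"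
    then consider "x = x0" | e c p where "e \<in> E'" "c \<in> C" "p \<in> cell_set B (k c + d e)" "x = comp_cell (e, c) p"
      by (auto simp: comp_dim_def)
    then show "x \<in> {x0} \<union> (\<Union>e\<in>E'. \<Phi> e ` cell_set A (d e))"
    proof cases
      case (2 e c p)
      have "(\<psi> c (fst (split_cell (k c) (d e) p)), snd (split_cell (k c) (d e) p)) \<in> cell_set A (d e)"
        using continuous_map_image_subset_topspace [OF continuous_map_\<psi>_split [OF 2(2), of "d e"]] 2(3) by blast
      then have "x \<in> \<Phi> e ` cell_set A (d e)" unfolding 2(4) comp_cell_eq o_def by blast
      then show ?thesis using 2(1) by blast
    qed simp
  qed
  then show "openin (cells_top A {x0} E' d \<Phi>) U =
      openin (cells_top B {x0} (E' \<times> C) comp_dim comp_cell) U" unfolding openin_final_top using o by auto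
qed

lemma comp_int:
  assumes "e \<in> E" "c \<in> C" "p \<in> cell_int B B0 (k c + d e)"
  shows "fst (split_cell (k c) (d e) p) \<in> cell_int B B0 (k c)"
    and "(\<psi> c (fst (split_cell (k c) (d e) p)), snd (split_cell (k c) (d e) p)) \<in> cell_int A {a0} (d e)"
proof -
  obtain b u where p: "p = (b, u)" "b \<in> topspace B - B0" "u \<in> cube_int (k c + d e)"
    using assms(3) by (auto simp: cell_int_def)
  have uc: "u \<in> cube (k c + d e)" using p(3) cube_int_subset by blast
  then have i: "cube_fst (k c) (d e) u \<in> cube_int (k c)" "cube_snd (k c) (d e) u \<in> cube_int (d e)"
    using cube_int_fst_snd [of u "k c" "d e"] p(3) by auto
  then show 1: "fst (split_cell (k c) (d e) p) \<in> cell_int B B0 (k c)" using p by (simp add: split_cell_def cell_int_def)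
  have "\<psi> c (fst (split_cell (k c) (d e) p)) \<in> topspace A - {a0}"
    using A.cell_new [OF assms(2) 1] 1 assms(2) unfolding A_total A.total_points by blast
  then show "(\<psi> c (fst (split_cell (k c) (d e) p)), snd (split_cell (k c) (d e) p)) \<in> cell_int A {a0} (d e)"
    using i p by (simp add: split_cell_def cell_int_def)
qed

lemma comp_inj:
  assumes "e \<in> E" "c \<in> C" "p \<in> cell_int B B0 (k c + d e)" "e' \<in> E" "c' \<in> C" "p' \<in> cell_int B B0 (k c' + d e')"
    and eq: "comp_cell (e, c) p = comp_cell (e', c') p'"
  shows "e = e' \<and> c = c' \<and> p = p'"
proof -
  let ?z = "(\<psi> c (fst (split_cell (k c) (d e) p)), snd (split_cell (k c) (d e) p))"
  let ?z' = "(\<psi> c' (fst (split_cell (k c') (d e') p')), snd (split_cell (k c') (d e') p'))"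
  have z: "\<Phi> e ?z = \<Phi> e' ?z'" using eq by (simp add: comp_cell_eq)
  have e: "e = e'" by (rule X.cells_disjoint [OF assms(1,4) comp_int(2) [OF assms(1,2,3)] comp_int(2) [OF assms(4,5,6)] z])
  then have zz: "?z = ?z'"
    using inj_onD [OF X.inj_cell [OF assms(1)] _ comp_int(2) [OF assms(1,2,3)]] comp_int(2) [OF assms(4,5,6)] z by simp
  then have \<psi>: "\<psi> c (fst (split_cell (k c) (d e) p)) = \<psi> c' (fst (split_cell (k c') (d e') p'))" by simp
  have c: "c = c'" by (rule A.cells_disjoint [OF assms(2,5) comp_int(1) [OF assms(1,2,3)] comp_int(1) [OF assms(4,5,6)] \<psi>])
  then have "fst (split_cell (k c) (d e) p) = fst (split_cell (k c') (d e') p')"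
    using inj_onD [OF A.inj_cell [OF assms(2)] _ comp_int(1) [OF assms(1,2,3)]] comp_int(1) [OF assms(4,5,6)] \<psi> by simp
  then have "fst p = fst p'" "cube_fst (k c) (d e) (snd p) = cube_fst (k c) (d e) (snd p')"
    "cube_snd (k c) (d e) (snd p) = cube_snd (k c) (d e) (snd p')" using zz c e by (auto simp: split_cell_def)
  then show ?thesis using cube_fst_snd_inj [of "snd p" "k c" "d e" "snd p'"] assms(3,6) c e by (auto simp: cell_int_def)
qed

lemma comp_rank_less:
  assumes "c' \<in> C" "rk e' < rk e \<or> e' = e \<and> rkC c' < rkC c"
  shows "comp_rank (e', c') < comp_rank (e, c)" using assms(2)
proof
  assume "rk e' < rk e"
  then have "Suc (rk e') * Suc N \<le> rk e * Suc N" by (intro mult_le_mono1) simp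
  then show ?thesis using N [OF assms(1)] by (simp add: comp_rank_def)
qed (simp add: comp_rank_def)

text \<open>The boundary of a product is covered by two closed pieces. Where the
  \<open>A\<close>-coordinate is on the boundary, the point moves into cells of \<open>A\<close> of
  lower rank within the same cell \<open>e\<close>; where the \<open>X\<close>-coordinate is on the
  boundary, it moves into cells of \<open>X\<close> of lower rank, with any cell of
  \<open>A\<close>. Both kinds of pairs are lexicographically smaller.\<close>

lemma comp_bd:
  assumes e: "e \<in> E" and c: "c \<in> C"
  shows "continuous_map (cell_bd_space B (k c + d e))
      (cells_top B {x0} {e' \<in> E \<times> C. comp_rank e' < comp_rank (e, c)} comp_dim comp_cell) (comp_cell (e, c))"
    (is "continuous_map ?P ?T _")
proof (rule continuous_map_paste)
  let ?f = "\<lambda>p. cube_fst (k c) (d e) (snd p)" and ?g = "\<lambda>p. cube_snd (k c) (d e) (snd p)"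
  have sub: "continuous_map ?P (top_of_set (cube (k c + d e))) snd" using continuous_map_into_fulltopology [OF continuous_map_snd]
    by (auto simp: continuous_map_in_subtopology intro: subsetD [OF cube_bd_subset])
  have fc: "continuous_map ?P (top_of_set (cube (k c))) ?f" and gc: "continuous_map ?P (top_of_set (cube (d e))) ?g"
    using continuous_map_compose [OF sub continuous_map_cube_fst_snd(1)]
      continuous_map_compose [OF sub continuous_map_cube_fst_snd(2)] by (auto simp: o_def)
  let ?S1 = "{p \<in> topspace ?P. ?f p \<in> cube_bd (k c)}" and ?S2 = "{p \<in> topspace ?P. ?g p \<in> cube_bd (d e)}"
  show "closedin ?P ?S1" "closedin ?P ?S2" using closedin_continuous_map_preimage [OF fc] closedin_continuous_map_preimage [OF gc]
      closed_subset [OF cube_bd_subset closed_cube_bd] by auto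
  show "topspace ?P \<subseteq> ?S1 \<union> ?S2" by (auto dest: cube_bd_fst_snd)
  have "continuous_map (subtopology ?P ?S1) (cell_bd_space B (k c)) (\<lambda>p. (fst p, ?f p))"
    using continuous_map_into_fulltopology [OF continuous_map_from_subtopology [OF fc]]
    by (auto simp: continuous_map_pairwise o_def continuous_map_from_subtopology continuous_map_fst continuous_map_in_subtopology)
  from continuous_map_compose [OF this A.bd [OF c]]
  have 1: "continuous_map (subtopology ?P ?S1)
      (prod_topology (cells_top B {a0} {c' \<in> C. rkC c' < rkC c} k \<psi>) (top_of_set (cube (d e))))
      (\<lambda>p. (\<psi> c (fst p, ?f p), ?g p))"
    using continuous_map_from_subtopology [OF gc, of ?S1] by (simp add: continuous_map_pairwise o_def)
  have 2: "continuous_map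
      (prod_topology (cells_top B {a0} {c' \<in> C. rkC c' < rkC c} k \<psi>) (top_of_set (cube (d e)))) ?T (\<Phi> e)"
    (is "continuous_map (prod_topology ?A' ?L) _ _") unfolding continuous_map_def
  proof (intro conjI allI impI)
    have low: "(e, c') \<in> {e' \<in> E \<times> C. comp_rank e' < comp_rank (e, c)}" if "c' \<in> C" "rkC c' < rkC c" for c'
      using comp_rank_less [OF that(1), of e e c] that e by simp
    show "\<Phi> e \<in> topspace (prod_topology ?A' ?L) \<rightarrow> topspace ?T"
    proof
      fix z assume "z \<in> topspace (prod_topology ?A' ?L)"
      then obtain a l where z: "z = (a, l)" "a \<in> topspace ?A'" "l \<in> cube (d e)" by auto
      show "\<Phi> e z \<in> topspace ?T"
      proof (cases "a = a0")
        case True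
        then show ?thesis using z \<Phi>_a0 [OF e] by simp
      next
        case False
        then obtain c' p where cp: "c' \<in> C" "rkC c' < rkC c" "p \<in> cell_set B (k c')" "a = \<psi> c' p" using z(2) by auto
        obtain p' where "p' \<in> cell_set B (k c' + d e)" "split_cell (k c') (d e) p' = (p, l)"
          by (rule split_cell_onto [OF cp(3) z(3)])
        then have "\<Phi> e z = comp_cell (e, c') p'" "p' \<in> topspace (cell_space B (comp_dim (e, c')))"
          using z(1) cp(4) by (auto simp: comp_cell_eq comp_dim_def)
        then show ?thesis using low [OF cp(1,2)] unfolding topspace_final_top by blast
      qed
    qed
    fix U assume "openin ?T U"
    then have opn: "openin (cell_space B (k c' + d e)) {p \<in> cell_set B (k c' + d e). comp_cell (e, c') p \<in> U}"
      if "c' \<in> {c' \<in> C. rkC c' < rkC c}" for c' using low [of c'] that unfolding openin_final_top comp_dim_def by fastforce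
    have "{c' \<in> C. rkC c' < rkC c} \<subseteq> C" by blast
    from openin_\<Phi>_if_comp [OF this e opn]
    show "openin (prod_topology ?A' ?L) {z \<in> topspace (prod_topology ?A' ?L). \<Phi> e z \<in> U}" by simp
  qed
  show "continuous_map (subtopology ?P ?S1) ?T (comp_cell (e, c))"
    using continuous_map_compose [OF 1 2] by (simp add: o_def comp_cell_eq split_cell_def)
  have "continuous_map (cell_bd_space B (k c + d e)) (cell_space B (k c)) (\<lambda>p. (fst p, ?f p))"
    using fc by (simp add: continuous_map_pairwise o_def continuous_map_fst)
  from continuous_map_from_subtopology [OF continuous_map_compose [OF this A.continuous_map_cell_total [OF c]], of ?S2]
  have "continuous_map (subtopology ?P ?S2) (cell_bd_space A (d e)) (\<lambda>p. (\<psi> c (fst p, ?f p), ?g p))"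
    using continuous_map_into_fulltopology [OF continuous_map_from_subtopology [OF gc, of ?S2]]
    by (auto simp: continuous_map_pairwise o_def A_total continuous_map_in_subtopology)
  from continuous_map_compose [OF this X.bd [OF e]]
  have 3: "continuous_map (subtopology ?P ?S2) (cells_top A {x0} {e' \<in> E. rk e' < rk e} d \<Phi>) (comp_cell (e, c))"
    by (simp add: o_def comp_cell_eq split_cell_def)
  have "{e' \<in> E. rk e' < rk e} \<times> C \<subseteq> {e' \<in> E \<times> C. comp_rank e' < comp_rank (e, c)}"
    using comp_rank_less by auto
  then have "continuous_map (cells_top A {x0} {e' \<in> E. rk e' < rk e} d \<Phi>) ?T id"
    unfolding final_top_comp [of "{e' \<in> E. rk e' < rk e}", simplified] by (rule continuous_map_final_top_mono)
  from continuous_map_compose [OF 3 this]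
  show "continuous_map (subtopology ?P ?S2) ?T (comp_cell (e, c))" by simp
qed

lemma comp_cell_complex: "cell_complex B B0 fl {x0} x0 (E \<times> C) comp_dim comp_cell comp_rank"
proof
  fix e assume "e \<in> E \<times> C"
  then obtain a c where e: "e = (a, c)" "a \<in> E" "c \<in> C" by auto
  show "0 < comp_rank e" using X.rk_pos [OF e(2)] by (simp add: comp_rank_def e(1))
  show "inj_on (comp_cell e) (cell_int B B0 (comp_dim e))"
    using comp_inj [OF e(2,3) _ e(2,3)] by (auto simp: inj_on_def e(1) comp_dim_def)
  show "comp_cell e p \<notin> {x0}" if "p \<in> cell_int B B0 (comp_dim e)" for p
    using X.cell_new [OF e(2) comp_int(2) [OF e(2,3)]] that by (simp add: e(1) comp_dim_def comp_cell_eq)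
  show "e = e'" if "e' \<in> E \<times> C" "p \<in> cell_int B B0 (comp_dim e)" "p' \<in> cell_int B B0 (comp_dim e')"
    "comp_cell e p = comp_cell e' p'" for e' p p'
    using comp_inj [OF e(2,3), of p "fst e'" "snd e'" p'] that by (auto simp: e(1) comp_dim_def)
  show "continuous_map (cell_bd_space B (comp_dim e)) (cells_top B {x0} {e' \<in> E \<times> C. comp_rank e' < comp_rank e}
      comp_dim comp_cell) (comp_cell e)" using comp_bd [OF e(2,3)] by (simp add: e(1) comp_dim_def)
  show "comp_cell e (b, u) = x0" if "b \<in> B0" "b \<in> topspace B" "u \<in> cube (comp_dim e)" for b u
    using A.B0 [OF e(3) that(1,2)] cube_fst_snd_in_cube [of u "k c" "d a"] that(3) \<Phi>_a0 [OF e(2)]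
    by (simp add: e(1) comp_dim_def comp_cell_eq split_cell_def)
  show "comp_cell e (b, u) = x0" if fl "b \<in> topspace B" "u \<in> cube_J (comp_dim e)" for b u
  proof -
    have u: "u \<in> cube (k c + d a)" using that(3) cube_J_subset cube_bd_subset by (auto simp: e(1) comp_dim_def)
    then have uc: "cube_fst (k c) (d a) u \<in> cube (k c)" "cube_snd (k c) (d a) u \<in> cube (d a)"
      using cube_fst_snd_in_cube by auto
    have "\<psi> c (b, cube_fst (k c) (d a) u) \<in> topspace A" using uc that(2) e(3) by (auto simp: A_total A.topspace_total)
    moreover have "cube_fst (k c) (d a) u \<in> cube_J (k c) \<or> cube_snd (k c) (d a) u \<in> cube_J (d a)"
      using that(3) by (intro cube_J_fst_snd) (simp add: e(1) comp_dim_def)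
    ultimately show ?thesis using A.J [OF that(1) e(3) that(2)] X.J [OF _ e(2)] \<Phi>_a0 [OF e(2) uc(2)]
      by (auto simp: e(1) comp_cell_eq split_cell_def)
  qed
qed simp_all

lemma comp_total: "X.total = cells_top B {x0} (E \<times> C) comp_dim comp_cell" unfolding X.total_def by (rule final_top_comp) simp

end

section \<open>Cubes and disks\<close>

primrec max_abs :: "nat \<Rightarrow> coords \<Rightarrow> real" where
  "max_abs 0 v = 0"
| "max_abs (Suc n) v = max (max_abs n v) \<bar>v n\<bar>"

definition sum_norm :: "nat \<Rightarrow> coords \<Rightarrow> real" where
  "sum_norm n v = sqrt (\<Sum>i<n. (v i)\<^sup>2)"

lemma max_abs_nonneg: "0 \<le> max_abs n v" by (induction n) auto

lemma max_abs_ge: "i < n \<Longrightarrow> \<bar>v i\<bar> \<le> max_abs n v" by (induction n) (auto simp: less_Suc_eq)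

lemma max_abs_le_iff: "0 \<le> c \<Longrightarrow> max_abs n v \<le> c \<longleftrightarrow> (\<forall>i<n. \<bar>v i\<bar> \<le> c)"
  by (induction n) (auto simp: less_Suc_eq)

lemma max_abs_attained: "max_abs n v \<noteq> 0 \<Longrightarrow> \<exists>i<n. max_abs n v = \<bar>v i\<bar>"
  by (induction n) (auto simp: less_Suc_eq max_def)

lemma max_abs_scale: "0 \<le> c \<Longrightarrow> max_abs n (\<lambda>i. c * v i) = c * max_abs n v"
  by (induction n) (auto simp: abs_mult max_mult_distrib_left)

lemma sum_norm_nonneg: "0 \<le> sum_norm n v" by (simp add: sum_norm_def sum_nonneg)

lemma sum_norm_ge: "i < n \<Longrightarrow> \<bar>v i\<bar> \<le> sum_norm n v" unfolding sum_norm_def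
  by (rule real_le_rsqrt) (auto intro: member_le_sum [of i "{..<n}" "\<lambda>i. (v i)\<^sup>2", simplified])

lemma sum_norm_scale: "0 \<le> c \<Longrightarrow> sum_norm n (\<lambda>i. c * v i) = c * sum_norm n v"
  by (simp add: sum_norm_def power_mult_distrib sum_distrib_left [symmetric] real_sqrt_mult)

lemma norm_zero_iff:
  shows "max_abs n v = 0 \<longleftrightarrow> (\<forall>i<n. v i = 0)" and "sum_norm n v = 0 \<longleftrightarrow> (\<forall>i<n. v i = 0)"
proof -
  show "max_abs n v = 0 \<longleftrightarrow> (\<forall>i<n. v i = 0)" using max_abs_le_iff [of 0 n v] max_abs_nonneg [of n v] by auto
  show "sum_norm n v = 0 \<longleftrightarrow> (\<forall>i<n. v i = 0)" by (auto simp: sum_norm_def sum_nonneg_eq_0_iff)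
qed

lemma continuous_on_coordinate: "continuous_on S (\<lambda>u::nat \<Rightarrow> real. u i)"
  by (rule continuous_on_subset [OF continuous_on_product_coordinates]) simp

lemma continuous_on_max_abs: "continuous_on S (max_abs n)"
proof (induction n)
  case (Suc n)
  have "continuous_on S (\<lambda>v. max (max_abs n v) \<bar>v n\<bar>)" by (intro continuous_intros Suc continuous_on_coordinate)
  then show ?case by (simp add: fun_eq_iff cong: continuous_on_cong)
qed (simp add: continuous_on_const)

lemma continuous_on_sum_norm: "continuous_on S (sum_norm n)"
  unfolding sum_norm_def by (intro continuous_intros continuous_on_coordinate)

text \<open>Away from the zeros of \<open>N\<close> this is a quotient of continuous functions. At a
  zero the function is bounded by \<open>M\<close>, which tends to 0 there. It yields continuity of
  the radial maps at the centre.\<close>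

lemma continuous_on_rescale:
  fixes M N :: "coords \<Rightarrow> real"
  assumes M: "continuous_on UNIV M" and N: "continuous_on UNIV N"
    and le: "\<And>v. \<bar>v i\<bar> \<le> N v" and M0: "\<And>v. 0 \<le> M v" "\<And>v. N v = 0 \<Longrightarrow> M v = 0"
  shows "continuous_on UNIV (\<lambda>v. M v / N v * v i)"
proof -
  have "isCont (\<lambda>v. M v / N v * v i) v" for v
  proof (cases "N v = 0")
    case False
    have "isCont M v" "isCont N v" "isCont (\<lambda>v::nat \<Rightarrow> real. v i) v"
      using M N continuous_on_coordinate [of UNIV i] unfolding continuous_on_eq_continuous_at [OF open_UNIV] by blast+
    then show ?thesis using False by (intro continuous_intros)
  next
    case True
    have N0: "0 \<le> N w" for w using le [of w] by linarith
    have nb: "norm (M w / N w * w i) \<le> M w" for w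
    proof (cases "N w = 0")
      case False
      have "\<bar>M w / N w * w i\<bar> = M w * (\<bar>w i\<bar> / N w)" using M0(1) [of w] N0 [of w] by (simp add: abs_mult)
      also have "\<dots> \<le> M w * 1"
        using le [of w] False N0 [of w] M0(1) [of w] by (intro mult_left_mono) (auto simp: divide_le_eq)
      finally show ?thesis by simp
    qed (use M0(1) in simp)
    have "isCont M v" using M unfolding continuous_on_eq_continuous_at [OF open_UNIV] by blast
    then have M_lim: "(M \<longlongrightarrow> 0) (at v)" using M0(2) [OF True] by (simp add: isCont_def)
    have "((\<lambda>w. M w / N w * w i) \<longlongrightarrow> 0) (at v)"
      by (rule Lim_null_comparison [OF always_eventually M_lim]) (use nb in blast)
    then show ?thesis using True by (simp add: isCont_def)
  qed
  then show ?thesis by (simp add: continuous_on_eq_continuous_at)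
qed

section \<open>The radial homeomorphism of cubes and disks\<close>

definition disk_set :: "nat \<Rightarrow> coords set" where
  "disk_set d = {x. (\<forall>i\<ge>d. x i = 0) \<and> sum_norm d x \<le> 1}"

definition sphere_set :: "nat \<Rightarrow> coords set" where
  "sphere_set d = {x. (\<forall>i\<ge>d. x i = 0) \<and> sum_norm d x = 1}"

lemma disk_eq: "disk d = top_of_set (disk_set d)" and disk_boundary_eq: "disk_boundary d = top_of_set (sphere_set d)"
  unfolding disk_def disk_boundary_def Euclidean_space_def subtopology_subtopology euclidean_product_topology
  by (rule arg_cong [where f = top_of_set], auto simp: disk_set_def sphere_set_def sum_norm_def)+

lemma topspace_disk: "topspace (disk d) = disk_set d" and topspace_disk_boundary: "topspace (disk_boundary d) = sphere_set d"
  by (simp_all add: disk_eq disk_boundary_eq)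

lemma sphere_subset_disk: "sphere_set d \<subseteq> disk_set d" by (auto simp: sphere_set_def disk_set_def)

text \<open>The cube is centred at the origin and rescaled along rays so that the maximum norm
  becomes the Euclidean norm. At the centre the quotient is \<open>0 / 0 = 0\<close>, which is the
  right value.\<close>

definition cube_to_disk :: "nat \<Rightarrow> coords \<Rightarrow> nat \<Rightarrow> real" where
  "cube_to_disk d u = (let v = (\<lambda>i. if i < d then 2 * u i - 1 else 0) in (\<lambda>i. max_abs d v / sum_norm d v * v i))"

definition disk_to_cube :: "nat \<Rightarrow> coords \<Rightarrow> nat \<Rightarrow> real" where
  "disk_to_cube d x = (\<lambda>i. if i < d then (sum_norm d x / max_abs d x * x i + 1) / 2 else 0)"

lemma max_abs_cong: "(\<And>i. i < n \<Longrightarrow> v i = w i) \<Longrightarrow> max_abs n v = max_abs n w" by (induction n) auto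

lemma cube_iff_max_abs:
  assumes "\<And>i. i \<ge> d \<Longrightarrow> u i = 0"
  shows "u \<in> cube d \<longleftrightarrow> max_abs d (\<lambda>i. 2 * u i - 1) \<le> 1"
    and "u \<in> cube_bd d \<longleftrightarrow> max_abs d (\<lambda>i. 2 * u i - 1) = 1"
proof -
  have a: "\<bar>2 * t - 1\<bar> \<le> 1 \<longleftrightarrow> 0 \<le> t \<and> t \<le> 1" "\<bar>2 * t - 1\<bar> = 1 \<longleftrightarrow> t = 0 \<or> t = 1" for t :: real
    by (auto simp: abs_if)
  show 1: "u \<in> cube d \<longleftrightarrow> max_abs d (\<lambda>i. 2 * u i - 1) \<le> 1"
    using assms by (auto simp: max_abs_le_iff a cube_def)
  show "u \<in> cube_bd d \<longleftrightarrow> max_abs d (\<lambda>i. 2 * u i - 1) = 1"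
  proof
    assume u: "u \<in> cube_bd d"
    then obtain i where i: "i < d" "u i = 0 \<or> u i = 1" by (auto simp: cube_bd_def)
    then have "1 \<le> max_abs d (\<lambda>i. 2 * u i - 1)" using max_abs_ge [OF i(1), of "\<lambda>i. 2 * u i - 1"] by linarith
    then show "max_abs d (\<lambda>i. 2 * u i - 1) = 1" using 1 u cube_bd_subset by auto
  next
    assume m: "max_abs d (\<lambda>i. 2 * u i - 1) = 1"
    then obtain i where "i < d" "\<bar>2 * u i - 1\<bar> = 1" using max_abs_attained [of d "\<lambda>i. 2 * u i - 1"] by auto
    then show "u \<in> cube_bd d" using 1 m a(2) by (auto simp: cube_bd_def)
  qed
qed

lemma cube_to_disk_norms:
  assumes u: "\<And>i. i \<ge> d \<Longrightarrow> u i = 0"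
  shows "sum_norm d (cube_to_disk d u) = max_abs d (\<lambda>i. 2 * u i - 1)" and "disk_to_cube d (cube_to_disk d u) = u"
proof -
  define v where "v = (\<lambda>i. if i < d then 2 * u i - 1 else 0)"
  have c: "cube_to_disk d u = (\<lambda>i. max_abs d v / sum_norm d v * v i)" by (simp add: cube_to_disk_def v_def Let_def)
  have mv: "max_abs d v = max_abs d (\<lambda>i. 2 * u i - 1)" by (rule max_abs_cong) (simp add: v_def)
  have nn: "0 \<le> max_abs d v / sum_norm d v" using max_abs_nonneg sum_norm_nonneg by simp
  have z: "sum_norm d v = 0 \<longleftrightarrow> max_abs d v = 0" by (simp add: norm_zero_iff)
  show sn: "sum_norm d (cube_to_disk d u) = max_abs d (\<lambda>i. 2 * u i - 1)"
    unfolding c sum_norm_scale [OF nn] mv [symmetric] using z by simp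
  have mn: "max_abs d (cube_to_disk d u) = max_abs d v / sum_norm d v * max_abs d v" unfolding c max_abs_scale [OF nn] ..
  have "sum_norm d (cube_to_disk d u) / max_abs d (cube_to_disk d u) * cube_to_disk d u i = v i" if "i < d" for i
  proof (cases "max_abs d v = 0")
    case True
    then show ?thesis using that by (simp add: c norm_zero_iff)
  next
    case False
    have ci: "cube_to_disk d u i = max_abs d v / sum_norm d v * v i" by (simp add: c)
    show ?thesis using z False unfolding sn mn mv [symmetric] ci by (simp add: field_simps)
  qed
  then show "disk_to_cube d (cube_to_disk d u) = u" using u by (auto simp: disk_to_cube_def fun_eq_iff v_def)
qed

lemma disk_to_cube_norms:
  assumes x: "\<And>i. i \<ge> d \<Longrightarrow> x i = 0"
  shows "max_abs d (\<lambda>i. 2 * disk_to_cube d x i - 1) = sum_norm d x" and "cube_to_disk d (disk_to_cube d x) = x"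
proof -
  define v where "v = (\<lambda>i. sum_norm d x / max_abs d x * x i)"
  have v: "2 * disk_to_cube d x i - 1 = v i" if "i < d" for i using that by (simp add: disk_to_cube_def v_def add_divide_distrib)
  have nn: "0 \<le> sum_norm d x / max_abs d x" using max_abs_nonneg sum_norm_nonneg by simp
  have z: "sum_norm d x = 0 \<longleftrightarrow> max_abs d x = 0" by (simp add: norm_zero_iff)
  have mv: "max_abs d v = sum_norm d x" unfolding v_def max_abs_scale [OF nn] using z by simp
  have sv: "sum_norm d v = sum_norm d x / max_abs d x * sum_norm d x" unfolding v_def sum_norm_scale [OF nn] ..
  show "max_abs d (\<lambda>i. 2 * disk_to_cube d x i - 1) = sum_norm d x"
    using max_abs_cong [of d "\<lambda>i. 2 * disk_to_cube d x i - 1" v] v mv by simp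
  have v': "(\<lambda>i. if i < d then 2 * disk_to_cube d x i - 1 else 0) = v" using v x by (auto simp: fun_eq_iff v_def)
  have "sum_norm d x / (sum_norm d x / max_abs d x * sum_norm d x) * (sum_norm d x / max_abs d x * x i) = x i" for i
  proof (cases "sum_norm d x = 0")
    case True
    then show ?thesis using x by (cases "i < d") (auto simp: norm_zero_iff)
  next
    case False
    then show ?thesis using z by (simp add: field_simps)
  qed
  then show "cube_to_disk d (disk_to_cube d x) = x" unfolding cube_to_disk_def v' Let_def mv sv by (auto simp: fun_eq_iff v_def)
qed

lemma cube_to_disk_mem:
  shows "u \<in> cube d \<Longrightarrow> cube_to_disk d u \<in> disk_set d"
    and "u \<in> cube d \<Longrightarrow> cube_to_disk d u \<in> sphere_set d \<longleftrightarrow> u \<in> cube_bd d"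
    and "x \<in> disk_set d \<Longrightarrow> disk_to_cube d x \<in> cube d"
    and "x \<in> disk_set d \<Longrightarrow> disk_to_cube d x \<in> cube_bd d \<longleftrightarrow> x \<in> sphere_set d"
proof -
  have z: "cube_to_disk d u i = 0" if "i \<ge> d" for i using that by (simp add: cube_to_disk_def Let_def)
  have z': "disk_to_cube d x i = 0" if "i \<ge> d" for i using that by (simp add: disk_to_cube_def)
  {
    assume u: "u \<in> cube d"
    then have u0: "\<And>i. i \<ge> d \<Longrightarrow> u i = 0" by (simp add: cube_def)
    show "cube_to_disk d u \<in> disk_set d" "cube_to_disk d u \<in> sphere_set d \<longleftrightarrow> u \<in> cube_bd d"
      using u cube_iff_max_abs [OF u0] cube_to_disk_norms(1) [OF u0] z by (auto simp: disk_set_def sphere_set_def)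
  }
  {
    assume x: "x \<in> disk_set d"
    then have x0: "\<And>i. i \<ge> d \<Longrightarrow> x i = 0" by (simp add: disk_set_def)
    show "disk_to_cube d x \<in> cube d" "disk_to_cube d x \<in> cube_bd d \<longleftrightarrow> x \<in> sphere_set d"
      using x x0 cube_iff_max_abs [of d "disk_to_cube d x", OF z'] disk_to_cube_norms(1) [OF x0]
      by (auto simp: disk_set_def sphere_set_def)
  }
qed

lemma cube_to_disk_inverse: "u \<in> cube d \<Longrightarrow> disk_to_cube d (cube_to_disk d u) = u"
  by (rule cube_to_disk_norms) (simp add: cube_def)

lemma disk_to_cube_inverse: "x \<in> disk_set d \<Longrightarrow> cube_to_disk d (disk_to_cube d x) = x"
  by (rule disk_to_cube_norms) (simp add: disk_set_def)

lemma continuous_on_cube_to_disk: "continuous_on S (cube_to_disk d)"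
proof (rule continuous_on_coordinatewise_then_product)
  fix i
  let ?c = "\<lambda>u j. if j < d then 2 * u j - 1 else (0::real)"
  show "continuous_on S (\<lambda>u. cube_to_disk d u i)"
  proof (cases "i < d")
    case True
    have "continuous_on S (\<lambda>u. ?c u j)" for j by (cases "j < d") (auto intro!: continuous_intros continuous_on_coordinate)
    then have c: "continuous_on S ?c" by (rule continuous_on_coordinatewise_then_product)
    have "continuous_on UNIV (\<lambda>v. max_abs d v / (sum_norm d v) * v i)"
    proof (rule continuous_on_rescale)
      show "\<bar>v i\<bar> \<le> sum_norm d v" for v by (rule sum_norm_ge [OF True])
    qed (auto simp: max_abs_nonneg norm_zero_iff continuous_on_max_abs continuous_on_sum_norm)
    from continuous_on_compose2 [OF this c] show ?thesis by (simp add: cube_to_disk_def Let_def)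
  next
    case False
    then show ?thesis by (simp add: cube_to_disk_def Let_def)
  qed
qed

lemma continuous_on_disk_to_cube: "continuous_on S (disk_to_cube d)"
proof (rule continuous_on_coordinatewise_then_product)
  fix i
  show "continuous_on S (\<lambda>u. disk_to_cube d u i)"
  proof (cases "i < d")
    case True
    have "continuous_on UNIV (\<lambda>v. sum_norm d v / (max_abs d v) * v i)"
    proof (rule continuous_on_rescale)
      show "\<bar>v i\<bar> \<le> max_abs d v" for v by (rule max_abs_ge [OF True])
    qed (auto simp: sum_norm_nonneg norm_zero_iff continuous_on_max_abs continuous_on_sum_norm)
    then have "continuous_on S (\<lambda>v. sum_norm d v / (max_abs d v) * v i)" by (rule continuous_on_subset) simp
    moreover have "continuous_on S (\<lambda>v. (f v + 1) / 2)" if "continuous_on S f" for f :: "_ \<Rightarrow> real"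
      using that by (intro continuous_intros) auto
    ultimately show ?thesis using True by (simp add: disk_to_cube_def)
  next
    case False
    then show ?thesis by (simp add: disk_to_cube_def)
  qed
qed

lemma homeomorphic_maps_cube_disk:
  "homeomorphic_maps (top_of_set (cube d)) (disk d) (cube_to_disk d) (disk_to_cube d)"
  "homeomorphic_maps (top_of_set (cube_bd d)) (disk_boundary d) (cube_to_disk d) (disk_to_cube d)"
proof -
  have s: "u \<in> cube_bd d \<Longrightarrow> u \<in> cube d" "x \<in> sphere_set d \<Longrightarrow> x \<in> disk_set d" for u x
    using cube_bd_subset sphere_subset_disk by auto
  show "homeomorphic_maps (top_of_set (cube d)) (disk d) (cube_to_disk d) (disk_to_cube d)"
    "homeomorphic_maps (top_of_set (cube_bd d)) (disk_boundary d) (cube_to_disk d) (disk_to_cube d)" using cube_to_disk_mem s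
    by (auto simp: homeomorphic_maps_def disk_eq disk_boundary_eq continuous_on_cube_to_disk continuous_on_disk_to_cube
        cube_to_disk_inverse disk_to_cube_inverse)
qed


section \<open>Discrete cores\<close>

abbreviation one_point :: "unit topology" where
  "one_point \<equiv> discrete_topology {()}"

abbreviation two_points :: "bool topology" where
  "two_points \<equiv> discrete_topology UNIV"

abbreviation ordinary_cells ::
    "bool \<Rightarrow> 'x \<Rightarrow> 'e set \<Rightarrow> ('e \<Rightarrow> nat) \<Rightarrow> ('e \<Rightarrow> unit \<times> coords \<Rightarrow> 'x) \<Rightarrow> ('e \<Rightarrow> nat) \<Rightarrow> bool" where
  "ordinary_cells fl x0 \<equiv> cell_complex one_point {} fl {x0} x0"

lemma openin_prod_discrete:
  assumes "V \<subseteq> D \<times> topspace L"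
  shows "openin (prod_topology (discrete_topology D) L) V \<longleftrightarrow> (\<forall>x\<in>D. openin L {l. (x, l) \<in> V})"
proof
  assume V: "openin (prod_topology (discrete_topology D) L) V"
  show "\<forall>x\<in>D. openin L {l. (x, l) \<in> V}"
  proof
    fix x assume x: "x \<in> D"
    have "continuous_map L (prod_topology (discrete_topology D) L) (\<lambda>l. (x, l))"
      using x by (simp add: continuous_map_pairwise o_def)
    from openin_continuous_map_preimage [OF this V]
    have "openin L {l \<in> topspace L. (x, l) \<in> V}" .
    moreover have "{l \<in> topspace L. (x, l) \<in> V} = {l. (x, l) \<in> V}" using assms by auto
    ultimately show "openin L {l. (x, l) \<in> V}" by simp
  qed
next
  assume R: "\<forall>x\<in>D. openin L {l. (x, l) \<in> V}"
  have "V = (\<Union>x\<in>D. {x} \<times> {l. (x, l) \<in> V})" using assms by auto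
  moreover have "openin (prod_topology (discrete_topology D) L) (\<Union>x\<in>D. {x} \<times> {l. (x, l) \<in> V})"
    using R by (intro openin_Union) (auto simp: openin_prod_Times_iff)
  ultimately show "openin (prod_topology (discrete_topology D) L) V" by simp
qed

lemma continuous_map_from_prod_discrete:
  "continuous_map (prod_topology (discrete_topology D) L) Y f \<longleftrightarrow> (\<forall>x\<in>D. continuous_map L Y (\<lambda>l. f (x, l)))"
proof
  assume f: "continuous_map (prod_topology (discrete_topology D) L) Y f"
  show "\<forall>x\<in>D. continuous_map L Y (\<lambda>l. f (x, l))"
  proof
    fix x assume x: "x \<in> D"
    have "continuous_map L (prod_topology (discrete_topology D) L) (\<lambda>l. (x, l))"
      using x by (simp add: continuous_map_pairwise o_def)
    from continuous_map_compose [OF this f] show "continuous_map L Y (\<lambda>l. f (x, l))" by (simp add: o_def)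
  qed
next
  assume R: "\<forall>x\<in>D. continuous_map L Y (\<lambda>l. f (x, l))"
  show "continuous_map (prod_topology (discrete_topology D) L) Y f" unfolding continuous_map_def
  proof (intro conjI allI impI)
    show "f \<in> topspace (prod_topology (discrete_topology D) L) \<rightarrow> topspace Y"
      using R by (auto simp: continuous_map_def)
    fix U assume U: "openin Y U"
    have "openin L {l. (x, l) \<in> preim (prod_topology (discrete_topology D) L) f U}" if "x \<in> D" for x
      using openin_continuous_map_preimage [OF bspec [OF R that] U] that by simp
    then show "openin (prod_topology (discrete_topology D) L) (preim (prod_topology (discrete_topology D) L) f U)"
      by (subst openin_prod_discrete) auto
  qed
qed

lemma openin_cell_one_point:
  "openin (cell_space one_point d) {p \<in> cell_set one_point d. \<Phi> p \<in> U} \<longleftrightarrow>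
     openin (top_of_set (cube d)) {u \<in> cube d. \<Phi> ((), u) \<in> U}" by (subst openin_prod_discrete) auto

text \<open>The copy over \<open>False\<close> is mapped to the base point, so its preimage is empty
  or the whole cube and gives no condition.\<close>

lemma openin_cell_bool:
  assumes "\<And>u. u \<in> cube d \<Longrightarrow> \<Phi> (False, u) = x0"
  shows "openin (cell_space two_points d) {p \<in> cell_set two_points d. \<Phi> p \<in> U} \<longleftrightarrow>
     openin (top_of_set (cube d)) {u \<in> cube d. \<Phi> (True, u) \<in> U}"
proof -
  have "{u. (False, u) \<in> {p \<in> cell_set two_points d. \<Phi> p \<in> U}} =
      (if x0 \<in> U then cube d else {})" using assms by auto
  moreover have "{u. (True, u) \<in> {p \<in> cell_set two_points d. \<Phi> p \<in> U}} =
      {u \<in> cube d. \<Phi> (True, u) \<in> U}" by auto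
  ultimately show ?thesis by (subst openin_prod_discrete) (auto simp: UNIV_bool)
qed

text \<open>Over \<open>S0\<close> the copy at the base point \<open>False\<close> is collapsed, so
  an \<open>S0\<close>-cell is the same as a single cube with \<open>fl\<close> still true: the
  faces in \<open>cube_J\<close> remain at the base point. \<open>bool_cell\<close> is the way
  back.\<close>

definition unit_cell :: "('e \<Rightarrow> bool \<times> coords \<Rightarrow> 'x) \<Rightarrow> 'e \<Rightarrow> unit \<times> coords \<Rightarrow> 'x" where
  "unit_cell \<Phi> e p = \<Phi> e (True, snd p)"

definition bool_cell :: "'x \<Rightarrow> ('e \<Rightarrow> unit \<times> coords \<Rightarrow> 'x) \<Rightarrow> 'e \<Rightarrow> bool \<times> coords \<Rightarrow> 'x" where
  "bool_cell x0 \<Phi> e p = (if fst p then \<Phi> e ((), snd p) else x0)"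

lemma final_top_bool_unit:
  assumes F: "\<And>e u. e \<in> E \<Longrightarrow> u \<in> cube (d e) \<Longrightarrow> \<Phi> e (False, u) = x0"
    and T: "\<And>e u. e \<in> E \<Longrightarrow> u \<in> cube (d e) \<Longrightarrow> \<Phi> e (True, u) = \<Phi>' e ((), u)" and x0: "x0 \<in> Q"
  shows "cells_top two_points Q E d \<Phi> = cells_top one_point Q E d \<Phi>'"
proof -
  have 1: "Q \<union> (\<Union>e\<in>E. \<Phi> e ` cell_set two_points (d e)) =
      Q \<union> (\<Union>e\<in>E. \<Phi>' e ` cell_set one_point (d e))"
  proof (intro equalityI subsetI)
    fix x assume "x \<in> Q \<union> (\<Union>e\<in>E. \<Phi> e ` cell_set two_points (d e))"
    then consider "x \<in> Q" | e b u where "e \<in> E" "u \<in> cube (d e)" "x = \<Phi> e (b, u)" by auto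
    then show "x \<in> Q \<union> (\<Union>e\<in>E. \<Phi>' e ` cell_set one_point (d e))"
    proof cases
      case (2 e b u)
      show ?thesis
      proof (cases b)
        case True
        then have "x = \<Phi>' e ((), u)" "((), u) \<in> cell_set one_point (d e)" using 2 T by auto
        then show ?thesis using 2(1) by blast
      next
        case False
        then show ?thesis using 2 F x0 by simp
      qed
    qed simp
  next
    fix x assume "x \<in> Q \<union> (\<Union>e\<in>E. \<Phi>' e ` cell_set one_point (d e))"
    then consider "x \<in> Q" | e u where "e \<in> E" "u \<in> cube (d e)" "x = \<Phi> e (True, u)" using T by auto
    then show "x \<in> Q \<union> (\<Union>e\<in>E. \<Phi> e ` cell_set two_points (d e))" by auto
  qed
  have 2: "openin (cell_space two_points (d e)) (cell_preimage two_points (d e) (\<Phi> e) U)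
      \<longleftrightarrow> openin (cell_space one_point (d e)) (cell_preimage one_point (d e) (\<Phi>' e) U)" if "e \<in> E" for e U
  proof -
    have "{u \<in> cube (d e). \<Phi> e (True, u) \<in> U} = {u \<in> cube (d e). \<Phi>' e ((), u) \<in> U}"
      using T [OF that] by auto
    then show ?thesis
      using openin_cell_bool [of "d e" "\<Phi> e" x0 U] F [OF that] openin_cell_one_point [of "d e" "\<Phi>' e" U] by simp
  qed
  show ?thesis unfolding topology_eq openin_final_top 1 using 2 by simp
qed

lemma cell_complex_unit_if_bool:
  assumes "cell_complex two_points {False} True {x0} x0 E d \<Phi> rk"
  shows "ordinary_cells True x0 E d (unit_cell \<Phi>) rk"
    and "cells_top two_points {x0} E d \<Phi> = cells_top one_point {x0} E d (unit_cell \<Phi>)"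
proof -
  interpret cell_complex "two_points" "{False}" True "{x0}" x0 E d \<Phi> rk by fact
  have eq: "cells_top two_points {x0} E' d \<Phi> = cells_top one_point {x0} E' d (unit_cell \<Phi>)" if "E' \<subseteq> E" for E'
    by (rule final_top_bool_unit) (use B0 that in \<open>auto simp: unit_cell_def\<close>)
  show "cells_top two_points {x0} E d \<Phi> = cells_top one_point {x0} E d (unit_cell \<Phi>)" by (rule eq) simp
  have int: "(True, snd p) \<in> cell_int two_points {False} n" if "p \<in> cell_int one_point {} n" for p n
    using that by (auto simp: cell_int_def)
  show "ordinary_cells True x0 E d (unit_cell \<Phi>) rk"
  proof
    fix e assume e: "e \<in> E"
    show "0 < rk e" by (rule rk_pos [OF e])
    show "inj_on (unit_cell \<Phi> e) (cell_int one_point {} (d e))"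
    proof (rule inj_onI)
      fix p p' assume p: "p \<in> cell_int one_point {} (d e)" "p' \<in> cell_int one_point {} (d e)"
        and eq: "unit_cell \<Phi> e p = unit_cell \<Phi> e p'"
      have "(True, snd p) = (True, snd p')"
        by (rule inj_onD [OF inj_cell [OF e] _ int [OF p(1)] int [OF p(2)]]) (use eq in \<open>simp add: unit_cell_def\<close>)
      then show "p = p'" by (simp add: prod_eq_iff)
    qed
    show "unit_cell \<Phi> e p \<notin> {x0}" if "p \<in> cell_int one_point {} (d e)" for p
      using cell_new [OF e int [OF that]] by (simp add: unit_cell_def)
    show "e = e'" if "e' \<in> E" "p \<in> cell_int one_point {} (d e)" "p' \<in> cell_int one_point {} (d e')"
      "unit_cell \<Phi> e p = unit_cell \<Phi> e' p'" for e' p p'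
      using cells_disjoint [OF e that(1) int int, of p p'] that by (simp add: unit_cell_def)
    have sub: "{e' \<in> E. rk e' < rk e} \<subseteq> E" by blast
    show "continuous_map (cell_bd_space one_point (d e))
        (cells_top one_point {x0} {e' \<in> E. rk e' < rk e} d (unit_cell \<Phi>)) (unit_cell \<Phi> e)"
      using bd [OF e] unfolding eq [OF sub] continuous_map_from_prod_discrete unit_cell_def by simp
    show "unit_cell \<Phi> e (b, u) = x0" if "u \<in> cube_J (d e)" for b u using J [OF TrueI e] that by (simp add: unit_cell_def)
  qed auto
qed

lemma cell_complex_bool_if_unit:
  assumes "ordinary_cells True x0 E d \<Phi> rk"
  shows "cell_complex two_points {False} True {x0} x0 E d (bool_cell x0 \<Phi>) rk"
    and "cells_top two_points {x0} E d (bool_cell x0 \<Phi>) = cells_top one_point {x0} E d \<Phi>"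
proof -
  interpret cell_complex one_point "{}" True "{x0}" x0 E d \<Phi> rk by fact
  have eq: "cells_top two_points {x0} E' d (bool_cell x0 \<Phi>) =
      cells_top one_point {x0} E' d \<Phi>" for E' by (rule final_top_bool_unit) (auto simp: bool_cell_def)
  show "cells_top two_points {x0} E d (bool_cell x0 \<Phi>) = cells_top one_point {x0} E d \<Phi>" by (rule eq)
  have int: "fst p" "((), snd p) \<in> cell_int one_point {} n" if "p \<in> cell_int two_points {False} n" for p n
    using that by (auto simp: cell_int_def)
  show "cell_complex two_points {False} True {x0} x0 E d (bool_cell x0 \<Phi>) rk"
  proof
    fix e assume e: "e \<in> E"
    show "0 < rk e" by (rule rk_pos [OF e])
    show "inj_on (bool_cell x0 \<Phi> e) (cell_int two_points {False} (d e))"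
    proof (rule inj_onI)
      fix p p' assume p: "p \<in> cell_int two_points {False} (d e)" "p' \<in> cell_int two_points {False} (d e)"
        and eq: "bool_cell x0 \<Phi> e p = bool_cell x0 \<Phi> e p'"
      have "((), snd p) = ((), snd p')" by (rule inj_onD [OF inj_cell [OF e] _ int(2) [OF p(1)] int(2) [OF p(2)]])
          (use eq int(1) p in \<open>simp add: bool_cell_def\<close>)
      then show "p = p'" using int(1) [OF p(1)] int(1) [OF p(2)] by (simp add: prod_eq_iff)
    qed
    show "bool_cell x0 \<Phi> e p \<notin> {x0}" if "p \<in> cell_int two_points {False} (d e)" for p
      using cell_new [OF e int(2) [OF that]] int(1) [OF that] by (simp add: bool_cell_def)
    show "e = e'" if "e' \<in> E" "p \<in> cell_int two_points {False} (d e)"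
      "p' \<in> cell_int two_points {False} (d e')"
      "bool_cell x0 \<Phi> e p = bool_cell x0 \<Phi> e' p'" for e' p p'
      using cells_disjoint [OF e that(1) int(2) int(2), of p p'] that int(1) by (simp add: bool_cell_def)
    show "continuous_map (cell_bd_space two_points (d e))
        (cells_top two_points {x0} {e' \<in> E. rk e' < rk e} d (bool_cell x0 \<Phi>)) (bool_cell x0 \<Phi> e)"
      using bd [OF e] unfolding eq continuous_map_from_prod_discrete by (simp add: bool_cell_def)
    show "bool_cell x0 \<Phi> e (b, u) = x0" if "u \<in> cube_J (d e)" for b u using J [OF TrueI e] that by (simp add: bool_cell_def)
  qed (auto simp: bool_cell_def)
qed


section \<open>Ordinary complexes as spaces presented by cells\<close>

lemma continuous_map_cell_disk:
  shows "continuous_map (cell_space one_point n) (disk n) (\<lambda>p. cube_to_disk n (snd p))"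
    and "continuous_map (cell_bd_space one_point n) (disk_boundary n) (\<lambda>p. cube_to_disk n (snd p))"
    and "continuous_map (disk n) (cell_space one_point n) (\<lambda>x. ((), disk_to_cube n x))"
    and "continuous_map (disk_boundary n) (cell_bd_space one_point n) (\<lambda>x. ((), disk_to_cube n x))"
  using homeomorphic_maps_cube_disk [of n] continuous_map_compose [OF continuous_map_snd]
  by (auto simp: homeomorphic_maps_def continuous_map_from_prod_discrete continuous_map_pairwise o_def)

lemma openin_disk_iff:
  "openin (disk n) {x \<in> disk_set n. P x} \<longleftrightarrow>
     openin (cell_space one_point n) {p \<in> cell_set one_point n. P (cube_to_disk n (snd p))}"
proof -
  have "quotient_map (top_of_set (cube n)) (disk n) (cube_to_disk n)"
    using homeomorphic_maps_cube_disk(1) by (meson homeomorphic_maps_map homeomorphic_map_def)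
  from quotient_map_openin [OF this, of "{x \<in> disk_set n. P x}"]
  have "openin (disk n) {x \<in> disk_set n. P x} \<longleftrightarrow>
      openin (top_of_set (cube n)) {u \<in> cube n. cube_to_disk n u \<in> {x \<in> disk_set n. P x}}" by (simp add: topspace_disk)
  also have "{u \<in> cube n. cube_to_disk n u \<in> {x \<in> disk_set n. P x}} = {u \<in> cube n. P (cube_to_disk n u)}"
    using cube_to_disk_mem(1) by auto
  also have "openin (top_of_set (cube n)) {u \<in> cube n. P (cube_to_disk n u)} \<longleftrightarrow>
      openin (cell_space one_point n) {p \<in> cell_set one_point n. P (cube_to_disk n (snd p))}"
    using openin_cell_one_point [of n "\<lambda>p. P (cube_to_disk n (snd p))" "{True}"] by simp
  finally show ?thesis .
qed

lemma cell_int_one_point: "p \<in> cell_int one_point {} n \<longleftrightarrow> snd p \<in> cube_int n"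
  by (cases p) (simp add: cell_int_def)

lemma is_pushout_disks_iff:
  fixes J :: "'j set" and d :: "'j \<Rightarrow> nat"
  defines "W \<equiv> sum_topology (\<lambda>k. disk_boundary (d k)) J" and "C \<equiv> sum_topology (\<lambda>k. disk (d k)) J"
  assumes g: "continuous_map W Z g"
  shows "is_pushout Z W C X g id f h \<longleftrightarrow> inj_on f (topspace Z) \<and> inj_on h (topspace C - topspace W) \<and>
    f ` topspace Z \<inter> h ` (topspace C - topspace W) = {} \<and>
    (\<forall>w\<in>topspace W. f (g w) = h w) \<and> topspace X = f ` topspace Z \<union> h ` topspace C \<and>
    (\<forall>U\<subseteq>topspace X. openin X U \<longleftrightarrow> openin Z (preim Z f U) \<and> openin C (preim C h U))"
proof -
  have "continuous_map W C id"
  proof -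
    have 1: "W = final_top {} J (\<lambda>k. disk_boundary (d k)) Pair"
      unfolding W_def topology_eq openin_final_top openin_sum_topology
    proof
      fix U
      have "Sigma J (topspace \<circ> (\<lambda>k. disk_boundary (d k))) = {} \<union> (\<Union>k\<in>J. Pair k ` topspace (disk_boundary (d k)))"
        by auto
      moreover have "{p \<in> topspace (disk_boundary (d k)). (k, p) \<in> U} = {p. (k, p) \<in> U}"
        if "U \<subseteq> Sigma J (topspace \<circ> (\<lambda>k. disk_boundary (d k)))" for k using that by auto
      ultimately show "(U \<subseteq> Sigma J (topspace \<circ> (\<lambda>k. disk_boundary (d k))) \<and> (\<forall>k\<in>J. openin (disk_boundary (d k)) {x. (k, x) \<in> U})) =
        (U \<subseteq> {} \<union> (\<Union>k\<in>J. Pair k ` topspace (disk_boundary (d k))) \<and>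
         (\<forall>k\<in>J. openin (disk_boundary (d k)) {p \<in> topspace (disk_boundary (d k)). (k, p) \<in> U}))"
        by (metis (no_types, lifting))
    qed
    show ?thesis unfolding 1
    proof (rule continuous_map_from_final_top)
      fix k assume k: "k \<in> J"
      have "continuous_map (disk_boundary (d k)) (disk (d k)) id"
        using sphere_subset_disk [of "d k"] by (auto simp: disk_eq disk_boundary_eq)
      from continuous_map_compose [OF this continuous_map_component_injection [OF k, of "\<lambda>k. disk (d k)"]]
      show "continuous_map (disk_boundary (d k)) C (id \<circ> Pair k)" by (simp add: C_def)
    qed simp
  qed
  from is_pushout_iff [OF inj_on_id g this] show ?thesis by simp
qed

lemma attaches_if_attach_ordinary_cells:
  fixes Z X :: "'x topology"
  assumes "attach_ordinary_cells P Z X f"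
  obtains J :: "'x set" and d \<Phi> where "attaches one_point {} False Z z0 X f J d \<Phi>" "\<And>k. k \<in> J \<Longrightarrow> P (d k)"
proof -
  obtain J :: "'x set" and d g h where d: "\<forall>k\<in>J. P (d k)"
    and po: "is_pushout Z (sum_topology (\<lambda>k. disk_boundary (d k)) J) (sum_topology (\<lambda>k. disk (d k)) J) X g id f h"
    using assms unfolding attach_ordinary_cells_def by blast
  let ?W = "sum_topology (\<lambda>k. disk_boundary (d k)) J" and ?C = "sum_topology (\<lambda>k. disk (d k)) J"
  have g: "continuous_map ?W Z g" using po by (simp add: is_pushout_def)
  note P = po [unfolded is_pushout_disks_iff [OF g]]
  have CW: "topspace ?C - topspace ?W = Sigma J (\<lambda>k. disk_set (d k) - sphere_set (d k))"
    and topC: "topspace ?C = Sigma J (\<lambda>k. disk_set (d k))" and topW: "topspace ?W = Sigma J (\<lambda>k. sphere_set (d k))"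
    by (auto simp: topspace_disk topspace_disk_boundary)
  define \<Phi> where "\<Phi> = (\<lambda>k p. h (k, cube_to_disk (d k) (snd (p :: unit \<times> coords))))"
  have int: "(k, cube_to_disk (d k) (snd p)) \<in> topspace ?C - topspace ?W"
    if "k \<in> J" "p \<in> cell_int one_point {} (d k)" for k p
    using that cube_to_disk_mem(1,2) [of "snd p" "d k"] cube_int_subset cube_int_bd_disjoint unfolding CW cell_int_one_point by blast
  have int_onto: "\<exists>p\<in>cell_int one_point {} (d k). x = cube_to_disk (d k) (snd p)"
    if "x \<in> disk_set (d k) - sphere_set (d k)" for x k
  proof -
    have "disk_to_cube (d k) x \<in> cube_int (d k)" using that cube_to_disk_mem(3,4) [of x "d k"] cube_cases by blast
    then show ?thesis
      using disk_to_cube_inverse that by (intro bexI [of _ "((), disk_to_cube (d k) x)"]) (auto simp: cell_int_one_point)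
  qed
  have "attaches one_point {} False Z z0 X f J d \<Phi>"
  proof
    show "inj_on f (topspace Z)" using P by blast
    have hC: "h ` topspace ?C = h ` topspace ?W \<union> h ` (topspace ?C - topspace ?W)"
      using sphere_subset_disk unfolding topC topW by blast
    have hW: "h ` topspace ?W \<subseteq> f ` topspace Z"
    proof
      fix x assume "x \<in> h ` topspace ?W"
      then obtain w where w: "w \<in> topspace ?W" "x = h w" by blast
      then have "x = f (g w)" "g w \<in> topspace Z" using P g by (auto simp: continuous_map_def)
      then show "x \<in> f ` topspace Z" by blast
    qed
    have hCW: "h ` (topspace ?C - topspace ?W) = (\<Union>k\<in>J. \<Phi> k ` cell_int one_point {} (d k))"
    proof (intro equalityI subsetI)
      fix x assume "x \<in> h ` (topspace ?C - topspace ?W)"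
      then obtain k y where y: "k \<in> J" "y \<in> disk_set (d k) - sphere_set (d k)" "x = h (k, y)" unfolding CW by blast
      then obtain p where "p \<in> cell_int one_point {} (d k)" "y = cube_to_disk (d k) (snd p)" using int_onto by blast
      then show "x \<in> (\<Union>k\<in>J. \<Phi> k ` cell_int one_point {} (d k))" using y by (auto simp: \<Phi>_def)
    next
      fix x assume "x \<in> (\<Union>k\<in>J. \<Phi> k ` cell_int one_point {} (d k))"
      then obtain k p where "k \<in> J" "p \<in> cell_int one_point {} (d k)" "x = \<Phi> k p" by blast
      then show "x \<in> h ` (topspace ?C - topspace ?W)" using int by (simp add: \<Phi>_def)
    qed
    have "topspace X = f ` topspace Z \<union> h ` topspace ?C" using P by blast
    then show "topspace X = f ` topspace Z \<union> (\<Union>k\<in>J. \<Phi> k ` cell_int one_point {} (d k))"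
      unfolding hC hCW by (simp only: Un_assoc [symmetric] Un_absorb2 [OF hW])
    fix k assume k: "k \<in> J"
    show "\<Phi> k p \<noteq> f z" if "p \<in> cell_int one_point {} (d k)" "z \<in> topspace Z" for p z
    proof -
      have "f ` topspace Z \<inter> h ` (topspace ?C - topspace ?W) = {}" using P by blast
      then show ?thesis using int [OF k that(1)] that(2) unfolding \<Phi>_def by blast
    qed
    have hinj: "inj_on h (topspace ?C - topspace ?W)" using P by blast
    have inj: "k = \<beta> \<and> p = p'" if "\<beta> \<in> J" "p \<in> cell_int one_point {} (d k)" "p' \<in> cell_int one_point {} (d \<beta>)"
      "\<Phi> k p = \<Phi> \<beta> p'" for \<beta> p p'
    proof -
      have eq: "(k, cube_to_disk (d k) (snd p)) = (\<beta>, cube_to_disk (d \<beta>) (snd p'))"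
        by (rule inj_onD [OF hinj _ int [OF k that(2)] int [OF that(1,3)]]) (use that(4) in \<open>simp add: \<Phi>_def\<close>)
      then have "disk_to_cube (d k) (cube_to_disk (d k) (snd p)) = disk_to_cube (d \<beta>) (cube_to_disk (d \<beta>) (snd p'))"
        by (metis Pair_inject)
      moreover have "snd p \<in> cube (d k)" "snd p' \<in> cube (d \<beta>)"
        using that(2,3) cube_int_subset unfolding cell_int_one_point by blast+
      ultimately have "snd p = snd p'" by (simp add: cube_to_disk_inverse)
      then show ?thesis using eq by (simp add: prod_eq_iff)
    qed
    show "inj_on (\<Phi> k) (cell_int one_point {} (d k))" using inj [OF k] by (auto intro: inj_onI)
    show "k = \<beta>" if "\<beta> \<in> J" "p \<in> cell_int one_point {} (d k)" "p' \<in> cell_int one_point {} (d \<beta>)"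
      "\<Phi> k p = \<Phi> \<beta> p'" for \<beta> p p' using inj [OF that] by blast
    show "\<exists>g. continuous_map (cell_bd_space one_point (d k)) Z g \<and>
         (\<forall>p\<in>cell_bd_set one_point (d k). \<Phi> k p = f (g p))"
    proof (intro exI conjI ballI)
      have "continuous_map (cell_bd_space one_point (d k)) ?W (Pair k \<circ> (\<lambda>p. cube_to_disk (d k) (snd p)))"
        by (rule continuous_map_compose [OF continuous_map_cell_disk(2)
              continuous_map_component_injection [OF k, of "\<lambda>k. disk_boundary (d k)"]])
      from continuous_map_compose [OF this g]
      show "continuous_map (cell_bd_space one_point (d k)) Z (\<lambda>p. g (k, cube_to_disk (d k) (snd p)))" by (simp add: o_def)
      fix p assume "p \<in> cell_bd_set one_point (d k)"
      then have "snd p \<in> cube_bd (d k)" by auto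
      then have "(k, cube_to_disk (d k) (snd p)) \<in> topspace ?W"
        unfolding topW using k cube_to_disk_mem(2) [of "snd p" "d k"] cube_bd_subset by blast
      then show "\<Phi> k p = f (g (k, cube_to_disk (d k) (snd p)))" using P by (simp add: \<Phi>_def)
    qed
  next
    fix U assume U: "U \<subseteq> topspace X"
    have "{x. (k, x) \<in> preim ?C h U} = {x \<in> disk_set (d k). h (k, x) \<in> U}" if "k \<in> J" for k
      using that unfolding topC by blast
    then have "openin ?C (preim ?C h U) \<longleftrightarrow>
        (\<forall>k\<in>J. openin (disk (d k)) {x \<in> disk_set (d k). h (k, x) \<in> U})"
      unfolding openin_sum_topology topspace_sum_topology by auto
    also have "\<dots> \<longleftrightarrow> (\<forall>k\<in>J. openin (cell_space one_point (d k)) {p \<in> cell_set one_point (d k). \<Phi> k p \<in> U})"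
      unfolding openin_disk_iff \<Phi>_def ..
    finally have oC: "openin ?C (preim ?C h U) \<longleftrightarrow>
        (\<forall>k\<in>J. openin (cell_space one_point (d k)) {p \<in> cell_set one_point (d k). \<Phi> k p \<in> U})" .
    have "openin X U \<longleftrightarrow> openin Z (preim Z f U) \<and> openin ?C (preim ?C h U)"
      by (rule P [THEN conjunct2, THEN conjunct2, THEN conjunct2, THEN conjunct2, THEN conjunct2, rule_format, OF U])
    then show "openin X U = (openin Z (preim Z f U) \<and>
        (\<forall>k\<in>J. openin (cell_space one_point (d k)) {p \<in> cell_set one_point (d k). \<Phi> k p \<in> U}))"
      unfolding oC .
  qed auto
  then show thesis using that d by blast
qed

lemma attach_ordinary_cells_if_attaches:
  fixes Z X :: "'x topology" and E :: "'x set"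
  assumes at: "attaches one_point {} False Z z0 X f E d \<Phi>" and P: "\<And>e. e \<in> E \<Longrightarrow> P (d e)"
  shows "attach_ordinary_cells P Z X f"
proof -
  interpret attaches one_point "{}" False Z z0 X f E d \<Phi> by fact
  let ?W = "sum_topology (\<lambda>k. disk_boundary (d k)) E" and ?C = "sum_topology (\<lambda>k. disk (d k)) E"
  have CW: "topspace ?C - topspace ?W = Sigma E (\<lambda>k. disk_set (d k) - sphere_set (d k))"
    and topC: "topspace ?C = Sigma E (\<lambda>k. disk_set (d k))" and topW: "topspace ?W = Sigma E (\<lambda>k. sphere_set (d k))"
    by (auto simp: topspace_disk topspace_disk_boundary)
  obtain g' where g': "\<And>e. e \<in> E \<Longrightarrow> continuous_map (cell_bd_space one_point (d e)) Z (g' e)"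
    "\<And>e p. e \<in> E \<Longrightarrow> p \<in> cell_bd_set one_point (d e) \<Longrightarrow> \<Phi> e p = f (g' e p)"
    using bd by metis
  define h where "h = (\<lambda>(k, x). \<Phi> k ((), disk_to_cube (d k) x))"
  define g where "g = (\<lambda>(k, x). g' k ((), disk_to_cube (d k) x))"
  have gc: "continuous_map ?W Z g" unfolding continuous_map_def
  proof (intro conjI allI impI)
    have c: "continuous_map (disk_boundary (d k)) Z (\<lambda>x. g (k, x))" if "k \<in> E" for k
      using continuous_map_compose [OF continuous_map_cell_disk(4) g'(1) [OF that]] by (simp add: g_def o_def)
    show "g \<in> topspace ?W \<rightarrow> topspace Z"
    proof
      fix w assume "w \<in> topspace ?W"
      then obtain k x where w: "w = (k, x)" "k \<in> E" "x \<in> topspace (disk_boundary (d k))" by auto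
      show "g w \<in> topspace Z" using continuous_map_image_subset_topspace [OF c [OF w(2)]] w(1,3) by blast
    qed
    fix U assume U: "openin Z U"
    have "{x. (k, x) \<in> preim ?W g U} = {x \<in> topspace (disk_boundary (d k)). g (k, x) \<in> U}" if "k \<in> E" for k
      using that by auto
    then show "openin ?W (preim ?W g U)" unfolding openin_sum_topology topspace_sum_topology
      using openin_continuous_map_preimage [OF c U] by auto
  qed
  have int: "((), disk_to_cube (d k) x) \<in> cell_int one_point {} (d k)" if "x \<in> disk_set (d k) - sphere_set (d k)" for k x
    using that cube_to_disk_mem(3,4) [of x "d k"] cube_cases unfolding cell_int_one_point by fastforce
  have "is_pushout Z ?W ?C X g id f h" unfolding is_pushout_disks_iff [OF gc]
  proof (intro conjI ballI allI impI)
    show "inj_on f (topspace Z)" by (rule inj_f)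
    show "inj_on h (topspace ?C - topspace ?W)" unfolding CW
    proof (rule inj_onI)
      fix c c' assume "c \<in> Sigma E (\<lambda>k. disk_set (d k) - sphere_set (d k))"
        "c' \<in> Sigma E (\<lambda>k. disk_set (d k) - sphere_set (d k))" and eq: "h c = h c'"
      then obtain k x \<beta> y where c: "c = (k, x)" "k \<in> E" "x \<in> disk_set (d k) - sphere_set (d k)"
        "c' = (\<beta>, y)" "\<beta> \<in> E" "y \<in> disk_set (d \<beta>) - sphere_set (d \<beta>)" by auto
      have eq': "\<Phi> k ((), disk_to_cube (d k) x) = \<Phi> \<beta> ((), disk_to_cube (d \<beta>) y)"
        using eq c by (simp add: h_def)
      then have "k = \<beta>" using cells_disjoint [OF c(2,5) int [OF c(3)] int [OF c(6)]] by simp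
      moreover have "disk_to_cube (d k) x = disk_to_cube (d k) y"
        using inj_onD [OF inj_cell [OF c(2)] _ int [OF c(3)]] int [OF c(6)] eq' \<open>k = \<beta>\<close> by auto
      then have "cube_to_disk (d k) (disk_to_cube (d k) x) = cube_to_disk (d k) (disk_to_cube (d k) y)" by simp
      then have "x = y" using disk_to_cube_inverse c \<open>k = \<beta>\<close> by auto
      ultimately show "c = c'" using c by simp
    qed
    show "f ` topspace Z \<inter> h ` (topspace ?C - topspace ?W) = {}"
    proof -
      have "h c \<noteq> f z" if "c \<in> topspace ?C - topspace ?W" "z \<in> topspace Z" for c z
        using that(1) cell_new [OF _ int that(2)] unfolding CW by (auto simp: h_def)
      then show ?thesis by (intro equals0I) (elim IntE imageE, simp)
    qed
    show "f (g w) = h w" if "w \<in> topspace ?W" for w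
    proof -
      obtain k x where w: "w = (k, x)" "k \<in> E" "x \<in> sphere_set (d k)" using \<open>w \<in> topspace ?W\<close> unfolding topW by auto
      then have "disk_to_cube (d k) x \<in> cube_bd (d k)" using cube_to_disk_mem(4) [of x "d k"] sphere_subset_disk by blast
      then show ?thesis using g'(2) [OF w(2), of "((), disk_to_cube (d k) x)"] w by (simp add: g_def h_def)
    qed
    have hC: "h ` topspace ?C = (\<Union>k\<in>E. \<Phi> k ` cell_set one_point (d k))"
    proof (intro equalityI subsetI)
      fix x assume "x \<in> h ` topspace ?C"
      then obtain k y where "k \<in> E" "y \<in> disk_set (d k)" "x = \<Phi> k ((), disk_to_cube (d k) y)"
        unfolding topC h_def by auto
      then show "x \<in> (\<Union>k\<in>E. \<Phi> k ` cell_set one_point (d k))" using cube_to_disk_mem(3) by auto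
    next
      fix x assume "x \<in> (\<Union>k\<in>E. \<Phi> k ` cell_set one_point (d k))"
      then obtain k u where u: "k \<in> E" "u \<in> cube (d k)" "x = \<Phi> k ((), u)" by auto
      then have "x = h (k, cube_to_disk (d k) u)" by (simp add: h_def cube_to_disk_inverse)
      moreover have "(k, cube_to_disk (d k) u) \<in> topspace ?C" using u cube_to_disk_mem(1) unfolding topC by blast
      ultimately show "x \<in> h ` topspace ?C" by blast
    qed
    have "cell_int one_point {} n \<subseteq> cell_set one_point n" for n using cube_int_subset by (auto simp: cell_int_def)
    then have "f ` topspace Z \<union> (\<Union>k\<in>E. \<Phi> k ` cell_int one_point {} (d k)) \<subseteq>
        f ` topspace Z \<union> (\<Union>k\<in>E. \<Phi> k ` cell_set one_point (d k))"
      by (intro Un_mono UN_mono image_mono subset_refl)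
    moreover have "f ` topspace Z \<union> (\<Union>k\<in>E. \<Phi> k ` cell_set one_point (d k)) \<subseteq> topspace X"
    using points cell_image by fastforce
    ultimately show "topspace X = f ` topspace Z \<union> h ` topspace ?C" unfolding hC points by (rule subset_antisym)
    fix U assume U: "U \<subseteq> topspace X"
    have "{x. (k, x) \<in> preim ?C h U} = {x \<in> disk_set (d k). h (k, x) \<in> U}" if "k \<in> E" for k
      using that unfolding topC by blast
    then have "openin ?C (preim ?C h U) \<longleftrightarrow>
        (\<forall>k\<in>E. openin (disk (d k)) {x \<in> disk_set (d k). h (k, x) \<in> U})"
      unfolding openin_sum_topology topspace_sum_topology by auto
    also have "\<dots> \<longleftrightarrow> (\<forall>k\<in>E. openin (cell_space one_point (d k)) {p \<in> cell_set one_point (d k). \<Phi> k p \<in> U})"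
    proof -
      have "{p \<in> cell_set one_point (d k). h (k, cube_to_disk (d k) (snd p)) \<in> U} =
          {p \<in> cell_set one_point (d k). \<Phi> k p \<in> U}" for k by (auto simp: h_def cube_to_disk_inverse)
      then show ?thesis unfolding openin_disk_iff by simp
    qed
    finally show "openin X U = (openin Z (preim Z f U) \<and> openin ?C (preim ?C h U))" using open_iff [OF U] by simp
  qed
  then show ?thesis unfolding attach_ordinary_cells_def using P by blast
qed

text \<open>In an ordinary complex the base point is a 0-cell. The next lemma takes it as the start of the
  filtration instead, and the one after it reverts this.\<close>

lemma cell_complex_base_cell:
  assumes cc: "cell_complex one_point {} False {} x0 E d \<Phi> rk"
    and e0: "e0 \<in> E" "d e0 = 0" "\<Phi> e0 ((), \<lambda>_. 0) = x0"
  shows "ordinary_cells False x0 (E - {e0}) d \<Phi> rk"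
    and "cells_top one_point {} E d \<Phi> = cells_top one_point {x0} (E - {e0}) d \<Phi>"
proof -
  interpret cell_complex one_point "{}" False "{}" x0 E d \<Phi> rk by fact
  have e0p: "\<Phi> e0 p = x0" if "p \<in> cell_set one_point (d e0)" for p using that e0 by auto
  show "ordinary_cells False x0 (E - {e0}) d \<Phi> rk"
  proof
    fix e assume e: "e \<in> E - {e0}"
    have "continuous_map (cells_top one_point {} {e' \<in> E. rk e' < rk e} d \<Phi>)
        (cells_top one_point {x0} {e' \<in> E - {e0}. rk e' < rk e} d \<Phi>) id" (is "continuous_map _ ?T _")
    proof (rule continuous_map_from_final_top)
      fix e' assume e': "e' \<in> {e' \<in> E. rk e' < rk e}"
      show "continuous_map (cell_space one_point (d e')) ?T (id \<circ> \<Phi> e')"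
      proof (cases "e' = e0")
        case True
        have "continuous_map (cell_space one_point (d e')) ?T (\<lambda>_. x0)" by simp
        then show ?thesis by (rule continuous_map_eq) (use e0p True in auto)
      next
        case False
        then show ?thesis
          using continuous_map_into_final_top [of e' "{e' \<in> E - {e0}. rk e' < rk e}" "\<lambda>e. cell_space one_point (d e)" "{x0}" \<Phi>] e'
          by simp
      qed
    qed simp
    have "e \<in> E" using e by simp
    from continuous_map_compose [OF bd [OF this] \<open>continuous_map _ ?T id\<close>]
    show "continuous_map (cell_bd_space one_point (d e))
        (cells_top one_point {x0} {e' \<in> E - {e0}. rk e' < rk e} d \<Phi>) (\<Phi> e)" by simp
    show "\<Phi> e p \<notin> {x0}" if "p \<in> cell_int one_point {} (d e)" for p
    proof -
      have "((), \<lambda>_. 0) \<in> cell_int one_point {} (d e0)" by (simp add: cell_int_def e0)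
      then show ?thesis using cells_disjoint [of e e0 p "((), \<lambda>_. 0)"] e that e0 by auto
    qed
  qed (use rk_pos inj_cell cells_disjoint in auto)
  have 1: "openin (cell_space one_point (d e0)) {p \<in> cell_set one_point (d e0). \<Phi> e0 p \<in> U}" for U
  proof -
    have "{p \<in> cell_set one_point (d e0). \<Phi> e0 p \<in> U} =
        (if x0 \<in> U then cell_set one_point (d e0) else {})" using e0p by auto
    then show ?thesis by (cases "x0 \<in> U") (simp_all only: if_True if_False openin_topspace openin_empty)
  qed
  have "\<Phi> e0 ` cell_set one_point (d e0) = {x0}" using e0 by auto
  then have 2: "{} \<union> (\<Union>e\<in>E. \<Phi> e ` cell_set one_point (d e)) =
      {x0} \<union> (\<Union>e\<in>E - {e0}. \<Phi> e ` cell_set one_point (d e))" using e0(1) by blast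
  show "cells_top one_point {} E d \<Phi> = cells_top one_point {x0} (E - {e0}) d \<Phi>"
    unfolding topology_eq openin_final_top 2 using 1 by blast
qed

lemma cell_complex_add_base_cell:
  assumes cc: "ordinary_cells False x0 E d \<Phi> (\<lambda>e. Suc (d e))"
  defines "E' \<equiv> insert None (Some ` E)" and "d' \<equiv> case_option 0 d" and "\<Phi>' \<equiv> case_option (\<lambda>_. x0) \<Phi>"
  shows "cell_complex one_point {} False {} x0 E' d' \<Phi>' (\<lambda>e. Suc (d' e))"
    and "cells_top one_point {x0} E d \<Phi> = cells_top one_point {} E' d' \<Phi>'"
proof -
  interpret cell_complex one_point "{}" False "{x0}" x0 E d \<Phi> "\<lambda>e. Suc (d e)" by fact
  have opn: "openin (cell_space one_point (d' None)) {p \<in> cell_set one_point (d' None). \<Phi>' None p \<in> U}" for U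
  proof -
    have "{p \<in> cell_set one_point (d' None). \<Phi>' None p \<in> U} =
        (if x0 \<in> U then cell_set one_point (d' None) else {})" by (auto simp: \<Phi>'_def)
    then show ?thesis by (cases "x0 \<in> U") (simp_all only: if_True if_False openin_topspace openin_empty)
  qed
  have eq: "cells_top one_point {x0} E1 d \<Phi> = cells_top one_point {} (insert None (Some ` E1)) d' \<Phi>'" for E1
  proof -
    have "{x0} \<union> (\<Union>e\<in>E1. \<Phi> e ` cell_set one_point (d e)) =
        {} \<union> (\<Union>e\<in>insert None (Some ` E1). \<Phi>' e ` cell_set one_point (d' e))" by (simp add: \<Phi>'_def d'_def)
    then show ?thesis unfolding topology_eq openin_final_top using opn by (simp add: \<Phi>'_def d'_def)
  qed
  show "cells_top one_point {x0} E d \<Phi> = cells_top one_point {} E' d' \<Phi>'" unfolding E'_def by (rule eq)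
  show "cell_complex one_point {} False {} x0 E' d' \<Phi>' (\<lambda>e. Suc (d' e))"
  proof
    fix e assume e: "e \<in> E'"
    show "inj_on (\<Phi>' e) (cell_int one_point {} (d' e))"
      using e inj_cell by (cases e) (auto simp: E'_def \<Phi>'_def d'_def cell_int_def)
    show "e = e'" if "e' \<in> E'" "p \<in> cell_int one_point {} (d' e)" "p' \<in> cell_int one_point {} (d' e')"
      "\<Phi>' e p = \<Phi>' e' p'" for e' p p'
      using e that cells_disjoint [of "the e" "the e'" p p'] cell_new [of "the e" p] cell_new [of "the e'" p']
      by (cases e; cases e') (auto simp: E'_def \<Phi>'_def d'_def)
    show "continuous_map (cell_bd_space one_point (d' e))
        (cells_top one_point {} {e' \<in> E'. Suc (d' e') < Suc (d' e)} d' \<Phi>') (\<Phi>' e)"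
    proof (cases "d' e = 0")
      case True
      have "cell_bd_set one_point (d' e) = {}" unfolding True by simp
      then show ?thesis by (simp add: null_topspace_iff_trivial)
    next
      case False
      then obtain a where a: "e = Some a" "a \<in> E" using e by (auto simp: E'_def d'_def)
      have "{e' \<in> E'. Suc (d' e') < Suc (d' e)} = insert None (Some ` {e' \<in> E. Suc (d e') < Suc (d a)})"
        using False by (auto simp: E'_def d'_def a)
      then show ?thesis using bd [OF a(2)] unfolding eq by (simp add: a \<Phi>'_def d'_def)
    qed
  qed auto
qed

lemma finite_dim_ordinary_CW_complex_cells:
  fixes A :: "'a pointed"
  assumes A: "finite_dim_ordinary_CW_complex A"
  obtains E :: "(nat \<times> 'a) set" and d \<Phi> rk N
  where "ordinary_cells False (basept A) E d \<Phi> rk"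
    "underlying A = cells_top one_point {basept A} E d \<Phi>"
    "\<And>e. e \<in> E \<Longrightarrow> rk e \<le> N"
proof -
  obtain F j c where S: "ordinary_CW_structure A F j c" and fd: "finite_dim_filtration (underlying A) F c"
    using A unfolding finite_dim_ordinary_CW_complex_def by blast
  have F0: "topspace (F 0) = {}" and F: "\<And>n. attach_ordinary_cells (\<lambda>d. d = n) (F n) (F (Suc n)) (j n)"
    and colim: "is_seq_colimit F j (underlying A) c" and base: "basept A \<in> c 1 ` topspace (F 1)"
    using S unfolding ordinary_CW_structure_def by auto
  \<comment> \<open>The filtration of an ordinary complex starts with the empty space, so there is
    no base point to name; \<open>undefined\<close> fills the place of \<open>z0\<close>.\<close>
  have "\<exists>(E :: 'a set) d \<Phi>. attaches one_point {} False (F n) undefined (F (Suc n)) (j n) E d \<Phi> \<and> (\<forall>e\<in>E. d e = n)" for n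
    using attaches_if_attach_ordinary_cells [OF F] by metis
  then obtain J :: "nat \<Rightarrow> 'a set" and d \<Phi> where
    at: "\<And>n. attaches one_point {} False (F n) undefined (F (Suc n)) (j n) (J n) (d n) (\<Phi> n)"
    and d: "\<And>n e. e \<in> J n \<Longrightarrow> d n e = n" by metis
  note top_F0 = F0
  interpret attaching_sequence one_point "{}" False F "\<lambda>_. undefined" j c "underlying A" "basept A" J d \<Phi>
    by (rule attaching_sequence.intro) (use at F0 colim in auto)
  have cc: "cell_complex one_point {} False {} (basept A) cells cell_dim cell_char cell_rank" using cell_complex top_F0 by simp
  obtain y where y: "y \<in> topspace (F 1)" "basept A = c 1 y" using base by blast
  \<comment> \<open>The base point lies in the 0-skeleton, which consists of 0-cells alone; hence it
    is the cell \<open>(0, k)\<close> for some \<open>k\<close>.\<close>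
  have "topspace (F (Suc 0)) = (\<Union>e\<in>J 0. \<Phi> 0 e ` cell_int one_point {} (d 0 e))"
    using attaches.points [OF at, of 0] top_F0 by simp
  then obtain k where k: "k \<in> J 0" "y \<in> \<Phi> 0 k ` cell_int one_point {} (d 0 k)" using y by auto
  then have y0: "y = \<Phi> 0 k ((), \<lambda>_. 0)" using d [OF k(1)] by (auto simp: cell_int_def)
  have e0: "(0, k) \<in> cells" "cell_dim (0, k) = 0" "cell_char (0, k) ((), \<lambda>_. 0) = basept A"
    using k(1) d [OF k(1)] y y0 by (auto simp: cells_def cell_dim_def cell_char_def)
  obtain N where "homeomorphic_map (F N) (underlying A) (c N)" using fd unfolding finite_dim_filtration_def by blast
  then have "pts A = c N ` topspace (F N)" by (auto simp: homeomorphic_map_def quotient_map_def)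
  then have "cell_rank e \<le> N" if "e \<in> cells" for e using cell_rank_le [of "()" N e] that by simp
  moreover have "underlying A = cells_top one_point {} cells cell_dim cell_char" using total top_F0 by simp
  ultimately show thesis
    using cell_complex_base_cell [OF cc e0] by (intro that [of "cells - {(0, k)}" cell_dim cell_char cell_rank N]) auto
qed

lemma generalized_ordinary_CW_complex_if_cells:
  fixes X :: "'x pointed" and E :: "'e set"
  assumes cc: "ordinary_cells False (basept X) E d \<Phi> rk" and X: "underlying X = cells_top one_point {basept X} E d \<Phi>"
  shows "generalized_ordinary_CW_complex X"
proof -
  obtain E' :: "'x set" and d' \<Phi>' rk' where
    cc': "ordinary_cells False (basept X) E' d' \<Phi>' rk'"
    and X': "underlying X = cells_top one_point {basept X} E' d' \<Phi>'"
    using cell_complex_index_by_points [OF cc, of "()"] unfolding X by (metis Diff_empty insertI1 topspace_discrete_topology)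
  interpret cell_complex one_point "{}" False "{basept X}" "basept X" E' d' \<Phi>' rk' by (rule cc')
  have X: "underlying X = total" using X' by (simp add: total_def)
  show ?thesis unfolding generalized_ordinary_CW_complex_def
  proof (intro exI conjI allI)
    show "topspace (stage (Suc 0)) = {basept X}" by (simp add: topspace_stage_1)
    show "id (basept X) = basept X" by simp
    show "attach_ordinary_cells (\<lambda>_. True) (stage (Suc n)) (stage (Suc (Suc n))) id" for n
      by (rule attach_ordinary_cells_if_attaches [OF attaches_stage]) simp
    show "is_seq_colimit (\<lambda>n. stage (Suc n)) (\<lambda>_. id) (underlying X) (\<lambda>_. id)"
      using is_seq_colimit_stage X by simp
  qed
qed

lemma ordinary_CW_complex_if_cells:
  fixes X :: "'x pointed" and E :: "'e set"
  assumes cc: "ordinary_cells False (basept X) E d \<Phi> (\<lambda>e. Suc (d e))"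
    and X: "underlying X = cells_top one_point {basept X} E d \<Phi>"
  shows "ordinary_CW_complex X"
proof -
  note cc1 = cell_complex_add_base_cell [OF cc]
  define F where "F = insert None (Some ` E)"
  define dF where "dF = case_option 0 d"
  define \<Psi> where "\<Psi> = case_option (\<lambda>_. basept X) \<Phi>"
  have cc2: "cell_complex one_point {} False {} (basept X) F dF \<Psi> (\<lambda>e. Suc (dF e))"
    and X2: "underlying X = cells_top one_point {} F dF \<Psi>" using cc1 X by (auto simp: F_def dF_def \<Psi>_def)
  obtain E' :: "'x set" and k where k: "bij_betw k E' F"
    and cc': "cell_complex one_point {} False {} (basept X) E' (dF \<circ> k) (\<Psi> \<circ> k) ((\<lambda>e. Suc (dF e)) \<circ> k)"
    and X': "underlying X = cells_top one_point {} E' (dF \<circ> k) (\<Psi> \<circ> k)"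
    using cell_complex_index_by_points [OF cc2, of "()"] unfolding X2 by (metis Diff_empty insertI1 topspace_discrete_topology)
  interpret cell_complex one_point "{}" False "{}" "basept X" E' "dF \<circ> k" "\<Psi> \<circ> k" "(\<lambda>e. Suc (dF e)) \<circ> k"
    by (rule cc')
  have X: "underlying X = total" using X' by (simp add: total_def)
  have "None \<in> F" by (simp add: F_def)
  then obtain a where a: "a \<in> E'" "k a = None" using k by (metis bij_betw_imp_surj_on imageE)
  show ?thesis unfolding ordinary_CW_complex_def ordinary_CW_structure_def
  proof (intro exI conjI allI)
    show "topspace (stage (Suc 0)) = {}" by (simp add: topspace_stage_1)
    show "attach_ordinary_cells (\<lambda>d. d = n) (stage (Suc n)) (stage (Suc (Suc n))) id" for n
      by (rule attach_ordinary_cells_if_attaches [OF attaches_stage]) simp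
    show "is_seq_colimit (\<lambda>n. stage (Suc n)) (\<lambda>_. id) (underlying X) (\<lambda>_. id)"
      using is_seq_colimit_stage X by simp
    have "basept X \<in> topspace (stage (Suc 1))" unfolding topspace_stage using a by (force simp: dF_def \<Psi>_def)
    then show "basept X \<in> id ` topspace (stage (Suc 1))" by simp
  qed
qed

section \<open>Maps of low-dimensional compacta miss points\<close>

definition l1_dist :: "nat \<Rightarrow> coords \<Rightarrow> coords \<Rightarrow> real" where
  "l1_dist n x y = (\<Sum>i<n. \<bar>x i - y i\<bar>)"

definition lipschitz_l1 :: "nat \<Rightarrow> coords set \<Rightarrow> (coords \<Rightarrow> real) \<Rightarrow> bool" where
  "lipschitz_l1 n K f \<longleftrightarrow> (\<exists>L\<ge>0. \<forall>x\<in>K. \<forall>y\<in>K. \<bar>f x - f y\<bar> \<le> L * l1_dist n x y)"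

lemma l1_dist_nonneg: "0 \<le> l1_dist n x y" by (simp add: l1_dist_def)

text \<open>Stone-Weierstrass for the ring of continuous Lipschitz functions on \<open>K\<close>:
  coordinates separate points, and a product of two members is Lipschitz because both are bounded on
  the compact set.\<close>

lemma lipschitz_approximation:
  assumes K: "compact K" "K \<subseteq> cube n" and f: "continuous_on K f" and e: "0 < e"
  obtains g where "continuous_on K g" "lipschitz_l1 n K g" "\<And>x. x \<in> K \<Longrightarrow> \<bar>f x - g x\<bar> < e"
proof -
  define R where "R = {g. continuous_on K g \<and> lipschitz_l1 n K g}"
  have "function_ring_on R K"
  proof
    show "compact K" by fact
    show "continuous_on K g" if "g \<in> R" for g using that by (simp add: R_def)
    show "(\<lambda>_. c) \<in> R" for c by (auto simp: R_def lipschitz_l1_def intro!: exI [of _ 0])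
    show "\<exists>f\<in>R. f x \<noteq> f y" if "x \<in> K" "y \<in> K" "x \<noteq> y" for x y
    proof -
      obtain i where i: "x i \<noteq> y i" using \<open>x \<noteq> y\<close> by auto
      have "x \<in> cube n" "y \<in> cube n" using that K(2) by auto
      then have "i < n" using i by (metis (mono_tags, lifting) cube_def mem_Collect_eq not_less)
      have "\<bar>u i - v i\<bar> \<le> l1_dist n u v" for u v
        unfolding l1_dist_def using member_le_sum [of i "{..<n}" "\<lambda>i. \<bar>u i - v i\<bar>"] \<open>i < n\<close> by simp
      then have "(\<lambda>u. u i) \<in> R" by (auto simp: R_def lipschitz_l1_def continuous_on_coordinate intro!: exI [of _ 1])
      then show ?thesis using i by (intro bexI [of _ "\<lambda>u. u i"])
    qed
    fix f g assume fg: "f \<in> R" "g \<in> R"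
    obtain L M where L: "0 \<le> L" "\<And>x y. x \<in> K \<Longrightarrow> y \<in> K \<Longrightarrow> \<bar>f x - f y\<bar> \<le> L * l1_dist n x y"
      and M: "0 \<le> M" "\<And>x y. x \<in> K \<Longrightarrow> y \<in> K \<Longrightarrow> \<bar>g x - g y\<bar> \<le> M * l1_dist n x y"
      using fg by (auto simp: R_def lipschitz_l1_def)
    have cont: "continuous_on K f" "continuous_on K g" using fg by (auto simp: R_def)
    show "(\<lambda>x. f x + g x) \<in> R"
    proof -
      have "\<bar>(f x + g x) - (f y + g y)\<bar> \<le> (L + M) * l1_dist n x y" if "x \<in> K" "y \<in> K" for x y
        using L(2) [OF that] M(2) [OF that] unfolding distrib_right by linarith
      then show ?thesis using cont L(1) M(1) by (auto simp: R_def lipschitz_l1_def intro!: continuous_intros exI [of _ "L + M"])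
    qed
    show "(\<lambda>x. f x * g x) \<in> R"
    proof -
      have "bounded (f ` K)" "bounded (g ` K)"
        using compact_continuous_image [OF cont(1) K(1)] compact_continuous_image [OF cont(2) K(1)]
        by (auto intro: compact_imp_bounded)
      then obtain b c where "\<And>x. x \<in> K \<Longrightarrow> \<bar>f x\<bar> \<le> b" "\<And>x. x \<in> K \<Longrightarrow> \<bar>g x\<bar> \<le> c"
        unfolding bounded_iff by auto
      then have bc: "\<bar>f x\<bar> \<le> \<bar>b\<bar>" "\<bar>g x\<bar> \<le> \<bar>c\<bar>" if "x \<in> K" for x using that by force+
      have "\<bar>f x * g x - f y * g y\<bar> \<le> (\<bar>b\<bar> * M + L * \<bar>c\<bar>) * l1_dist n x y" if "x \<in> K" "y \<in> K" for x y
      proof -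
        have "f x * g x - f y * g y = f x * (g x - g y) + (f x - f y) * g y" by (simp add: algebra_simps)
        also have "\<bar>\<dots>\<bar> \<le> \<bar>f x\<bar> * \<bar>g x - g y\<bar> + \<bar>f x - f y\<bar> * \<bar>g y\<bar>"
          by (metis abs_mult abs_triangle_ineq)
        also have "\<dots> \<le> \<bar>b\<bar> * (M * l1_dist n x y) + (L * l1_dist n x y) * \<bar>c\<bar>"
          using bc that L M l1_dist_nonneg [of n x y] by (intro add_mono mult_mono) auto
        finally show ?thesis by (simp add: algebra_simps)
      qed
      then show ?thesis using cont L(1) M(1)
        by (auto simp: R_def lipschitz_l1_def intro!: continuous_intros exI [of _ "\<bar>b\<bar> * M + L * \<bar>c\<bar>"])
    qed
  qed
  then obtain g where "g \<in> R" "\<forall>x\<in>K. \<bar>f x - g x\<bar> < e"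
    using function_ring_on.Stone_Weierstrass_basic [OF _ f e] by blast
  then show thesis using that by (auto simp: R_def)
qed

text \<open>Pigeonhole: at scale \<open>1/M\<close> a box in \<open>\<real>\<^sup>m\<close> has \<open>M\<^sup>m\<close> grid points, whereas the boundary of the
  \<open>n\<close>-cube is covered by \<open>O(M\<^sup>n\<^sup>-\<^sup>1)\<close> sets whose images each contain at most one grid point.\<close>

lemma lipschitz_misses_point:
  fixes g :: "nat \<Rightarrow> coords \<Rightarrow> real"
  assumes K: "K \<subseteq> cube_bd n" and nm: "n \<le> m" and ab: "a < b"
    and g: "\<And>i. i < m \<Longrightarrow> lipschitz_l1 n K (g i)"
  obtains y where "\<And>i. i < m \<Longrightarrow> a \<le> y i \<and> y i \<le> b" "\<And>i. i \<ge> m \<Longrightarrow> y i = 0"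
    "\<And>x. x \<in> K \<Longrightarrow> \<exists>i<m. g i x \<noteq> y i"
proof (cases "n = 0")
  case True
  then have "K = {}" using K by simp
  then show thesis using that [of "\<lambda>i. if i < m then a else 0"] ab by auto
next
  case False
  note point = that
  have n: "1 \<le> n" using False by simp
  have "\<exists>L\<ge>0. \<forall>i<m. \<forall>x\<in>K. \<forall>y\<in>K. \<bar>g i x - g i y\<bar> \<le> L * l1_dist n x y"
  proof -
    obtain L where L: "\<And>i. i < m \<Longrightarrow> 0 \<le> L i" "\<And>i x y. i < m \<Longrightarrow> x \<in> K \<Longrightarrow> y \<in> K \<Longrightarrow> \<bar>g i x - g i y\<bar> \<le> L i * l1_dist n x y"
      using g unfolding lipschitz_l1_def by metis
    have "\<bar>g i x - g i y\<bar> \<le> (\<Sum>i<m. L i) * l1_dist n x y" if "i < m" "x \<in> K" "y \<in> K" for i x y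
    proof -
      have "L i \<le> (\<Sum>i<m. L i)" using L(1) that by (intro member_le_sum) auto
      then show ?thesis using L(2) [OF that] l1_dist_nonneg [of n x y] by (meson mult_right_mono order_trans)
    qed
    then show ?thesis using L(1) by (intro exI [of _ "\<Sum>i<m. L i"]) (auto intro: sum_nonneg)
  qed
  then obtain L where L: "0 \<le> L" "\<And>i x y. i < m \<Longrightarrow> x \<in> K \<Longrightarrow> y \<in> K \<Longrightarrow> \<bar>g i x - g i y\<bar> \<le> L * l1_dist n x y"
    by blast
  \<comment> \<open>Chosen so that \<open>L * n / N < (b - a) / M\<close> for
    \<open>N = p * M\<close>: two points that agree up to \<open>1 / N\<close> in every coordinate
    have images closer than the grid spacing.\<close>
  obtain p :: nat where p: "L * n / (b - a) < p" using reals_Archimedean2 by blast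
  then have p0: "0 < p" using L(1) ab by (metis divide_nonneg_pos diff_gt_0_iff_gt mult_nonneg_nonneg of_nat_0_le_iff
        of_nat_0_less_iff order_le_less_trans)
  \<comment> \<open>There will be at most
    \<open>2 * n * (2 * N) ^ (n - 1) = (M - 1) * M ^ (n - 1)\<close> buckets, which is less than
    \<open>M ^ n\<close>.\<close>
  define M where "M = 2 * n * (2 * p) ^ (n - 1) + 1"
  define N where "N = p * M"
  have M0: "0 < M" by (simp add: M_def)
  have N0: "0 < N" using M0 p0 by (simp add: N_def)
  define grid where "grid = PiE {..<m} (\<lambda>_. {..<M})"
  define pt where "pt = (\<lambda>s i. if i < m then a + (b - a) * real (s i) / real M else 0)"
  \<comment> \<open>A bucket records a face of the cube, by its coordinate and its side, and the
    integer parts of \<open>N\<close> times the other coordinates.\<close>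
  define buckets where "buckets = (SIGMA j:{..<n}. (UNIV :: bool set) \<times> PiE ({..<n} - {j}) (\<lambda>_. {..N}))"
  have card_grid: "card grid = M ^ m" by (simp add: grid_def card_PiE)
  have "card buckets = (\<Sum>j<n. 2 * (N + 1) ^ (n - 1))" by (auto simp: card_cartesian_product card_PiE finite_PiE buckets_def)
  also have "\<dots> = 2 * n * (N + 1) ^ (n - 1)" by simp
  also have "\<dots> \<le> 2 * n * (2 * N) ^ (n - 1)" using N0 by (intro mult_left_mono power_mono) auto
  also have "\<dots> = (M - 1) * M ^ (n - 1)"
  proof -
    have "(2 * N) ^ (n - 1) = (2 * p) ^ (n - 1) * M ^ (n - 1)" unfolding N_def by (metis mult.assoc power_mult_distrib)
    moreover have "M - 1 = 2 * n * (2 * p) ^ (n - 1)" by (simp add: M_def)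
    ultimately show ?thesis by (simp only: mult.assoc)
  qed
  also have "\<dots> < M * M ^ (n - 1)" using M0 by simp
  also have "\<dots> = M ^ n" using n by (metis One_nat_def Suc_diff_le diff_Suc_Suc diff_zero power_Suc)
  also have "\<dots> \<le> M ^ m" using nm M0 by (intro power_increasing) auto
  finally have card_less: "card buckets < card grid" using card_grid by simp
  have fin: "finite buckets" by (auto simp: buckets_def intro!: finite_SigmaI finite_cartesian_product finite_PiE)
  show thesis
  proof (rule ccontr)
    assume "\<not> thesis"
    have "\<exists>x\<in>K. \<forall>i<m. g i x = pt s i" if s: "s \<in> grid" for s
    proof (rule ccontr)
      assume "\<not> (\<exists>x\<in>K. \<forall>i<m. g i x = pt s i)"
      moreover have "a \<le> pt s i \<and> pt s i \<le> b" if "i < m" for i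
      proof -
        have "s i < M" using s that by (auto simp: grid_def)
        then have "real (s i) / real M \<le> 1" "0 \<le> real (s i) / real M" by auto
        then have "(b - a) * (real (s i) / real M) \<le> b - a" "0 \<le> (b - a) * (real (s i) / real M)"
          using ab mult_left_le [of "real (s i) / real M" "b - a"] by auto
        then show ?thesis using that by (simp add: pt_def)
      qed
      moreover have "pt s i = 0" if "i \<ge> m" for i using that by (simp add: pt_def)
      ultimately have thesis by (intro point [of "pt s"]) blast+
      then show False using \<open>\<not> thesis\<close> by simp
    qed
    then obtain x where x: "\<And>s. s \<in> grid \<Longrightarrow> x s \<in> K" "\<And>s i. s \<in> grid \<Longrightarrow> i < m \<Longrightarrow> g i (x s) = pt s i"
      by metis
    have "\<exists>j<n. u j = 0 \<or> u j = 1" if "u \<in> K" for u using that K by (auto simp: cube_bd_def)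
    then obtain j where j: "\<And>u. u \<in> K \<Longrightarrow> j u < n" "\<And>u. u \<in> K \<Longrightarrow> u (j u) = 0 \<or> u (j u) = (1::real)" by metis
    define bucket where "bucket u = (j u, u (j u) = 1, restrict (\<lambda>l. nat \<lfloor>real N * u l\<rfloor>) ({..<n} - {j u}))"
      for u :: "nat \<Rightarrow> real"
    have "bucket (x s) \<in> buckets" if s: "s \<in> grid" for s
    proof -
      have "x s \<in> cube n" using x(1) [OF s] K cube_bd_subset by blast
      then have "nat \<lfloor>real N * x s l\<rfloor> \<le> N" if "l < n" for l
      proof -
        have "real N * x s l \<le> real N" using \<open>x s \<in> cube n\<close> that by (intro mult_left_le) (auto simp: cube_def)
        then show ?thesis by (simp add: nat_le_iff floor_le_iff)
      qed
      then show ?thesis using j(1) [OF x(1) [OF s]] by (auto simp: bucket_def buckets_def)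
    qed
    then have "(\<lambda>s. bucket (x s)) ` grid \<subseteq> buckets" by blast
    then have "card ((\<lambda>s. bucket (x s)) ` grid) < card grid" using card_mono [OF fin] card_less by (meson order_le_less_trans)
    then have "\<not> inj_on (\<lambda>s. bucket (x s)) grid" using card_image by fastforce
    then obtain s s' where s: "s \<in> grid" "s' \<in> grid" "s \<noteq> s'" "bucket (x s) = bucket (x s')" by (auto simp: inj_on_def)
    define u v where "u = x s" and "v = x s'"
    have uv: "u \<in> K" "v \<in> K" using x(1) s by (auto simp: u_def v_def)
    then have uvc: "u \<in> cube n" "v \<in> cube n" using K cube_bd_subset by blast+
    have juv: "j u = j v" "u (j u) = v (j u)" using s(4) j(2) [OF uv(1)] j(2) [OF uv(2)] by (auto simp: bucket_def u_def v_def)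
    have "\<bar>u l - v l\<bar> \<le> 1 / N" if l: "l < n" for l
    proof (cases "l = j u")
      case True
      then show ?thesis using juv by simp
    next
      case False
      have "snd (snd (bucket u)) l = nat \<lfloor>real N * u l\<rfloor>" "snd (snd (bucket v)) l = nat \<lfloor>real N * v l\<rfloor>"
        using False l juv by (simp_all add: bucket_def)
      then have "nat \<lfloor>real N * u l\<rfloor> = nat \<lfloor>real N * v l\<rfloor>" using s(4) by (simp add: u_def v_def)
      moreover have "0 \<le> N * u l" "0 \<le> N * v l" using uvc l by (auto simp: cube_def)
      ultimately have "\<lfloor>real N * u l\<rfloor> = \<lfloor>real N * v l\<rfloor>" by (metis nat_eq_iff zero_le_floor)
      then have "\<bar>N * u l - N * v l\<bar> \<le> 1" by linarith
      then have "N * \<bar>u l - v l\<bar> \<le> 1" by (metis abs_mult abs_of_nat right_diff_distrib)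
      then show ?thesis using N0 by (simp add: field_simps)
    qed
    then have "l1_dist n u v \<le> (\<Sum>l<n. 1 / real N)" unfolding l1_dist_def by (intro sum_mono) auto
    then have dist: "l1_dist n u v \<le> n / N" by simp
    obtain i where i: "i < m" "s i \<noteq> s' i" using s(1-3) unfolding grid_def by (metis PiE_ext lessThan_iff)
    have "1 \<le> \<bar>real (s i) - real (s' i)\<bar>" using i(2) by linarith
    then have "(b - a) / M \<le> (b - a) / M * \<bar>real (s i) - real (s' i)\<bar>"
      using ab mult_left_mono [of 1 "\<bar>real (s i) - real (s' i)\<bar>" "(b - a) / M"] by simp
    also have "\<dots> = \<bar>pt s i - pt s' i\<bar>"
    proof -
      have "pt s i - pt s' i = (b - a) / M * (real (s i) - real (s' i))" using i(1) by (simp add: pt_def algebra_simps)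
      then show ?thesis using ab by (simp add: abs_mult)
    qed
    also have "\<dots> = \<bar>g i u - g i v\<bar>" using x(2) s i by (simp add: u_def v_def)
    also have "\<dots> \<le> L * (n / N)" using L(2) [OF i(1) uv] L(1) dist mult_left_mono by fastforce
    finally have "(b - a) / M \<le> L * n / (p * M)" by (simp add: N_def)
    from mult_right_mono [OF this, of "real M"] have "b - a \<le> L * n / p" using M0 by simp
    then show False using p p0 ab by (simp add: field_simps)
  qed
qed


section \<open>Pushing points of a cube to its boundary\<close>

text \<open>The Minkowski gauge of the cube as seen from an interior point \<open>y\<close>: it is
  homogeneous along rays from \<open>y\<close> and equals 1 exactly on the boundary.\<close>

definition gauge_at :: "nat \<Rightarrow> coords \<Rightarrow> coords \<Rightarrow> real" where
  "gauge_at m y u = max_abs m (\<lambda>i. max ((u i - y i) / (1 - y i)) ((y i - u i) / y i))"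

text \<open>The linear homotopy from the identity to the radial projection from \<open>y\<close>.
  Gauges below \<open>h\<close> are replaced by \<open>h\<close>; this keeps the map continuous at
  \<open>y\<close>, and points of gauge at least \<open>h\<close> still arrive on the
  boundary.\<close>

definition push_out :: "nat \<Rightarrow> coords \<Rightarrow> real \<Rightarrow> real \<Rightarrow> coords \<Rightarrow> nat \<Rightarrow> real" where
  "push_out m y h t u = (\<lambda>i. if i < m then (1 - t) * u i + t * (y i + (u i - y i) / max (gauge_at m y u) h) else 0)"

context
  fixes m :: nat and y :: "nat \<Rightarrow> real"
  assumes y: "y \<in> cube_int m"
begin

lemma y_bounds: "i < m \<Longrightarrow> 0 < y i" "i < m \<Longrightarrow> y i < 1" using y by (auto simp: cube_int_def)

lemma gauge_coord_nonneg: "i < m \<Longrightarrow> 0 \<le> max ((s - y i) / (1 - y i)) ((y i - s) / y i)"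
  unfolding le_max_iff_disj using y_bounds [of i] by (cases "s \<ge> y i") (auto simp: zero_le_divide_iff)

lemma gauge_coord_le:
  assumes "i < m"
  shows "max ((s - y i) / (1 - y i)) ((y i - s) / y i) \<le> 1 \<longleftrightarrow> 0 \<le> s \<and> s \<le> 1"
  using y_bounds [OF assms] by (auto simp: divide_le_eq)

lemma gauge_coord_eq:
  assumes "i < m" "0 \<le> s" "s \<le> 1"
  shows "max ((s - y i) / (1 - y i)) ((y i - s) / y i) = 1 \<longleftrightarrow> s = 0 \<or> s = 1"
proof -
  have 1: "(s - y i) / (1 - y i) = 1 \<longleftrightarrow> s = 1" and 2: "(y i - s) / y i = 1 \<longleftrightarrow> s = 0"
    using y_bounds [OF assms(1)] by (auto simp: divide_eq_1_iff)
  have "(s - y i) / (1 - y i) \<le> 1" "(y i - s) / y i \<le> 1" using gauge_coord_le [OF assms(1), of s] assms by auto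
  then show ?thesis using 1 2 by (auto simp: max_def split: if_splits)
qed

lemma gauge_coord_ge:
  assumes "i < m"
  shows "\<bar>s - y i\<bar> \<le> max ((s - y i) / (1 - y i)) ((y i - s) / y i)"
proof (cases "s \<ge> y i")
  case True
  have "(s - y i) * (1 - y i) \<le> s - y i" using True y_bounds [OF assms] mult_left_le [of "1 - y i" "s - y i"] by simp
  then have "s - y i \<le> (s - y i) / (1 - y i)" using y_bounds [OF assms] by (simp add: le_divide_eq)
  then show ?thesis using True by simp
next
  case False
  have "(y i - s) * y i \<le> y i - s" using False y_bounds [OF assms] by simp
  then have "y i - s \<le> (y i - s) / y i" using y_bounds [OF assms] by (simp add: le_divide_eq)
  then show ?thesis using False by simp
qed

lemma cube_iff_gauge:
  assumes u: "\<And>i. i \<ge> m \<Longrightarrow> u i = 0"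
  shows "u \<in> cube m \<longleftrightarrow> gauge_at m y u \<le> 1" and "u \<in> cube_bd m \<longleftrightarrow> gauge_at m y u = 1"
proof -
  let ?w = "\<lambda>i. max ((u i - y i) / (1 - y i)) ((y i - u i) / y i)"
  have w: "\<bar>?w i\<bar> = ?w i" if "i < m" for i using gauge_coord_nonneg [OF that] by (rule abs_of_nonneg)
  show 1: "u \<in> cube m \<longleftrightarrow> gauge_at m y u \<le> 1"
    unfolding gauge_at_def using u w gauge_coord_le by (auto simp: max_abs_le_iff cube_def simp del: max.bounded_iff)
  show "u \<in> cube_bd m \<longleftrightarrow> gauge_at m y u = 1"
  proof
    assume b: "u \<in> cube_bd m"
    then obtain i where i: "i < m" "u i = 0 \<or> u i = 1" "0 \<le> u i" "u i \<le> 1" by (auto simp: cube_bd_def)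
    then have "?w i = 1" using gauge_coord_eq by blast
    then have "1 \<le> gauge_at m y u" unfolding gauge_at_def using max_abs_ge [OF i(1), of ?w] by simp
    then show "gauge_at m y u = 1" using 1 b cube_bd_subset by auto
  next
    assume g: "gauge_at m y u = 1"
    then obtain i where i: "i < m" "\<bar>?w i\<bar> = 1" using max_abs_attained [of m ?w] unfolding gauge_at_def by auto
    have c: "u \<in> cube m" using g 1 by simp
    then have "u i = 0 \<or> u i = 1" using gauge_coord_eq [OF i(1), of "u i"] i w by (auto simp: cube_def)
    then show "u \<in> cube_bd m" using c i(1) by (auto simp: cube_bd_def)
  qed
qed

lemma gauge_ge: "i < m \<Longrightarrow> \<bar>u i - y i\<bar> \<le> gauge_at m y u" unfolding gauge_at_def
  using gauge_coord_ge [of i "u i"] max_abs_ge [of i m "\<lambda>i. max ((u i - y i) / (1 - y i)) ((y i - u i) / y i)"] by linarith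

lemma gauge_scale:
  assumes "0 \<le> c"
  shows "gauge_at m y (\<lambda>i. y i + c * (u i - y i)) = c * gauge_at m y u"
proof -
  have "max ((y i + c * (u i - y i) - y i) / (1 - y i)) ((y i - (y i + c * (u i - y i))) / y i) =
      c * max ((u i - y i) / (1 - y i)) ((y i - u i) / y i)" for i using assms by (simp add: max_mult_distrib_left algebra_simps)
  then show ?thesis unfolding gauge_at_def using max_abs_scale [OF assms] by simp
qed

lemma gauge_cong: "(\<And>i. i < m \<Longrightarrow> u i = v i) \<Longrightarrow> gauge_at m y u = gauge_at m y v"
  unfolding gauge_at_def by (rule max_abs_cong) simp

lemma continuous_on_gauge: "continuous_on S (gauge_at m y)"
proof -
  have "continuous_on S (\<lambda>u. max ((u i - y i) / (1 - y i)) ((y i - u i) / y i))" for i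
    unfolding divide_inverse by (intro continuous_intros continuous_on_coordinate)
  then have "continuous_on S (\<lambda>u. \<lambda>i. max ((u i - y i) / (1 - y i)) ((y i - u i) / y i))"
    by (rule continuous_on_coordinatewise_then_product)
  from continuous_on_compose2 [OF continuous_on_max_abs this subset_UNIV] show ?thesis unfolding gauge_at_def .
qed

lemma push_out_1:
  assumes h: "0 < h" "h \<le> 1" and u: "u \<in> cube m"
  shows "push_out m y h 1 u \<in> cube m" and "h \<le> gauge_at m y u \<Longrightarrow> push_out m y h 1 u \<in> cube_bd m"
    and "u \<in> cube_bd m \<Longrightarrow> push_out m y h 1 u = u"
proof -
  let ?c = "1 / max (gauge_at m y u) h"
  have c: "0 \<le> ?c" using h by simp
  have z: "push_out m y h 1 u i = 0" if "i \<ge> m" for i using that by (simp add: push_out_def)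
  have "gauge_at m y (push_out m y h 1 u) = gauge_at m y (\<lambda>i. y i + ?c * (u i - y i))"
    by (rule gauge_cong) (simp add: push_out_def)
  then have g: "gauge_at m y (push_out m y h 1 u) = gauge_at m y u / max (gauge_at m y u) h" unfolding gauge_scale [OF c] by simp
  have "gauge_at m y (push_out m y h 1 u) \<le> 1" unfolding g using h by (simp add: divide_le_eq)
  then show "push_out m y h 1 u \<in> cube m" using cube_iff_gauge(1) [of "push_out m y h 1 u"] z by blast
  show "push_out m y h 1 u \<in> cube_bd m" if "h \<le> gauge_at m y u"
  proof -
    have "gauge_at m y (push_out m y h 1 u) = 1" unfolding g using h that by (auto simp: max_def)
    then show ?thesis using cube_iff_gauge(2) [of "push_out m y h 1 u"] z by blast
  qed
  have u0: "\<And>i. i \<ge> m \<Longrightarrow> u i = 0" using u by (simp add: cube_def)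
  show "push_out m y h 1 u = u" if "u \<in> cube_bd m" using that h u0 cube_iff_gauge(2) [of u] by (auto simp: push_out_def)
qed

lemma push_out_cube:
  assumes h: "0 < h" "h \<le> 1" and u: "u \<in> cube m" and t: "0 \<le> t" "t \<le> 1"
  shows "push_out m y h t u \<in> cube m" and "u \<in> cube_bd m \<Longrightarrow> push_out m y h t u = u"
    and "push_out m y h 0 u = u"
proof -
  have e: "push_out m y h t u i = (1 - t) * u i + t * push_out m y h 1 u i" for i using u by (simp add: push_out_def cube_def)
  have p: "push_out m y h 1 u \<in> cube m" by (rule push_out_1(1) [OF h u])
  show "push_out m y h t u \<in> cube m" unfolding cube_def mem_Collect_eq e
  proof (intro conjI allI impI)
    fix i assume i: "i < m"
    have b: "0 \<le> u i" "u i \<le> 1" "0 \<le> push_out m y h 1 u i" "push_out m y h 1 u i \<le> 1"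
      using u p i by (auto simp: cube_def)
    then show "0 \<le> (1 - t) * u i + t * push_out m y h 1 u i" using t by simp
    show "(1 - t) * u i + t * push_out m y h 1 u i \<le> 1" using b t by (intro convex_bound_le) auto
  qed (use u p in \<open>auto simp: cube_def\<close>)
  show "push_out m y h t u = u" if "u \<in> cube_bd m" using e push_out_1(3) [OF h u that] by (auto simp: fun_eq_iff algebra_simps)
  show "push_out m y h 0 u = u" using u by (auto simp: push_out_def fun_eq_iff cube_def)
qed

lemma continuous_map_push_out:
  assumes h: "0 < h" "h \<le> 1"
  shows "continuous_map (prod_topology (top_of_set (cube m)) I01) (top_of_set (cube m))
    (\<lambda>z. push_out m y h (snd z) (fst z))"
proof -
  let ?X = "cube m \<times> {0..1::real}"
  have g: "continuous_on ?X (\<lambda>z. gauge_at m y (fst z))"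
    by (rule continuous_on_compose2 [OF continuous_on_gauge continuous_on_fst [OF continuous_on_id] subset_UNIV])
  have u: "continuous_on ?X (\<lambda>z. fst z i)" for i
    by (rule continuous_on_compose2 [OF continuous_on_coordinate continuous_on_fst [OF continuous_on_id] subset_UNIV])
  have nz: "max (gauge_at m y v) h \<noteq> 0" for v using h by (simp add: max_def)
  have "continuous_on ?X (\<lambda>z. push_out m y h (snd z) (fst z) i)" for i
    using g u nz by (cases "i < m") (auto simp: push_out_def intro!: continuous_intros)
  then have "continuous_on ?X (\<lambda>z. push_out m y h (snd z) (fst z))" by (rule continuous_on_coordinatewise_then_product)
  moreover have "push_out m y h (snd z) (fst z) \<in> cube m" if "z \<in> ?X" for z using push_out_cube(1) [OF h] that by auto
  ultimately show ?thesis by (auto simp: prod_topology_subtopology_eu)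
qed

end

section \<open>Closed subspaces of complexes\<close>

lemma cell_bd_subtopology: "cell_bd_space B n = subtopology (cell_space B n) (topspace B \<times> cube_bd n)"
proof -
  have "subtopology (cell_space B n) (topspace B \<times> cube_bd n) =
      prod_topology (subtopology B (topspace B)) (subtopology (top_of_set (cube n)) (cube_bd n))" by (rule subtopology_Times)
  also have "subtopology (top_of_set (cube n)) (cube_bd n) = top_of_set (cube_bd n)"
    using cube_bd_subset [of n] by (simp add: subtopology_subtopology Int_absorb1)
  finally show ?thesis by simp
qed

lemma closedin_cell_bd:
  assumes "closedin (cell_bd_space B n) T"
  shows "closedin (cell_space B n) T"
proof -
  have "closedin (cell_space B n) (topspace B \<times> cube_bd n)"
    by (simp add: closedin_prod_Times_iff closed_subset cube_bd_subset closed_cube_bd)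
  then show ?thesis using assms closedin_trans_full unfolding cell_bd_subtopology by blast
qed

context cell_complex
begin

lemma closedin_stage: "closedin (stage r) C \<longleftrightarrow> C \<subseteq> topspace (stage r) \<and>
    (\<forall>e\<in>E. rk e < r \<longrightarrow> closedin (cell_space B (d e)) (cell_preimage B (d e) (\<Phi> e) C))"
  unfolding stage_def closedin_final_top topspace_final_top by auto

lemma closedin_total: "closedin total C \<longleftrightarrow> C \<subseteq> topspace total \<and>
    (\<forall>e\<in>E. closedin (cell_space B (d e)) (cell_preimage B (d e) (\<Phi> e) C))"
  unfolding total_def closedin_final_top topspace_final_top by auto

text \<open>With \<open>B0\<close> empty, a point of a cell of rank at least \<open>r\<close> that
  is mapped into the stage \<open>r\<close> lies on the boundary of the cell. So the preimage of
  \<open>C\<close> in such a cell is closed in the boundary, by induction on the rank, and the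
  boundary is closed in the cell.\<close>

lemma closedin_stage_mono:
  assumes B0: "B0 = {}" and C: "closedin (stage r) C" and rs: "r \<le> s"
  shows "closedin (stage s) C" using rs
proof (induction s rule: less_induct)
  case (less s)
  have Cr: "C \<subseteq> topspace (stage r)" by (rule closedin_subset [OF C])
  show ?case unfolding closedin_stage
  proof (intro conjI ballI impI)
    show "C \<subseteq> topspace (stage s)" using Cr stage_mono [OF less.prems] by blast
    fix e assume e: "e \<in> E" "rk e < s"
    show "closedin (cell_space B (d e)) (cell_preimage B (d e) (\<Phi> e) C)"
    proof (cases "rk e < r")
      case True
      then show ?thesis using C e by (simp add: closedin_stage)
    next
      case False
      then have "closedin (stage (rk e)) C" using less.IH [OF e(2)] by simp
      from closedin_cell_bd [OF closedin_continuous_map_preimage [OF bd_stage [OF e(1)] this]]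
      have "closedin (cell_space B (d e)) {p \<in> cell_bd_set B (d e). \<Phi> e p \<in> C}" .
      moreover have "{p \<in> cell_bd_set B (d e). \<Phi> e p \<in> C} = cell_preimage B (d e) (\<Phi> e) C"
      proof (intro equalityI subsetI)
        fix p assume "p \<in> cell_preimage B (d e) (\<Phi> e) C"
        then have p: "p \<in> cell_set B (d e)" "\<Phi> e p \<in> C" by auto
        have "p \<notin> cell_int B {} (d e)" using cell_int_rank [OF e(1), of p r] p(2) Cr False B0 by auto
        then have "p \<in> cell_bd_set B (d e)" using p(1) cube_cases by (auto simp: cell_int_def)
        then show "p \<in> {p \<in> cell_bd_set B (d e). \<Phi> e p \<in> C}" using p(2) by simp
      qed (use cube_bd_subset in auto)
      ultimately show ?thesis by simp
    qed
  qed
qed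

lemma closedin_total_if_stage:
  assumes B0: "B0 = {}" and C: "closedin (stage r) C"
  shows "closedin total C" unfolding closedin_total
proof (intro conjI ballI)
  show "C \<subseteq> topspace total" using closedin_subset [OF C] stage_subset_total by blast
  fix e assume e: "e \<in> E"
  have "closedin (stage (max r (Suc (rk e)))) C" by (rule closedin_stage_mono [OF B0 C]) simp
  then show "closedin (cell_space B (d e)) (cell_preimage B (d e) (\<Phi> e) C)" using e by (simp add: closedin_stage)
qed

text \<open>Closed sets of a stage stay closed in the whole complex. Maps with image in a stage can
  therefore be regarded as maps into the stage.\<close>

lemma stage_eq_subtopology:
  assumes B0: "B0 = {}"
  shows "stage r = subtopology total (topspace (stage r))" unfolding topology_eq openin_subtopology
proof (intro allI iffI)
  fix U assume U: "openin (stage r) U"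
  have "closedin total (topspace (stage r) - U)" by (rule closedin_total_if_stage [OF B0]) (use U in blast)
  then have "openin total (topspace total - (topspace (stage r) - U))" by blast
  moreover have "U = (topspace total - (topspace (stage r) - U)) \<inter> topspace (stage r)"
    using openin_subset [OF U] stage_subset_total [of r] by blast
  ultimately show "\<exists>T. openin total T \<and> U = T \<inter> topspace (stage r)" by blast
next
  fix U assume "\<exists>T. openin total T \<and> U = T \<inter> topspace (stage r)"
  then show "openin (stage r) U" using openin_total_stage by blast
qed

lemma continuous_map_into_stage:
  assumes "B0 = {}" "continuous_map K total f" "\<And>x. x \<in> topspace K \<Longrightarrow> f x \<in> topspace (stage r)"
  shows "continuous_map K (stage r) f"
  using assms(2,3) by (subst stage_eq_subtopology [OF assms(1)]) (auto simp: continuous_map_in_subtopology)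

lemma continuous_map_stage_into_total: "continuous_map K (stage r) f \<Longrightarrow> continuous_map K total f"
  using continuous_map_compose [OF _ continuous_map_stage_total] by fastforce

text \<open>Among the cells of rank at most that of \<open>e\<close>, only \<open>e\<close> itself
  meets the open cell \<open>e\<close>, and it does so injectively. So an interior point is closed
  in the stage of its cell, and then in the whole complex.\<close>

lemma closedin_point:
  assumes B0: "B0 = {}" and B: "t1_space B" and x: "x \<in> topspace total"
  shows "closedin total {x}"
proof -
  consider "x \<in> Q" | e p where "e \<in> E" "p \<in> cell_int B B0 (d e)" "x = \<Phi> e p" using x unfolding total_points by blast
  then show ?thesis
  proof cases
    case 1
    then have "{x} = topspace (stage (Suc 0))" using Q by (auto simp: topspace_stage_1)
    then have "closedin (stage (Suc 0)) {x}" by (metis closedin_topspace)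
    then show ?thesis by (rule closedin_total_if_stage [OF B0])
  next
    case (2 e p)
    have "closedin (stage (Suc (rk e))) {x}" unfolding closedin_stage
    proof (intro conjI ballI impI)
      show "{x} \<subseteq> topspace (stage (Suc (rk e)))" using cell_int_rank [OF 2(1,2), of "Suc (rk e)"] 2(3) by simp
      fix e' assume e': "e' \<in> E" "rk e' < Suc (rk e)"
      let ?S = "{p' \<in> cell_set B (d e'). \<Phi> e' p' \<in> {x}}"
      have S01: "?S \<subseteq> {p} \<and> (?S \<noteq> {} \<longrightarrow> e' = e)"
      proof -
        have "e' = e \<and> p' = p" if p': "p' \<in> cell_set B (d e')" "\<Phi> e' p' = x" for p'
        proof -
          have "p' \<in> cell_int B B0 (d e')"
          proof (rule ccontr)
            assume "p' \<notin> cell_int B B0 (d e')"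
            then have "\<Phi> e' p' \<in> topspace (stage (rk e'))" using cell_space_cases [OF e'(1) p'(1)] B0 by blast
            then show False using cell_int_rank [OF 2(1,2), of "rk e'"] 2(3) p'(2) e'(2) by simp
          qed
          moreover from this have "e' = e" using cells_disjoint [OF e'(1) 2(1) _ 2(2)] 2(3) p'(2) by simp
          ultimately show ?thesis using inj_onD [OF inj_cell [OF 2(1)], of p' p] 2 p'(2) by simp
        qed
        then show ?thesis by auto
      qed
      have "closedin (cell_space B (d e)) {p}"
      proof -
        have "t1_space (cell_space B (d e))"
          using B by (auto simp: t1_space_prod_topology Hausdorff_imp_t1_space Hausdorff_space_cube)
        moreover have "p \<in> cell_set B (d e)" using 2(2) cube_int_subset by (auto simp: cell_int_def)
        ultimately show ?thesis by (meson t1_space_closedin_singleton)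
      qed
      then show "closedin (cell_space B (d e')) ?S"
      proof (cases "?S = {}")
        case True
        show ?thesis unfolding True by simp
      next
        case False
        with S01 have e: "e' = e" by (simp only: simp_thms)
        have S: "?S = {p}" using subset_singletonD [OF conjunct1 [OF S01]] False by argo
        show ?thesis unfolding S unfolding e by fact
      qed
    qed
    then show ?thesis by (rule closedin_total_if_stage [OF B0])
  qed
qed

text \<open>Each cell maps into one stage, where the set is finite and hence closed. This supplies
  closed discrete sets of points from cells of growing dimension.\<close>

lemma closedin_if_finite_in_stages:
  assumes B0: "B0 = {}" and B: "t1_space B" and S: "S \<subseteq> topspace total"
    and fin: "\<And>r. finite (S \<inter> topspace (stage r))"
  shows "closedin total S" unfolding closedin_total
proof (intro conjI ballI S)
  fix e assume e: "e \<in> E"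
  let ?F = "S \<inter> topspace (stage (Suc (rk e)))"
  have "?F = (\<Union>x\<in>?F. {x})" by blast
  moreover have "closedin total (\<Union>x\<in>?F. {x})"
    using fin [of "Suc (rk e)"] closedin_point [OF B0 B] S by (intro closedin_Union) auto
  ultimately have "closedin total ?F" by simp
  then have "closedin (cell_space B (d e)) (cell_preimage B (d e) (\<Phi> e) ?F)" using e by (simp add: closedin_total)
  moreover have "cell_preimage B (d e) (\<Phi> e) ?F = cell_preimage B (d e) (\<Phi> e) S" using e by (auto simp: topspace_stage)
  ultimately show "closedin (cell_space B (d e)) (cell_preimage B (d e) (\<Phi> e) S)" by simp
qed

end

text \<open>A set all of whose subsets are closed is discrete, and a discrete compact set is finite.
  It is applied to one point for each cell, or for each dimension, that a compact image
  meets.\<close>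

lemma finite_if_subsets_closed_compact:
  assumes K: "compactin X K" and S: "S \<subseteq> K" and cl: "\<And>T. T \<subseteq> S \<Longrightarrow> closedin X T"
  shows "finite S"
proof -
  have "compactin X S" by (rule closed_compactin [OF K S cl]) simp
  moreover have "subtopology X S = discrete_topology S"
  proof -
    have "openin (subtopology X S) T" if "T \<subseteq> S" for T
    proof -
      have "openin X (topspace X - (S - T))" using cl [of "S - T"] by blast
      moreover have "T = (topspace X - (S - T)) \<inter> S" using that closedin_subset [OF cl [OF subset_refl]] by blast
      ultimately show ?thesis unfolding openin_subtopology by blast
    qed
    moreover have "topspace (subtopology X S) = S" using closedin_subset [OF cl [OF subset_refl]] by auto
    ultimately show ?thesis by (metis discrete_topology_unique openin_subset subset_refl insert_subset)
  qed
  ultimately show ?thesis by (simp add: compactin_subspace compact_space_discrete_topology)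
qed


section \<open>Cellular approximation\<close>

text \<open>Points that are already at the base point stay there during all deformations; this is
  what preserves the collapsed faces of the cells.\<close>

abbreviation "homotopic_fixing Z y \<equiv> homotopic_with (\<lambda>h. \<forall>x\<in>Z. h x = y)"

text \<open>The rank is the dimension plus 1, so \<open>stage (Suc m)\<close> consists of the base
  point and the cells of dimension less than \<open>m\<close>.\<close>

locale cellular_complex = cell_complex one_point "{}" fl "{x0}" x0 E d \<Phi> "\<lambda>e. Suc (d e)"
  for fl and x0 :: 'x and E :: "'e set" and d \<Phi>
begin

definition ch :: "'e \<Rightarrow> coords \<Rightarrow> 'x" where
  "ch e u = \<Phi> e ((), u)"

lemma t1_one_point: "t1_space one_point" by (simp add: Hausdorff_imp_t1_space)

lemma ch_eq: "\<Phi> e p = ch e (snd p)" by (cases p) (simp add: ch_def)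

lemma continuous_map_ch:
  "e \<in> E \<Longrightarrow> d e < m \<Longrightarrow> continuous_map (top_of_set (cube (d e))) (stage (Suc m)) (ch e)"
  using continuous_map_cell_stage [of e "Suc m"] by (simp add: continuous_map_from_prod_discrete ch_def [abs_def])

lemma ch_mem_stage: "e \<in> E \<Longrightarrow> d e < m \<Longrightarrow> u \<in> cube (d e) \<Longrightarrow> ch e u \<in> topspace (stage (Suc m))"
  using continuous_map_ch [of e m] by (auto simp: continuous_map_def)

lemma ch_bd: "e \<in> E \<Longrightarrow> u \<in> cube_bd (d e) \<Longrightarrow> ch e u \<in> topspace (stage (Suc (d e)))"
  using bd_stage [of e] by (auto simp: continuous_map_def ch_def)

lemma ch_int_stage: "e \<in> E \<Longrightarrow> u \<in> cube_int (d e) \<Longrightarrow> ch e u \<in> topspace (stage (Suc m)) \<longleftrightarrow> d e < m"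
  using cell_int_rank [of e "((), u)" "Suc m"] by (simp add: ch_def cell_int_def)

text \<open>The boundary of \<open>e'\<close> lies in cells of dimension below \<open>d e'\<close>,
  hence below \<open>d e\<close>, so it cannot meet the open cell \<open>e\<close>; what is left is
  injectivity on open cells.\<close>

lemma ch_inj:
  assumes "e \<in> E" "e' \<in> E" "u \<in> cube_int (d e)" "u' \<in> cube (d e')" "d e' \<le> d e" "ch e u = ch e' u'"
  shows "e = e' \<and> u = u'"
proof -
  have "u' \<in> cube_int (d e')"
  proof (rule ccontr)
    assume "u' \<notin> cube_int (d e')"
    then have "u' \<in> cube_bd (d e')" using assms(4) cube_cases by blast
    then show False using ch_bd [OF assms(2)] ch_int_stage [OF assms(1,3), of "d e'"] assms(5,6) by simp
  qed
  then have i: "((), u) \<in> cell_int one_point {} (d e)" "((), u') \<in> cell_int one_point {} (d e')"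
    using assms(3) by (auto simp: cell_int_def)
  have "e = e'" using cells_disjoint [OF assms(1,2) i] assms(6) by (simp add: ch_def)
  then show ?thesis using inj_onD [OF inj_cell [OF assms(1)], of "((), u)" "((), u')"] i assms(6) by (simp add: ch_def)
qed

lemma x0_not_int: "e \<in> E \<Longrightarrow> u \<in> cube_int (d e) \<Longrightarrow> ch e u \<noteq> x0"
  using cell_new [of e "((), u)"] by (auto simp: ch_def cell_int_def)

lemma x0_stage: "x0 \<in> topspace (stage r)" by (simp add: topspace_stage)

lemma stage_cells: "topspace (stage (Suc m)) = {x0} \<union> (\<Union>e\<in>{e \<in> E. d e < m}. ch e ` cube_int (d e))"
using stage_points by (auto simp: cell_int_def ch_def)

lemma closedin_stage_ch:
  "closedin (stage (Suc m)) C \<longleftrightarrow> C \<subseteq> topspace (stage (Suc m)) \<and>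
    (\<forall>e\<in>E. d e < m \<longrightarrow> closedin (top_of_set (cube (d e))) {u \<in> cube (d e). ch e u \<in> C})"
proof -
  have "closedin (cell_space one_point n) (cell_preimage one_point n (\<Phi> e) C) \<longleftrightarrow>
      closedin (top_of_set (cube n)) {u \<in> cube n. ch e u \<in> C}" for e n
  proof -
    have "{p \<in> cell_set one_point n. \<Phi> e p \<notin> C} = cell_set one_point n -
        cell_preimage one_point n (\<Phi> e) C" by blast
    moreover have "{u \<in> cube n. ch e u \<notin> C} = cube n - {u \<in> cube n. ch e u \<in> C}" by blast
    ultimately show ?thesis using openin_cell_one_point [of n "\<Phi> e" "- C"] unfolding closedin_def by (simp add: ch_def)
  qed
  then show ?thesis unfolding closedin_stage by simp
qed

lemma closedin_ch_image:
  assumes e: "e \<in> E" and D: "closed D" "D \<subseteq> cube_int (d e)"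
  shows "closedin total (ch e ` D)"
proof (rule closedin_total_if_stage [OF refl])
  show "closedin (stage (Suc (Suc (d e)))) (ch e ` D)" unfolding closedin_stage_ch
  proof (intro conjI ballI impI)
    show "ch e ` D \<subseteq> topspace (stage (Suc (Suc (d e))))"
      using ch_mem_stage [OF e, of "Suc (d e)"] D(2) cube_int_subset by auto
    fix e' assume e': "e' \<in> E" "d e' < Suc (d e)"
    have i: "e = e' \<and> u' \<in> D" if "u' \<in> cube (d e')" "ch e' u' \<in> ch e ` D" for u'
    proof -
      obtain u where u: "u \<in> D" "ch e u = ch e' u'" using \<open>ch e' u' \<in> _\<close> by (metis imageE)
      show ?thesis using ch_inj [OF e e'(1) subsetD [OF D(2) u(1)] \<open>u' \<in> cube _\<close> _ u(2)] e'(2) u(1) by simp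
    qed
    have "{u \<in> cube (d e'). ch e' u \<in> ch e ` D} = (if e' = e then D else {})"
    proof (cases "e' = e")
      case True
      then show ?thesis using i subset_trans [OF D(2) cube_int_subset] by auto
    next
      case False
      then show ?thesis using i by auto
    qed
    then show "closedin (top_of_set (cube (d e'))) {u \<in> cube (d e'). ch e' u \<in> ch e ` D}"
      using D by (auto intro!: closed_subset)
  qed
qed

text \<open>In the skeleton where \<open>e\<close> has top dimension no other cell meets the open
  cell \<open>e\<close>. Cells of higher dimension may do so, and therefore the claim is made in
  this skeleton and not in the whole complex.\<close>

lemma openin_ch_image:
  assumes e: "e \<in> E" and V: "V \<subseteq> cube_int (d e)" "openin (top_of_set (cube (d e))) V"
  shows "openin (stage (Suc (Suc (d e)))) (ch e ` V)"
proof -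
  let ?T = "topspace (stage (Suc (Suc (d e))))"
  have sub: "ch e ` V \<subseteq> ?T" using ch_mem_stage [OF e, of "Suc (d e)"] V(1) cube_int_subset by auto
  have "closedin (stage (Suc (Suc (d e)))) (?T - ch e ` V)" unfolding closedin_stage_ch
  proof (intro conjI ballI impI)
    fix e' assume e': "e' \<in> E" "d e' < Suc (d e)"
    have i: "e = e' \<and> u' \<in> V" if "u' \<in> cube (d e')" "ch e' u' \<in> ch e ` V" for u'
    proof -
      obtain u where u: "u \<in> V" "ch e u = ch e' u'" using \<open>ch e' u' \<in> _\<close> by (metis imageE)
      show ?thesis using ch_inj [OF e e'(1) subsetD [OF V(1) u(1)] \<open>u' \<in> cube _\<close> _ u(2)] e'(2) u(1) by simp
    qed
    have "{u \<in> cube (d e'). ch e' u \<in> ?T - ch e ` V} = cube (d e') - (if e' = e then V else {})"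
    proof (cases "e' = e")
      case True
      then show ?thesis using i ch_mem_stage [OF e'(1,2)] by auto
    next
      case False
      then show ?thesis using i ch_mem_stage [OF e'(1,2)] by auto
    qed
    then show "closedin (top_of_set (cube (d e'))) {u \<in> cube (d e'). ch e' u \<in> ?T - ch e ` V}"
      using V(2) by (auto intro: closedin_diff)
  qed auto
  then show ?thesis using sub by (simp add: openin_closedin)
qed

definition coord :: "'e \<Rightarrow> 'x \<Rightarrow> nat \<Rightarrow> real" where
  "coord e w = (SOME u. u \<in> cube_int (d e) \<and> ch e u = w)"

lemma coord_ch: "e \<in> E \<Longrightarrow> u \<in> cube_int (d e) \<Longrightarrow> coord e (ch e u) = u"
  unfolding coord_def using ch_inj [of e e] cube_int_subset by (intro some_equality) blast+

text \<open>Closed subsets of the compact set \<open>D\<close> have closed images in the whole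
  complex, so the inverse of \<open>ch e\<close> is continuous on the image of
  \<open>D\<close>.\<close>

lemma continuous_map_coord:
  assumes e: "e \<in> E" and D: "compact D" "D \<subseteq> cube_int (d e)" and f: "continuous_map K total f"
  shows "continuous_map (subtopology K {x \<in> topspace K. f x \<in> ch e ` D}) (top_of_set D) (coord e \<circ> f)"
  unfolding continuous_map_closedin
proof (intro conjI allI impI)
  let ?S = "{x \<in> topspace K. f x \<in> ch e ` D}"
  show "coord e \<circ> f \<in> topspace (subtopology K ?S) \<rightarrow> topspace (top_of_set D)" using coord_ch [OF e] D(2) by auto
  fix C assume C: "closedin (top_of_set D) C"
  have CD: "closed C" "C \<subseteq> D"
    using closedin_closed_trans [OF C compact_imp_closed [OF D(1)]] closedin_imp_subset [OF C] by simp_all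
  have "closedin K {x \<in> topspace K. f x \<in> ch e ` C}"
    by (rule closedin_continuous_map_preimage [OF f closedin_ch_image [OF e CD(1) subset_trans [OF CD(2) D(2)]]])
  then have "closedin (subtopology K ?S) (?S \<inter> {x \<in> topspace K. f x \<in> ch e ` C})"
    by (rule closedin_subtopology_Int_closed)
  moreover have "?S \<inter> {x \<in> topspace K. f x \<in> ch e ` C} = {x \<in> topspace (subtopology K ?S). (coord e \<circ> f) x \<in> C}"
    using coord_ch [OF e] D(2) CD(2) by fastforce
  ultimately show "closedin (subtopology K ?S) {x \<in> topspace (subtopology K ?S). (coord e \<circ> f) x \<in> C}" by simp
qed

definition push_cell :: "'e \<Rightarrow> coords \<Rightarrow> real \<Rightarrow> 'x \<times> real \<Rightarrow> 'x" where
  "push_cell e y h z = (if fst z \<in> ch e ` cube_int (d e) then ch e (push_out (d e) y h (snd z) (coord e (fst z))) else fst z)"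

lemma push_cell_ch:
  assumes e: "e \<in> E" and y: "y \<in> cube_int (d e)" and h: "0 < h" "h \<le> 1" and u: "u \<in> cube (d e)" and t: "0 \<le> t" "t \<le> 1"
  shows "push_cell e y h (ch e u, t) = ch e (push_out (d e) y h t u)"
proof (cases "u \<in> cube_int (d e)")
  case True
  then show ?thesis by (simp add: push_cell_def coord_ch [OF e])
next
  case False
  then have b: "u \<in> cube_bd (d e)" using u cube_cases by blast
  have "ch e u \<notin> ch e ` cube_int (d e)"
  proof
    assume "ch e u \<in> ch e ` cube_int (d e)"
    then obtain u' where "u' \<in> cube_int (d e)" "ch e u' = ch e u" by (metis imageE)
    then show False using ch_inj [OF e e _ u, of u'] False by simp
  qed
  then show ?thesis using push_out_cube(2) [OF y h u t b] by (simp add: push_cell_def)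
qed

text \<open>Continuity is tested on cells times the interval. On \<open>e\<close> itself the map is
  \<open>push_out\<close>, by \<open>push_cell_ch\<close>; every other cell of this skeleton avoids
  the open cell \<open>e\<close>, so nothing moves on it.\<close>

lemma continuous_map_push_cell:
  assumes e: "e \<in> E" and y: "y \<in> cube_int (d e)" and h: "0 < h" "h \<le> 1"
  shows "continuous_map (prod_topology (stage (Suc (Suc (d e)))) I01) (stage (Suc (Suc (d e)))) (push_cell e y h)"
proof -
  let ?T = "stage (Suc (Suc (d e)))" and ?I = "I01"
  have "continuous_map (prod_topology (cells_top one_point {x0} {e' \<in> E. Suc (d e') < Suc (Suc (d e))} d \<Phi>) ?I) ?T
      (push_cell e y h)"
  proof (rule continuous_map_from_prod_final_top [OF locally_compact_Icc Hausdorff_Icc])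
    fix x assume "x \<in> {x0}"
    then have "push_cell e y h (x, t) = x0" for t using x0_not_int [OF e] by (auto simp: push_cell_def)
    then show "continuous_map ?I ?T (\<lambda>t. push_cell e y h (x, t))" using x0_stage by simp
  next
    fix e' assume "e' \<in> {e' \<in> E. Suc (d e') < Suc (Suc (d e))}"
    then have e': "e' \<in> E" "d e' < Suc (d e)" by auto
    let ?P = "prod_topology (cell_space one_point (d e')) ?I"
    show "continuous_map ?P ?T (\<lambda>(p, t). push_cell e y h (\<Phi> e' p, t))"
    proof (cases "e' = e")
      case True
      have "continuous_map ?P (top_of_set (cube (d e))) (\<lambda>z. snd (fst z))"
        using continuous_map_compose [OF continuous_map_fst continuous_map_snd, of one_point "top_of_set (cube (d e))" ?I]
        unfolding True by (simp add: o_def)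
      then have "continuous_map ?P (prod_topology (top_of_set (cube (d e))) ?I) (\<lambda>z. (snd (fst z), snd z))"
        by (simp only: continuous_map_pairwise o_def fst_conv snd_conv continuous_map_snd)
      from continuous_map_compose [OF continuous_map_compose [OF this continuous_map_push_out [OF y h]] continuous_map_ch [OF e, of "Suc (d e)"]]
      have "continuous_map ?P ?T (\<lambda>z. ch e (push_out (d e) y h (snd z) (snd (fst z))))" by (simp add: o_def)
      then show ?thesis by (rule continuous_map_eq) (auto simp: True ch_eq push_cell_ch [OF e y h])
    next
      case False
      have "continuous_map ?P ?T (\<Phi> e' \<circ> fst)"
        by (rule continuous_map_compose [OF continuous_map_fst continuous_map_cell_stage]) (use e' in auto)
      then show ?thesis
      proof (rule continuous_map_eq)
        fix z assume "z \<in> topspace ?P"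
        then have "snd (fst z) \<in> cube (d e')" by auto
        have "\<Phi> e' (fst z) \<notin> ch e ` cube_int (d e)"
        proof
          assume "\<Phi> e' (fst z) \<in> ch e ` cube_int (d e)"
          then obtain u' where "u' \<in> cube_int (d e)" "ch e u' = ch e' (snd (fst z))" by (metis imageE ch_eq)
          then show False
            using ch_inj [OF e e'(1), of u' "snd (fst z)"] \<open>snd (fst z) \<in> cube (d e')\<close> e'(2) False by simp
        qed
        then show "(\<Phi> e' \<circ> fst) z = (case z of (p, t) \<Rightarrow> push_cell e y h (\<Phi> e' p, t))"
          by (simp add: push_cell_def case_prod_unfold)
      qed
    qed
  qed
  then show ?thesis by (simp add: stage_def)
qed

text \<open>A map from the boundary of an \<open>n\<close>-cube can be deformed off the open cell \<open>e\<close> of dimension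
  at least \<open>n\<close>: approximate it inside the cell by a Lipschitz map, which misses a point \<open>y\<close> near the
  center, and push away from \<open>y\<close>.\<close>

lemma deform_off_cell:
  assumes e: "e \<in> E" "n \<le> d e" and \<phi>: "continuous_map (top_of_set (cube_bd n)) (stage (Suc (Suc (d e)))) \<phi>"
    and Z: "\<And>x. x \<in> Z \<Longrightarrow> \<phi> x = x0"
  obtains \<phi>' where "homotopic_fixing Z x0 (top_of_set (cube_bd n)) total \<phi> \<phi>'"
    "\<And>x. x \<in> cube_bd n \<Longrightarrow> \<phi>' x \<notin> ch e ` cube_int (d e)"
    "\<And>x. x \<in> cube_bd n \<Longrightarrow> \<phi>' x = \<phi> x \<or> \<phi>' x \<in> topspace (stage (Suc (d e)))"
proof -
  define m where "m = d e"
  let ?T = "stage (Suc (Suc m))" and ?K = "top_of_set (cube_bd n)" and ?I = "I01"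
  have nm: "n \<le> m" and \<phi>T: "continuous_map ?K ?T \<phi>" using e \<phi> by (auto simp: m_def)
  have \<phi>t: "continuous_map ?K total \<phi>" by (rule continuous_map_stage_into_total [OF \<phi>T])
  have chT: "continuous_map (top_of_set (cube m)) ?T (ch e)" using continuous_map_ch [OF e(1), of "Suc (d e)"] by (simp add: m_def)
  \<comment> \<open>Distance from the centre in the maximum norm, normalised to be 1 on the boundary
    of the cube.\<close>
  define \<beta> where "\<beta> u = max_abs m (\<lambda>i. 2 * u i - 1)" for u :: "nat \<Rightarrow> real"
  have \<beta>c: "continuous_on S \<beta>" for S
  proof -
    have "continuous_on S (\<lambda>u. \<lambda>i. 2 * u i - 1 :: real)"
      by (intro continuous_on_coordinatewise_then_product continuous_intros continuous_on_coordinate)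
    from continuous_on_compose2 [OF continuous_on_max_abs this subset_UNIV] show ?thesis unfolding \<beta>_def .
  qed
  have \<beta>_near: "\<beta> v \<le> \<beta> u + 1/10" if "\<And>i. i < m \<Longrightarrow> \<bar>v i - u i\<bar> \<le> 1/20" for u v
  proof -
    have "\<bar>2 * v i - 1\<bar> \<le> \<beta> u + 1/10" if "i < m" for i
      using \<open>\<And>i. i < m \<Longrightarrow> \<bar>v i - u i\<bar> \<le> 1/20\<close> [OF that] max_abs_ge [OF that, of "\<lambda>i. 2 * u i - 1"]
      unfolding \<beta>_def by linarith
    then show ?thesis unfolding \<beta>_def [of v] using max_abs_nonneg [of m "\<lambda>i. 2 * u i - 1"]
      by (subst max_abs_le_iff) (auto simp: \<beta>_def)
  qed
  have cube_\<beta>: "u \<in> cube m \<longleftrightarrow> \<beta> u \<le> 1" "u \<in> cube_bd m \<longleftrightarrow> \<beta> u = 1" if "\<And>i. i \<ge> m \<Longrightarrow> u i = 0" for u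
    using cube_iff_max_abs [of m u] that by (auto simp: \<beta>_def)
  have int_\<beta>: "u \<in> cube_int m" if "\<And>i. i \<ge> m \<Longrightarrow> u i = 0" "\<beta> u < 1" for u
    using cube_\<beta> [of u] that cube_cases [of u m] by auto
  define D where "D r = {u \<in> cube m. \<beta> u \<le> r}" for r
  have D_int: "D r \<subseteq> cube_int m" if "r < 1" for r using int_\<beta> that by (auto simp: D_def cube_def)
  have D_compact: "compact (D r)" for r
  proof -
    have "closedin (top_of_set (cube m)) (cube m \<inter> \<beta> -` {..r})" by (intro continuous_closedin_preimage \<beta>c) simp
    moreover have "cube m \<inter> \<beta> -` {..r} = D r" by (auto simp: D_def)
    ultimately show ?thesis using closedin_compact [OF compact_cube] by metis
  qed
  \<comment> \<open>The approximation takes place only where \<open>\<phi>\<close> lies in the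
    concentric cube \<open>\<beta> \<le> 2/3\<close>, a compact part of the open cell; there
    \<open>a\<close> gives its coordinates.\<close>
  define K2 where "K2 = {x \<in> cube_bd n. \<phi> x \<in> ch e ` D (2/3)}"
  define a where "a = coord e \<circ> \<phi>"
  have a_ch: "a x \<in> D (2/3)" "ch e (a x) = \<phi> x" if "x \<in> K2" for x
    using that coord_ch [OF e(1)] D_int [of "2/3"] by (auto simp: K2_def a_def m_def)
  have K2_closed: "closedin ?K K2"
  proof -
    have "closedin total (ch e ` D (2/3))"
      using D_int [of "2/3"] compact_imp_closed [OF D_compact] by (intro closedin_ch_image e) (auto simp: m_def)
    from closedin_continuous_map_preimage [OF \<phi>t this] show ?thesis by (simp add: K2_def)
  qed
  have compact_bd: "compact (cube_bd n)" by (rule compact_cube_bd)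
  have K2_compact: "compact K2" using closedin_compact [OF compact_bd K2_closed] .
  have K2_sub: "K2 \<subseteq> cube_bd n" by (auto simp: K2_def)
  have a_cont: "continuous_on K2 a"
  proof -
    have "continuous_map (subtopology ?K {x \<in> topspace ?K. \<phi> x \<in> ch e ` D (2/3)}) (top_of_set (D (2/3))) a"
      unfolding a_def by (rule continuous_map_coord [OF e(1) D_compact _ \<phi>t]) (use D_int [of "2/3"] in \<open>simp add: m_def\<close>)
    moreover have "subtopology ?K {x \<in> topspace ?K. \<phi> x \<in> ch e ` D (2/3)} = top_of_set K2"
      using K2_sub by (simp add: K2_def subtopology_subtopology Int_absorb1)
    ultimately show ?thesis by (simp add: continuous_map_in_subtopology)
  qed
  have "\<exists>g. continuous_on K2 g \<and> lipschitz_l1 n K2 g \<and> (\<forall>x\<in>K2. \<bar>a x i - g x\<bar> < 1/20)" for i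
  proof -
    have "continuous_on K2 (\<lambda>x. a x i)" using continuous_on_compose2 [OF continuous_on_coordinate a_cont subset_UNIV] .
    from lipschitz_approximation [OF K2_compact subset_trans [OF K2_sub cube_bd_subset] this, of "1/20"]
    show ?thesis by (metis divide_pos_pos zero_less_numeral zero_less_one)
  qed
  then obtain g where g: "\<And>i. continuous_on K2 (g i)" "\<And>i. lipschitz_l1 n K2 (g i)"
    "\<And>i x. x \<in> K2 \<Longrightarrow> \<bar>a x i - g i x\<bar> < 1/20" by metis
  \<comment> \<open>The box for \<open>y\<close> has half-width 1/20 around the centre, so
    \<open>\<beta> y \<le> 1/10\<close>; an error of 1/20 in the coordinates changes
    \<open>\<beta>\<close> by at most 1/10. Hence only points with
    \<open>\<beta> (a x) \<le> 1/5\<close> can be moved to \<open>y\<close>, and there the cutoff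
    \<open>\<mu>\<close> below is 1.\<close>
  obtain y where y: "\<And>i. i < m \<Longrightarrow> 9/20 \<le> y i \<and> y i \<le> 11/20" "\<And>i. i \<ge> m \<Longrightarrow> y i = 0"
    "\<And>x. x \<in> K2 \<Longrightarrow> \<exists>i<m. g i x \<noteq> y i"
    using lipschitz_misses_point [OF K2_sub nm, of "9/20" "11/20" g] g(2) by auto
  have y_int: "y \<in> cube_int m" using y by (force simp: cube_int_def)
  \<comment> \<open>A cutoff, 1 for \<open>\<beta> \<le> 1/3\<close> and 0 for
    \<open>\<beta> \<ge> 2/3\<close>. It makes the deformation from \<open>a\<close> towards
    \<open>g\<close> die out at the edge of \<open>K2\<close>, where it must agree with the constant
    homotopy.\<close>
  define \<mu> where "\<mu> x = max 0 (min 1 (2 - 3 * \<beta> (a x)))" for x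
  have \<mu>01: "0 \<le> \<mu> x" "\<mu> x \<le> 1" for x by (auto simp: \<mu>_def)
  have \<mu>c: "continuous_on K2 \<mu>"
    unfolding \<mu>_def by (intro continuous_intros continuous_on_compose2 [OF \<beta>c a_cont subset_UNIV])
  define A where "A t x = (\<lambda>i. if i < m then a x i + t * \<mu> x * (g i x - a x i) else 0)" for t x
  have A_near: "\<bar>A t x i - a x i\<bar> \<le> 1/20" if "x \<in> K2" "0 \<le> t" "t \<le> 1" "i < m" for t x i
  proof -
    have "\<bar>t * \<mu> x * (g i x - a x i)\<bar> \<le> 1 * \<bar>g i x - a x i\<bar>"
      unfolding abs_mult using that \<mu>01 [of x] mult_le_one [of t "\<mu> x"] by (intro mult_right_mono) auto
    then show ?thesis using g(3) [OF that(1), of i] that(4) by (simp add: A_def abs_minus_commute)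
  qed
  have A_D: "A t x \<in> D (9/10)" if "x \<in> K2" "0 \<le> t" "t \<le> 1" for t x
  proof -
    have "\<beta> (A t x) \<le> \<beta> (a x) + 1/10" using A_near [OF that] by (intro \<beta>_near)
    then have "\<beta> (A t x) \<le> 9/10" using a_ch(1) [OF that(1)] by (simp add: D_def)
    then show ?thesis using cube_\<beta>(1) [of "A t x"] by (simp add: D_def A_def)
  qed
  have A_int: "A t x \<in> cube_int m" if "x \<in> K2" "0 \<le> t" "t \<le> 1" for t x using A_D [OF that] D_int [of "9/10"] by auto
  have A0: "A 0 x = a x" if "x \<in> K2" for x using a_ch(1) [OF that] by (auto simp: A_def fun_eq_iff D_def cube_def)
  have A_cont: "continuous_on ({0..1} \<times> K2) (\<lambda>z. A (fst z) (snd z))"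
  proof (rule continuous_on_coordinatewise_then_product)
    fix i
    have s: "continuous_on ({0..1} \<times> K2) (\<lambda>z. f (snd z))" if "continuous_on K2 f" for f :: "_ \<Rightarrow> real"
      by (rule continuous_on_compose2 [OF that continuous_on_snd [OF continuous_on_id]]) auto
    have "continuous_on K2 (\<lambda>x. a x i)" using continuous_on_compose2 [OF continuous_on_coordinate a_cont subset_UNIV] .
    then show "continuous_on ({0..1} \<times> K2) (\<lambda>z. A (fst z) (snd z) i)"
      using s [OF g(1), of i] s [OF \<mu>c] s [of "\<lambda>x. a x i"] by (cases "i < m") (auto simp: A_def intro!: continuous_intros)
  qed
  define H where "H z = (if snd z \<in> K2 then ch e (A (fst z) (snd z)) else \<phi> (snd z))" for z :: "real \<times> coords"
  \<comment> \<open>The closed set on which nothing moves. It meets \<open>K2\<close> only where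
    \<open>\<mu>\<close> vanishes, so the two descriptions of \<open>H\<close> agree.\<close>
  define K3 where "K3 = {x \<in> cube_bd n. \<phi> x \<notin> ch e ` {u \<in> cube m. \<beta> u < 2/3}}"
  have K3_closed: "closedin ?K K3"
  proof -
    have "openin (top_of_set (cube m)) (cube m \<inter> \<beta> -` {..<2/3})" by (intro continuous_openin_preimage_gen \<beta>c) simp
    moreover have "cube m \<inter> \<beta> -` {..<2/3} = {u \<in> cube m. \<beta> u < 2/3}" by auto
    moreover have "{u \<in> cube m. \<beta> u < 2/3} \<subseteq> cube_int m" using int_\<beta> by (auto simp: cube_def)
    ultimately have "openin ?T (ch e ` {u \<in> cube m. \<beta> u < 2/3})"
      using openin_ch_image [OF e(1), of "{u \<in> cube m. \<beta> u < 2/3}"] by (simp add: m_def)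
    from openin_continuous_map_preimage [OF \<phi>T this]
    have "closedin ?K (topspace ?K - {x \<in> topspace ?K. \<phi> x \<in> ch e ` {u \<in> cube m. \<beta> u < 2/3}})" by blast
    moreover have "topspace ?K - {x \<in> topspace ?K. \<phi> x \<in> ch e ` {u \<in> cube m. \<beta> u < 2/3}} = K3"
      by (auto simp: K3_def)
    ultimately show ?thesis by simp
  qed
  have K23: "cube_bd n \<subseteq> K2 \<union> K3" by (auto simp: K2_def K3_def D_def)
  have H3: "H (t, x) = \<phi> x" if "x \<in> K3" for t x
  proof (cases "x \<in> K2")
    case True
    have "\<not> \<beta> (a x) < 2/3" using that a_ch [OF True] by (force simp: K3_def D_def)
    then have "\<mu> x = 0" by (simp add: \<mu>_def)
    then have "A t x = A 0 x" unfolding A_def by (simp only: mult_zero_left mult_zero_right)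
    then show ?thesis using True A0 [OF True] a_ch(2) [OF True] by (simp add: H_def)
  qed (simp add: H_def)
  have H_cont: "continuous_map (prod_topology ?I ?K) ?T H"
  proof (rule continuous_map_paste)
    show "closedin (prod_topology ?I ?K) ({0..1} \<times> K2)" "closedin (prod_topology ?I ?K) ({0..1} \<times> K3)"
      unfolding closedin_prod_Times_iff using K2_closed K3_closed by simp_all
    show "topspace (prod_topology ?I ?K) \<subseteq> {0..1} \<times> K2 \<union> {0..1} \<times> K3" using K23 by auto
    have st: "subtopology (prod_topology ?I ?K) ({0..1} \<times> S) = prod_topology ?I (top_of_set S)" if "S \<subseteq> cube_bd n" for S
      using that by (simp add: subtopology_Times subtopology_subtopology Times_Int_Times Int_absorb1)
    have "continuous_map (prod_topology ?I (top_of_set K2)) (top_of_set (cube m)) (\<lambda>z. A (fst z) (snd z))"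
      using A_cont A_D by (auto simp: prod_topology_subtopology_eu continuous_map_in_subtopology D_def)
    from continuous_map_compose [OF this chT]
    have "continuous_map (prod_topology ?I (top_of_set K2)) ?T (\<lambda>z. ch e (A (fst z) (snd z)))" by (simp add: o_def)
    then show "continuous_map (subtopology (prod_topology ?I ?K) ({0..1} \<times> K2)) ?T H"
      unfolding st [OF K2_sub] by (rule continuous_map_eq) (auto simp: H_def)
    have K3_sub: "K3 \<subseteq> cube_bd n" by (auto simp: K3_def)
    have "continuous_map (top_of_set K3) ?T \<phi>"
      using continuous_map_from_subtopology [OF \<phi>T, of K3] K3_sub by (simp add: subtopology_subtopology Int_absorb1)
    from continuous_map_compose [OF continuous_map_snd this]
    have "continuous_map (prod_topology ?I (top_of_set K3)) ?T (\<phi> \<circ> snd)" .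
    then show "continuous_map (subtopology (prod_topology ?I ?K) ({0..1} \<times> K3)) ?T H"
      unfolding st [OF K3_sub] by (rule continuous_map_eq) (auto simp: H3)
  qed
  have HZ: "H (t, x) = x0" if "x \<in> Z" for t x
  proof -
    have "x \<notin> K2"
    proof
      assume "x \<in> K2"
      then obtain v where v: "v \<in> D (2/3)" "\<phi> x = ch e v" unfolding K2_def by blast
      have "v \<in> cube_int (d e)" using subsetD [OF D_int v(1)] by (simp add: m_def)
      from x0_not_int [OF e(1) this] have "\<phi> x \<noteq> x0" unfolding v(2) .
      then show False using Z [OF that] by simp
    qed
    then show ?thesis using Z [OF that] by (simp add: H_def)
  qed
  define \<phi>1 where "\<phi>1 = (\<lambda>x. H (1, x))"
  have hom1: "homotopic_fixing Z x0 ?K total \<phi> \<phi>1" unfolding homotopic_with_def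
  proof (intro exI conjI ballI allI)
    show "continuous_map (prod_topology ?I ?K) total H" by (rule continuous_map_stage_into_total [OF H_cont])
    show "H (0, x) = \<phi> x" for x using A0 a_ch(2) by (simp add: H_def)
  qed (auto simp: \<phi>1_def HZ)
  have \<phi>1T: "continuous_map ?K ?T \<phi>1"
  proof -
    have "continuous_map ?K (prod_topology ?I ?K) (\<lambda>x. (1, x))" by (auto intro!: continuous_intros)
    from continuous_map_compose [OF this H_cont] show ?thesis by (simp add: \<phi>1_def o_def)
  qed
  \<comment> \<open>If \<open>A 1 x\<close> were \<open>y\<close>, then \<open>\<mu> x = 1\<close>,
    so \<open>A 1 x\<close> would be the value of the Lipschitz approximation \<open>g\<close>,
    which avoids \<open>y\<close>.\<close>
  have gauge_A: "0 < gauge_at m y (A 1 x)" if x: "x \<in> K2" for x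
  proof (rule ccontr)
    assume "\<not> 0 < gauge_at m y (A 1 x)"
    then have eq: "A 1 x i = y i" if "i < m" for i using gauge_ge [OF y_int that, of "A 1 x"] by simp
    have "\<bar>2 * y i - 1\<bar> \<le> 1/10" if "i < m" for i using y(1) [OF that] by linarith
    then have "\<beta> y \<le> 1/10" unfolding \<beta>_def by (subst max_abs_le_iff) auto
    moreover have "\<beta> (a x) \<le> \<beta> y + 1/10"
      using A_near [OF x, of 1] eq by (intro \<beta>_near) (force simp: abs_minus_commute)
    ultimately have "\<mu> x = 1" by (simp add: \<mu>_def)
    then have "g i x = y i" if "i < m" for i using eq [OF that] that by (simp add: A_def)
    then show False using y(3) [OF x] by blast
  qed
  \<comment> \<open>On the compact set \<open>K2\<close> the gauge is bounded below. The bound 1/4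
    serves the points of the cell outside \<open>K2\<close>: there some coordinate differs from 1/2
    by more than 1/3, hence from that of \<open>y\<close> by more than 1/4.\<close>
  obtain h where h: "0 < h" "h \<le> 1/4" "\<And>x. x \<in> K2 \<Longrightarrow> h \<le> gauge_at m y (A 1 x)"
  proof (cases "K2 = {}")
    case True
    then show thesis using that [of "1/4"] by simp
  next
    case False
    have "continuous_on K2 (\<lambda>x. A 1 x)"
      by (rule continuous_on_compose2 [OF A_cont, of _ "\<lambda>x. (1, x)", simplified]) (auto intro!: continuous_intros)
    from continuous_on_compose2 [OF continuous_on_gauge [OF y_int] this subset_UNIV]
    have "continuous_on K2 (\<lambda>x. gauge_at m y (A 1 x))" .
    then obtain x where x: "x \<in> K2" "\<And>x'. x' \<in> K2 \<Longrightarrow> gauge_at m y (A 1 x) \<le> gauge_at m y (A 1 x')"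
      using continuous_attains_inf [OF K2_compact False] by blast
    show thesis
      by (rule that [of "min (1/4) (gauge_at m y (A 1 x))"]) (use gauge_A [OF x(1)] x(2) in \<open>auto simp: min.coboundedI2\<close>)
  qed
  have h1: "h \<le> 1" using h by simp
  define \<phi>2 where "\<phi>2 = (\<lambda>x. push_cell e y h (\<phi>1 x, 1))"
  have pc: "continuous_map (prod_topology ?T ?I) ?T (push_cell e y h)"
    using continuous_map_push_cell [OF e(1) _ h(1) h1, of y] y_int by (simp add: m_def)
  have hom2: "homotopic_fixing Z x0 ?K total \<phi>1 \<phi>2"
  proof -
    have "continuous_map (prod_topology ?I ?K) (prod_topology ?T ?I) (\<lambda>z. (\<phi>1 (snd z), fst z))"
      using continuous_map_compose [OF continuous_map_snd \<phi>1T, of ?I] continuous_map_fst [of ?I ?K]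
      by (simp only: continuous_map_pairwise o_def fst_conv snd_conv)
    from continuous_map_stage_into_total [OF continuous_map_compose [OF this pc]]
    have c: "continuous_map (prod_topology ?I ?K) total (\<lambda>z. push_cell e y h (\<phi>1 (snd z), fst z))" by (simp add: o_def)
    have 0: "push_cell e y h (\<phi>1 x, 0) = \<phi>1 x" for x
    proof (cases "\<phi>1 x \<in> ch e ` cube_int m")
      case True
      then obtain u where u: "u \<in> cube_int m" "\<phi>1 x = ch e u" by blast
      then have uc: "u \<in> cube m" using cube_int_subset by blast
      show ?thesis using push_cell_ch [OF e(1) _ h(1) h1, of y u 0] push_out_cube(3) [OF y_int h(1) h1 uc, of 0] y_int u(2) uc
        by (simp add: m_def)
    qed (simp add: push_cell_def m_def)
    have "push_cell e y h (\<phi>1 x, t) = x0" if "x \<in> Z" for x t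
      using HZ [OF that] x0_not_int [OF e(1)] by (auto simp: push_cell_def \<phi>1_def)
    then show ?thesis unfolding homotopic_with_def using c 0
      by (intro exI [of _ "\<lambda>z. push_cell e y h (\<phi>1 (snd z), fst z)"]) (simp add: \<phi>2_def)
  qed
  have bd_case: "\<phi>2 x \<notin> ch e ` cube_int m \<and> \<phi>2 x \<in> topspace (stage (Suc m))"
    if u: "\<phi>1 x = ch e u" "u \<in> cube m" "h \<le> gauge_at m y u" for x u
  proof -
    have b: "push_out m y h 1 u \<in> cube_bd m" by (rule push_out_1(2) [OF y_int h(1) h1 u(2,3)])
    have "\<phi>2 x = ch e (push_out m y h 1 u)"
      using push_cell_ch [OF e(1) _ h(1) h1, of y u 1] y_int u by (simp add: \<phi>2_def m_def)
    moreover have "ch e (push_out m y h 1 u) \<notin> ch e ` cube_int m"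
      using ch_inj [OF e(1,1), of _ "push_out m y h 1 u"] b cube_bd_subset cube_int_bd_disjoint by (fastforce simp: m_def)
    ultimately show ?thesis using ch_bd [OF e(1)] b by (simp add: m_def)
  qed
  have final: "\<phi>2 x \<notin> ch e ` cube_int m \<and> (\<phi>2 x = \<phi> x \<or> \<phi>2 x \<in> topspace (stage (Suc m)))" if x: "x \<in> cube_bd n" for x
  proof (cases "x \<in> K2")
    case True
    have "\<phi>1 x = ch e (A 1 x)" using True by (simp add: \<phi>1_def H_def)
    moreover have "A 1 x \<in> cube m" using A_D [OF True] by (simp add: D_def)
    ultimately show ?thesis using bd_case h(3) [OF True] by blast
  next
    case False
    have 1: "\<phi>1 x = \<phi> x" using False by (simp add: \<phi>1_def H_def)
    show ?thesis
    proof (cases "\<phi> x \<in> ch e ` cube_int m")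
      case True
      then obtain u where u: "u \<in> cube_int m" "\<phi> x = ch e u" by blast
      have uc: "u \<in> cube m" using u(1) cube_int_subset by blast
      have "\<not> \<beta> u \<le> 2/3" using False x u uc by (auto simp: K2_def D_def)
      then obtain i where i: "i < m" "2/3 < \<bar>2 * u i - 1\<bar>"
        unfolding \<beta>_def by (subst (asm) max_abs_le_iff) (auto simp: not_le)
      have "1/4 \<le> \<bar>u i - y i\<bar>" using i y(1) [OF i(1)] by linarith
      then have "h \<le> gauge_at m y u" using gauge_ge [OF y_int i(1), of u] h(2) by linarith
      then show ?thesis using bd_case [of x u] 1 u uc by simp
    next
      case False
      then show ?thesis using 1 by (simp add: \<phi>2_def push_cell_def m_def)
    qed
  qed
  show thesis by (rule that [OF homotopic_with_trans [OF hom1 hom2]]) (use final in \<open>auto simp: m_def\<close>)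
qed

text \<open>A compact image meets only finitely many open cells of dimension \<open>m\<close>: one
  point chosen in each gives a set all of whose subsets are closed. These cells are cleared one by
  one; each step keeps a value or moves it to the lower skeleton, so no new cell of dimension
  \<open>m\<close> is met.\<close>

lemma deform_off_dimension:
  assumes nm: "n \<le> m" and \<phi>: "continuous_map (top_of_set (cube_bd n)) (stage (Suc (Suc m))) \<phi>"
    and Z: "\<And>x. x \<in> Z \<Longrightarrow> \<phi> x = x0"
  shows "\<exists>\<phi>'. homotopic_fixing Z x0 (top_of_set (cube_bd n)) total \<phi> \<phi>' \<and>
    continuous_map (top_of_set (cube_bd n)) (stage (Suc m)) \<phi>'"
proof -
  let ?K = "top_of_set (cube_bd n)"
  define hit where "hit f = {e \<in> E. d e = m \<and> (\<exists>x\<in>cube_bd n. \<exists>u\<in>cube_int m. f x = ch e u)}" for f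
  have "finite (hit \<phi>)"
  proof -
    have "\<exists>w. \<exists>x\<in>cube_bd n. \<exists>u\<in>cube_int m. w = \<phi> x \<and> w = ch e u" if "e \<in> hit \<phi>" for e
      using that unfolding hit_def by blast
    then obtain w where w: "\<And>e. e \<in> hit \<phi> \<Longrightarrow> \<exists>x\<in>cube_bd n. \<exists>u\<in>cube_int m. w e = \<phi> x \<and> w e = ch e u" by metis
    have hE: "e \<in> E" "d e = m" if "e \<in> hit \<phi>" for e using that by (auto simp: hit_def)
    have wK: "w e \<in> \<phi> ` cube_bd n" if "e \<in> hit \<phi>" for e using w [OF that] by blast
    have wi: "e' = e \<and> ch e u' = w e \<and> u' = coord e (w e)"
      if a: "e \<in> hit \<phi>" "e' \<in> E" "d e' \<le> m" "u' \<in> cube (d e')" "ch e' u' = w e" for e e' u'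
    proof -
      obtain u where u: "u \<in> cube_int m" "w e = ch e u" using w [OF a(1)] by blast
      then have "e = e' \<and> u = u'" using ch_inj [OF hE(1) [OF a(1)] a(2), of u u'] hE(2) [OF a(1)] a by simp
      then show ?thesis using u coord_ch [OF hE(1) [OF a(1)], of u] hE(2) [OF a(1)] by simp
    qed
    have "finite (w ` hit \<phi>)"
    proof (rule finite_if_subsets_closed_compact)
      have "compact (cube_bd n)" by (rule compact_cube_bd)
      then show "compactin total (\<phi> ` cube_bd n)"
        by (intro image_compactin [OF _ continuous_map_stage_into_total [OF \<phi>]]) (simp add: compactin_subtopology)
      show "w ` hit \<phi> \<subseteq> \<phi> ` cube_bd n" using wK by blast
      fix T assume T: "T \<subseteq> w ` hit \<phi>"
      show "closedin total T"
      proof (rule closedin_total_if_stage [OF refl])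
        show "closedin (stage (Suc (Suc m))) T" unfolding closedin_stage_ch
        proof (intro conjI ballI impI)
          show "T \<subseteq> topspace (stage (Suc (Suc m)))" using T wK continuous_map_image_subset_topspace [OF \<phi>] by auto
          fix e' assume e': "e' \<in> E" "d e' < Suc m"
          \<comment> \<open>A cell of dimension at most \<open>m\<close> contains at most the one
            point chosen in it.\<close>
          have "{u \<in> cube (d e'). ch e' u \<in> T} \<subseteq> {coord e' (w e')}"
          proof
            fix u assume "u \<in> {u \<in> cube (d e'). ch e' u \<in> T}"
            then have u: "u \<in> cube (d e')" "ch e' u \<in> w ` hit \<phi>" using T by auto
            then obtain e where e: "e \<in> hit \<phi>" "ch e' u = w e" by (metis imageE)
            from wi [OF e(1) e'(1) _ u(1) e(2)] e'(2) show "u \<in> {coord e' (w e')}" by simp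
          qed
          from finite_subset [OF this]
          show "closedin (top_of_set (cube (d e'))) {u \<in> cube (d e'). ch e' u \<in> T}"
            by (intro closed_subset finite_imp_closed) auto
        qed
      qed
    qed
    moreover have "inj_on w (hit \<phi>)"
    proof (rule inj_onI)
      fix e e' assume e: "e \<in> hit \<phi>" "e' \<in> hit \<phi>" "w e = w e'"
      obtain u where u: "u \<in> cube_int m" "w e' = ch e' u" using w [OF e(2)] by blast
      have "d e' \<le> m" "u \<in> cube (d e')" using hE(2) [OF e(2)] subsetD [OF cube_int_subset u(1)] by simp_all
      moreover have "ch e' u = w e" by (rule trans [OF u(2) [symmetric] e(3) [symmetric]])
      ultimately show "e = e'" using wi [OF e(1) hE(1) [OF e(2)]] by blast
    qed
    ultimately show ?thesis by (rule finite_imageD)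
  qed
  have "\<exists>\<phi>'. homotopic_fixing Z x0 ?K total f \<phi>' \<and> continuous_map ?K (stage (Suc m)) \<phi>'"
    if "finite F" "hit f \<subseteq> F" "continuous_map ?K (stage (Suc (Suc m))) f" "\<forall>x\<in>Z. f x = x0" for f F using that
  proof (induction F arbitrary: f rule: finite_induct)
    case (empty f)
    note f = empty
    show ?case
    proof -
      have "f x \<in> topspace (stage (Suc m))" if x: "x \<in> cube_bd n" for x
      proof (rule ccontr)
        assume n: "f x \<notin> topspace (stage (Suc m))"
        have "f x \<in> topspace (stage (Suc (Suc m)))" using f(2) x by (auto simp: continuous_map_def)
        with n obtain e u where "e \<in> E" "d e = m" "u \<in> cube_int (d e)" "f x = ch e u"
          unfolding stage_cells by (auto simp: less_Suc_eq)
        then have "e \<in> hit f" using x unfolding hit_def by blast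
        then show False using f(1) by blast
      qed
      then have "continuous_map ?K (stage (Suc m)) f"
        using continuous_map_into_stage [OF refl continuous_map_stage_into_total [OF f(2)]] by simp
      then show "\<exists>\<phi>'. homotopic_fixing Z x0 ?K total f \<phi>' \<and> continuous_map ?K (stage (Suc m)) \<phi>'"
        using f(3) continuous_map_stage_into_total [OF f(2)] by (intro exI [of _ f]) simp
    qed
  next
    case (insert e F f)
    note f = insert.prems
    show ?case
    proof -
      show ?thesis
      proof (cases "e \<in> hit f")
        case False
        then show ?thesis using insert.IH [of f] f by blast
      next
        case True
        then have e: "e \<in> E" "d e = m" by (auto simp: hit_def)
        obtain f1 where f1: "homotopic_fixing Z x0 ?K total f f1"
          "\<And>x. x \<in> cube_bd n \<Longrightarrow> f1 x \<notin> ch e ` cube_int m"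
          "\<And>x. x \<in> cube_bd n \<Longrightarrow> f1 x = f x \<or> f1 x \<in> topspace (stage (Suc m))"
          using deform_off_cell [of e n f Z] e nm f(2,3) by auto
        have "f1 x \<in> topspace (stage (Suc (Suc m)))" if "x \<in> cube_bd n" for x
          using f1(3) [OF that] f(2) that stage_mono [of "Suc m" "Suc (Suc m)"] by (auto simp: continuous_map_def)
        then have c: "continuous_map ?K (stage (Suc (Suc m))) f1"
          using homotopic_with_imp_continuous_maps [OF f1(1)] by (intro continuous_map_into_stage) auto
        have "hit f1 \<subseteq> F"
        proof
          fix e' assume "e' \<in> hit f1"
          then obtain x u where x: "e' \<in> E" "d e' = m" "x \<in> cube_bd n" "u \<in> cube_int m" "f1 x = ch e' u"
            by (auto simp: hit_def)
          then have "f1 x \<notin> topspace (stage (Suc m))" using ch_int_stage [of e' u m] by simp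
          then have "f x = ch e' u" using f1(3) [OF x(3)] x(5) by simp
          then have "e' \<in> hit f" using x unfolding hit_def by blast
          moreover have "e' \<noteq> e" using f1(2) [OF x(3)] x(4,5) by blast
          ultimately show "e' \<in> F" using f(1) by blast
        qed
        moreover have "\<forall>x\<in>Z. f1 x = x0" using homotopic_with_imp_property [OF f1(1)] by blast
        ultimately obtain \<phi>' where "homotopic_fixing Z x0 ?K total f1 \<phi>'" "continuous_map ?K (stage (Suc m)) \<phi>'"
          using insert.IH [of f1] c by blast
        then show ?thesis using homotopic_with_trans [OF f1(1)] by blast
      qed
    qed
  qed
  from this [OF \<open>finite (hit \<phi>)\<close> subset_refl \<phi>] show ?thesis using Z by blast
qed

text \<open>One point is chosen for each dimension that the image meets. Such a set has finitely
  many points in every stage, so all its subsets are closed, and compactness makes the set of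
  dimensions finite.\<close>

lemma compact_image_in_stage:
  assumes K: "compact_space K" and \<phi>: "continuous_map K total \<phi>"
  obtains M where "\<And>x. x \<in> topspace K \<Longrightarrow> \<phi> x \<in> topspace (stage (Suc M))"
proof -
  define D where "D = {m. \<exists>e\<in>E. d e = m \<and> (\<exists>u\<in>cube_int m. ch e u \<in> \<phi> ` topspace K)}"
  have "\<exists>w. \<exists>e\<in>E. d e = m \<and> (\<exists>u\<in>cube_int m. w = ch e u \<and> w \<in> \<phi> ` topspace K)" if "m \<in> D" for m
    using that unfolding D_def by blast
  then obtain w where w: "\<And>m. m \<in> D \<Longrightarrow> \<exists>e\<in>E. d e = m \<and> (\<exists>u\<in>cube_int m. w m = ch e u \<and> w m \<in> \<phi> ` topspace K)" by metis
  have wr: "w m \<in> topspace (stage (Suc r)) \<longleftrightarrow> m < r" if m: "m \<in> D" for m r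
  proof -
    obtain e u where "e \<in> E" "d e = m" "u \<in> cube_int (d e)" "w m = ch e u" using w [OF m] by auto
    then show ?thesis using ch_int_stage [of e u r] by simp
  qed
  have wK: "w m \<in> \<phi> ` topspace K" if "m \<in> D" for m using w [OF that] by blast
  have im: "\<phi> ` topspace K \<subseteq> topspace total" using \<phi> by (auto simp: continuous_map_def)
  have "finite (w ` D)"
  proof (rule finite_if_subsets_closed_compact)
    show "compactin total (\<phi> ` topspace K)" using K by (intro image_compactin [OF _ \<phi>]) (simp add: compact_space_def)
    show "w ` D \<subseteq> \<phi> ` topspace K" using wK by blast
    fix T assume T: "T \<subseteq> w ` D"
    show "closedin total T"
    proof (rule closedin_if_finite_in_stages [OF refl t1_one_point])
      show "T \<subseteq> topspace total" using T wK im by blast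
      fix r
      have "T \<inter> topspace (stage r) \<subseteq> w ` {..<r}"
      proof
        fix x assume x: "x \<in> T \<inter> topspace (stage r)"
        then obtain m where m: "m \<in> D" "x = w m" using T by blast
        have "x \<in> topspace (stage (Suc r))" using x stage_mono [of r "Suc r"] by auto
        then show "x \<in> w ` {..<r}" using wr [OF m(1)] m(2) by simp
      qed
      then show "finite (T \<inter> topspace (stage r))" by (rule finite_subset) simp
    qed
  qed
  moreover have "inj_on w D"
  proof (rule inj_onI)
    fix m m' assume m: "m \<in> D" "m' \<in> D" "w m = w m'"
    have "m < r \<longleftrightarrow> m' < r" for r using wr [OF m(1)] wr [OF m(2)] m(3) by simp
    then show "m = m'" by (metis lessI less_not_refl linorder_less_linear)
  qed
  ultimately have "finite D" by (rule finite_imageD)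
  then have "\<exists>M. \<forall>m\<in>D. m < M" by (simp only: finite_nat_set_iff_bounded)
  then obtain M where M: "\<And>m. m \<in> D \<Longrightarrow> m < M" by blast
  show thesis
  proof (rule that)
    fix x assume x: "x \<in> topspace K"
    then obtain r where "\<phi> x \<in> topspace (stage r)" using im total_stage by blast
    then have "\<phi> x \<in> topspace (stage (Suc r))" using stage_mono [of r "Suc r"] by auto
    then consider "\<phi> x = x0" | e u where "e \<in> E" "u \<in> cube_int (d e)" "\<phi> x = ch e u" unfolding stage_cells by blast
    then show "\<phi> x \<in> topspace (stage (Suc M))"
    proof cases
      case (2 e u)
      have "ch e u \<in> \<phi> ` topspace K" using x unfolding 2(3) [symmetric] by blast
      then have "d e \<in> D" using 2(1,2) unfolding D_def by blast
      then show ?thesis using 2 M ch_int_stage by simp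
    qed (simp add: x0_stage)
  qed
qed

text \<open>Descending induction on the skeleton that contains the image: as long as its top
  dimension is at least \<open>n\<close>, the cells of that dimension can be cleared. The result
  lies in cells of dimension less than \<open>n\<close>, the dimension of the cell to be
  attached.\<close>

lemma cellular_approximation:
  assumes \<phi>: "continuous_map (top_of_set (cube_bd n)) total \<phi>" and Z: "\<And>x. x \<in> Z \<Longrightarrow> \<phi> x = x0"
  obtains \<phi>' where "homotopic_fixing Z x0 (top_of_set (cube_bd n)) total \<phi> \<phi>'"
    "continuous_map (top_of_set (cube_bd n)) (stage (Suc n)) \<phi>'"
proof -
  let ?K = "top_of_set (cube_bd n)"
  have "compact (cube_bd n)" by (rule compact_cube_bd)
  then have "compact_space ?K" by (simp add: compact_space_subtopology)
  then obtain M where M: "\<And>x. x \<in> cube_bd n \<Longrightarrow> \<phi> x \<in> topspace (stage (Suc M))"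
    using compact_image_in_stage [OF _ \<phi>] by auto
  have "\<exists>\<phi>'. homotopic_fixing Z x0 ?K total \<phi> \<phi>' \<and> continuous_map ?K (stage (Suc n)) \<phi>'"
    using continuous_map_into_stage [OF refl \<phi>, of "Suc M"] M Z
  proof (induction M arbitrary: \<phi>)
    case 0
    then have c: "continuous_map ?K (stage (Suc 0)) \<phi>" by simp
    have "continuous_map ?K (stage (Suc n)) \<phi>"
      using continuous_map_compose [OF c continuous_map_stage_mono [of "Suc 0" "Suc n"]] by simp
    then show ?case using continuous_map_stage_into_total [OF c] 0(3) by (intro exI [of _ \<phi>]) simp
  next
    case (Suc M)
    then have c: "continuous_map ?K (stage (Suc (Suc M))) \<phi>" by simp
    show ?case
    proof (cases "n \<le> M")
      case True
      obtain \<phi>1 where \<phi>1: "homotopic_fixing Z x0 ?K total \<phi> \<phi>1" "continuous_map ?K (stage (Suc M)) \<phi>1"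
        using deform_off_dimension [OF True c] Suc.prems(3) by blast
      have "\<forall>x\<in>Z. \<phi>1 x = x0" using homotopic_with_imp_property [OF \<phi>1(1)] by blast
      moreover have "\<phi>1 x \<in> topspace (stage (Suc M))" if "x \<in> cube_bd n" for x
        using \<phi>1(2) that by (auto simp: continuous_map_def)
      ultimately obtain \<phi>' where "homotopic_fixing Z x0 ?K total \<phi>1 \<phi>'" "continuous_map ?K (stage (Suc n)) \<phi>'"
        using Suc.IH [of \<phi>1] \<phi>1(2) by blast
      then show ?thesis using homotopic_with_trans [OF \<phi>1(1)] by blast
    next
      case False
      then have "continuous_map ?K (stage (Suc n)) \<phi>"
        using continuous_map_compose [OF c continuous_map_stage_mono [of "Suc (Suc M)" "Suc n"]] by simp
      then show ?thesis using continuous_map_stage_into_total [OF c] Suc.prems(3) by (intro exI [of _ \<phi>]) simp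
    qed
  qed
  then show thesis using that by blast
qed

end

section \<open>Constructions by recursion over the cells\<close>

text \<open>Well-founded recursion with a choice at each \<open>e\<close>. By \<open>cong\<close>
  the property at \<open>e\<close> sees only the values at \<open>e\<close> and at smaller ranks, so
  later choices do not disturb it.\<close>

lemma rank_recursion:
  fixes rk :: "'e \<Rightarrow> nat"
  assumes step: "\<And>e f. e \<in> E \<Longrightarrow> (\<And>e'. e' \<in> E \<Longrightarrow> rk e' < rk e \<Longrightarrow> P e' f) \<Longrightarrow> \<exists>v. P e (f(e := v))"
    and cong: "\<And>e f g. e \<in> E \<Longrightarrow> f e = g e \<Longrightarrow> (\<And>e'. e' \<in> E \<Longrightarrow> rk e' < rk e \<Longrightarrow> f e' = g e') \<Longrightarrow> P e f \<Longrightarrow> P e g"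
  shows "\<exists>f. \<forall>e\<in>E. P e f"
proof -
  define F where "F f e = (SOME v. P e (f(e := v)))" for f e
  define h where "h = wfrec (Wellfounded.measure rk) F"
  have h: "h e = (SOME v. P e ((cut h (Wellfounded.measure rk) e)(e := v)))" for e
    unfolding h_def by (subst wfrec) (simp_all add: F_def)
  have "P e h" if "e \<in> E" for e using that
  proof (induction "rk e" arbitrary: e rule: less_induct)
    case less
    let ?c = "cut h (Wellfounded.measure rk) e"
    have c: "?c e' = h e'" if "rk e' < rk e" for e' using that by (simp add: cut_apply)
    have "P e' ?c" if "e' \<in> E" "rk e' < rk e" for e'
      using c that by (intro cong [OF that(1) _ _ less.hyps [OF that(2,1)]]) simp_all
    from someI_ex [OF step [OF less.prems this]] have "P e (?c(e := h e))" unfolding h [symmetric] .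
    then show ?case by (rule cong [OF less.prems, rotated 2]) (simp_all add: c)
  qed
  then show ?thesis by blast
qed

context cell_complex
begin

text \<open>The product of \<open>total\<close> with \<open>L\<close> is tested on the products of
  the cells with \<open>L\<close>, so it suffices to extend over one cell at a time.
  \<open>Pr\<close> concerns the map on the line over a single point \<open>w\<close>, and is
  therefore settled when the open cell containing \<open>w\<close> is reached.\<close>

lemma extend_over_cells:
  fixes Pr :: "'x \<Rightarrow> ('l \<Rightarrow> 'y) \<Rightarrow> bool"
  assumes L: "locally_compact_space L" "Hausdorff_space L" and B0: "B0 = {}" and o: "continuous_map L Y a" "Pr x0 a"
    and step: "\<And>e g. e \<in> E \<Longrightarrow> continuous_map (prod_topology (stage (rk e)) L) Y g \<Longrightarrow>
        (\<And>w. w \<in> topspace (stage (rk e)) \<Longrightarrow> Pr w (\<lambda>l. g (w, l))) \<Longrightarrow>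
        \<exists>h. continuous_map (prod_topology (cell_space B (d e)) L) Y h \<and>
          (\<forall>p\<in>cell_bd_set B (d e). \<forall>l\<in>topspace L. h (p, l) = g (\<Phi> e p, l)) \<and>
          (\<forall>p\<in>cell_int B {} (d e). Pr (\<Phi> e p) (\<lambda>l. h (p, l)))"
  shows "\<exists>G. continuous_map (prod_topology total L) Y G \<and> (\<forall>w\<in>topspace total. Pr w (\<lambda>l. G (w, l)))"
proof -
  \<comment> \<open>The open cell that contains \<open>w\<close>, with the coordinates of
    \<open>w\<close> in it; unique because open cells are disjoint and \<open>\<Phi>\<close> is
    injective on them.\<close>
  define rep where "rep w = (SOME z. fst z \<in> E \<and> snd z \<in> cell_int B {} (d (fst z)) \<and> w = \<Phi> (fst z) (snd z))" for w
  have rep: "rep (\<Phi> e p) = (e, p)" if "e \<in> E" "p \<in> cell_int B {} (d e)" for e p unfolding rep_def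
  proof (rule some_equality)
    fix z assume z: "fst z \<in> E \<and> snd z \<in> cell_int B {} (d (fst z)) \<and> \<Phi> e p = \<Phi> (fst z) (snd z)"
    then have "e = fst z" using cells_disjoint [of e "fst z" p "snd z"] that B0 by simp
    moreover from this have "p = snd z" using inj_onD [OF inj_cell [OF that(1)], of p "snd z"] z that B0 by simp
    ultimately show "z = (e, p)" by (simp add: prod_eq_iff)
  qed (use that in simp)
  \<comment> \<open>A family \<open>f\<close> enters only through its values on open cells; at a
    boundary point of a cell the value comes from the lower cell that contains its image.\<close>
  define glue where "glue f z = (if fst z \<in> Q then a (snd z) else f (fst (rep (fst z))) (snd (rep (fst z)), snd z))" for f and z :: "'x \<times> 'l"
  have glue_int: "glue f (\<Phi> e p, l) = f e (p, l)" if "e \<in> E" "p \<in> cell_int B {} (d e)" for e p l f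
    using rep [OF that] cell_new [OF that(1), of p] that(2) B0 by (simp add: glue_def)
  have glue_Q: "glue f (x, l) = a l" if "x \<in> Q" for x l f using that by (simp add: glue_def)
  define good where "good e f \<longleftrightarrow> continuous_map (prod_topology (cell_space B (d e)) L) Y (\<lambda>(p, l). glue f (\<Phi> e p, l)) \<and>
    (\<forall>p\<in>cell_int B {} (d e). Pr (\<Phi> e p) (\<lambda>l. glue f (\<Phi> e p, l)))" for e f
  have glue_cong: "glue f (w, l) = glue g (w, l)"
    if "w \<in> topspace (stage r)" "\<And>e'. e' \<in> E \<Longrightarrow> rk e' < r \<Longrightarrow> f e' = g e'" for f g w l r
  proof -
    have "w \<in> Q \<or> (\<exists>e\<in>E. rk e < r \<and> (\<exists>p\<in>cell_int B {} (d e). w = \<Phi> e p))"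
      using that(1) unfolding stage_points B0 by blast
    then show ?thesis using that(2) by (auto simp: glue_int glue_Q)
  qed
  have cases: "p \<in> cell_bd_set B (d e) \<or> p \<in> cell_int B {} (d e)"
    if "p \<in> cell_set B (d e)" for p e using that cube_cases by (auto simp: cell_int_def)
  have bdst: "\<Phi> e p \<in> topspace (stage (rk e))" if "e \<in> E" "p \<in> cell_bd_set B (d e)" for e p
    using continuous_map_image_subset_topspace [OF bd_stage [OF that(1)]] that(2) by blast
  have Qc: "continuous_map L Y (\<lambda>l. glue f (x, l))" if "x \<in> Q" for f x using o(1) by (simp add: glue_Q [OF that])
  have "\<exists>f. \<forall>e\<in>E. good e f"
  proof (rule rank_recursion [where rk = rk])
    fix e f assume e: "e \<in> E" and f: "\<And>e'. e' \<in> E \<Longrightarrow> rk e' < rk e \<Longrightarrow> good e' f"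
    have "continuous_map (prod_topology (stage (rk e)) L) Y (glue f)" unfolding stage_def
      using f Qc by (intro continuous_map_from_prod_final_top [OF L]) (auto simp: good_def)
    moreover have "Pr w (\<lambda>l. glue f (w, l))" if w: "w \<in> topspace (stage (rk e))" for w
    proof -
      consider "w \<in> Q" | e' p where "e' \<in> E" "rk e' < rk e" "p \<in> cell_int B {} (d e')" "w = \<Phi> e' p"
        using w unfolding stage_points B0 by blast
      then show ?thesis
      proof cases
        case 1
        then have "w = x0" using Q by blast
        then show ?thesis using 1 o(2) by (simp add: glue_Q)
      next
        case (2 e' p)
        then show ?thesis using f [OF 2(1,2)] by (simp add: good_def)
      qed
    qed
    ultimately obtain h where h: "continuous_map (prod_topology (cell_space B (d e)) L) Y h"
      "\<And>p l. p \<in> cell_bd_set B (d e) \<Longrightarrow> l \<in> topspace L \<Longrightarrow> h (p, l) = glue f (\<Phi> e p, l)"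
      "\<And>p. p \<in> cell_int B {} (d e) \<Longrightarrow> Pr (\<Phi> e p) (\<lambda>l. h (p, l))" using step [OF e] by metis
    have "good e (f(e := h))" unfolding good_def
    proof (intro conjI ballI)
      have "h (p, l) = glue (f(e := h)) (\<Phi> e p, l)"
        if p: "p \<in> cell_set B (d e)" and l: "l \<in> topspace L" for p l using cases [OF p]
      proof
        assume b: "p \<in> cell_bd_set B (d e)"
        have "glue (f(e := h)) (\<Phi> e p, l) = glue f (\<Phi> e p, l)" by (rule glue_cong [OF bdst [OF e b]]) auto
        then show ?thesis using h(2) [OF b l] by simp
      qed (simp add: glue_int [OF e])
      then show "continuous_map (prod_topology (cell_space B (d e)) L) Y (\<lambda>(p, l). glue (f(e := h)) (\<Phi> e p, l))"
        by (intro continuous_map_eq [OF h(1)]) auto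
      show "Pr (\<Phi> e p) (\<lambda>l. glue (f(e := h)) (\<Phi> e p, l))" if "p \<in> cell_int B {} (d e)" for p
        using h(3) [OF that] by (simp add: glue_int [OF e that])
    qed
    then show "\<exists>v. good e (f(e := v))" by blast
  next
    fix e f g assume e: "e \<in> E" and fg: "f e = g e" "\<And>e'. e' \<in> E \<Longrightarrow> rk e' < rk e \<Longrightarrow> f e' = g e'" and "good e f"
    have "glue f (\<Phi> e p, l) = glue g (\<Phi> e p, l)" if "p \<in> cell_set B (d e)" for p l
      using cases [OF that] glue_cong [OF bdst [OF e], of p f g l] fg by (auto simp: glue_int [OF e])
    moreover have "cell_int B {} (d e) \<subseteq> cell_set B (d e)" using cube_int_subset by (auto simp: cell_int_def)
    ultimately show "good e g"
      using \<open>good e f\<close> continuous_map_eq [of "prod_topology (cell_space B (d e)) L" Y "\<lambda>(p, l). glue f (\<Phi> e p, l)" "\<lambda>(p, l). glue g (\<Phi> e p, l)"]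
      unfolding good_def by (auto simp: glue_int [OF e] fg(1))
  qed
  then obtain f where f: "\<And>e. e \<in> E \<Longrightarrow> good e f" by blast
  have "continuous_map (prod_topology total L) Y (glue f)" unfolding total_def
    using f Qc by (intro continuous_map_from_prod_final_top [OF L]) (auto simp: good_def)
  moreover have "Pr w (\<lambda>l. glue f (w, l))" if w: "w \<in> topspace total" for w
  proof -
    consider "w \<in> Q" | e' p where "e' \<in> E" "p \<in> cell_int B {} (d e')" "w = \<Phi> e' p"
      using w unfolding total_points B0 by blast
    then show ?thesis
    proof cases
      case 1
      then have "w = x0" using Q by blast
      then show ?thesis using 1 o(2) by (simp add: glue_Q)
    next
      case (2 e' p)
      then show ?thesis using f [OF 2(1)] by (simp add: good_def)
    qed
  qed
  ultimately show ?thesis by blast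
qed

end


section \<open>Pushing a prism to one end and its walls\<close>

text \<open>The prism \<open>{0..1} \<times> cube d\<close> is projected radially from a point above the end opposite to
  \<open>s\<close>, namely at height \<open>2 - 3 * s\<close>. A point moves away from the center of projection and, once it
  has reached the end \<open>s\<close> or the walls, uses up the remaining time there.\<close>

definition prism_gauge :: "real \<Rightarrow> nat \<Rightarrow> real \<times> coords \<Rightarrow> real" where
  "prism_gauge s d p = max (\<bar>fst p - (2 - 3 * s)\<bar> / 2) (max_abs d (\<lambda>i. 2 * snd p i - 1))"

text \<open>The factor \<open>c\<close> grows with time until the gauge of the moving point is 1,
  that is, until it meets the end \<open>s\<close> or a wall. Gauges are at least 1/2, so this needs
  a factor of at most 2, while \<open>1 + 2 * \<tau>\<close> reaches 3: every point arrives before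
  time 1.\<close>

definition prism_push :: "real \<Rightarrow> nat \<Rightarrow> (real \<times> coords) \<times> real \<Rightarrow> real \<times> coords" where
  "prism_push s d z = (let c = min (1 / prism_gauge s d (fst z)) (1 + 2 * snd z) in
     (2 - 3 * s + c * (fst (fst z) - (2 - 3 * s)), \<lambda>i. if i < d then 1/2 + c * (snd (fst z) i - 1/2) else 0))"

text \<open>The time spent since arrival, rescaled to end at 1 for every starting point. Where the
  gauge is 1 from the beginning it is the time itself.\<close>

definition prism_time :: "real \<Rightarrow> nat \<Rightarrow> (real \<times> coords) \<times> real \<Rightarrow> real" where
  "prism_time s d z = max 0 ((1 + 2 * snd z - 1 / prism_gauge s d (fst z)) / (3 - 1 / prism_gauge s d (fst z)))"

context
  fixes s :: real and d :: nat
  assumes s: "s = 0 \<or> s = 1"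
begin

lemma prism_gauge:
  assumes "p \<in> {0..1} \<times> cube d"
  shows "1/2 \<le> prism_gauge s d p" "prism_gauge s d p \<le> 1"
    "prism_gauge s d p = 1 \<longleftrightarrow> fst p = s \<or> snd p \<in> cube_bd d"
proof -
  obtain t u where p: "p = (t, u)" "0 \<le> t" "t \<le> 1" "u \<in> cube d" using assms by auto
  have z: "\<And>i. i \<ge> d \<Longrightarrow> u i = 0" using p(4) by (simp add: cube_def)
  have a: "1/2 \<le> \<bar>t - (2 - 3 * s)\<bar> / 2" "\<bar>t - (2 - 3 * s)\<bar> / 2 \<le> 1" "\<bar>t - (2 - 3 * s)\<bar> / 2 = 1 \<longleftrightarrow> t = s"
    using s p(2,3) by auto
  have b: "max_abs d (\<lambda>i. 2 * u i - 1) \<le> 1" "u \<in> cube_bd d \<longleftrightarrow> max_abs d (\<lambda>i. 2 * u i - 1) = 1"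
    using cube_iff_max_abs [OF z] p(4) by auto
  have "\<bar>t - (2 - 3 * s)\<bar> / 2 \<le> prism_gauge s d p" by (simp add: prism_gauge_def p(1))
  then show "1/2 \<le> prism_gauge s d p" using a(1) by linarith
  show "prism_gauge s d p \<le> 1" using a(2) b by (simp add: prism_gauge_def p(1))
  show "prism_gauge s d p = 1 \<longleftrightarrow> fst p = s \<or> snd p \<in> cube_bd d"
    using a b by (auto simp: prism_gauge_def p(1) max_def)
qed

lemma prism_push:
  assumes p: "p \<in> {0..1} \<times> cube d" and \<tau>: "0 \<le> \<tau>" "\<tau> \<le> 1"
  shows "prism_push s d (p, \<tau>) \<in> {0..1} \<times> cube d" "0 \<le> prism_time s d (p, \<tau>)" "prism_time s d (p, \<tau>) \<le> 1"
    and "prism_push s d (p, 0) = p" "prism_time s d (p, 0) = 0" "prism_time s d (p, 1) = 1"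
    and "prism_time s d (p, \<tau>) \<noteq> 0 \<Longrightarrow> fst (prism_push s d (p, \<tau>)) = s \<or> snd (prism_push s d (p, \<tau>)) \<in> cube_bd d"
    and "fst p = s \<or> snd p \<in> cube_bd d \<Longrightarrow> prism_push s d (p, \<tau>) = p \<and> prism_time s d (p, \<tau>) = \<tau>"
proof -
  obtain t u where tu: "p = (t, u)" "0 \<le> t" "t \<le> 1" "u \<in> cube d" using p by auto
  define M where "M = prism_gauge s d p"
  define c where "c = min (1 / M) (1 + 2 * \<tau>)"
  have M: "1/2 \<le> M" "M \<le> 1" using prism_gauge [OF p] by (auto simp: M_def)
  have M1: "1 \<le> 1 / M" "1 / M \<le> 2" using M by (auto simp: field_simps)
  have c: "1 \<le> c" "c * M \<le> 1"
  proof -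
    show "1 \<le> c" using M1 \<tau> by (simp add: c_def)
    have "c * M \<le> 1 / M * M" using M by (intro mult_right_mono) (auto simp: c_def)
    then show "c * M \<le> 1" using M by simp
  qed
  have u0: "u i = 0" if "i \<ge> d" for i using tu(4) that by (simp add: cube_def)
  have id: "(2 - 3 * s + 1 * (t - (2 - 3 * s)), \<lambda>i. if i < d then 1/2 + 1 * (u i - 1/2) else 0) = p"
    using u0 by (auto simp: tu(1))
  let ?q = "prism_push s d (p, \<tau>)"
  have q: "?q = (2 - 3 * s + c * (t - (2 - 3 * s)), \<lambda>i. if i < d then 1/2 + c * (u i - 1/2) else 0)"
    unfolding prism_push_def Let_def c_def M_def tu(1) by (simp only: fst_conv snd_conv)
  have gq: "prism_gauge s d ?q = c * M"
  proof -
    have "max_abs d (\<lambda>i. 2 * snd ?q i - 1) = max_abs d (\<lambda>i. c * (2 * u i - 1))"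
      by (rule max_abs_cong) (simp add: q algebra_simps)
    also have "\<dots> = c * max_abs d (\<lambda>i. 2 * u i - 1)" using c by (intro max_abs_scale) simp
    finally have 1: "max_abs d (\<lambda>i. 2 * snd ?q i - 1) = c * max_abs d (\<lambda>i. 2 * u i - 1)" .
    have 2: "\<bar>fst ?q - (2 - 3 * s)\<bar> / 2 = c * (\<bar>t - (2 - 3 * s)\<bar> / 2)" using c by (simp add: q abs_mult)
    show ?thesis unfolding M_def prism_gauge_def 1 2 using c by (simp add: tu(1) max_mult_distrib_left)
  qed
  have le: "max_abs d (\<lambda>i. 2 * snd ?q i - 1) \<le> 1" "\<bar>fst ?q - (2 - 3 * s)\<bar> / 2 \<le> 1"
    using c(2) unfolding gq [symmetric] prism_gauge_def max.bounded_iff by blast+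
  have "snd ?q \<in> cube d" using le(1) cube_iff_max_abs(1) [of d "snd ?q"] by (simp add: q)
  moreover have "fst ?q \<in> {0..1}"
  proof -
    define y where "y = c * (t - (2 - 3 * s))"
    have f: "fst ?q = 2 - 3 * s + y" by (simp add: q y_def)
    have "1 * 1 \<le> c * \<bar>t - (2 - 3 * s)\<bar>" using c s tu(2,3) by (intro mult_mono) auto
    then have "1 \<le> \<bar>y\<bar>" using c by (simp add: y_def abs_mult)
    moreover have "s = 0 \<Longrightarrow> y \<le> 0" "s = 1 \<Longrightarrow> 0 \<le> y"
      using c tu(2,3) unfolding y_def by (auto intro!: mult_nonneg_nonneg mult_nonneg_nonpos)
    ultimately show ?thesis using s le(2) unfolding f by auto
  qed
  ultimately show qin: "?q \<in> {0..1} \<times> cube d" by (metis mem_Times_iff)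
  have t: "prism_time s d (p, \<tau>) = max 0 ((1 + 2 * \<tau> - 1 / M) / (3 - 1 / M))" for \<tau> by (simp add: prism_time_def M_def)
  show "0 \<le> prism_time s d (p, \<tau>)" by (simp add: t)
  have "(1 + 2 * \<tau> - 1 / M) / (3 - 1 / M) \<le> 1" using M1 \<tau> by (subst divide_le_eq_1_pos) auto
  then show "prism_time s d (p, \<tau>) \<le> 1" by (simp add: t)
  have "(1 - 1 / M) / (3 - 1 / M) \<le> 0" using M1 by (intro divide_nonpos_pos) auto
  then show "prism_time s d (p, 0) = 0" by (simp add: t)
  have "3 - 1 / M \<noteq> 0" using M1 by simp
  then show "prism_time s d (p, 1) = 1" by (simp add: t)
  have m: "min (1 / prism_gauge s d p) (1 + 2 * 0) = 1" using M1 by (simp add: M_def)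
  have "prism_push s d (p, 0) = (2 - 3 * s + 1 * (t - (2 - 3 * s)), \<lambda>i. if i < d then 1/2 + 1 * (u i - 1/2) else 0)"
    unfolding prism_push_def Let_def fst_conv snd_conv m by (simp only: tu(1) fst_conv snd_conv)
  then show "prism_push s d (p, 0) = p" using id by (rule trans)
  show "fst ?q = s \<or> snd ?q \<in> cube_bd d" if "prism_time s d (p, \<tau>) \<noteq> 0"
  proof -
    have "0 < x" if "max 0 x \<noteq> 0" for x :: real using that by simp
    then have "0 < (1 + 2 * \<tau> - 1 / M) / (3 - 1 / M)" using \<open>prism_time s d (p, \<tau>) \<noteq> 0\<close> unfolding t by blast
    then have "1 / M < 1 + 2 * \<tau>" using M1 by (simp add: zero_less_divide_iff)
    then have "c * M = 1" using M by (simp add: c_def)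
    then show ?thesis using gq prism_gauge(3) [OF qin] by simp
  qed
  show "prism_push s d (p, \<tau>) = p \<and> prism_time s d (p, \<tau>) = \<tau>" if "fst p = s \<or> snd p \<in> cube_bd d"
  proof -
    have "M = 1" using prism_gauge(3) [OF p] that by (simp add: M_def)
    then have "c = 1" using \<tau> by (simp add: c_def)
    have "?q = p" using q unfolding \<open>c = 1\<close> id .
    then show ?thesis using \<open>M = 1\<close> \<tau> by (simp add: t)
  qed
qed

lemma continuous_map_prism_push:
  defines "T \<equiv> prod_topology (cell_space I01 d) I01"
  shows "continuous_map T (prod_topology (cell_space I01 d) I01) (\<lambda>z. (prism_push s d z, prism_time s d z))"
proof -
  let ?S = "({0..1} \<times> cube d) \<times> {0..1::real}"
  have T: "T = top_of_set ?S" unfolding T_def by (simp add: prod_topology_subtopology_eu)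
  have u: "continuous_on ?S (\<lambda>z. snd (fst z) i)" for i
    by (rule continuous_on_compose2 [OF continuous_on_coordinate [of UNIV i] continuous_on_snd [OF continuous_on_fst [OF continuous_on_id]]]) simp
  have g: "continuous_on ?S (\<lambda>z. prism_gauge s d (fst z))"
  proof -
    have "continuous_on ?S (\<lambda>z. \<lambda>i. 2 * snd (fst z) i - 1)"
      by (intro continuous_on_coordinatewise_then_product continuous_intros u)
    from continuous_on_compose2 [OF continuous_on_max_abs this subset_UNIV]
    show ?thesis unfolding prism_gauge_def by (intro continuous_intros) auto
  qed
  have nz: "prism_gauge s d (fst z) \<noteq> 0" "3 - 1 / prism_gauge s d (fst z) \<noteq> 0" if "z \<in> ?S" for z
  proof -
    have m: "1/2 \<le> prism_gauge s d (fst z)" using that prism_gauge(1) [of "fst z"] by auto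
    then show "prism_gauge s d (fst z) \<noteq> 0" by simp
    have "1 / prism_gauge s d (fst z) \<le> 2" using m by (simp add: field_simps)
    then show "3 - 1 / prism_gauge s d (fst z) \<noteq> 0" by simp
  qed
  have 1: "continuous_on ?S (\<lambda>z. min (1 / prism_gauge s d (fst z)) (1 + 2 * snd z))"
    by (intro continuous_intros g) (use nz in blast)
  have 2: "continuous_on ?S (\<lambda>z. (if i < d then 1/2 + min (1 / prism_gauge s d (fst z)) (1 + 2 * snd z) * (snd (fst z) i - 1/2) else 0))" for i
    by (cases "i < d") (auto intro!: continuous_intros 1 u simp del: min_def)
  have 3: "continuous_on ?S (prism_push s d)" unfolding prism_push_def Let_def
    by (intro continuous_on_Pair continuous_on_coordinatewise_then_product 2 continuous_intros 1)
  have 4: "continuous_on ?S (prism_time s d)" unfolding prism_time_def by (intro continuous_intros g) (use nz in blast)+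
  have "continuous_on ?S (\<lambda>z. (prism_push s d z, prism_time s d z))" by (intro continuous_on_Pair 3 4)
  moreover have "(prism_push s d z, prism_time s d z) \<in> ?S" if "z \<in> ?S" for z
  proof -
    have z: "fst z \<in> {0..1} \<times> cube d" "0 \<le> snd z" "snd z \<le> 1" using that by auto
    have "prism_push s d z \<in> {0..1} \<times> cube d" "0 \<le> prism_time s d z" "prism_time s d z \<le> 1"
      using prism_push(1-3) [OF z] by simp_all
    then show ?thesis by (simp only: mem_Times_iff fst_conv snd_conv atLeastAtMost_iff)
  qed
  ultimately have "continuous_map (top_of_set ?S) (top_of_set ?S) (\<lambda>z. (prism_push s d z, prism_time s d z))"
    by (simp only: continuous_map_in_subtopology continuous_map_iff_continuous topspace_euclidean_subtopology) blast
  then show ?thesis unfolding T [unfolded T_def] T_def by simp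
qed

end

section \<open>Replacing a generalized complex by a cellular one\<close>

text \<open>A cylinder joins the complex \<open>X\<close> at height 0 to a complex at height 1 whose cells are attached
  in the order of their dimensions. Its cells are \<open>{0..1} \<times> cube (d e)\<close>, and the interior of the
  cell \<open>e\<close> is the product of \<open>{0..1}\<close> with the interior of the cell \<open>e\<close> of \<open>X\<close>. The line over the
  base point is collapsed to \<open>(x0, 0)\<close>.\<close>

locale cylinder =
  fixes fl :: bool and x0 :: 'x and E :: "'e set" and d :: "'e \<Rightarrow> nat"
    and \<Phi> :: "'e \<Rightarrow> unit \<times> coords \<Rightarrow> 'x" and rk :: "'e \<Rightarrow> nat"
    and \<Psi> :: "'e \<Rightarrow> real \<times> coords \<Rightarrow> 'x \<times> real"
  assumes X: "ordinary_cells fl x0 E d \<Phi> rk"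
    and \<Psi>_int: "e \<in> E \<Longrightarrow> u \<in> cube_int (d e) \<Longrightarrow> \<Psi> e (t, u) = (\<Phi> e ((), u), t)"
    and \<Psi>_side: "e \<in> E \<Longrightarrow> u \<in> cube (d e) \<Longrightarrow> s = 0 \<or> s = 1 \<Longrightarrow>
        \<Psi> e (s, u) = (if fst (\<Psi> e (s, u)) = x0 then (x0, 0) else (fst (\<Psi> e (s, u)), s))"
    and \<Psi>_0: "e \<in> E \<Longrightarrow> u \<in> cube (d e) \<Longrightarrow> fst (\<Psi> e (0, u)) = \<Phi> e ((), u)"
    and \<Psi>_base: "e \<in> E \<Longrightarrow> u \<in> cube_bd (d e) \<Longrightarrow> \<Phi> e ((), u) = x0 \<Longrightarrow> 0 \<le> t \<Longrightarrow> t \<le> 1 \<Longrightarrow> \<Psi> e (t, u) = (x0, 0)"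
    and \<Psi>_bd: "e \<in> E \<Longrightarrow> continuous_map (cell_bd_space I01 (d e))
        (cells_top I01 {(x0, 0)} {e' \<in> E. rk e' < rk e} d \<Psi>) (\<Psi> e)"
    and top_bd: "e \<in> E \<Longrightarrow> continuous_map (cell_bd_space one_point (d e))
        (cells_top one_point {x0} {e' \<in> E. rk e' < rk e \<and> d e' < d e} d (\<lambda>e p. fst (\<Psi> e (1, snd p))))
        (\<lambda>p. fst (\<Psi> e (1, snd p)))"
begin

definition end_cell :: "real \<Rightarrow> 'e \<Rightarrow> unit \<times> coords \<Rightarrow> 'x" where
  "end_cell s e p = fst (\<Psi> e (s, snd p))"

text \<open>The line over the base point is a single point, so the base point of either end sits at
  height 0.\<close>

definition incl :: "real \<Rightarrow> 'x \<Rightarrow> 'x \<times> real" where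
  "incl s y = (if y = x0 then (x0, 0) else (y, s))"

definition on_end :: "real \<Rightarrow> 'x \<times> real \<Rightarrow> bool" where
  "on_end s w \<longleftrightarrow> w = (x0, 0) \<or> snd w = s"

definition end_top :: "real \<Rightarrow> 'x topology" where
  "end_top s = cells_top one_point {x0} E d (end_cell s)"

sublocale X: cell_complex one_point "{}" fl "{x0}" x0 E d \<Phi> rk by (rule X)

lemma interior_eq:
  assumes "e \<in> E" "e' \<in> E" "u \<in> cube_int (d e)" "u' \<in> cube_int (d e')" "\<Phi> e ((), u) = \<Phi> e' ((), u')"
  shows "e = e' \<and> u = u'"
proof -
  have i: "((), u) \<in> cell_int one_point {} (d e)" "((), u') \<in> cell_int one_point {} (d e')"
    using assms by (auto simp: cell_int_def)
  have "e = e'" using X.cells_disjoint [OF assms(1,2) i assms(5)] .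
  then show ?thesis using inj_onD [OF X.inj_cell [OF assms(1)], of "((), u)" "((), u')"] i assms(5) by simp
qed

lemma interior_not_x0: "e \<in> E \<Longrightarrow> u \<in> cube_int (d e) \<Longrightarrow> \<Phi> e ((), u) \<noteq> x0"
  using X.cell_new [of e "((), u)"] by (auto simp: cell_int_def)

sublocale W: cell_complex I01 "{}" fl "{(x0, 0)}" "(x0, 0)" E d \<Psi> rk
proof
  show "inj_on (\<Psi> e) (cell_int I01 {} (d e))" if "e \<in> E" for e
    using interior_eq [OF that that] \<Psi>_int [OF that] by (auto simp: cell_int_def inj_on_def)
  show "\<Psi> e p \<notin> {(x0, 0)}" if "e \<in> E" "p \<in> cell_int I01 {} (d e)" for e p
    using interior_not_x0 [OF that(1)] \<Psi>_int [OF that(1)] that(2) by (auto simp: cell_int_def)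
  show "e = e'" if "e \<in> E" "e' \<in> E" "p \<in> cell_int I01 {} (d e)"
    "p' \<in> cell_int I01 {} (d e')" "\<Psi> e p = \<Psi> e' p'" for e e' p p'
  proof -
    obtain t u t' u' where p: "p = (t, u)" "p' = (t', u')" "u \<in> cube_int (d e)" "u' \<in> cube_int (d e')"
      using \<open>p \<in> _\<close> \<open>p' \<in> _\<close> by (auto simp: cell_int_def)
    then show ?thesis
      using interior_eq [OF \<open>e \<in> E\<close> \<open>e' \<in> E\<close> p(3,4)] \<Psi>_int [OF \<open>e \<in> E\<close> p(3)] \<Psi>_int [OF \<open>e' \<in> E\<close> p(4)] \<open>\<Psi> e p = \<Psi> e' p'\<close>
      by simp
  qed
  show "\<Psi> e (b, u) = (x0, 0)" if "fl" "e \<in> E" "b \<in> topspace I01" "u \<in> cube_J (d e)" for e b u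
    using \<Psi>_base [OF that(2) subsetD [OF cube_J_subset that(4)] X.J [OF that(1,2) _ that(4)]] that(3) by simp
qed (use \<Psi>_bd X.rk_pos in auto)

text \<open>At height 1 the attaching maps reach only cells that are smaller in dimension as well as
  in rank, so there the rank can be replaced by the dimension plus 1.\<close>

sublocale Y: cellular_complex fl x0 E d "end_cell 1"
proof
  have int: "end_cell 1 e p = \<Phi> e p" if "e \<in> E" "p \<in> cell_int one_point {} (d e)" for e p
    using \<Psi>_int [OF that(1)] that(2) by (auto simp: cell_int_def end_cell_def)
  show "inj_on (end_cell 1 e) (cell_int one_point {} (d e))" if "e \<in> E" for e
    using X.inj_cell [OF that] int [OF that] by (simp add: inj_on_def)
  show "end_cell 1 e p \<notin> {x0}" if "e \<in> E" "p \<in> cell_int one_point {} (d e)" for e p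
    using X.cell_new [OF that] int [OF that] by simp
  show "e = e'" if "e \<in> E" "e' \<in> E" "p \<in> cell_int one_point {} (d e)" "p' \<in> cell_int one_point {} (d e')"
    "end_cell 1 e p = end_cell 1 e' p'" for e e' p p'
    using X.cells_disjoint [OF that(1-4)] int [OF that(1,3)] int [OF that(2,4)] that(5) by simp
  show "end_cell 1 e (b, u) = x0" if "fl" "e \<in> E" "b \<in> topspace one_point" "u \<in> cube_J (d e)" for e b u
    using \<Psi>_base [OF that(2) subsetD [OF cube_J_subset that(4)] X.J [OF that(1,2) _ that(4)], of 1] by (simp add: end_cell_def)
  show "continuous_map (cell_bd_space one_point (d e))
      (cells_top one_point {x0} {e' \<in> E. Suc (d e') < Suc (d e)} d (end_cell 1)) (end_cell 1 e)"
    if "e \<in> E" for e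
  proof -
    have eq: "end_cell 1 = (\<lambda>e p. fst (\<Psi> e (1, snd p)))" by (simp add: fun_eq_iff end_cell_def)
    have sub: "{e' \<in> E. rk e' < rk e \<and> d e' < d e} \<subseteq> {e' \<in> E. Suc (d e') < Suc (d e)}" by auto
    show ?thesis using continuous_map_compose [OF top_bd [OF that] continuous_map_final_top_mono [OF sub]] unfolding eq by simp
  qed
qed auto

lemma end_top_0: "end_top 0 = X.total" unfolding end_top_def X.total_def by (rule final_top_cong) (auto simp: end_cell_def \<Psi>_0)

lemma end_top_1: "end_top 1 = Y.total" by (simp add: end_top_def Y.total_def)

lemma fst_incl [simp]: "fst (incl s y) = y" by (simp add: incl_def)

lemma \<Psi>_incl: "e \<in> E \<Longrightarrow> u \<in> cube (d e) \<Longrightarrow> s = 0 \<or> s = 1 \<Longrightarrow> \<Psi> e (s, u) = incl s (end_cell s e (b, u))"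
  using \<Psi>_side [of e u s] by (simp add: incl_def end_cell_def)

lemma on_end_incl: "on_end s (incl s y)" by (simp add: on_end_def incl_def)

lemma x0_W: "(x0, 0) \<in> topspace W.total" by (simp add: W.topspace_total)

lemma W_stage_point:
  assumes "w \<in> topspace (W.stage r)"
  shows "w = (x0, 0) \<or> (\<exists>e\<in>E. rk e < r \<and> (\<exists>u\<in>cube_int (d e). \<exists>t\<in>{0..1}. w = \<Psi> e (t, u) \<and> w = (\<Phi> e ((), u), t)))"
proof -
  consider "w = (x0, 0)" | e p where "e \<in> E" "rk e < r" "p \<in> cell_int I01 {} (d e)" "w = \<Psi> e p"
    using assms unfolding W.stage_points by blast
  then show ?thesis
  proof cases
    case (2 e p)
    obtain t u where "p = (t, u)" "t \<in> {0..1}" "u \<in> cube_int (d e)" using 2(3) by (auto simp: cell_int_def)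
    then show ?thesis using 2 \<Psi>_int [OF 2(1), of u t] by blast
  qed simp
qed

lemma on_end_point:
  assumes "w \<in> topspace W.total" "on_end s w" "s = 0 \<or> s = 1"
  shows "w = incl s (fst w)" "fst w \<in> topspace (end_top s)"
proof -
  obtain r where "w \<in> topspace (W.stage r)" using W.total_stage [OF assms(1)] by blast
  then consider "w = (x0, 0)" | e u t where "e \<in> E" "u \<in> cube_int (d e)" "w = (\<Phi> e ((), u), t)"
    using W_stage_point by blast
  then have "w = incl s (fst w) \<and> fst w \<in> topspace (end_top s)"
  proof cases
    case 1
    then show ?thesis by (simp add: incl_def end_top_def)
  next
    case (2 e u t)
    then have n: "\<Phi> e ((), u) \<noteq> x0" using interior_not_x0 by blast
    then have "t = s" using assms(2) 2(3) by (simp add: on_end_def)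
    moreover have "\<Phi> e ((), u) = end_cell s e ((), u)" using \<Psi>_int [OF 2(1,2)] by (simp add: end_cell_def)
    moreover have "((), u) \<in> cell_set one_point (d e)" using 2(2) cube_int_subset by auto
    ultimately show ?thesis using n 2(1,3) by (auto simp: incl_def end_top_def)
  qed
  then show "w = incl s (fst w)" "fst w \<in> topspace (end_top s)" by blast+
qed

lemma continuous_map_incl:
  assumes s: "s = 0 \<or> s = 1"
  shows "continuous_map (end_top s) W.total (incl s)" unfolding end_top_def
proof (rule continuous_map_from_final_top)
  show "incl s x \<in> topspace W.total" if "x \<in> {x0}" for x using that x0_W by (simp add: incl_def)
  fix e assume e: "e \<in> E"
  have "continuous_map (cell_space one_point (d e)) (cell_space I01 (d e)) (\<lambda>p. (s, snd p))"
    using s by (simp only: continuous_map_pairwise o_def fst_conv snd_conv continuous_map_snd) auto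
  from continuous_map_compose [OF this W.continuous_map_cell_total [OF e]]
  show "continuous_map (cell_space one_point (d e)) W.total (incl s \<circ> end_cell s e)"
    by (rule continuous_map_eq) (use \<Psi>_incl [OF e _ s] in auto)
qed

text \<open>Induction on the rank. In a prism the preimage of the copy of \<open>C\<close> consists
  of a part of the end \<open>s\<close> and a part of the walls; the latter is mapped to lower
  stages, where the claim is known. Each end is thereby embedded as a closed subspace.\<close>

lemma closedin_incl:
  assumes s: "s = 0 \<or> s = 1" and C: "closedin (end_top s) C"
  shows "closedin W.total (incl s ` C)"
proof -
  have Csub: "C \<subseteq> topspace (end_top s)" by (rule closedin_subset [OF C])
  have sub: "incl s ` C \<subseteq> topspace W.total"
    using Csub continuous_map_image_subset_topspace [OF continuous_map_incl [OF s]] by blast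
  have Ce: "closedin (top_of_set (cube (d e))) {u \<in> cube (d e). end_cell s e ((), u) \<in> C}" if "e \<in> E" for e
  proof -
    have "continuous_map (top_of_set (cube (d e))) (cell_space one_point (d e)) (\<lambda>u. ((), u))"
      by (simp only: continuous_map_pairwise o_def fst_conv snd_conv) auto
    moreover have "continuous_map (cell_space one_point (d e)) (end_top s) (end_cell s e)" unfolding end_top_def using that
      by (rule continuous_map_into_final_top [where P = "\<lambda>e. cell_space one_point (d e)" and q = "end_cell s"])
    ultimately have "continuous_map (top_of_set (cube (d e))) (end_top s) (end_cell s e \<circ> (\<lambda>u. ((), u)))"
      by (rule continuous_map_compose)
    from closedin_continuous_map_preimage [OF this C] show ?thesis by simp
  qed
  have inC: "w \<in> incl s ` C \<longleftrightarrow> on_end s w \<and> fst w \<in> C" if "w \<in> topspace W.total" for w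
    using on_end_point(1) [OF that _ s] on_end_incl [of s] by (metis fst_incl imageE imageI)
  have "closedin (cell_space I01 (d e)) {p \<in> cell_set I01 (d e). \<Psi> e p \<in> incl s ` C}"
    if "e \<in> E" for e using that
  proof (induction "rk e" arbitrary: e rule: less_induct)
    case less
    let ?P = "cell_space I01 (d e)" and ?Q = "cell_bd_space I01 (d e)"
    let ?S = "{s} \<times> {u \<in> cube (d e). end_cell s e ((), u) \<in> C}"
      and ?T = "{p \<in> topspace ?Q. \<Psi> e p \<in> incl s ` C \<inter> topspace (W.stage (rk e))}"
    have "closedin ?P ?S" using Ce [OF less.prems] s unfolding closedin_prod_Times_iff by auto
    moreover have "closedin ?P ?T"
    proof (rule closedin_cell_bd)
      have "closedin (W.stage (rk e)) (incl s ` C \<inter> topspace (W.stage (rk e)))" unfolding W.closedin_stage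
      proof (intro conjI ballI impI)
        fix e' assume e': "e' \<in> E" "rk e' < rk e"
        have "{p \<in> cell_set I01 (d e'). \<Psi> e' p \<in> incl s ` C \<inter> topspace (W.stage (rk e))} =
            {p \<in> cell_set I01 (d e'). \<Psi> e' p \<in> incl s ` C}" using e' by (auto simp: W.topspace_stage)
        then show "closedin (cell_space I01 (d e'))
            {p \<in> cell_set I01 (d e'). \<Psi> e' p \<in> incl s ` C \<inter> topspace (W.stage (rk e))}"
          using less.hyps [OF e'(2,1)] by simp
      qed simp
      from closedin_continuous_map_preimage [OF W.bd_stage [OF less.prems] this] show "closedin ?Q ?T" .
    qed
    ultimately have "closedin ?P (?S \<union> ?T)" by (rule closedin_Un)
    moreover have "{p \<in> topspace ?P. \<Psi> e p \<in> incl s ` C} = ?S \<union> ?T"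
    proof (intro equalityI subsetI)
      fix p assume p: "p \<in> {p \<in> topspace ?P. \<Psi> e p \<in> incl s ` C}"
      then obtain t u where tu: "p = (t, u)" "t \<in> {0..1}" "u \<in> cube (d e)" by auto
      show "p \<in> ?S \<union> ?T"
      proof (cases "u \<in> cube_bd (d e)")
        case True
        then have "p \<in> topspace ?Q" using tu by simp
        then show ?thesis using p continuous_map_image_subset_topspace [OF W.bd_stage [OF less.prems]] by blast
      next
        case False
        then have u: "u \<in> cube_int (d e)" using tu(3) cube_cases by blast
        have w: "\<Psi> e p = (\<Phi> e ((), u), t)" using \<Psi>_int [OF less.prems u] tu(1) by simp
        have "\<Psi> e p \<in> topspace W.total" using p sub by auto
        then have "on_end s (\<Psi> e p)" "\<Phi> e ((), u) \<in> C" using inC p w by auto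
        moreover have "end_cell s e ((), u) = \<Phi> e ((), u)" using \<Psi>_int [OF less.prems u] by (simp add: end_cell_def)
        ultimately show ?thesis using w interior_not_x0 [OF less.prems u] tu by (simp add: on_end_def)
      qed
    next
      fix p assume "p \<in> ?S \<union> ?T"
      then show "p \<in> {p \<in> topspace ?P. \<Psi> e p \<in> incl s ` C}"
      proof
        assume "p \<in> ?S"
        then obtain u where "p = (s, u)" "u \<in> cube (d e)" "end_cell s e ((), u) \<in> C" by auto
        then show ?thesis using \<Psi>_incl [OF less.prems _ s, of u "()"] s by auto
      qed (use cube_bd_subset in auto)
    qed
    ultimately show ?case by simp
  qed
  then show ?thesis unfolding W.closedin_total using sub by blast
qed

text \<open>The cylinder need not be a product, so the first component is used only for maps into an
  end; there it is the inverse of \<open>incl s\<close>, which takes closed sets to closed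
  sets.\<close>

lemma continuous_map_fst_end:
  assumes s: "s = 0 \<or> s = 1" and f: "continuous_map K W.total f" and S: "\<And>k. k \<in> topspace K \<Longrightarrow> on_end s (f k)"
  shows "continuous_map K (end_top s) (\<lambda>k. fst (f k))" unfolding continuous_map_closedin
proof (intro conjI allI impI)
  have fW: "f k \<in> topspace W.total" if "k \<in> topspace K" for k using continuous_map_image_subset_topspace [OF f] that by blast
  note p = on_end_point [OF fW S s]
  show "(\<lambda>k. fst (f k)) \<in> topspace K \<rightarrow> topspace (end_top s)" using p(2) by blast
  fix C assume "closedin (end_top s) C"
  from closedin_continuous_map_preimage [OF f closedin_incl [OF s this]]
  have "closedin K {k \<in> topspace K. f k \<in> incl s ` C}" .
  moreover have "f k \<in> incl s ` C \<longleftrightarrow> fst (f k) \<in> C" if "k \<in> topspace K" for k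
    using p(1) [OF that that] by (metis fst_incl imageE imageI)
  then have "{k \<in> topspace K. f k \<in> incl s ` C} = {k \<in> topspace K. fst (f k) \<in> C}" by blast
  ultimately show "closedin K {k \<in> topspace K. fst (f k) \<in> C}" by simp
qed

text \<open>A point of a prism first runs radially to the end \<open>s\<close> or to a wall; from a
  wall it spends the remaining time following the deformation already constructed on the lower
  stage. Points of the end never move, which makes the result a deformation retraction.\<close>

lemma deformation_onto_end:
  assumes s: "s = 0 \<or> s = 1"
  shows "\<exists>G. continuous_map (prod_topology W.total I01) W.total G \<and>
    (\<forall>w\<in>topspace W.total. G (w, 0) = w \<and> on_end s (G (w, 1)) \<and> (on_end s w \<longrightarrow> (\<forall>\<tau>\<in>{0..1}. G (w, \<tau>) = w)))"
proof -
  let ?I = "I01"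
  define Pr where "Pr w f \<longleftrightarrow> f 0 = w \<and> on_end s (f 1) \<and> (on_end s w \<longrightarrow> (\<forall>\<tau>\<in>{0..1}. f \<tau> = w))"
    for w and f :: "real \<Rightarrow> 'x \<times> real"
  have "\<exists>G. continuous_map (prod_topology W.total ?I) W.total G \<and> (\<forall>w\<in>topspace W.total. Pr w (\<lambda>\<tau>. G (w, \<tau>)))"
  proof (rule W.extend_over_cells [OF locally_compact_Icc Hausdorff_Icc refl])
    show "continuous_map ?I W.total (\<lambda>_. (x0, 0))" using x0_W by simp
    show "Pr (x0, 0) (\<lambda>_. (x0, 0))" by (simp add: Pr_def on_end_def)
    fix e g assume e: "e \<in> E" and g: "continuous_map (prod_topology (W.stage (rk e)) ?I) W.total g"
      and Pg: "\<And>w. w \<in> topspace (W.stage (rk e)) \<Longrightarrow> Pr w (\<lambda>l. g (w, l))"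
    let ?P = "cell_space ?I (d e)" and ?Q = "cell_bd_space ?I (d e)"
    let ?T = "prod_topology ?P ?I"
    define R where "R z = (prism_push s (d e) z, prism_time s (d e) z)" for z
    \<comment> \<open>\<open>F\<close> continues from the pair \<open>R z\<close> of current
      position and remaining time: on the walls by the lower deformation, elsewhere by standing
      still.\<close>
    define F where "F z = (if snd (fst z) \<in> cube_bd (d e) then g (\<Psi> e (fst z), snd z) else \<Psi> e (fst z))" for z
    have R: "continuous_map ?T ?T R" unfolding R_def by (rule continuous_map_prism_push [OF s])
    have TS: "topspace ?T = ({0..1} \<times> cube (d e)) \<times> {0..1}" by simp
    have RT: "R z \<in> ({0..1} \<times> cube (d e)) \<times> {0..1}" if "z \<in> topspace ?T" for z
      using continuous_map_image_subset_topspace [OF R] that unfolding TS by blast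
    have bdW: "\<Psi> e p \<in> topspace (W.stage (rk e))" if "p \<in> {0..1} \<times> cube_bd (d e)" for p
      using continuous_map_image_subset_topspace [OF W.bd_stage [OF e]] that by auto
    have end\<Psi>: "on_end s (\<Psi> e (s, u))" if "u \<in> cube (d e)" for u
      using \<Psi>_incl [OF e that s, of "()"] on_end_incl by simp
    have Fst: "F z = \<Psi> e (fst z)" if z: "z \<in> ({0..1} \<times> cube (d e)) \<times> {0..1}" "snd z = 0 \<or> fst (fst z) = s" for z
    proof (cases "snd (fst z) \<in> cube_bd (d e)")
      case True
      obtain t u \<tau> where z': "z = ((t, u), \<tau>)" "t \<in> {0..1}" "u \<in> cube (d e)" "\<tau> \<in> {0..1}" using z(1) by auto
      have "(t, u) \<in> {0..1} \<times> cube_bd (d e)" using True z' by simp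
      then have P: "Pr (\<Psi> e (t, u)) (\<lambda>l. g (\<Psi> e (t, u), l))" using Pg [OF bdW] by blast
      have "\<tau> = 0 \<or> on_end s (\<Psi> e (t, u))" using z(2) z' end\<Psi> by auto
      then show ?thesis using P z'(4) True unfolding F_def Pr_def z'(1) by auto
    qed (simp add: F_def)
    \<comment> \<open>Either no time has passed since arrival or the point is at the end, and then
      \<open>F\<close> is the characteristic map by \<open>Fst\<close>; or the point is on a wall.
      Both conditions are closed, and \<open>prism_time\<close> is positive only after arrival, so
      one of them always holds.\<close>
    define A where "A = {z \<in> topspace ?T. snd (R z) = 0 \<or> fst (fst (R z)) = s}"
    define B where "B = {z \<in> topspace ?T. snd (fst (R z)) \<in> cube_bd (d e)}"
    have c1: "continuous_map ?T euclideanreal (\<lambda>z. snd (R z))"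
      using continuous_map_compose [OF R continuous_map_snd] by (simp add: o_def)
    have c2: "continuous_map ?T ?I (\<lambda>z. fst (fst (R z)))"
      using continuous_map_compose [OF continuous_map_compose [OF R continuous_map_fst] continuous_map_fst] by (simp only: o_def)
    have c3: "continuous_map ?T (top_of_set (cube (d e))) (\<lambda>z. snd (fst (R z)))"
      using continuous_map_compose [OF continuous_map_compose [OF R continuous_map_fst] continuous_map_snd] by (simp only: o_def)
    have "continuous_map ?T W.total (\<lambda>z. F (R z))"
    proof (rule continuous_map_paste [where S = A and T = B])
      have "closedin ?T {z \<in> topspace ?T. snd (R z) \<in> {0}}" by (rule closedin_continuous_map_preimage [OF c1]) simp
      moreover have "closedin ?T {z \<in> topspace ?T. fst (fst (R z)) \<in> {s}}"
        by (rule closedin_continuous_map_preimage [OF c2]) (use s in \<open>auto intro!: closed_subset\<close>)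
      ultimately have "closedin ?T ({z \<in> topspace ?T. snd (R z) \<in> {0}} \<union> {z \<in> topspace ?T. fst (fst (R z)) \<in> {s}})"
        by (rule closedin_Un)
      moreover have "{z \<in> topspace ?T. snd (R z) \<in> {0}} \<union> {z \<in> topspace ?T. fst (fst (R z)) \<in> {s}} = A"
        unfolding A_def by blast
      ultimately show "closedin ?T A" by simp
      have "closedin (top_of_set (cube (d e))) (cube_bd (d e))" by (rule closed_subset [OF cube_bd_subset closed_cube_bd])
      from closedin_continuous_map_preimage [OF c3 this] show "closedin ?T B" unfolding B_def .
      show "topspace ?T \<subseteq> A \<union> B"
      proof
        fix z assume z: "z \<in> topspace ?T"
        then have "fst z \<in> {0..1} \<times> cube (d e)" "0 \<le> snd z" "snd z \<le> 1" unfolding TS by auto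
        from prism_push(7) [OF s this] show "z \<in> A \<union> B" using z unfolding A_def B_def R_def by auto
      qed
      have "continuous_map ?T W.total (\<lambda>z. \<Psi> e (fst (R z)))"
        using continuous_map_compose [OF continuous_map_compose [OF R continuous_map_fst] W.continuous_map_cell_total [OF e]]
        by (simp only: o_def)
      then show "continuous_map (subtopology ?T A) W.total (\<lambda>z. F (R z))"
        by (rule continuous_map_eq [OF continuous_map_from_subtopology])
          (use Fst [OF RT] in \<open>simp only: A_def topspace_subtopology Int_iff mem_Collect_eq\<close>)
      have "continuous_map (subtopology ?T B) (prod_topology ?Q ?I) R"
      proof (rule iffD2 [OF continuous_map_pairwise], rule conjI)
        have "continuous_map (subtopology ?T B) ?P (fst \<circ> R)"
          by (rule continuous_map_from_subtopology [OF continuous_map_compose [OF R continuous_map_fst]])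
        moreover have "(fst \<circ> R) z \<in> topspace ?I \<times> cube_bd (d e)" if "z \<in> topspace (subtopology ?T B)" for z
          using that RT [of z] unfolding B_def by (auto simp: mem_Times_iff)
        ultimately show "continuous_map (subtopology ?T B) ?Q (fst \<circ> R)"
          unfolding cell_bd_subtopology continuous_map_in_subtopology by blast
        show "continuous_map (subtopology ?T B) ?I (snd \<circ> R)"
          by (rule continuous_map_from_subtopology [OF continuous_map_compose [OF R continuous_map_snd]])
      qed
      moreover have "continuous_map (prod_topology ?Q ?I) (prod_topology (W.stage (rk e)) ?I) (\<lambda>z. (\<Psi> e (fst z), snd z))"
        using continuous_map_compose [OF continuous_map_fst W.bd_stage [OF e], of ?I]
        by (simp only: continuous_map_pairwise o_def fst_conv snd_conv continuous_map_snd)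
      ultimately have "continuous_map (subtopology ?T B) W.total (g \<circ> ((\<lambda>z. (\<Psi> e (fst z), snd z)) \<circ> R))"
        using g by (intro continuous_map_compose)
      then show "continuous_map (subtopology ?T B) W.total (\<lambda>z. F (R z))" by (rule continuous_map_eq) (simp add: B_def F_def)
    qed
    moreover have "F (R (p, l)) = g (\<Psi> e p, l)" if "p \<in> topspace ?Q" "l \<in> topspace ?I" for p l
    proof -
      have p: "p \<in> {0..1} \<times> cube (d e)" "snd p \<in> cube_bd (d e)" "0 \<le> l" "l \<le> 1"
        using that cube_bd_subset by auto
      have "R (p, l) = (p, l)" using prism_push(8) [OF s p(1,3,4)] p(2) by (simp add: R_def)
      then show ?thesis using p(2) by (simp add: F_def)
    qed
    moreover have "Pr (\<Psi> e p) (\<lambda>l. F (R (p, l)))" if p: "p \<in> cell_int ?I {} (d e)" for p unfolding Pr_def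
    proof (intro conjI impI ballI)
      have pP: "p \<in> {0..1} \<times> cube (d e)" using p cube_int_subset by (auto simp: cell_int_def)
      have "snd p \<notin> cube_bd (d e)" using p cube_int_bd_disjoint by (auto simp: cell_int_def)
      moreover have "R (p, 0) = (p, 0)" using prism_push(4,5) [OF s pP, of 0] by (simp add: R_def)
      ultimately show "F (R (p, 0)) = \<Psi> e p" by (simp add: F_def)
      have R1: "R (p, 1) = (prism_push s (d e) (p, 1), 1)" using prism_push(6) [OF s pP, of 1] by (simp add: R_def)
      let ?q = "prism_push s (d e) (p, 1)"
      have q: "?q \<in> {0..1} \<times> cube (d e)" "fst ?q = s \<or> snd ?q \<in> cube_bd (d e)"
        using prism_push(1,7) [OF s pP, of 1] R1 by (simp_all add: R_def)
      show "on_end s (F (R (p, 1)))"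
      proof (cases "snd ?q \<in> cube_bd (d e)")
        case True
        have "?q \<in> {0..1} \<times> cube_bd (d e)" using q(1) True by (metis mem_Times_iff)
        from Pg [OF bdW [OF this]] show ?thesis using True by (simp add: F_def R1 Pr_def)
      next
        case False
        then have "?q = (s, snd ?q)" "snd ?q \<in> cube (d e)" using q by (metis prod.collapse, metis mem_Times_iff)
        then have "on_end s (\<Psi> e ?q)" using end\<Psi> by metis
        then show ?thesis using False by (simp add: F_def R1)
      qed
      fix \<tau> :: real assume "on_end s (\<Psi> e p)" "\<tau> \<in> {0..1}"
      obtain t u where tu: "p = (t, u)" "u \<in> cube_int (d e)" using p by (auto simp: cell_int_def)
      have "t = s" using \<open>on_end s (\<Psi> e p)\<close> \<Psi>_int [OF e tu(2)] interior_not_x0 [OF e tu(2)] tu(1) by (simp add: on_end_def)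
      then have "R (p, \<tau>) = (p, \<tau>)" using prism_push(8) [OF s pP, of \<tau>] \<open>\<tau> \<in> {0..1}\<close> tu(1) by (simp add: R_def)
      then show "F (R (p, \<tau>)) = \<Psi> e p" using \<open>snd p \<notin> cube_bd (d e)\<close> by (simp add: F_def)
    qed
    ultimately show "\<exists>h. continuous_map ?T W.total h \<and>
        (\<forall>p\<in>topspace ?Q. \<forall>l\<in>topspace ?I. h (p, l) = g (\<Psi> e p, l)) \<and> (\<forall>p\<in>cell_int ?I {} (d e). Pr (\<Psi> e p) (\<lambda>l. h (p, l)))"
      by blast
  qed
  then show ?thesis unfolding Pr_def .
qed

end

context cylinder
begin

text \<open>Both ends are deformation retracts of the same cylinder: include one end and retract to
  the other.\<close>

lemma ends_homotopy_equivalent: "pointed_homotopy_equivalent (X.total, x0) (Y.total, x0)"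
proof -
  let ?I = "I01"
  obtain G where G: "\<And>s. s = 0 \<or> s = 1 \<Longrightarrow> continuous_map (prod_topology W.total ?I) W.total (G s) \<and>
    (\<forall>w\<in>topspace W.total. G s (w, 0) = w \<and> on_end s (G s (w, 1)) \<and> (on_end s w \<longrightarrow> (\<forall>\<tau>\<in>{0..1}. G s (w, \<tau>) = w)))"
    using deformation_onto_end by metis
  have Gc: "continuous_map (prod_topology W.total ?I) W.total (G s)" if "s = 0 \<or> s = 1" for s using G [OF that] by blast
  have G0: "G s (w, 0) = w" and G1: "on_end s (G s (w, 1))"
    and Gs: "on_end s w \<Longrightarrow> 0 \<le> \<tau> \<Longrightarrow> \<tau> \<le> 1 \<Longrightarrow> G s (w, \<tau>) = w"
    if "s = 0 \<or> s = 1" "w \<in> topspace W.total" for s w \<tau> using G [OF that(1)] that(2) by simp_all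
  define r where "r s w = fst (G s (w, 1))" for s w
  have rc: "continuous_map W.total (end_top s) (r s)" if s: "s = 0 \<or> s = 1" for s
  proof -
    have "continuous_map W.total (prod_topology W.total ?I) (\<lambda>w. (w, 1))" by (simp add: continuous_map_pairwise o_def)
    from continuous_map_compose [OF this Gc [OF s]]
    have "continuous_map W.total W.total (\<lambda>w. G s (w, 1))" by (simp add: o_def)
    from continuous_map_fst_end [OF s this G1 [OF s]] show ?thesis by (simp add: r_def [abs_def])
  qed
  have iW: "incl s y \<in> topspace W.total" if "s = 0 \<or> s = 1" "y \<in> topspace (end_top s)" for s y
    using continuous_map_image_subset_topspace [OF continuous_map_incl [OF that(1)]] that(2) by blast
  have GW: "G s (w, \<tau>) \<in> topspace W.total" if "s = 0 \<or> s = 1" "w \<in> topspace W.total" "\<tau> \<in> {0..1}" for s w \<tau>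
    using continuous_map_image_subset_topspace [OF Gc [OF that(1)]] that(2,3) by auto
  have x0e: "x0 \<in> topspace (end_top s)" for s by (simp add: end_top_def)
  have r_incl: "r s (incl s y) = y" if "s = 0 \<or> s = 1" "y \<in> topspace (end_top s)" for s y
    using Gs [OF that(1) iW [OF that] on_end_incl, of 1] by (simp add: r_def)
  have incl_x0: "incl s x0 = (x0, 0)" for s by (simp add: incl_def)
  have r_x0: "r s (incl s' x0) = x0" if "s = 0 \<or> s = 1" for s s' using r_incl [OF that x0e] by (simp add: incl_x0)
  have pm: "pointed_map (end_top s, x0) (end_top s', x0) (r s' \<circ> incl s)" if "s = 0 \<or> s = 1" "s' = 0 \<or> s' = 1" for s s'
    unfolding pointed_map_def
    using continuous_map_compose [OF continuous_map_incl [OF that(1)] rc [OF that(2)]] r_x0 [OF that(2)] by simp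
  have hom: "pointed_homotopic (end_top s, x0) (end_top s, x0) ((r s \<circ> incl s') \<circ> (r s' \<circ> incl s)) id"
    if s: "s = 0 \<or> s = 1" "s' = 0 \<or> s' = 1" for s s'
  proof -
    \<comment> \<open>The deformation onto the end \<open>s'\<close>, seen from the end
      \<open>s\<close>: it joins the identity at time 0 to the round trip at time 1.\<close>
    define H where "H z = r s (G s' (incl s (snd z), fst z))" for z
    have "continuous_map (prod_topology ?I (end_top s)) (prod_topology W.total ?I) (\<lambda>z. (incl s (snd z), fst z))"
      using continuous_map_compose [OF continuous_map_snd continuous_map_incl [OF s(1)], of ?I]
        continuous_map_fst [of ?I "end_top s"] by (simp only: continuous_map_pairwise o_def fst_conv snd_conv)
    from continuous_map_compose [OF continuous_map_compose [OF this Gc [OF s(2)]] rc [OF s(1)]]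
    have H: "continuous_map (prod_topology ?I (end_top s)) (end_top s) H" by (simp add: H_def [abs_def] o_def)
    have "homotopic_with (\<lambda>h. h x0 = x0) (end_top s) (end_top s) id ((r s \<circ> incl s') \<circ> (r s' \<circ> incl s))"
    proof (subst homotopic_with)
      have "H (0, y) = y" if "y \<in> topspace (end_top s)" for y
        using G0 [OF s(2) iW [OF s(1) that]] r_incl [OF s(1) that] by (simp add: H_def)
      moreover have "H (1, y) = r s (incl s' (r s' (incl s y)))" if "y \<in> topspace (end_top s)" for y
        using on_end_point(1) [OF GW [OF s(2) iW [OF s(1) that], of 1] G1 [OF s(2) iW [OF s(1) that]] s(2)] by (simp add: H_def r_def)
      moreover have "H (t, x0) = x0" if "t \<in> {0..1}" for t
        using Gs [OF s(2) iW [OF s(1) x0e], of t] that r_x0 [OF s(1), of s] incl_x0 by (simp add: H_def on_end_def)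
      ultimately show "\<exists>h. continuous_map (prod_topology ?I (end_top s)) (end_top s) h \<and> (\<forall>x\<in>topspace (end_top s). h (0, x) = id x) \<and>
          (\<forall>x\<in>topspace (end_top s). h (1, x) = ((r s \<circ> incl s') \<circ> (r s' \<circ> incl s)) x) \<and> (\<forall>t\<in>{0..1}. h (t, x0) = x0)"
        using H by (intro exI [of _ H]) simp
    qed (use x0e in auto)
    then show ?thesis unfolding pointed_homotopic_def by (simp add: homotopic_with_sym)
  qed
  have "pointed_homotopy_equivalent (end_top 0, x0) (end_top 1, x0)" unfolding pointed_homotopy_equivalent_def
    by (intro exI [of _ "r 1 \<circ> incl 0"] exI [of _ "r 0 \<circ> incl 1"] conjI pm hom) simp_all
  then show ?thesis unfolding end_top_0 end_top_1 .
qed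

text \<open>The attaching map of a further cell of \<open>X\<close> is deformed, inside the cylinder, first to the end
  at height 1 and then, by cellular approximation, to a map into the cells of smaller dimension.\<close>

lemma attaching_homotopy:
  assumes \<phi>: "continuous_map (top_of_set (cube_bd n)) X.total \<phi>"
  obtains h where "continuous_map (cell_bd_space I01 n) W.total h"
    "\<And>u. h (0, u) = (\<phi> u, 0)" "\<And>u. h (1, u) = incl 1 (fst (h (1, u)))"
    "\<And>u t. u \<in> cube_bd n \<Longrightarrow> \<phi> u = x0 \<Longrightarrow> 0 \<le> t \<Longrightarrow> t \<le> 1 \<Longrightarrow> h (t, u) = (x0, 0)"
    "continuous_map (top_of_set (cube_bd n)) (Y.stage (Suc n)) (\<lambda>u. fst (h (1, u)))"
proof -
  let ?I = "I01" and ?K = "top_of_set (cube_bd n)"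
  \<comment> \<open>Points attached at \<open>x0\<close> are kept at the base point by both
    deformations, which gives the clause \<open>\<Psi>_base\<close> for the new cell.\<close>
  define Z where "Z = {u \<in> cube_bd n. \<phi> u = x0}"
  obtain G where G: "continuous_map (prod_topology W.total ?I) W.total G"
    "\<And>w. w \<in> topspace W.total \<Longrightarrow> G (w, 0) = w" "\<And>w. w \<in> topspace W.total \<Longrightarrow> on_end 1 (G (w, 1))"
    "\<And>w \<tau>. w \<in> topspace W.total \<Longrightarrow> on_end 1 w \<Longrightarrow> \<tau> \<in> {0..1} \<Longrightarrow> G (w, \<tau>) = w"
    using deformation_onto_end [of 1] by blast
  have \<phi>W: "continuous_map ?K W.total (\<lambda>u. incl 0 (\<phi> u))"
    using continuous_map_compose [OF \<phi> [folded end_top_0] continuous_map_incl] by (simp add: o_def)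
  have \<phi>t: "incl 0 (\<phi> u) \<in> topspace W.total" if "u \<in> cube_bd n" for u
    using continuous_map_image_subset_topspace [OF \<phi>W] that by auto
  have "continuous_map (prod_topology ?I ?K) (prod_topology W.total ?I) (\<lambda>z. (incl 0 (\<phi> (snd z)), fst z))"
    using continuous_map_compose [OF continuous_map_snd \<phi>W, of ?I] continuous_map_fst [of ?I ?K]
    by (simp only: continuous_map_pairwise o_def fst_conv snd_conv)
  from continuous_map_compose [OF this G(1)]
  have Gc: "continuous_map (prod_topology ?I ?K) W.total (\<lambda>z. G (incl 0 (\<phi> (snd z)), fst z))" by (simp only: o_def fst_conv)
  define \<phi>1 where "\<phi>1 u = fst (G (incl 0 (\<phi> u), 1))" for u
  have GZ: "G (incl 0 (\<phi> u), \<tau>) = (x0, 0)" if "u \<in> Z" "\<tau> \<in> {0..1}" for u \<tau>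
    using G(4) [OF x0_W _ that(2)] that(1) by (simp add: Z_def incl_def on_end_def)
  have G1c: "continuous_map ?K W.total (\<lambda>u. G (incl 0 (\<phi> u), 1))"
  proof -
    have "continuous_map ?K (prod_topology ?I ?K) (\<lambda>x. (1, x))" by (auto intro!: continuous_intros)
    from continuous_map_compose [OF this Gc] show ?thesis by (simp add: o_def)
  qed
  have \<phi>1c: "continuous_map ?K Y.total \<phi>1"
    using continuous_map_fst_end [OF _ G1c, of 1] G(3) \<phi>t by (simp add: end_top_1 \<phi>1_def [abs_def])
  have hom1: "homotopic_fixing Z (x0, 0) ?K W.total (\<lambda>u. incl 0 (\<phi> u)) (incl 1 \<circ> \<phi>1)"
  proof (subst homotopic_with)
    have "G (incl 0 (\<phi> u), 1) = incl 1 (\<phi>1 u)" if "u \<in> cube_bd n" for u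
    proof -
      have "G (incl 0 (\<phi> u), 1) \<in> topspace W.total" using continuous_map_image_subset_topspace [OF G1c] that by auto
      from on_end_point(1) [OF this G(3) [OF \<phi>t [OF that]]] show ?thesis by (simp add: \<phi>1_def)
    qed
    then show "\<exists>h. continuous_map (prod_topology ?I ?K) W.total h \<and> (\<forall>x\<in>topspace ?K. h (0, x) = incl 0 (\<phi> x)) \<and>
        (\<forall>x\<in>topspace ?K. h (1, x) = (incl 1 \<circ> \<phi>1) x) \<and> (\<forall>t\<in>{0..1}. \<forall>u\<in>Z. h (t, u) = (x0, 0))"
      using Gc GZ G(2) \<phi>t by (intro exI [of _ "\<lambda>z. G (incl 0 (\<phi> (snd z)), fst z)"]) simp
  next
    show "(\<forall>u\<in>Z. h u = (x0, 0)) = (\<forall>u\<in>Z. k u = (x0, 0))" if "\<And>x. x \<in> topspace ?K \<Longrightarrow> h x = k x" for h k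
    proof -
      have "h u = k u" if "u \<in> Z" for u using \<open>\<And>x. x \<in> topspace ?K \<Longrightarrow> h x = k x\<close> that by (simp add: Z_def)
      then show ?thesis by simp
    qed
  qed
  have \<phi>1Z: "\<phi>1 u = x0" if "u \<in> Z" for u using GZ [OF that, of 1] by (simp add: \<phi>1_def)
  obtain \<phi>' where \<phi>': "homotopic_fixing Z x0 ?K Y.total \<phi>1 \<phi>'"
    "continuous_map ?K (Y.stage (Suc n)) \<phi>'" using Y.cellular_approximation [OF \<phi>1c \<phi>1Z] by blast
  have "homotopic_fixing Z (x0, 0) ?K W.total (incl 1 \<circ> \<phi>1) (incl 1 \<circ> \<phi>')"
    by (rule homotopic_with_compose_continuous_map_left [OF \<phi>' (1)])
      (use continuous_map_incl [of 1] in \<open>simp_all add: end_top_1 incl_def\<close>)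
  from homotopic_with_trans [OF hom1 this]
  obtain h where h: "continuous_map (prod_topology ?I ?K) W.total h" "\<And>u. h (0, u) = incl 0 (\<phi> u)"
    "\<And>u. h (1, u) = incl 1 (\<phi>' u)" "\<And>t u. t \<in> {0..1} \<Longrightarrow> u \<in> Z \<Longrightarrow> h (t, u) = (x0, 0)"
    unfolding homotopic_with_def by auto
  show thesis
  proof (rule that [of h])
    show "h (0, u) = (\<phi> u, 0)" for u by (simp add: h(2) incl_def)
    show "continuous_map ?K (Y.stage (Suc n)) (\<lambda>u. fst (h (1, u)))" using \<phi>'(2) by (simp add: h(3))
  qed (use h in \<open>simp_all add: Z_def\<close>)
qed

end

text \<open>Recursion on the rank. The interior of each new prism is prescribed, so only the values
  on its walls have to be chosen; the cells of lower rank form a cylinder, and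
  \<open>attaching_homotopy\<close> inside it provides these values.\<close>

lemma cylinder_exists:
  fixes \<Phi> :: "'e \<Rightarrow> unit \<times> coords \<Rightarrow> 'x"
  assumes X: "ordinary_cells fl x0 E d \<Phi> rk"
  shows "\<exists>\<Psi>. cylinder fl x0 E d \<Phi> rk \<Psi>"
proof -
  interpret X: cell_complex one_point "{}" fl "{x0}" x0 E d \<Phi> rk by (rule X)
  let ?I = "I01"
  \<comment> \<open>Only the wall values are taken from \<open>\<psi>\<close>; in the interior the
    prism is the product of the open cell with the interval.\<close>
  define ext where "ext \<psi> e p = (if snd p \<in> cube_bd (d e) then \<psi> e p else (\<Phi> e ((), snd p), fst p))"
    for \<psi> :: "'e \<Rightarrow> real \<times> coords \<Rightarrow> 'x \<times> real" and e p
  define Wl where "Wl \<psi> e = cells_top ?I {(x0, 0)} {e' \<in> E. rk e' < rk e} d (ext \<psi>)" for \<psi> e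
  define Yl where "Yl \<psi> e = cells_top one_point {x0} {e' \<in> E. rk e' < rk e \<and> d e' < d e} d
      (\<lambda>e p. fst (ext \<psi> e (1, snd p)))" for \<psi> e
  \<comment> \<open>The clauses of \<open>cylinder\<close> for the single cell \<open>e\<close>.
    They depend only on \<open>\<psi>\<close> at \<open>e\<close> and at cells of smaller rank, as
    the recursion requires.\<close>
  define good where "good e \<psi> \<longleftrightarrow> continuous_map (cell_bd_space ?I (d e)) (Wl \<psi> e) (ext \<psi> e) \<and>
    continuous_map (cell_bd_space one_point (d e)) (Yl \<psi> e) (\<lambda>p. fst (ext \<psi> e (1, snd p))) \<and>
    (\<forall>u\<in>cube_bd (d e). ext \<psi> e (0, u) = (\<Phi> e ((), u), 0) \<and>
      ext \<psi> e (1, u) = (if fst (ext \<psi> e (1, u)) = x0 then (x0, 0) else (fst (ext \<psi> e (1, u)), 1)) \<and>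
      (\<Phi> e ((), u) = x0 \<longrightarrow> (\<forall>t\<in>{0..1}. ext \<psi> e (t, u) = (x0, 0))))" for e \<psi>
  have ext_int: "ext \<psi> e (t, u) = (\<Phi> e ((), u), t)" if "u \<in> cube_int (d e)" for \<psi> e t u
    using cube_int_bd_disjoint [OF that] by (simp add: ext_def)
  have ext_cong: "ext f e = ext g e" if "f e = g e" for f g e using that by (simp add: ext_def fun_eq_iff)
  have Wl_cong: "Wl f e = Wl g e" and Yl_cong: "Yl f e = Yl g e"
    if "\<And>e'. e' \<in> E \<Longrightarrow> rk e' < rk e \<Longrightarrow> f e' = g e'" for f g e
  proof -
    have "ext f e' = ext g e'" if "e' \<in> E" "rk e' < rk e" for e'
      by (rule ext_cong) (use \<open>\<And>e'. e' \<in> E \<Longrightarrow> rk e' < rk e \<Longrightarrow> f e' = g e'\<close> that in blast)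
    then show "Wl f e = Wl g e" "Yl f e = Yl g e" unfolding Wl_def Yl_def by (intro final_top_cong; simp)+
  qed
  have cyl: "cylinder fl x0 E' d \<Phi> rk (ext \<psi>)"
    if E': "E' \<subseteq> E" "\<And>e e'. e \<in> E' \<Longrightarrow> e' \<in> E \<Longrightarrow> rk e' < rk e \<Longrightarrow> e' \<in> E'" and g: "\<And>e. e \<in> E' \<Longrightarrow> good e \<psi>"
    for E' \<psi>
  proof (rule cylinder.intro)
    have low: "{e' \<in> E'. rk e' < rk e} = {e' \<in> E. rk e' < rk e}" "{e' \<in> E'. rk e' < rk e \<and> d e' < d e} = {e' \<in> E. rk e' < rk e \<and> d e' < d e}"
      if "e \<in> E'" for e using E' that by blast+
    note s = subsetD [OF E'(1)]
    show "ordinary_cells fl x0 E' d \<Phi> rk"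
    proof
      show "continuous_map (cell_bd_space one_point (d e)) (cells_top one_point {x0} {e' \<in> E'. rk e' < rk e} d \<Phi>) (\<Phi> e)"
        if "e \<in> E'" for e unfolding low [OF that] using X.bd [OF s [OF that]] .
      show "e = e'" if "e \<in> E'" "e' \<in> E'" "p \<in> cell_int one_point {} (d e)" "p' \<in> cell_int one_point {} (d e')" "\<Phi> e p = \<Phi> e' p'" for e e' p p'
        using X.cells_disjoint [OF s [OF that(1)] s [OF that(2)] that(3-5)] .
    qed (use s X.rk_pos X.inj_cell X.cell_new X.J in auto)
    show "ext \<psi> e (t, u) = (\<Phi> e ((), u), t)" if "u \<in> cube_int (d e)" for e t u using ext_int [OF that] .
    show "fst (ext \<psi> e (0, u)) = \<Phi> e ((), u)" if "e \<in> E'" "u \<in> cube (d e)" for e u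
      using g [OF that(1)] ext_int [of u e] cube_cases [OF that(2)] unfolding good_def by auto
    show "ext \<psi> e (s, u) = (if fst (ext \<psi> e (s, u)) = x0 then (x0, 0) else (fst (ext \<psi> e (s, u)), s))"
      if "e \<in> E'" "u \<in> cube (d e)" "s = 0 \<or> s = 1" for e u s
    proof (cases "u \<in> cube_bd (d e)")
      case True
      then have "ext \<psi> e (0, u) = (\<Phi> e ((), u), 0)"
        "ext \<psi> e (1, u) = (if fst (ext \<psi> e (1, u)) = x0 then (x0, 0) else (fst (ext \<psi> e (1, u)), 1))"
        using g [OF that(1)] unfolding good_def by blast+
      then show ?thesis using that(3) by auto
    next
      case False
      then have i: "u \<in> cube_int (d e)" using cube_cases [OF that(2)] by blast
      then have "\<Phi> e ((), u) \<noteq> x0" using X.cell_new [OF s [OF that(1)], of "((), u)"] by (simp add: cell_int_def)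
      then show ?thesis by (simp add: ext_int [OF i])
    qed
    show "ext \<psi> e (t, u) = (x0, 0)" if "e \<in> E'" "u \<in> cube_bd (d e)" "\<Phi> e ((), u) = x0" "0 \<le> t" "t \<le> 1" for e t u
      using g [OF that(1)] that(2-5) unfolding good_def by simp
    show "continuous_map (cell_bd_space ?I (d e)) (cells_top ?I {(x0, 0)} {e' \<in> E'. rk e' < rk e} d (ext \<psi>)) (ext \<psi> e)"
      if "e \<in> E'" for e using g [OF that] unfolding low [OF that] good_def Wl_def by blast
    show "continuous_map (cell_bd_space one_point (d e))
        (cells_top one_point {x0} {e' \<in> E'. rk e' < rk e \<and> d e' < d e} d (\<lambda>e p. fst (ext \<psi> e (1, snd p))))
        (\<lambda>p. fst (ext \<psi> e (1, snd p)))"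
      if "e \<in> E'" for e using g [OF that] unfolding low [OF that] good_def Yl_def by blast
  qed
  have "\<exists>\<psi>. \<forall>e\<in>E. good e \<psi>"
  proof (rule rank_recursion [where rk = rk])
    fix e \<psi> assume e: "e \<in> E" and lower: "\<And>e'. e' \<in> E \<Longrightarrow> rk e' < rk e \<Longrightarrow> good e' \<psi>"
    let ?E = "{e' \<in> E. rk e' < rk e}"
    interpret C: cylinder fl x0 ?E d \<Phi> rk "ext \<psi>" by (rule cyl) (use lower in auto)
    have "C.X.total = X.stage (rk e)" by (simp add: C.X.total_def X.stage_def)
    then have "continuous_map (top_of_set (cube_bd (d e))) C.X.total (\<lambda>u. \<Phi> e ((), u))"
      using X.bd_stage [OF e] by (simp add: continuous_map_from_prod_discrete)
    from C.attaching_homotopy [OF this]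
    obtain h where h: "continuous_map (cell_bd_space ?I (d e)) C.W.total h"
      "\<And>u. h (0, u) = (\<Phi> e ((), u), 0)" "\<And>u. h (1, u) = C.incl 1 (fst (h (1, u)))"
      "\<And>u t. u \<in> cube_bd (d e) \<Longrightarrow> \<Phi> e ((), u) = x0 \<Longrightarrow> 0 \<le> t \<Longrightarrow> t \<le> 1 \<Longrightarrow> h (t, u) = (x0, 0)"
      "continuous_map (top_of_set (cube_bd (d e))) (C.Y.stage (Suc (d e))) (\<lambda>u. fst (h (1, u)))" by blast
    let ?\<psi> = "\<psi>(e := h)"
    have e_ext: "ext ?\<psi> e p = h p" if "snd p \<in> cube_bd (d e)" for p using that by (simp add: ext_def)
    have W: "Wl ?\<psi> e = C.W.total" unfolding C.W.total_def Wl_def [symmetric] by (rule Wl_cong) auto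
    \<comment> \<open>The part of the top end made of cells of dimension below \<open>d e\<close> is
      exactly the target demanded by \<open>top_bd\<close>.\<close>
    have "{e' \<in> ?E. Suc (d e') < Suc (d e)} = {e' \<in> E. rk e' < rk e \<and> d e' < d e}" by auto
    then have "C.Y.stage (Suc (d e)) = Yl \<psi> e" unfolding C.Y.stage_def Yl_def by (simp add: C.end_cell_def [abs_def])
    moreover have "Yl ?\<psi> e = Yl \<psi> e" by (rule Yl_cong) auto
    ultimately have Y: "Yl ?\<psi> e = C.Y.stage (Suc (d e))" by simp
    have "good e ?\<psi>" unfolding good_def W Y
    proof (intro conjI)
      show "continuous_map (cell_bd_space ?I (d e)) C.W.total (ext ?\<psi> e)"
        by (rule continuous_map_eq [OF h(1)]) (simp only: e_ext topspace_prod_topology topspace_euclidean_subtopology mem_Times_iff)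
      have "continuous_map (cell_bd_space one_point (d e)) (C.Y.stage (Suc (d e))) (\<lambda>p. fst (h (1, snd p)))"
        using h(5) by (simp add: continuous_map_from_prod_discrete)
      then show "continuous_map (cell_bd_space one_point (d e)) (C.Y.stage (Suc (d e))) (\<lambda>p. fst (ext ?\<psi> e (1, snd p)))"
        by (rule continuous_map_eq) (auto simp: e_ext)
      show "\<forall>u\<in>cube_bd (d e). ext ?\<psi> e (0, u) = (\<Phi> e ((), u), 0) \<and>
          ext ?\<psi> e (1, u) = (if fst (ext ?\<psi> e (1, u)) = x0 then (x0, 0) else (fst (ext ?\<psi> e (1, u)), 1)) \<and>
          (\<Phi> e ((), u) = x0 \<longrightarrow> (\<forall>t\<in>{0..1}. ext ?\<psi> e (t, u) = (x0, 0)))"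
      proof (intro ballI conjI impI)
        fix u assume u: "u \<in> cube_bd (d e)"
        then have eh: "ext ?\<psi> e (t, u) = h (t, u)" for t using e_ext by simp
        show "ext ?\<psi> e (0, u) = (\<Phi> e ((), u), 0)" unfolding eh by (rule h(2))
        show "ext ?\<psi> e (1, u) = (if fst (ext ?\<psi> e (1, u)) = x0 then (x0, 0) else (fst (ext ?\<psi> e (1, u)), 1))"
          unfolding eh using h(3) [of u] unfolding C.incl_def .
        show "ext ?\<psi> e (t, u) = (x0, 0)" if "\<Phi> e ((), u) = x0" "t \<in> {0..1}" for t
          unfolding eh using h(4) [OF u that(1)] that(2) by simp
      qed
    qed
    then show "\<exists>v. good e (\<psi>(e := v))" by blast
  next
    fix e f g assume "f e = g e" and low: "\<And>e'. e' \<in> E \<Longrightarrow> rk e' < rk e \<Longrightarrow> f e' = g e'" and good: "good e f"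
    have eqs: "ext f e = ext g e" "Wl f e = Wl g e" "Yl f e = Yl g e"
      using ext_cong [of f e g] \<open>f e = g e\<close> Wl_cong [of e f g] Yl_cong [of e f g] low by blast+
    show "good e g" using good unfolding good_def eqs .
  qed
  then obtain \<psi> where "\<forall>e\<in>E. good e \<psi>" by blast
  then show ?thesis using cyl [of E \<psi>] by blast
qed

lemma cellular_replacement:
  fixes \<Phi> :: "'e \<Rightarrow> unit \<times> coords \<Rightarrow> 'x"
  assumes X: "ordinary_cells fl x0 E d \<Phi> rk"
  obtains \<Phi>' where "ordinary_cells fl x0 E d \<Phi>' (\<lambda>e. Suc (d e))"
    "pointed_homotopy_equivalent (cells_top one_point {x0} E d \<Phi>, x0) (cells_top one_point {x0} E d \<Phi>', x0)"
proof -
  obtain \<Psi> where "cylinder fl x0 E d \<Phi> rk \<Psi>" using cylinder_exists [OF X] by blast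
  then interpret cylinder fl x0 E d \<Phi> rk \<Psi> .
  show thesis by (rule that [of "end_cell 1"])
      (use ends_homotopy_equivalent Y.cell_complex_axioms in \<open>simp_all add: X.total_def Y.total_def\<close>)
qed


text \<open>Common to all three claims: with \<open>B0\<close> and \<open>fl\<close> left open it
  serves pointed cores and ordinary cells alike.\<close>

lemma generalized_CW_complex_over_cells:
  fixes A :: "'a pointed" and X :: "'x pointed" and C :: "(nat \<times> 'a) set"
  assumes X: "generalized_CW_complex A X" and A: "cell_complex B B0 fl {basept A} (basept A) C k \<psi> rkC"
      "underlying A = cells_top B {basept A} C k \<psi>" "\<And>c. c \<in> C \<Longrightarrow> rkC c \<le> N"
  obtains E :: "((nat \<times> bool \<times> 'x) \<times> nat \<times> 'a) set" and d \<Phi> rk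
  where "cell_complex B B0 fl {basept X} (basept X) E d \<Phi> rk"
    "underlying X = cells_top B {basept X} E d \<Phi>"
proof -
  have "pointed_space A" by (simp add: pointed_space_def A(2))
  then obtain E :: "(nat \<times> bool \<times> 'x) set" and d \<Phi> rk where E: "pointed_cells A (basept X) E d \<Phi> rk"
      "underlying X = cells_top (underlying A) {basept X} E d \<Phi>" using generalized_CW_complex_cells X by blast
  interpret complex_over_complex B B0 fl "basept A" C k \<psi> rkC "underlying A" "basept X" E d \<Phi> rk N
    by (intro complex_over_complex.intro complex_over_complex_axioms.intro A(1) E(1) A(3))
      (simp_all add: A(2) cell_complex.total_def [OF A(1)])
  show thesis by (rule that [OF comp_cell_complex]) (simp add: E(2) comp_total [symmetric] X.total_def)
qed

theorem theorem1p1: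
  fixes B :: "'b pointed" and A :: "'a pointed" and X :: "'x pointed"
  assumes "generalized_CW_complex A X"
  shows
    "(pointed_space B \<and> finite_dim_CW_complex B A \<longrightarrow> generalized_CW_complex B X) \<and>
     (finite_dim_CW_complex S0 A \<longrightarrow> generalized_CW_complex S0 X \<and>
        (\<exists>Y :: 'x pointed. CW_complex S0 Y \<and> pointed_homotopy_equivalent X Y)) \<and>
     (finite_dim_ordinary_CW_complex A \<longrightarrow> generalized_ordinary_CW_complex X \<and>
        (\<exists>Y :: 'x pointed. ordinary_CW_complex Y \<and> pointed_homotopy_equivalent X Y))"
proof (intro conjI impI)
  show "generalized_CW_complex B X" if B: "pointed_space B \<and> finite_dim_CW_complex B A"
  proof -
    obtain C :: "(nat \<times> 'a) set" and k \<psi> rkC N where C: "pointed_cells B (basept A) C k \<psi> rkC"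
      "underlying A = cells_top (underlying B) {basept A} C k \<psi>" "\<And>c. c \<in> C \<Longrightarrow> rkC c \<le> N"
      using finite_dim_CW_complex_cells B by blast
    from generalized_CW_complex_over_cells [OF assms C] generalized_CW_complex_if_cells B show ?thesis by metis
  qed
next
  assume A: "finite_dim_CW_complex S0 A"
  have S0: "pointed_space S0" by (simp add: S0_def pointed_space_def)
  obtain C :: "(nat \<times> 'a) set" and k \<psi> rkC N where C: "pointed_cells S0 (basept A) C k \<psi> rkC"
    "underlying A = cells_top (underlying S0) {basept A} C k \<psi>" "\<And>c. c \<in> C \<Longrightarrow> rkC c \<le> N"
    using finite_dim_CW_complex_cells [OF S0 A] by blast
  obtain E :: "((nat \<times> bool \<times> 'x) \<times> nat \<times> 'a) set" and d \<Phi> rk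
    where E: "pointed_cells S0 (basept X) E d \<Phi> rk"
      "underlying X = cells_top (underlying S0) {basept X} E d \<Phi>" using generalized_CW_complex_over_cells [OF assms C] by blast
  show "generalized_CW_complex S0 X" by (rule generalized_CW_complex_if_cells [OF S0 E])
  \<comment> \<open>The cellular replacement is carried out for single cubes with \<open>fl\<close>
    true, and the result is translated back, so that the new complex again has core
    \<open>S0\<close>.\<close>
  note E' = E [unfolded S0_def fst_conv snd_conv]
  obtain \<Phi>' where \<Phi>': "ordinary_cells True (basept X) E d \<Phi>' (\<lambda>e. Suc (d e))"
    "pointed_homotopy_equivalent (cells_top one_point {basept X} E d (unit_cell \<Phi>), basept X)
       (cells_top one_point {basept X} E d \<Phi>', basept X)"
    using cellular_replacement [OF cell_complex_unit_if_bool(1) [OF E'(1)]] by blast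
  define Y where "Y = (cells_top one_point {basept X} E d \<Phi>', basept X)"
  have "(cells_top one_point {basept X} E d (unit_cell \<Phi>), basept X) = X"
    unfolding cell_complex_unit_if_bool(2) [OF E'(1), symmetric] E'(2) [symmetric] by simp
  then have "pointed_homotopy_equivalent X Y" using \<Phi>'(2) by (simp add: Y_def)
  moreover have "CW_complex S0 Y"
  proof -
    \<comment> \<open>The indices are moved to the points of the space, as \<open>CW_complex\<close>
      requires.\<close>
    have "() \<in> topspace one_point - {}" by simp
    from cell_complex_index_by_points [OF \<Phi>'(1) this]
    obtain E1 :: "'x set" and k1 where E1: "ordinary_cells True (basept X) E1 (d \<circ> k1) (\<Phi>' \<circ> k1) ((\<lambda>e. Suc (d e)) \<circ> k1)"
      "cells_top one_point {basept X} E d \<Phi>' = cells_top one_point {basept X} E1 (d \<circ> k1) (\<Phi>' \<circ> k1)" by metis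
    note b = cell_complex_bool_if_unit [OF E1(1)]
    show ?thesis
      by (rule CW_complex_if_cells [OF S0, where E = E1 and d = "d \<circ> k1" and \<Phi> = "bool_cell (basept X) (\<Phi>' \<circ> k1)"])
        (use b in \<open>simp_all add: S0_def Y_def E1(2) o_def\<close>)
  qed
  ultimately show "\<exists>Y :: 'x pointed. CW_complex S0 Y \<and> pointed_homotopy_equivalent X Y" by blast
next
  assume A: "finite_dim_ordinary_CW_complex A"
  obtain C :: "(nat \<times> 'a) set" and k \<psi> rkC N where C: "ordinary_cells False (basept A) C k \<psi> rkC"
    "underlying A = cells_top one_point {basept A} C k \<psi>" "\<And>c. c \<in> C \<Longrightarrow> rkC c \<le> N"
    using finite_dim_ordinary_CW_complex_cells [OF A] by blast
  obtain E :: "((nat \<times> bool \<times> 'x) \<times> nat \<times> 'a) set" and d \<Phi> rk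
    where E: "ordinary_cells False (basept X) E d \<Phi> rk"
      "underlying X = cells_top one_point {basept X} E d \<Phi>" using generalized_CW_complex_over_cells [OF assms C] by blast
  show "generalized_ordinary_CW_complex X" by (rule generalized_ordinary_CW_complex_if_cells [OF E])
  obtain \<Phi>' where \<Phi>': "ordinary_cells False (basept X) E d \<Phi>' (\<lambda>e. Suc (d e))"
    "pointed_homotopy_equivalent (cells_top one_point {basept X} E d \<Phi>, basept X)
       (cells_top one_point {basept X} E d \<Phi>', basept X)" using cellular_replacement [OF E(1)] by blast
  define Y where "Y = (cells_top one_point {basept X} E d \<Phi>', basept X)"
  have "pointed_homotopy_equivalent X Y" using \<Phi>'(2) by (simp add: Y_def E(2) [symmetric])
  moreover have "ordinary_CW_complex Y"
    by (rule ordinary_CW_complex_if_cells [where E = E and d = d and \<Phi> = \<Phi>']) (use \<Phi>'(1) in \<open>simp_all add: Y_def\<close>)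
  ultimately show "\<exists>Y :: 'x pointed. ordinary_CW_complex Y \<and> pointed_homotopy_equivalent X Y" by blast
qed

end
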